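(* The operations $T_i,d_-,d_+,d_+^*,e_i$ define an action of the algebra $\tilde{\mathbb{A}}$ on $V_*$. Furthermore, the kernel of the natural map $\tilde{\mathbb{A}}e_0\to V_*$ that sends $fe_0$ to $f(1)$ (with $1\in V_0$) is given by $Ie_0$, where $I\subset\tilde{\mathbb{A}}$ is the ideal generated by the elements $d_+^*d_+^m-d_+^{m+1}$, $m\ge0$. In particular, there is an isomorphism $V_*\cong\tilde{\mathbb{A}}e_0/Ie_0$.
   Context: Plethysm. $\mathrm{Sym}[X]$ is the ring of symmetric functions over $\mathbb{Q}(q,t)$ in $X=x_1+x_2+\cdots$. For an expression $A$, $p_n[A]$ is obtained by replacing every variable and parameter (including $q,t,x_i,y_i$) by its $n$-th power (with $p_n[-A]=-p_n[A]$), and $F[A]$ is the image of $F\in\mathrm{Sym}[X]$ under $p_n\mapsto p_n[A]$ (coefficients fixed). $\mathrm{Exp}[A]=\sum_{n\ge0}h_n[A]$. Operators. $V_k=\mathrm{Sym}[X]\otimes\mathbb{Q}[y_1,\dots,y_k]$, $V_*=\bigoplus_{k\ge0}V_k$; plethystic substitutions act on the $\mathrm{Sym}[X]$ factor only; $e_k$ is the projection onto $V_k$. For $1\le i\le k-1$, $T_i:V_k\to V_k$ is $T_iP=\frac{(q-1)y_iP+(y_{i+1}-qy_i)s_iP}{y_{i+1}-y_i}$, where $s_i$ exchanges $y_i$ and $y_{i+1}$. Define $d_+,d_+^*:V_k\to V_{k+1}$ and $d_-:V_k\to V_{k-1}$ ($k\ge1$) by $$d_+F=T_1\cdots T_k\big(F[X+(q-1)y_{k+1}]\big),\quad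 d_-F=-F[X-(q-1)y_k]\,\mathrm{Exp}[-y_k^{-1}X]\big|_{y_k^{-1}},\quad d_+^*F=\gamma\,F[X+(q-1)y_{k+1}],$$ where $|_{y_k^{-1}}$ is the coefficient of $y_k^{-1}$ and $\gamma$ is the substitution $y_i\mapsto y_{i+1}$ ($1\le i\le k$), $y_{k+1}\mapsto ty_1$. The algebra $\mathbb{A}=\mathbb{A}_q$ (over $\mathbb{Q}(q,t)$) is the path algebra of the quiver with vertex set $\mathbb{Z}_{\ge0}$, arrows $d_+$ from $i$ to $i+1$, arrows $d_-$ from $i+1$ to $i$, and loops $T_1,\dots,T_{k-1}$ at vertex $k$ (the same letters $T_i,d_\pm$ are used at every vertex; products are read as compositions of operators, right to left; $e_k$ is the idempotent at vertex $k$), modulo the relations, for paths beginning at vertex $k$, whenever all terms make sense: $$(T_i-1)(T_i+q)=0,\quad T_iT_{i+1}T_i=T_{i+1}T_iT_{i+1},\quad T_iT_j=T_jT_i\ (|i-j|>1),$$ $$T_id_-=d_-T_i,\quad d_+T_i=T_{i+1}d_+,\quad T_1d_+^2=d_+^2,\quad d_-^2T_{k-1}=d_-^2,$$ $$d_-(d_+d_--d_-d_+)T_{k-1}=q(d_+d_--d_-d_+)d_-\ (k\ge2),\qquad T_1(d_+d_--d_-d_+)d_+=q\,d_+(d_+d_--d_-d_+).$$ Elements $y_1,\dots,y_k\in e_k\mathbb{A}e_k$ are defined by $y_k=\frac1{q-1}T_{k-1}^{-1}\cdots T_1^{-1}(d_+d_--d_-d_+)$ and $y_i=q^{-1}T_iy_{i+1}T_i$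 for $i<k$. $\mathbb{A}^*=\mathbb{A}_{q^{-1}}$ is the same algebra with $q$ replaced by $q^{-1}$, with generators denoted $d_\pm^*,T_i^*,e_i^*$, and $z_i$ denotes the element of $\mathbb{A}^*$ corresponding to $y_i$: $z_k=\frac1{q^{-1}-1}(T_{k-1}^* )^{-1}\cdots(T_1^* )^{-1}(d_+^*d_-^*-d_-^*d_+^* )$, $z_i=q\,T_i^*z_{i+1}T_i^*$. $\tilde{\mathbb{A}}=\tilde{\mathbb{A}}_{q,t}$ is the quotient of the free product of $\mathbb{A}$ and $\mathbb{A}^*$ (as algebras over $\mathbb{Q}(q,t)$) by the relations $$d_-^*=d_-,\quad T_i^*=T_i^{-1},\quad e_i^*=e_i,\quad z_{i+1}d_+=d_+z_i,\quad y_{i+1}d_+^*=d_+^*y_i,\quad z_1d_+=-y_1d_+^*\,t\,q^{k+1},$$ where $k$ is the vertex at which the paths begin.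
   Formalization: "Ideal generated by" is taken as the left ideal generated by these elements; with the two-sided ideal the claim fails, since (d_+^* - d_+)d_-d_+e_0 would lie in Ie_0 but sends 1 to (q-1)(t-1)y_1, which is nonzero. *)

theory Defs
  imports
    "HOL-Library.Poly_Mapping"
    "HOL-Computational_Algebra.Formal_Laurent_Series"
    "HOL-Computational_Algebra.Fraction_Field"
begin

section \<open>The ground field\<close>

text \<open>\<open>\<rat>(q,t)\<close>, the fraction field of \<open>\<rat>[q][t]\<close>.\<close>

type_synonym qt = "rat poly poly fract"

definition qq :: qt where "qq = Fract [:[:0, 1:]:] 1"
definition tt :: qt where "tt = Fract [:0, 1:] 1"


section \<open>Symmetric functions\<close>

text \<open>
  A monomial in \<open>x\<^sub>0, x\<^sub>1, \<dots>\<close> is a finitely supported exponent vector.  A symmetric function is a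
  formal series of bounded degree that is invariant under all permutations of the variables.
\<close>

type_synonym monomial = "nat \<Rightarrow>\<^sub>0 nat"

definition mdeg :: "monomial \<Rightarrow> nat" where
  "mdeg m = (\<Sum>i\<in>Poly_Mapping.keys m. Poly_Mapping.lookup m i)"

definition is_sym :: "(monomial \<Rightarrow> 'a::zero) \<Rightarrow> bool" where
  "is_sym f \<longleftrightarrow> (\<exists>d. \<forall>m. f m \<noteq> 0 \<longrightarrow> mdeg m \<le> d) \<and>
     (\<forall>p m. bij p \<longrightarrow> f (Poly_Mapping.map_key p m) = f m)"

typedef (overloaded) 'a symfun = "{f :: monomial \<Rightarrow> 'a::zero. is_sym f}"
  morphisms coeff_sym Abs_symfun
  by (rule exI[of _ "\<lambda>_. 0"]) (simp add: is_sym_def)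

setup_lifting type_definition_symfun

lemma mdeg_superset:
  assumes "finite A" "Poly_Mapping.keys m \<subseteq> A"
  shows "mdeg m = (\<Sum>i\<in>A. Poly_Mapping.lookup m i)"
  unfolding mdeg_def using assms by (intro sum.mono_neutral_left) (auto simp: in_keys_iff)

lemma mdeg_add: "mdeg (a + b) = mdeg a + mdeg b"
proof -
  let ?A = "Poly_Mapping.keys a \<union> Poly_Mapping.keys b"
  have "mdeg (a + b) = (\<Sum>i\<in>?A. Poly_Mapping.lookup (a + b) i)"
    by (rule mdeg_superset) (use Poly_Mapping.keys_add[of a b] in auto)
  moreover have "mdeg a = (\<Sum>i\<in>?A. Poly_Mapping.lookup a i)"
    "mdeg b = (\<Sum>i\<in>?A. Poly_Mapping.lookup b i)"
    by (rule mdeg_superset; auto)+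
  ultimately show ?thesis by (simp add: lookup_add sum.distrib)
qed

lemma mdeg_map_key:
  assumes "bij p"
  shows "mdeg (Poly_Mapping.map_key p m) = mdeg m"
proof -
  have inj: "inj p" using assms by (rule bij_is_inj)
  have "mdeg m = (\<Sum>i\<in>p ` (p -` Poly_Mapping.keys m). Poly_Mapping.lookup m i)"
    unfolding mdeg_def using assms by (simp add: bij_is_surj surj_image_vimage_eq)
  also have "\<dots> = (\<Sum>i\<in>p -` Poly_Mapping.keys m. Poly_Mapping.lookup m (p i))"
    by (subst sum.reindex) (use inj in \<open>auto intro: inj_on_subset\<close>)
  finally show ?thesis
    by (simp add: mdeg_def keys_map_key[OF inj] map_key.rep_eq inj)
qed

lemma map_key_0_iff:
  assumes "bij p"
  shows "Poly_Mapping.map_key p m = 0 \<longleftrightarrow> m = 0"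
proof
  assume *: "Poly_Mapping.map_key p m = 0"
  show "m = 0"
  proof (rule poly_mapping_eqI)
    fix i
    obtain j where "i = p j" using assms by (meson bij_pointE)
    then have "Poly_Mapping.lookup m i = Poly_Mapping.lookup (Poly_Mapping.map_key p m) j"
      using assms by (simp add: map_key.rep_eq bij_is_inj)
    then show "Poly_Mapping.lookup m i = Poly_Mapping.lookup 0 i" by (simp add: *)
  qed
qed (simp add: assms bij_is_inj)

definition decomps :: "monomial \<Rightarrow> (monomial \<times> monomial) set" where
  "decomps m = {(a, b). a + b = m}"

lemma finite_decomps: "finite (decomps m)"
proof -
  let ?K = "Poly_Mapping.keys m"
  let ?r = "\<lambda>a. restrict (Poly_Mapping.lookup a) ?K"
  have le: "Poly_Mapping.lookup a i \<le> Poly_Mapping.lookup m i" if "a + b = m" for a b :: monomial and i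
    using that by (auto simp: lookup_add)
  let ?L = "{a. \<exists>b. a + b = m}"
  have "?r ` ?L \<subseteq> PiE ?K (\<lambda>i. {..Poly_Mapping.lookup m i})"
    using le by (auto simp: PiE_iff)
  moreover have "finite (PiE ?K (\<lambda>i. {..Poly_Mapping.lookup m i}))"
    by (intro finite_PiE) auto
  ultimately have fin: "finite (?r ` ?L)" by (rule finite_subset)
  have "inj_on ?r ?L"
  proof (rule inj_onI)
    fix a a' assume a: "a \<in> ?L" "a' \<in> ?L" "?r a = ?r a'"
    show "a = a'"
    proof (rule poly_mapping_eqI)
      fix i
      show "Poly_Mapping.lookup a i = Poly_Mapping.lookup a' i"
      proof (cases "i \<in> ?K")
        case True
        then show ?thesis using fun_cong[OF a(3), of i] by simp
      next
        case False
        then have "Poly_Mapping.lookup m i = 0" by (simp add: in_keys_iff)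
        moreover obtain b b' where "a + b = m" "a' + b' = m" using a(1,2) by blast
        ultimately show ?thesis using le[of a b i] le[of a' b' i] by simp
      qed
    qed
  qed
  with fin have fL: "finite ?L" by (rule finite_imageD)
  have "decomps m \<subseteq> ?L \<times> ?L"
    by (auto simp: decomps_def) (metis add.commute)
  then show ?thesis using fL by (meson finite_SigmaI finite_subset)
qed

instantiation symfun :: (comm_ring_1) comm_ring_1
begin

lift_definition zero_symfun :: "'a symfun" is "\<lambda>_. 0" by (simp add: is_sym_def)

lift_definition one_symfun :: "'a symfun" is "\<lambda>m. if m = 0 then 1 else 0"
  by (auto simp: is_sym_def map_key_0_iff intro!: exI[of _ 0] simp: mdeg_def split: if_splits)

lift_definition plus_symfun :: "'a symfun \<Rightarrow> 'a symfun \<Rightarrow> 'a symfun" is "\<lambda>f g m. f m + g m"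
proof -
  fix f g :: "monomial \<Rightarrow> 'a"
  assume "is_sym f" "is_sym g"
  then obtain d e where "\<forall>m. f m \<noteq> 0 \<longrightarrow> mdeg m \<le> d" "\<forall>m. g m \<noteq> 0 \<longrightarrow> mdeg m \<le> e"
    by (auto simp: is_sym_def)
  then have "\<forall>m. f m + g m \<noteq> 0 \<longrightarrow> mdeg m \<le> max d e"
    by (metis add.right_neutral le_max_iff_disj)
  with \<open>is_sym f\<close> \<open>is_sym g\<close> show "is_sym (\<lambda>m. f m + g m)"
    unfolding is_sym_def by auto
qed

lift_definition uminus_symfun :: "'a symfun \<Rightarrow> 'a symfun" is "\<lambda>f m. - f m"
  by (auto simp: is_sym_def)

definition minus_symfun :: "'a symfun \<Rightarrow> 'a symfun \<Rightarrow> 'a symfun" where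
  "minus_symfun f g = f + - g"

lift_definition times_symfun :: "'a symfun \<Rightarrow> 'a symfun \<Rightarrow> 'a symfun"
  is "\<lambda>f g m. \<Sum>(a, b)\<in>decomps m. f a * g b"
proof -
  fix f g :: "monomial \<Rightarrow> 'a"
  assume fg: "is_sym f" "is_sym g"
  then obtain d e where de: "\<And>m. f m \<noteq> 0 \<Longrightarrow> mdeg m \<le> d" "\<And>m. g m \<noteq> 0 \<Longrightarrow> mdeg m \<le> e"
    by (auto simp: is_sym_def)
  have "mdeg m \<le> d + e" if "(\<Sum>(a, b)\<in>decomps m. f a * g b) \<noteq> 0" for m
  proof -
    obtain ab where "ab \<in> decomps m" "(case ab of (a, b) \<Rightarrow> f a * g b) \<noteq> 0"
      using \<open>(\<Sum>(a, b)\<in>decomps m. f a * g b) \<noteq> 0\<close> by (rule sum.not_neutral_contains_not_neutral)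
    then obtain a b where "a + b = m" "f a * g b \<noteq> 0"
      by (cases ab) (auto simp: decomps_def)
    then show ?thesis using de[of a] de(2)[of b]
      by (metis add_mono mdeg_add mult_not_zero)
  qed
  moreover have "(\<Sum>(a, b)\<in>decomps (Poly_Mapping.map_key p m). f a * g b) =
      (\<Sum>(a, b)\<in>decomps m. f a * g b)" if p: "bij p" for p m
  proof -
    have inj: "inj p" "inj (inv p)" using p by (auto simp: bij_is_inj bij_imp_bij_inv)
    have inv1: "Poly_Mapping.map_key p (Poly_Mapping.map_key (inv p) a) = a" for a :: monomial
      using inj p by (simp add: map_key_compose map_key_id[unfolded id_def[symmetric]] id_def[symmetric] inv_o_cancel)
    have inv2: "Poly_Mapping.map_key (inv p) (Poly_Mapping.map_key p a) = a" for a :: monomial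
      using inj p bij_is_surj[OF p]
      by (simp add: map_key_compose map_key_id[unfolded id_def[symmetric]] surj_iff[THEN iffD1])
    show ?thesis
      by (rule sum.reindex_bij_witness[where
            i = "\<lambda>(a, b). (Poly_Mapping.map_key p a, Poly_Mapping.map_key p b)" and
            j = "\<lambda>(a, b). (Poly_Mapping.map_key (inv p) a, Poly_Mapping.map_key (inv p) b)"])
        (use fg p in \<open>auto simp: decomps_def inv1 inv2 map_key_plus[OF inj(1), symmetric]
          map_key_plus[OF inj(2), symmetric] is_sym_def bij_imp_bij_inv\<close>)
  qed
  ultimately show "is_sym (\<lambda>m. \<Sum>(a, b)\<in>decomps m. f a * g b)"
    unfolding is_sym_def by blast
qed

instance
proof
  fix f g h :: "'a symfun"
  show "f + g + h = f + (g + h)" by transfer (simp add: add.assoc)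
  show "f + g = g + f" by transfer (simp add: add.commute)
  show "0 + f = f" by transfer simp
  show "- f + f = 0" by transfer simp
  show "f - g = f + - g" by (rule minus_symfun_def)
  show "f * g = g * f"
  proof (transfer, rule ext)
    fix f g :: "monomial \<Rightarrow> 'a" and m
    show "(\<Sum>(a, b)\<in>decomps m. f a * g b) = (\<Sum>(a, b)\<in>decomps m. g a * f b)"
      by (rule sum.reindex_bij_witness[where i = prod.swap and j = prod.swap])
        (auto simp: decomps_def add.commute mult.commute)
  qed
  show "1 * f = f"
  proof (transfer, rule ext)
    fix f :: "monomial \<Rightarrow> 'a" and m
    have "(\<Sum>(a, b)\<in>decomps m. (if a = 0 then 1 else 0) * f b) =
        (\<Sum>(a, b)\<in>{(0::monomial, m)}. (if a = 0 then 1 else 0) * f b)"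
      by (intro sum.mono_neutral_right) (use finite_decomps[of m] in \<open>auto simp: decomps_def split: if_splits\<close>)
    then show "(\<Sum>(a, b)\<in>decomps m. (if a = 0 then 1 else 0) * f b) = f m" by simp
  qed
  show "(f + g) * h = f * h + g * h"
    by transfer (auto simp: fun_eq_iff distrib_right sum.distrib[symmetric] intro!: sum.cong)
  show "f * g * h = f * (g * h)"
  proof (transfer, rule ext)
    fix f g h :: "monomial \<Rightarrow> 'a" and m
    have "(\<Sum>(a, b)\<in>decomps m. (\<Sum>(a, b)\<in>decomps a. f a * g b) * h b) =
      (\<Sum>x\<in>decomps m. \<Sum>y\<in>decomps (fst x). f (fst y) * g (snd y) * h (snd x))"
      by (simp add: sum_distrib_right split_def)
    also have "\<dots> = (\<Sum>(x, y)\<in>Sigma (decomps m) (\<lambda>x. decomps (fst x)). f (fst y) * g (snd y) * h (snd x))"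
      by (rule sum.Sigma) (auto simp: finite_decomps)
    also have "\<dots> = (\<Sum>(x, y)\<in>Sigma (decomps m) (\<lambda>x. decomps (snd x)). f (fst x) * (g (fst y) * h (snd y)))"
      by (rule sum.reindex_bij_witness[where
            i = "\<lambda>((a, bc), (b, c)). ((a + b, c), (a, b))" and
            j = "\<lambda>((ab, c), (a, b)). ((a, b + c), (b, c))"])
        (auto simp: decomps_def add.assoc mult.assoc)
    also have "\<dots> = (\<Sum>x\<in>decomps m. \<Sum>y\<in>decomps (snd x). f (fst x) * (g (fst y) * h (snd y)))"
      by (rule sum.Sigma[symmetric]) (auto simp: finite_decomps)
    finally show "(\<Sum>(a, b)\<in>decomps m. (\<Sum>(a, b)\<in>decomps a. f a * g b) * h b) =
        (\<Sum>(a, b)\<in>decomps m. f a * (\<Sum>(a, b)\<in>decomps b. g a * h b))"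
      by (simp add: sum_distrib_left split_def)
  qed
  show "(0::'a symfun) \<noteq> 1" by transfer (auto simp: fun_eq_iff)
qed

end

lift_definition sym_const :: "'a::comm_ring_1 \<Rightarrow> 'a symfun" is "\<lambda>c m. if m = 0 then c else 0"
  by (auto simp: is_sym_def map_key_0_iff intro!: exI[of _ 0] simp: mdeg_def split: if_splits)

lemma map_key_eq_single_iff:
  assumes p: "bij p"
  shows "(\<exists>i. Poly_Mapping.map_key p m = Poly_Mapping.single i n) \<longleftrightarrow> (\<exists>i. m = Poly_Mapping.single i n)"
proof
  assume "\<exists>i. m = Poly_Mapping.single i n"
  then obtain i where i: "m = Poly_Mapping.single i n" by blast
  obtain j where "i = p j" using p by (meson bij_pointE)
  then show "\<exists>i. Poly_Mapping.map_key p m = Poly_Mapping.single i n"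
    using i p by (auto simp: bij_is_inj)
next
  assume "\<exists>i. Poly_Mapping.map_key p m = Poly_Mapping.single i n"
  then obtain i where i: "Poly_Mapping.map_key p m = Poly_Mapping.single i n" by blast
  have "m = Poly_Mapping.single (p i) n"
  proof (rule poly_mapping_eqI)
    fix k
    obtain j where k: "k = p j" using p by (meson bij_pointE)
    have "Poly_Mapping.lookup m k = Poly_Mapping.lookup (Poly_Mapping.map_key p m) j"
      using p by (simp add: k map_key.rep_eq bij_is_inj)
    also have "\<dots> = Poly_Mapping.lookup (Poly_Mapping.single (p i) n) k"
      using p by (simp add: i k lookup_single bij_is_inj[THEN inj_eq])
    finally show "Poly_Mapping.lookup m k = Poly_Mapping.lookup (Poly_Mapping.single (p i) n) k" .
  qed
  then show "\<exists>i. m = Poly_Mapping.single i n" by blast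
qed

text \<open>The power sum \<open>p\<^sub>n\<close>; it is used for \<open>n \<ge> 1\<close> only.\<close>

lift_definition psum :: "nat \<Rightarrow> 'a::comm_ring_1 symfun"
  is "\<lambda>n m. if \<exists>i. m = Poly_Mapping.single i n then 1 else 0"
proof -
  fix n
  have "mdeg (Poly_Mapping.single i n) \<le> n" for i by (simp add: mdeg_def)
  then show "is_sym (\<lambda>m. if \<exists>i. m = Poly_Mapping.single i n then (1::'a) else 0)"
    unfolding is_sym_def by (auto simp: map_key_eq_single_iff intro!: exI[of _ n])
qed

lift_definition hsum :: "nat \<Rightarrow> 'a::comm_ring_1 symfun"
  is "\<lambda>n m. if mdeg m = n then 1 else 0"
  by (auto simp: is_sym_def mdeg_map_key)


section \<open>Plethysm\<close>

definition ring_homo :: "('a::comm_ring_1 \<Rightarrow> 'b::comm_ring_1) \<Rightarrow> bool" where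
  "ring_homo \<phi> \<longleftrightarrow> \<phi> 1 = 1 \<and> (\<forall>a b. \<phi> (a + b) = \<phi> a + \<phi> b) \<and> (\<forall>a b. \<phi> (a * b) = \<phi> a * \<phi> b)"

text \<open>
  The target ring is a \<open>\<rat>(q,t)\<close>-algebra through the structure map \<open>c\<close>, and a plethystic alphabet
  \<open>A\<close> is given by the sequence \<open>a n = p\<^sub>n[A]\<close> for \<open>n \<ge> 1\<close>.  Then \<open>plethysm c a F = F[A]\<close>:
  the image of \<open>F\<close> under the algebra homomorphism with \<open>p\<^sub>n \<mapsto> p\<^sub>n[A]\<close> (it exists and is
  unique because \<open>Sym\<close> is freely generated by the power sums).
\<close>

definition plethysm :: "(qt \<Rightarrow> 'b::comm_ring_1) \<Rightarrow> (nat \<Rightarrow> 'b) \<Rightarrow> qt symfun \<Rightarrow> 'b" where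
  "plethysm c a = (THE \<phi>. ring_homo \<phi> \<and> (\<forall>r. \<phi> (sym_const r) = c r) \<and> (\<forall>n\<ge>1. \<phi> (psum n) = a n))"

definition Exp :: "(qt \<Rightarrow> 'b::{comm_ring_1, t2_space}) \<Rightarrow> (nat \<Rightarrow> 'b) \<Rightarrow> 'b" where
  "Exp c a = suminf (\<lambda>n. plethysm c a (hsum n))"


section \<open>The spaces \<open>V\<^sub>k\<close>, \<open>V\<^sub>*\<close> and their operators\<close>

text \<open>
  \<open>V\<^sub>k = Sym[X] \<otimes> \<rat>[y\<^sub>1,\<dots>,y\<^sub>k]\<close> consists of the polynomials with coefficients in \<open>Sym[X]\<close> that
  involve only \<open>y\<^sub>1, \<dots>, y\<^sub>k\<close>.
\<close>

type_synonym vpoly = "monomial \<Rightarrow>\<^sub>0 qt symfun"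

definition V :: "nat \<Rightarrow> vpoly set" where
  "V k = {F. \<forall>m\<in>Poly_Mapping.keys F. Poly_Mapping.keys m \<subseteq> {1..k}}"

definition vsym :: "qt symfun \<Rightarrow> vpoly" where
  "vsym f = Poly_Mapping.single 0 f"

definition vconst :: "qt \<Rightarrow> vpoly" where
  "vconst c = vsym (sym_const c)"

definition yvar :: "nat \<Rightarrow> vpoly" where
  "yvar i = Poly_Mapping.single (Poly_Mapping.single i 1) 1"

text \<open>Apply \<open>\<phi>\<close> to the \<open>Sym[X]\<close> factor and substitute \<open>g i\<close> for \<open>y\<^sub>i\<close>.\<close>

definition eval_v :: "(qt symfun \<Rightarrow> 'b::comm_ring_1) \<Rightarrow> (nat \<Rightarrow> 'b) \<Rightarrow> vpoly \<Rightarrow> 'b" where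
  "eval_v \<phi> g F = (\<Sum>m\<in>Poly_Mapping.keys F. \<phi> (Poly_Mapping.lookup F m) *
     (\<Prod>i\<in>Poly_Mapping.keys m. g i ^ Poly_Mapping.lookup m i))"

definition swap_y :: "nat \<Rightarrow> vpoly \<Rightarrow> vpoly" where
  "swap_y i = eval_v vsym (\<lambda>j. if j = i then yvar (i + 1) else if j = i + 1 then yvar i else yvar j)"

definition T_op :: "nat \<Rightarrow> vpoly \<Rightarrow> vpoly" where
  "T_op i P = (THE Q. (yvar (i + 1) - yvar i) * Q =
     vconst (qq - 1) * yvar i * P + (yvar (i + 1) - vconst qq * yvar i) * swap_y i P)"

text \<open>\<open>F[X + (q-1)y\<^sub>i]\<close>, where \<open>p\<^sub>n[X + (q-1)y\<^sub>i] = p\<^sub>n[X] + (q\<^sup>n-1) y\<^sub>i\<^sup>n\<close>.\<close>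

definition pleth_plus :: "nat \<Rightarrow> vpoly \<Rightarrow> vpoly" where
  "pleth_plus i = eval_v
     (plethysm vconst (\<lambda>n. vsym (psum n) + vconst (qq ^ n - 1) * yvar i ^ n)) yvar"

definition dplus_op :: "nat \<Rightarrow> vpoly \<Rightarrow> vpoly" where
  "dplus_op k F = foldr T_op [1..<Suc k] (pleth_plus (k + 1) F)"

definition dplus_star_op :: "nat \<Rightarrow> vpoly \<Rightarrow> vpoly" where
  "dplus_star_op k F = eval_v vsym
     (\<lambda>i. if i = k + 1 then vconst tt * yvar 1 else yvar (i + 1)) (pleth_plus (k + 1) F)"

text \<open>
  The product defining \<open>d\<^sub>-\<close> is formed in the Laurent series in the indeterminate \<open>y\<^sub>k\<^sup>-\<^sup>1\<close>; thus
  \<^const>\<open>fls_X\<close> is \<open>y\<^sub>k\<^sup>-\<^sup>1\<close>, \<^const>\<open>fls_X_inv\<close> is \<open>y\<^sub>k\<close>, and the coefficient of \<open>y\<^sub>k\<^sup>-\<^sup>1\<close> has index 1.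
  The alphabets are \<open>p\<^sub>n[X - (q-1)y\<^sub>k] = p\<^sub>n[X] - (q\<^sup>n-1) y\<^sub>k\<^sup>n\<close> and
  \<open>p\<^sub>n[-y\<^sub>k\<^sup>-\<^sup>1 X] = - y\<^sub>k\<^sup>-\<^sup>n p\<^sub>n[X]\<close>.
\<close>

definition pleth_minus_laurent :: "nat \<Rightarrow> vpoly \<Rightarrow> vpoly fls" where
  "pleth_minus_laurent k = eval_v
     (plethysm (\<lambda>c. fls_const (vconst c))
       (\<lambda>n. fls_const (vsym (psum n)) - fls_const (vconst (qq ^ n - 1)) * fls_X_inv ^ n))
     (\<lambda>i. if i = k then fls_X_inv else fls_const (yvar i))"

definition Exp_laurent :: "vpoly fls" where
  "Exp_laurent = Exp (\<lambda>c. fls_const (vconst c)) (\<lambda>n. - (fls_X ^ n * fls_const (vsym (psum n))))"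

definition dminus_op :: "nat \<Rightarrow> vpoly \<Rightarrow> vpoly" where
  "dminus_op k F = - fls_nth (pleth_minus_laurent k F * Exp_laurent) 1"

text \<open>\<open>V\<^sub>* = \<Oplus>\<^sub>k V\<^sub>k\<close> as finitely supported families.\<close>

type_synonym vfam = "nat \<Rightarrow>\<^sub>0 vpoly"

definition Vstar :: "vfam set" where
  "Vstar = {v. \<forall>k. Poly_Mapping.lookup v k \<in> V k}"

definition vscale :: "qt \<Rightarrow> vfam \<Rightarrow> vfam" where
  "vscale c v = Poly_Mapping.map (\<lambda>F. vconst c * F) v"

definition vac :: vfam where
  "vac = Poly_Mapping.single 0 1"

text \<open>An operator \<open>V\<^sub>k \<rightarrow> V\<^sub>l\<close>, extended by \<open>0\<close> to the other summands of \<open>V\<^sub>*\<close>.\<close>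

definition on_summand :: "nat \<Rightarrow> nat \<Rightarrow> (vpoly \<Rightarrow> vpoly) \<Rightarrow> vfam \<Rightarrow> vfam" where
  "on_summand k l f v = Poly_Mapping.single l (f (Poly_Mapping.lookup v k))"


section \<open>Algebras over \<open>\<rat>(q,t)\<close>\<close>

text \<open>Associative algebras, not necessarily with a unit (the quiver has infinitely many vertices).\<close>

class qt_algebra = ring +
  fixes smul :: "qt \<Rightarrow> 'a \<Rightarrow> 'a"  (infixr "\<cdot>" 72)
  assumes smul_add_left: "(c + d) \<cdot> x = c \<cdot> x + d \<cdot> x"
    and smul_add_right: "c \<cdot> (x + y) = c \<cdot> x + c \<cdot> y"
    and smul_assoc: "(c * d) \<cdot> x = c \<cdot> d \<cdot> x"
    and smul_one: "1 \<cdot> x = x"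
    and smul_mult_left: "c \<cdot> (x * y) = (c \<cdot> x) * y"
    and smul_mult_right: "c \<cdot> (x * y) = x * (c \<cdot> y)"

lemma smul_zero_left: "0 \<cdot> x = (0::'a::qt_algebra)"
  using smul_add_left[of 0 0 x] by simp

lemma smul_minus_one: "(- 1) \<cdot> x = - (x::'a::qt_algebra)"
  using smul_add_left[of "- 1" 1 x] by (simp add: smul_zero_left smul_one eq_neg_iff_add_eq_0)

lemma smul_minus_right: "c \<cdot> (- x) = - (c \<cdot> (x::'a::qt_algebra))"
  by (metis smul_minus_one smul_assoc mult.commute)

lemma smul_diff_right: "c \<cdot> (x - y) = c \<cdot> x - c \<cdot> (y::'a::qt_algebra)"
  using smul_add_right[of c x "- y"] by (simp add: smul_minus_right)

inductive_set ideal_gen :: "'a::qt_algebra set \<Rightarrow> 'a set" for S where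
  base: "x \<in> S \<Longrightarrow> x \<in> ideal_gen S"
| zero: "0 \<in> ideal_gen S"
| add: "x \<in> ideal_gen S \<Longrightarrow> y \<in> ideal_gen S \<Longrightarrow> x + y \<in> ideal_gen S"
| smul: "x \<in> ideal_gen S \<Longrightarrow> c \<cdot> x \<in> ideal_gen S"
| mult_left: "x \<in> ideal_gen S \<Longrightarrow> a * x \<in> ideal_gen S"
| mult_right: "x \<in> ideal_gen S \<Longrightarrow> x * a \<in> ideal_gen S"

inductive_set left_ideal_gen :: "'a::qt_algebra set \<Rightarrow> 'a set" for S where
  base: "x \<in> S \<Longrightarrow> x \<in> left_ideal_gen S"
| zero: "0 \<in> left_ideal_gen S"
| add: "x \<in> left_ideal_gen S \<Longrightarrow> y \<in> left_ideal_gen S \<Longrightarrow> x + y \<in> left_ideal_gen S"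
| smul: "x \<in> left_ideal_gen S \<Longrightarrow> c \<cdot> x \<in> left_ideal_gen S"
| mult_left: "x \<in> left_ideal_gen S \<Longrightarrow> a * x \<in> left_ideal_gen S"

definition icong :: "'a::qt_algebra set \<Rightarrow> 'a \<Rightarrow> 'a \<Rightarrow> bool" where
  "icong S x y \<longleftrightarrow> x - y \<in> ideal_gen S"

lemma icong_refl: "icong S x x"
  by (simp add: icong_def ideal_gen.zero)

lemma icong_sym: "icong S x y \<Longrightarrow> icong S y x"
  using ideal_gen.smul[of "x - y" S "- 1"] by (simp add: icong_def smul_minus_one)

lemma icong_trans: "icong S x y \<Longrightarrow> icong S y z \<Longrightarrow> icong S x z"
  using ideal_gen.add[of "x - y" S "y - z"] by (simp add: icong_def)

lemma icong_equivp: "equivp (icong S)"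
  by (rule equivpI) (auto intro!: reflpI sympI transpI intro: icong_refl icong_sym icong_trans)

lemma icong_add: "icong S x x' \<Longrightarrow> icong S y y' \<Longrightarrow> icong S (x + y) (x' + y')"
  using ideal_gen.add[of "x - x'" S "y - y'"] by (simp add: icong_def algebra_simps)

lemma icong_smul: "icong S x y \<Longrightarrow> icong S (c \<cdot> x) (c \<cdot> y)"
  using ideal_gen.smul[of "x - y" S c] by (simp add: icong_def smul_diff_right)

lemma icong_uminus: "icong S x y \<Longrightarrow> icong S (- x) (- y)"
  using icong_smul[of S x y "- 1"] by (simp add: smul_minus_one)

lemma icong_mult: "icong S x x' \<Longrightarrow> icong S y y' \<Longrightarrow> icong S (x * y) (x' * y')"
  using ideal_gen.add[OF ideal_gen.mult_right[of "x - x'" S y] ideal_gen.mult_left[of "y - y'" S x']]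
  by (simp add: icong_def algebra_simps)


section \<open>Partial semigroup algebras: free algebras and path algebras\<close>

text \<open>
  The algebra with basis a set with a partial associative composition, where a product of two basis
  elements is \<open>0\<close> if they are not composable.  For nonempty words this is the free (non-unital)
  algebra, for the paths of a quiver it is the path algebra.
\<close>

class partial_semigroup =
  fixes pcomp :: "'a \<Rightarrow> 'a \<Rightarrow> 'a option"
  assumes pcomp_assoc: "Option.bind (pcomp a b) (\<lambda>x. pcomp x c) = Option.bind (pcomp b c) (pcomp a)"

typedef 'p psalg = "UNIV :: ('p \<Rightarrow>\<^sub>0 qt) set" ..

setup_lifting type_definition_psalg

definition pterm :: "'p::partial_semigroup \<Rightarrow> 'p \<Rightarrow> qt \<Rightarrow> ('p \<Rightarrow>\<^sub>0 qt)" where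
  "pterm a b c = (case pcomp a b of None \<Rightarrow> 0 | Some x \<Rightarrow> Poly_Mapping.single x c)"

definition pmul :: "('p::partial_semigroup \<Rightarrow>\<^sub>0 qt) \<Rightarrow> ('p \<Rightarrow>\<^sub>0 qt) \<Rightarrow> ('p \<Rightarrow>\<^sub>0 qt)" where
  "pmul f g = (\<Sum>a\<in>Poly_Mapping.keys f. \<Sum>b\<in>Poly_Mapping.keys g.
     pterm a b (Poly_Mapping.lookup f a * Poly_Mapping.lookup g b))"

lemma pterm_zero [simp]: "pterm a b 0 = 0"
  by (simp add: pterm_def split: option.split)

lemma pterm_add: "pterm a b (c + d) = pterm a b c + pterm a b d"
  by (simp add: pterm_def single_add split: option.split)

lemma pmul_superset:
  assumes "finite A" "Poly_Mapping.keys f \<subseteq> A" "finite B" "Poly_Mapping.keys g \<subseteq> B"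
  shows "pmul f g = (\<Sum>a\<in>A. \<Sum>b\<in>B. pterm a b (Poly_Mapping.lookup f a * Poly_Mapping.lookup g b))"
proof -
  have "pmul f g = (\<Sum>a\<in>Poly_Mapping.keys f. \<Sum>b\<in>B.
      pterm a b (Poly_Mapping.lookup f a * Poly_Mapping.lookup g b))"
    unfolding pmul_def using assms
    by (intro sum.cong refl sum.mono_neutral_left) (auto simp: in_keys_iff)
  also have "\<dots> = (\<Sum>a\<in>A. \<Sum>b\<in>B. pterm a b (Poly_Mapping.lookup f a * Poly_Mapping.lookup g b))"
    using assms by (intro sum.mono_neutral_left) (auto simp: in_keys_iff)
  finally show ?thesis .
qed

lemma pmul_add_left: "pmul (f + f') g = pmul f g + pmul f' g"
proof -
  let ?A = "Poly_Mapping.keys f \<union> Poly_Mapping.keys f'"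
  have "finite ?A" "Poly_Mapping.keys (f + f') \<subseteq> ?A" "Poly_Mapping.keys f \<subseteq> ?A"
    "Poly_Mapping.keys f' \<subseteq> ?A"
    using Poly_Mapping.keys_add[of f f'] by auto
  then show ?thesis
    by (simp add: pmul_superset[where A = ?A and B = "Poly_Mapping.keys g"] lookup_add
        distrib_right pterm_add sum.distrib)
qed

lemma pmul_add_right: "pmul f (g + g') = pmul f g + pmul f g'"
proof -
  let ?B = "Poly_Mapping.keys g \<union> Poly_Mapping.keys g'"
  have "finite ?B" "Poly_Mapping.keys (g + g') \<subseteq> ?B" "Poly_Mapping.keys g \<subseteq> ?B"
    "Poly_Mapping.keys g' \<subseteq> ?B"
    using Poly_Mapping.keys_add[of g g'] by auto
  then show ?thesis
    by (simp add: pmul_superset[where B = ?B and A = "Poly_Mapping.keys f"] lookup_add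
        distrib_left pterm_add sum.distrib)
qed

lemma pmul_zero [simp]: "pmul 0 g = 0" "pmul f 0 = 0"
  by (simp_all add: pmul_def)

lemma pmul_sum_left: "pmul (\<Sum>i\<in>I. F i) g = (\<Sum>i\<in>I. pmul (F i) g)"
  by (induction I rule: infinite_finite_induct) (simp_all add: pmul_add_left)

lemma pmul_sum_right: "pmul f (\<Sum>i\<in>I. G i) = (\<Sum>i\<in>I. pmul f (G i))"
  by (induction I rule: infinite_finite_induct) (simp_all add: pmul_add_right)

lemma pmul_single: "pmul (Poly_Mapping.single a c) (Poly_Mapping.single b d) = pterm a b (c * d)"
  by (subst pmul_superset[where A = "{a}" and B = "{b}"]) auto

lemma pm_sum_single: "f = (\<Sum>a\<in>Poly_Mapping.keys f. Poly_Mapping.single a (Poly_Mapping.lookup f a))"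
  by (rule poly_mapping_eqI)
    (auto simp: Poly_Mapping.lookup_sum lookup_single when_def in_keys_iff sum.delta')

lemma pmul_assoc_single:
  "pmul (pmul (Poly_Mapping.single a x) (Poly_Mapping.single b y)) (Poly_Mapping.single c z) =
   pmul (Poly_Mapping.single a x) (pmul (Poly_Mapping.single b y) (Poly_Mapping.single c z))"
  using pcomp_assoc[of a b c]
  by (cases "pcomp a b"; cases "pcomp b c") (auto simp: pterm_def pmul_single mult.assoc)

lemma pmul_assoc: "pmul (pmul f g) h = pmul f (pmul g h)"
proof -
  let ?s = "\<lambda>f a. Poly_Mapping.single a (Poly_Mapping.lookup f a)"
  have "pmul (pmul (\<Sum>a\<in>Poly_Mapping.keys f. ?s f a) (\<Sum>b\<in>Poly_Mapping.keys g. ?s g b))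
      (\<Sum>c\<in>Poly_Mapping.keys h. ?s h c) =
    pmul (\<Sum>a\<in>Poly_Mapping.keys f. ?s f a)
      (pmul (\<Sum>b\<in>Poly_Mapping.keys g. ?s g b) (\<Sum>c\<in>Poly_Mapping.keys h. ?s h c))"
    by (simp only: pmul_sum_left pmul_sum_right pmul_assoc_single)
  then show ?thesis by (simp only: pm_sum_single[symmetric])
qed

definition pm_scale :: "qt \<Rightarrow> ('p \<Rightarrow>\<^sub>0 qt) \<Rightarrow> ('p \<Rightarrow>\<^sub>0 qt)" where
  "pm_scale c f = Poly_Mapping.map ((*) c) f"

lemma lookup_pm_scale [simp]: "Poly_Mapping.lookup (pm_scale c f) a = c * Poly_Mapping.lookup f a"
  by (simp add: pm_scale_def Poly_Mapping.map.rep_eq when_def)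

lemma pm_scale_sum: "pm_scale c (\<Sum>i\<in>I. F i) = (\<Sum>i\<in>I. pm_scale c (F i))"
  by (rule poly_mapping_eqI) (simp add: Poly_Mapping.lookup_sum sum_distrib_left)

lemma pm_scale_pterm: "pm_scale c (pterm a b d) = pterm a b (c * d)"
  by (rule poly_mapping_eqI) (simp add: pterm_def lookup_single when_def split: option.split)

lemma keys_pm_scale: "Poly_Mapping.keys (pm_scale c f) \<subseteq> Poly_Mapping.keys f"
  by (auto simp: in_keys_iff)

lemma pm_scale_pmul:
  "pm_scale c (pmul f g) = pmul (pm_scale c f) g" "pm_scale c (pmul f g) = pmul f (pm_scale c g)"
proof -
  let ?A = "Poly_Mapping.keys f" and ?B = "Poly_Mapping.keys g"
  have f: "pmul (pm_scale c f) g =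
      (\<Sum>a\<in>?A. \<Sum>b\<in>?B. pterm a b (c * Poly_Mapping.lookup f a * Poly_Mapping.lookup g b))"
    using keys_pm_scale[of c f] by (subst pmul_superset[where A = ?A and B = ?B]) auto
  have g: "pmul f (pm_scale c g) =
      (\<Sum>a\<in>?A. \<Sum>b\<in>?B. pterm a b (Poly_Mapping.lookup f a * (c * Poly_Mapping.lookup g b)))"
    using keys_pm_scale[of c g] by (subst pmul_superset[where A = ?A and B = ?B]) auto
  show "pm_scale c (pmul f g) = pmul (pm_scale c f) g" "pm_scale c (pmul f g) = pmul f (pm_scale c g)"
    unfolding f g by (simp_all add: pmul_def pm_scale_sum pm_scale_pterm ac_simps)
qed

instantiation psalg :: (partial_semigroup) qt_algebra
begin

lift_definition zero_psalg :: "'a psalg" is 0 .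
lift_definition plus_psalg :: "'a psalg \<Rightarrow> 'a psalg \<Rightarrow> 'a psalg" is "(+)" .
lift_definition uminus_psalg :: "'a psalg \<Rightarrow> 'a psalg" is uminus .
lift_definition minus_psalg :: "'a psalg \<Rightarrow> 'a psalg \<Rightarrow> 'a psalg" is "(-)" .
lift_definition times_psalg :: "'a psalg \<Rightarrow> 'a psalg \<Rightarrow> 'a psalg" is pmul .
lift_definition smul_psalg :: "qt \<Rightarrow> 'a psalg \<Rightarrow> 'a psalg" is pm_scale .

instance
proof
  fix x y z :: "'a psalg" and c d :: qt
  show "x + y + z = x + (y + z)" by transfer (rule add.assoc)
  show "x + y = y + x" by transfer (rule add.commute)
  show "0 + x = x" by transfer simp
  show "- x + x = 0" by transfer simp
  show "x - y = x + - y" by transfer simp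
  show "x * y * z = x * (y * z)" by transfer (rule pmul_assoc)
  show "(x + y) * z = x * z + y * z" by transfer (rule pmul_add_left)
  show "x * (y + z) = x * y + x * z" by transfer (rule pmul_add_right)
  show "(c + d) \<cdot> x = c \<cdot> x + d \<cdot> x"
    by transfer (rule poly_mapping_eqI, simp add: lookup_add distrib_right)
  show "c \<cdot> (x + y) = c \<cdot> x + c \<cdot> y"
    by transfer (rule poly_mapping_eqI, simp add: lookup_add distrib_left)
  show "(c * d) \<cdot> x = c \<cdot> d \<cdot> x" by transfer (rule poly_mapping_eqI, simp add: mult.assoc)
  show "1 \<cdot> x = x" by transfer (rule poly_mapping_eqI, simp)
  show "c \<cdot> (x * y) = (c \<cdot> x) * y" by transfer (rule pm_scale_pmul)
  show "c \<cdot> (x * y) = x * (c \<cdot> y)" by transfer (rule pm_scale_pmul)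
qed

end

definition basis_elt :: "'p \<Rightarrow> 'p psalg" where
  "basis_elt a = Abs_psalg (Poly_Mapping.single a 1)"


section \<open>The free product of two algebras\<close>

typedef 'g word = "{w :: 'g list. w \<noteq> []}"
  by (rule exI[of _ "[undefined]"]) simp

setup_lifting type_definition_word

instantiation word :: (type) partial_semigroup
begin

lift_definition append_word :: "'a word \<Rightarrow> 'a word \<Rightarrow> 'a word" is "(@)" by simp

definition pcomp_word :: "'a word \<Rightarrow> 'a word \<Rightarrow> 'a word option" where
  "pcomp_word u v = Some (append_word u v)"

instance
proof
  fix a b c :: "'a word"
  have "append_word (append_word a b) c = append_word a (append_word b c)" by transfer simp
  then show "Option.bind (pcomp a b) (\<lambda>x. pcomp x c) = Option.bind (pcomp b c) (pcomp a)"
    by (simp add: pcomp_word_def)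
qed

end

definition letter :: "'g \<Rightarrow> 'g word psalg" where
  "letter g = basis_elt (Abs_word [g])"

text \<open>
  The free product is the free algebra on the disjoint union of the two algebras, modulo the
  relations that make both inclusions algebra homomorphisms.
\<close>

definition hom_rels :: "('a::qt_algebra \<Rightarrow> 'c::qt_algebra) \<Rightarrow> 'c set" where
  "hom_rels i = {i (x + y) - (i x + i y) | x y. True} \<union> {i (c \<cdot> x) - c \<cdot> i x | c x. True} \<union>
     {i (x * y) - i x * i y | x y. True}"

definition free_product_rels :: "('a::qt_algebra + 'b::qt_algebra) word psalg set" where
  "free_product_rels = hom_rels (\<lambda>a. letter (Inl a)) \<union> hom_rels (\<lambda>b. letter (Inr b))"

quotient_type (overloaded) ('a, 'b) free_product =
    "('a::qt_algebra + 'b::qt_algebra) word psalg" / "icong free_product_rels"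
  by (rule icong_equivp)

instantiation free_product :: (qt_algebra, qt_algebra) qt_algebra
begin

lift_definition zero_free_product :: "('a, 'b) free_product" is 0 .
lift_definition plus_free_product ::
  "('a, 'b) free_product \<Rightarrow> ('a, 'b) free_product \<Rightarrow> ('a, 'b) free_product" is "(+)"
  by (rule icong_add)
lift_definition uminus_free_product :: "('a, 'b) free_product \<Rightarrow> ('a, 'b) free_product" is uminus
  by (rule icong_uminus)
definition minus_free_product ::
  "('a, 'b) free_product \<Rightarrow> ('a, 'b) free_product \<Rightarrow> ('a, 'b) free_product" where
  "minus_free_product x y = x + - y"
lift_definition times_free_product ::
  "('a, 'b) free_product \<Rightarrow> ('a, 'b) free_product \<Rightarrow> ('a, 'b) free_product" is "(*)"
  by (rule icong_mult)
lift_definition smul_free_product :: "qt \<Rightarrow> ('a, 'b) free_product \<Rightarrow> ('a, 'b) free_product" is "(\<cdot>)"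
  by (rule icong_smul)

instance
proof
  fix x y z :: "('a, 'b) free_product" and c d :: qt
  show "x + y + z = x + (y + z)" by transfer (simp add: add.assoc icong_refl)
  show "x + y = y + x" by transfer (simp add: add.commute icong_refl)
  show "0 + x = x" by transfer (simp add: icong_refl)
  show "- x + x = 0" by transfer (simp add: icong_refl)
  show "x - y = x + - y" by (rule minus_free_product_def)
  show "x * y * z = x * (y * z)" by transfer (simp add: mult.assoc icong_refl)
  show "(x + y) * z = x * z + y * z" by transfer (simp add: distrib_right icong_refl)
  show "x * (y + z) = x * y + x * z" by transfer (simp add: distrib_left icong_refl)
  show "(c + d) \<cdot> x = c \<cdot> x + d \<cdot> x" by transfer (simp add: smul_add_left icong_refl)
  show "c \<cdot> (x + y) = c \<cdot> x + c \<cdot> y" by transfer (simp add: smul_add_right icong_refl)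
  show "(c * d) \<cdot> x = c \<cdot> d \<cdot> x" by transfer (simp add: smul_assoc icong_refl)
  show "1 \<cdot> x = x" by transfer (simp add: smul_one icong_refl)
  show "c \<cdot> (x * y) = (c \<cdot> x) * y" by transfer (simp add: smul_mult_left icong_refl)
  show "c \<cdot> (x * y) = x * (c \<cdot> y)" by transfer (simp add: smul_mult_right icong_refl)
qed

end

definition fp_inl :: "'a::qt_algebra \<Rightarrow> ('a, 'b::qt_algebra) free_product" where
  "fp_inl a = abs_free_product (letter (Inl a))"

definition fp_inr :: "'b::qt_algebra \<Rightarrow> ('a::qt_algebra, 'b) free_product" where
  "fp_inr b = abs_free_product (letter (Inr b))"


section \<open>The quiver and its path algebra\<close>

text \<open>
  All arrows are indexed by the vertex \<open>k\<close> at which they begin: \<open>Dplus k\<close> goes from \<open>k\<close> to \<open>k + 1\<close>,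
  \<open>Dminus k\<close> (for \<open>k \<ge> 1\<close>) from \<open>k\<close> to \<open>k - 1\<close>, and \<open>Loop k i\<close> (for \<open>1 \<le> i < k\<close>) is the loop
  \<open>T\<^sub>i\<close> at \<open>k\<close>.
\<close>

datatype arrow = Dplus nat | Dminus nat | Loop nat nat

fun is_arrow :: "arrow \<Rightarrow> bool" where
  "is_arrow (Dplus k) \<longleftrightarrow> True"
| "is_arrow (Dminus k) \<longleftrightarrow> 1 \<le> k"
| "is_arrow (Loop k i) \<longleftrightarrow> 1 \<le> i \<and> i < k"

fun source :: "arrow \<Rightarrow> nat" where
  "source (Dplus k) = k"
| "source (Dminus k) = k"
| "source (Loop k i) = k"

fun target :: "arrow \<Rightarrow> nat" where
  "target (Dplus k) = k + 1"
| "target (Dminus k) = k - 1"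
| "target (Loop k i) = k"

text \<open>
  A path is a triple of its end vertex, its arrows and its start vertex.  Paths are composed from
  right to left, so the last arrow of the list is the first one of the path.
\<close>

fun is_path :: "nat \<Rightarrow> arrow list \<Rightarrow> nat \<Rightarrow> bool" where
  "is_path b [] a \<longleftrightarrow> b = a"
| "is_path b (x # xs) a \<longleftrightarrow> is_arrow x \<and> target x = b \<and> is_path (source x) xs a"

lemma is_path_append: "is_path c u b \<Longrightarrow> is_path b v a \<Longrightarrow> is_path c (u @ v) a"
  by (induction u arbitrary: c) auto

typedef path = "{(b, w, a). is_path b w a}"
  by (rule exI[of _ "(0, [], 0)"]) simp

setup_lifting type_definition_path

lift_definition path_end :: "path \<Rightarrow> nat" is fst .
lift_definition path_start :: "path \<Rightarrow> nat" is "\<lambda>p. snd (snd p)" .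
lift_definition path_append :: "path \<Rightarrow> path \<Rightarrow> path" is
  "\<lambda>(b, w, a) (b', w', a'). if a = b' then (b, w @ w', a') else (b, w, a)"
  by (auto intro: is_path_append split: if_splits)

instantiation path :: partial_semigroup
begin

definition pcomp_path :: "path \<Rightarrow> path \<Rightarrow> path option" where
  "pcomp_path u v = (if path_start u = path_end v then Some (path_append u v) else None)"

instance
proof
  fix a b c :: path
  have 1: "path_start (path_append a b) = path_start b" if "path_start a = path_end b" for a b
    using that by transfer auto
  have 2: "path_end (path_append a b) = path_end a" if "path_start a = path_end b" for a b
    using that by transfer auto
  have 3: "path_append (path_append a b) c = path_append a (path_append b c)"
    if "path_start a = path_end b" "path_start b = path_end c"
    using that by transfer auto
  show "Option.bind (pcomp a b) (\<lambda>x. pcomp x c) = Option.bind (pcomp b c) (pcomp a)"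
    by (auto simp: pcomp_path_def 1 2 3)
qed

end

definition vertex_elt :: "nat \<Rightarrow> path psalg" where
  "vertex_elt k = basis_elt (Abs_path (k, [], k))"

definition arrow_elt :: "arrow \<Rightarrow> path psalg" where
  "arrow_elt x = basis_elt (Abs_path (target x, [x], source x))"


section \<open>The algebras \<open>\<bbbA>\<close> and \<open>\<bbbA>\<^sup>*\<close>\<close>

text \<open>
  The generators \<open>e\<^sub>k\<close>, \<open>d\<^sub>+\<close>, \<open>d\<^sub>-\<close>, \<open>T\<^sub>i\<close> in an algebra; the first argument is always the vertex
  at which the generator begins.
\<close>

record 'a dyck_gens =
  gE :: "nat \<Rightarrow> 'a"
  gP :: "nat \<Rightarrow> 'a"
  gM :: "nat \<Rightarrow> 'a"
  gT :: "nat \<Rightarrow> nat \<Rightarrow> 'a"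

definition map_gens :: "('a \<Rightarrow> 'b) \<Rightarrow> 'a dyck_gens \<Rightarrow> 'b dyck_gens" where
  "map_gens f G = \<lparr>gE = \<lambda>k. f (gE G k), gP = \<lambda>k. f (gP G k), gM = \<lambda>k. f (gM G k),
     gT = \<lambda>k i. f (gT G k i)\<rparr>"

definition path_gens :: "path psalg dyck_gens" where
  "path_gens = \<lparr>gE = vertex_elt, gP = \<lambda>k. arrow_elt (Dplus k), gM = \<lambda>k. arrow_elt (Dminus k),
     gT = \<lambda>k i. arrow_elt (Loop k i)\<rparr>"

text \<open>\<open>d\<^sub>+d\<^sub>- - d\<^sub>-d\<^sub>+\<close> on paths beginning at \<open>k \<ge> 1\<close>.\<close>

definition dcomm :: "'a::qt_algebra dyck_gens \<Rightarrow> nat \<Rightarrow> 'a" where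
  "dcomm G k = gP G (k - 1) * gM G k - gM G (k + 1) * gP G k"

definition dyck_rels :: "qt \<Rightarrow> 'a::qt_algebra dyck_gens \<Rightarrow> 'a set" where
  "dyck_rels c G =
     {(gT G k i - gE G k) * (gT G k i + c \<cdot> gE G k) | k i. 1 \<le> i \<and> i < k} \<union>
     {gT G k i * gT G k (i + 1) * gT G k i - gT G k (i + 1) * gT G k i * gT G k (i + 1)
       | k i. 1 \<le> i \<and> i + 1 < k} \<union>
     {gT G k i * gT G k j - gT G k j * gT G k i
       | k i j. 1 \<le> i \<and> i < k \<and> 1 \<le> j \<and> j < k \<and> (i + 1 < j \<or> j + 1 < i)} \<union>
     {gT G (k - 1) i * gM G k - gM G k * gT G k i | k i. 1 \<le> i \<and> i < k - 1} \<union>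
     {gP G k * gT G k i - gT G (k + 1) (i + 1) * gP G k | k i. 1 \<le> i \<and> i < k} \<union>
     {gT G (k + 2) 1 * gP G (k + 1) * gP G k - gP G (k + 1) * gP G k | k. True} \<union>
     {gM G (k - 1) * gM G k * gT G k (k - 1) - gM G (k - 1) * gM G k | k. 2 \<le> k} \<union>
     {gM G k * dcomm G k * gT G k (k - 1) - c \<cdot> (dcomm G (k - 1) * gM G k) | k. 2 \<le> k} \<union>
     {gT G (k + 1) 1 * dcomm G (k + 1) * gP G k - c \<cdot> (gP G k * dcomm G k) | k. 1 \<le> k}"

text \<open>The inverse of \<open>x\<close> in the corner algebra with unit \<open>e\<close>.\<close>

definition corner_inv :: "'a::qt_algebra \<Rightarrow> 'a \<Rightarrow> 'a" where
  "corner_inv e x = (THE y. e * y = y \<and> y * e = y \<and> x * y = e \<and> y * x = e)"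

definition gTinv :: "'a::qt_algebra dyck_gens \<Rightarrow> nat \<Rightarrow> nat \<Rightarrow> 'a" where
  "gTinv G k i = corner_inv (gE G k) (gT G k i)"

text \<open>The element \<open>y\<^sub>i\<close> at the vertex \<open>k\<close>, for \<open>1 \<le> i \<le> k\<close>.\<close>

function ygen :: "qt \<Rightarrow> 'a::qt_algebra dyck_gens \<Rightarrow> nat \<Rightarrow> nat \<Rightarrow> 'a" where
  "ygen c G k i =
     (if i < k then inverse c \<cdot> (gT G k i * ygen c G k (i + 1) * gT G k i)
      else (1 / (c - 1)) \<cdot> foldr (\<lambda>j x. gTinv G k j * x) (rev [1..<k]) (dcomm G k))"
  by pat_completeness auto
termination by (relation "measure (\<lambda>(c, G, k, i). k - i)") auto

declare ygen.simps [simp del]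

quotient_type dyck = "path psalg" / "icong (dyck_rels qq path_gens)"
  by (rule icong_equivp)

instantiation dyck :: qt_algebra
begin

lift_definition zero_dyck :: dyck is 0 .
lift_definition plus_dyck :: "dyck \<Rightarrow> dyck \<Rightarrow> dyck" is "(+)" by (rule icong_add)
lift_definition uminus_dyck :: "dyck \<Rightarrow> dyck" is uminus by (rule icong_uminus)
definition minus_dyck :: "dyck \<Rightarrow> dyck \<Rightarrow> dyck" where "minus_dyck x y = x + - y"
lift_definition times_dyck :: "dyck \<Rightarrow> dyck \<Rightarrow> dyck" is "(*)" by (rule icong_mult)
lift_definition smul_dyck :: "qt \<Rightarrow> dyck \<Rightarrow> dyck" is "(\<cdot>)" by (rule icong_smul)

instance
proof
  fix x y z :: dyck and c d :: qt
  show "x + y + z = x + (y + z)" by transfer (simp add: add.assoc icong_refl)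
  show "x + y = y + x" by transfer (simp add: add.commute icong_refl)
  show "0 + x = x" by transfer (simp add: icong_refl)
  show "- x + x = 0" by transfer (simp add: icong_refl)
  show "x - y = x + - y" by (rule minus_dyck_def)
  show "x * y * z = x * (y * z)" by transfer (simp add: mult.assoc icong_refl)
  show "(x + y) * z = x * z + y * z" by transfer (simp add: distrib_right icong_refl)
  show "x * (y + z) = x * y + x * z" by transfer (simp add: distrib_left icong_refl)
  show "(c + d) \<cdot> x = c \<cdot> x + d \<cdot> x" by transfer (simp add: smul_add_left icong_refl)
  show "c \<cdot> (x + y) = c \<cdot> x + c \<cdot> y" by transfer (simp add: smul_add_right icong_refl)
  show "(c * d) \<cdot> x = c \<cdot> d \<cdot> x" by transfer (simp add: smul_assoc icong_refl)
  show "1 \<cdot> x = x" by transfer (simp add: smul_one icong_refl)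
  show "c \<cdot> (x * y) = (c \<cdot> x) * y" by transfer (simp add: smul_mult_left icong_refl)
  show "c \<cdot> (x * y) = x * (c \<cdot> y)" by transfer (simp add: smul_mult_right icong_refl)
qed

end

quotient_type dyck_star = "path psalg" / "icong (dyck_rels (inverse qq) path_gens)"
  by (rule icong_equivp)

instantiation dyck_star :: qt_algebra
begin

lift_definition zero_dyck_star :: dyck_star is 0 .
lift_definition plus_dyck_star :: "dyck_star \<Rightarrow> dyck_star \<Rightarrow> dyck_star" is "(+)" by (rule icong_add)
lift_definition uminus_dyck_star :: "dyck_star \<Rightarrow> dyck_star" is uminus by (rule icong_uminus)
definition minus_dyck_star :: "dyck_star \<Rightarrow> dyck_star \<Rightarrow> dyck_star" where
  "minus_dyck_star x y = x + - y"
lift_definition times_dyck_star :: "dyck_star \<Rightarrow> dyck_star \<Rightarrow> dyck_star" is "(*)"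
  by (rule icong_mult)
lift_definition smul_dyck_star :: "qt \<Rightarrow> dyck_star \<Rightarrow> dyck_star" is "(\<cdot>)" by (rule icong_smul)

instance
proof
  fix x y z :: dyck_star and c d :: qt
  show "x + y + z = x + (y + z)" by transfer (simp add: add.assoc icong_refl)
  show "x + y = y + x" by transfer (simp add: add.commute icong_refl)
  show "0 + x = x" by transfer (simp add: icong_refl)
  show "- x + x = 0" by transfer (simp add: icong_refl)
  show "x - y = x + - y" by (rule minus_dyck_star_def)
  show "x * y * z = x * (y * z)" by transfer (simp add: mult.assoc icong_refl)
  show "(x + y) * z = x * z + y * z" by transfer (simp add: distrib_right icong_refl)
  show "x * (y + z) = x * y + x * z" by transfer (simp add: distrib_left icong_refl)
  show "(c + d) \<cdot> x = c \<cdot> x + d \<cdot> x" by transfer (simp add: smul_add_left icong_refl)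
  show "c \<cdot> (x + y) = c \<cdot> x + c \<cdot> y" by transfer (simp add: smul_add_right icong_refl)
  show "(c * d) \<cdot> x = c \<cdot> d \<cdot> x" by transfer (simp add: smul_assoc icong_refl)
  show "1 \<cdot> x = x" by transfer (simp add: smul_one icong_refl)
  show "c \<cdot> (x * y) = (c \<cdot> x) * y" by transfer (simp add: smul_mult_left icong_refl)
  show "c \<cdot> (x * y) = x * (c \<cdot> y)" by transfer (simp add: smul_mult_right icong_refl)
qed

end

definition dyck_alg_gens :: "dyck dyck_gens" where
  "dyck_alg_gens = map_gens abs_dyck path_gens"

definition dyck_star_gens :: "dyck_star dyck_gens" where
  "dyck_star_gens = map_gens abs_dyck_star path_gens"

definition y_elt :: "nat \<Rightarrow> nat \<Rightarrow> dyck" where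
  "y_elt k i = ygen qq dyck_alg_gens k i"

definition z_elt :: "nat \<Rightarrow> nat \<Rightarrow> dyck_star" where
  "z_elt k i = ygen (inverse qq) dyck_star_gens k i"


section \<open>The double Dyck path algebra\<close>

definition double_rels :: "(dyck, dyck_star) free_product set" where
  "double_rels =
     {fp_inr (gM dyck_star_gens k) - fp_inl (gM dyck_alg_gens k) | k. 1 \<le> k} \<union>
     {fp_inr (gT dyck_star_gens k i) - fp_inl (gTinv dyck_alg_gens k i) | k i. 1 \<le> i \<and> i < k} \<union>
     {fp_inr (gE dyck_star_gens k) - fp_inl (gE dyck_alg_gens k) | k. True} \<union>
     {fp_inr (z_elt (k + 1) (i + 1)) * fp_inl (gP dyck_alg_gens k) -
        fp_inl (gP dyck_alg_gens k) * fp_inr (z_elt k i) | k i. 1 \<le> i \<and> i \<le> k} \<union>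
     {fp_inl (y_elt (k + 1) (i + 1)) * fp_inr (gP dyck_star_gens k) -
        fp_inr (gP dyck_star_gens k) * fp_inl (y_elt k i) | k i. 1 \<le> i \<and> i \<le> k} \<union>
     {fp_inr (z_elt (k + 1) 1) * fp_inl (gP dyck_alg_gens k) -
        (- tt * qq ^ (k + 1)) \<cdot> (fp_inl (y_elt (k + 1) 1) * fp_inr (gP dyck_star_gens k)) | k. True}"

quotient_type double_dyck = "(dyck, dyck_star) free_product" / "icong double_rels"
  by (rule icong_equivp)

instantiation double_dyck :: qt_algebra
begin

lift_definition zero_double_dyck :: double_dyck is 0 .
lift_definition plus_double_dyck :: "double_dyck \<Rightarrow> double_dyck \<Rightarrow> double_dyck" is "(+)"
  by (rule icong_add)
lift_definition uminus_double_dyck :: "double_dyck \<Rightarrow> double_dyck" is uminus by (rule icong_uminus)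
definition minus_double_dyck :: "double_dyck \<Rightarrow> double_dyck \<Rightarrow> double_dyck" where
  "minus_double_dyck x y = x + - y"
lift_definition times_double_dyck :: "double_dyck \<Rightarrow> double_dyck \<Rightarrow> double_dyck" is "(*)"
  by (rule icong_mult)
lift_definition smul_double_dyck :: "qt \<Rightarrow> double_dyck \<Rightarrow> double_dyck" is "(\<cdot>)"
  by (rule icong_smul)

instance
proof
  fix x y z :: double_dyck and c d :: qt
  show "x + y + z = x + (y + z)" by transfer (simp add: add.assoc icong_refl)
  show "x + y = y + x" by transfer (simp add: add.commute icong_refl)
  show "0 + x = x" by transfer (simp add: icong_refl)
  show "- x + x = 0" by transfer (simp add: icong_refl)
  show "x - y = x + - y" by (rule minus_double_dyck_def)
  show "x * y * z = x * (y * z)" by transfer (simp add: mult.assoc icong_refl)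
  show "(x + y) * z = x * z + y * z" by transfer (simp add: distrib_right icong_refl)
  show "x * (y + z) = x * y + x * z" by transfer (simp add: distrib_left icong_refl)
  show "(c + d) \<cdot> x = c \<cdot> x + d \<cdot> x" by transfer (simp add: smul_add_left icong_refl)
  show "c \<cdot> (x + y) = c \<cdot> x + c \<cdot> y" by transfer (simp add: smul_add_right icong_refl)
  show "(c * d) \<cdot> x = c \<cdot> d \<cdot> x" by transfer (simp add: smul_assoc icong_refl)
  show "1 \<cdot> x = x" by transfer (simp add: smul_one icong_refl)
  show "c \<cdot> (x * y) = (c \<cdot> x) * y" by transfer (simp add: smul_mult_left icong_refl)
  show "c \<cdot> (x * y) = x * (c \<cdot> y)" by transfer (simp add: smul_mult_right icong_refl)
qed

end

definition double_gens :: "double_dyck dyck_gens" where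
  "double_gens = map_gens (\<lambda>a. abs_double_dyck (fp_inl a)) dyck_alg_gens"

definition double_star_gens :: "double_dyck dyck_gens" where
  "double_star_gens = map_gens (\<lambda>b. abs_double_dyck (fp_inr b)) dyck_star_gens"


section \<open>Actions and the polynomial representation\<close>

definition is_action :: "(double_dyck \<Rightarrow> vfam \<Rightarrow> vfam) \<Rightarrow> bool" where
  "is_action \<rho> \<longleftrightarrow>
     (\<forall>x. \<forall>v\<in>Vstar. \<rho> x v \<in> Vstar) \<and>
     (\<forall>x. \<forall>v\<in>Vstar. \<forall>w\<in>Vstar. \<rho> x (v + w) = \<rho> x v + \<rho> x w) \<and>
     (\<forall>x c. \<forall>v\<in>Vstar. \<rho> x (vscale c v) = vscale c (\<rho> x v)) \<and>
     (\<forall>x y. \<forall>v\<in>Vstar. \<rho> (x + y) v = \<rho> x v + \<rho> y v) \<and>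
     (\<forall>c x. \<forall>v\<in>Vstar. \<rho> (c \<cdot> x) v = vscale c (\<rho> x v)) \<and>
     (\<forall>x y. \<forall>v\<in>Vstar. \<rho> (x * y) v = \<rho> x (\<rho> y v))"

definition acts_by_operators :: "(double_dyck \<Rightarrow> vfam \<Rightarrow> vfam) \<Rightarrow> bool" where
  "acts_by_operators \<rho> \<longleftrightarrow> (\<forall>v\<in>Vstar.
     (\<forall>k. \<rho> (gE double_gens k) v = on_summand k k (\<lambda>F. F) v) \<and>
     (\<forall>k i. 1 \<le> i \<and> i < k \<longrightarrow> \<rho> (gT double_gens k i) v = on_summand k k (T_op i) v) \<and>
     (\<forall>k\<ge>1. \<rho> (gM double_gens k) v = on_summand k (k - 1) (dminus_op k) v) \<and>
     (\<forall>k. \<rho> (gP double_gens k) v = on_summand k (k + 1) (dplus_op k) v) \<and>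
     (\<forall>k. \<rho> (gP double_star_gens k) v = on_summand k (k + 1) (dplus_star_op k) v))"

definition Ae0 :: "double_dyck set" where
  "Ae0 = {f * gE double_gens 0 | f. True}"

text \<open>\<open>d\<^sub>+\<^sup>m\<close> on paths beginning at \<open>k\<close>.\<close>

primrec dplus_pow :: "nat \<Rightarrow> nat \<Rightarrow> double_dyck" where
  "dplus_pow k 0 = gE double_gens k"
| "dplus_pow k (Suc m) = gP double_gens (k + m) * dplus_pow k m"

text \<open>
  The ideal \<open>I\<close> is a left ideal: the kernel of \<open>f e\<^sub>0 \<mapsto> f(1)\<close> is a left submodule, while the
  two-sided ideal contains \<open>(d\<^sub>+\<^sup>* - d\<^sub>+) d\<^sub>-d\<^sub>+e\<^sub>0\<close>, which sends \<open>1\<close> to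
  \<open>(q-1)(t-1)y\<^sub>1 \<noteq> 0\<close>.  The generators are taken at every vertex \<open>k\<close>; those at \<open>k \<noteq> 0\<close> are
  annihilated by \<open>e\<^sub>0\<close> from the right.
\<close>

definition I_ideal :: "double_dyck set" where
  "I_ideal = left_ideal_gen
     {gP double_star_gens (k + m) * dplus_pow k m - dplus_pow k (m + 1) | k m. True}"

definition Ie0 :: "double_dyck set" where
  "Ie0 = {x * gE double_gens 0 | x. x \<in> I_ideal}"

definition Ie0_rel :: "(double_dyck \<times> double_dyck) set" where
  "Ie0_rel = {(x, y). x \<in> Ae0 \<and> y \<in> Ae0 \<and> x - y \<in> Ie0}"

text \<open>
  An isomorphism of left modules from \<open>\<bbbA>\<^sub>q\<^sub>,\<^sub>t e\<^sub>0 / Ie\<^sub>0\<close> (the set of cosets) to \<open>V\<^sub>*\<close>; the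
  linear structure and the action on the quotient are those of representatives.
\<close>

definition is_quotient_iso ::
  "(double_dyck \<Rightarrow> vfam \<Rightarrow> vfam) \<Rightarrow> (double_dyck set \<Rightarrow> vfam) \<Rightarrow> bool" where
  "is_quotient_iso \<rho> \<Phi> \<longleftrightarrow>
     bij_betw \<Phi> (Ae0 // Ie0_rel) Vstar \<and>
     (\<forall>x\<in>Ae0. \<forall>y\<in>Ae0. \<Phi> (Ie0_rel `` {x + y}) = \<Phi> (Ie0_rel `` {x}) + \<Phi> (Ie0_rel `` {y})) \<and>
     (\<forall>c. \<forall>x\<in>Ae0. \<Phi> (Ie0_rel `` {c \<cdot> x}) = vscale c (\<Phi> (Ie0_rel `` {x}))) \<and>
     (\<forall>a. \<forall>x\<in>Ae0. \<Phi> (Ie0_rel `` {a * x}) = \<rho> a (\<Phi> (Ie0_rel `` {x})))"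

end

theory Submission
  imports Defs "HOL-Combinatorics.Permutations"
begin

text \<open>
  The automorphism \<open>F \<mapsto> F[X - (q-1)(y\<^sub>1 + \<dots> + y\<^sub>k)]\<close> of \<open>V\<^sub>k\<close> straightens the operators: \<open>d\<^sub>+\<close> becomes
  \<open>T\<^sub>1\<cdots>T\<^sub>k\<close>, \<open>d\<^sub>+\<^sup>*\<close> becomes a ring homomorphism, and \<open>d\<^sub>-\<close> becomes the \<open>V\<^sub>k\<^sub>-\<^sub>1\<close>-linear map that replaces
  \<open>y\<^sub>k\<^sup>n\<close> by a coefficient of a rational generating series.  The defining relations are then identities
  between such coefficient functionals.

  For the kernel, the relations of \<open>\<bbbA>\<close> alone show that \<open>\<bbbA>e\<^sub>0\<close> is spanned by the elements
  \<open>y\<^sup>ad\<^sub>+\<^sup>kr\<close>, where \<open>r\<close> is a product of the elements \<open>d\<^sub>-y\<^sub>1\<^sup>nd\<^sub>+e\<^sub>0\<close>, and that the latter commute.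
  On \<open>V\<^sub>0\<close> they act as multiplication by \<open>-h\<^sub>n\<^sub>+\<^sub>1[-X]\<close>, and these freely generate \<open>Sym\<close>.  So there
  is a linear map \<open>V\<^sub>* \<rightarrow> \<bbbA>e\<^sub>0\<close> that recovers every element of \<open>\<bbbA>e\<^sub>0\<close> from its value at 1.  Finally
  \<open>\<bbbA>e\<^sub>0 + Ie\<^sub>0\<close> is closed under \<open>d\<^sub>+\<^sup>*\<close>, hence it is everything, and the kernel is \<open>Ie\<^sub>0\<close>.
\<close>

text \<open>Straightening pays off because adjoining y_i multiplies the series that defines d_- by
  (v - y_i)/(v - q y_i), while v - q y_i is also the coefficient of the exchanged term in T_i.
  Identities between d_- and T_i thus reduce to cancelling linear factors inside a coefficient
  functional. Where two functionals are composed, what survives is antisymmetric in two variables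
  and is killed by applying the same functional in both.

  No basis of the algebra is known beforehand. The relations give only a spanning set, and linear
  independence is never proved inside the algebra: it is inherited from the values on V. Defining
  the inverse map needs the elements d_- y_1^n d_+ to commute, which is the hard consequence of the
  relations; it is extracted from d_-^2 T_1 = d_-^2 by telescoping.

  Since I is only a left ideal, the identification of d_+^* with d_+ is available only next to a
  power of d_+ that starts at e_0. A letter d_+^* further to the left has to be moved through the
  word. Its commutator with d_- lies outside the unstarred letters, so closure must be proved modulo
  Ie_0 for several kinds of elements simultaneously.\<close>

lemma ring_homo_simps:
  assumes "ring_homo \<phi>"
  shows "\<phi> 0 = 0" "\<phi> 1 = 1" "\<phi> (a + b) = \<phi> a + \<phi> b" "\<phi> (a * b) = \<phi> a * \<phi> b"
    "\<phi> (- a) = - \<phi> a" "\<phi> (a - b) = \<phi> a - \<phi> b" "\<phi> (a ^ n) = \<phi> a ^ n"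
    "\<phi> (of_nat n) = of_nat n"
proof -
  have h: "\<phi> 1 = 1" "\<And>a b. \<phi> (a + b) = \<phi> a + \<phi> b" "\<And>a b. \<phi> (a * b) = \<phi> a * \<phi> b"
    using assms by (auto simp: ring_homo_def)
  show z: "\<phi> 0 = 0" using h(2)[of 0 0] by simp
  show "\<phi> 1 = 1" "\<phi> (a + b) = \<phi> a + \<phi> b" "\<phi> (a * b) = \<phi> a * \<phi> b" by (fact h)+
  show m: "\<phi> (- a) = - \<phi> a" for a using h(2)[of a "- a"] z by (simp add: eq_neg_iff_add_eq_0 add.commute)
  show "\<phi> (a - b) = \<phi> a - \<phi> b" using h(2)[of a "- b"] m by simp
  show "\<phi> (a ^ n) = \<phi> a ^ n" by (induction n) (simp_all add: h)
  show "\<phi> (of_nat n) = of_nat n" by (induction n) (simp_all add: h z)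
qed

lemma ring_homo_sum: "ring_homo \<phi> \<Longrightarrow> \<phi> (\<Sum>i\<in>A. f i) = (\<Sum>i\<in>A. \<phi> (f i))"
  by (induction A rule: infinite_finite_induct) (simp_all add: ring_homo_simps)

lemma ring_homo_comp: "ring_homo \<phi> \<Longrightarrow> ring_homo \<psi> \<Longrightarrow> ring_homo (\<lambda>x. \<psi> (\<phi> x))"
  by (simp add: ring_homo_def)

section \<open>Evaluation of polynomials in countably many variables\<close>

definition mpeval :: "('r::comm_ring_1 \<Rightarrow> 'b::comm_ring_1) \<Rightarrow> (nat \<Rightarrow> 'b) \<Rightarrow> (monomial \<Rightarrow>\<^sub>0 'r) \<Rightarrow> 'b" where
  "mpeval \<phi> g F = (\<Sum>m\<in>Poly_Mapping.keys F. \<phi> (Poly_Mapping.lookup F m) *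
     (\<Prod>i\<in>Poly_Mapping.keys m. g i ^ Poly_Mapping.lookup m i))"

definition monoval :: "(nat \<Rightarrow> 'b::comm_monoid_mult) \<Rightarrow> monomial \<Rightarrow> 'b" where
  "monoval g m = (\<Prod>i\<in>Poly_Mapping.keys m. g i ^ Poly_Mapping.lookup m i)"

lemma monoval_superset:
  assumes "finite A" "Poly_Mapping.keys m \<subseteq> A"
  shows "monoval g m = (\<Prod>i\<in>A. g i ^ Poly_Mapping.lookup m i)"
  unfolding monoval_def using assms by (intro prod.mono_neutral_left) (auto simp: in_keys_iff)

lemma monoval_add: "monoval g (a + b) = monoval g a * monoval g b"
proof -
  let ?A = "Poly_Mapping.keys a \<union> Poly_Mapping.keys b"
  have "monoval g (a + b) = (\<Prod>i\<in>?A. g i ^ Poly_Mapping.lookup (a + b) i)"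
    by (rule monoval_superset) (use Poly_Mapping.keys_add[of a b] in auto)
  moreover have "monoval g a = (\<Prod>i\<in>?A. g i ^ Poly_Mapping.lookup a i)"
    "monoval g b = (\<Prod>i\<in>?A. g i ^ Poly_Mapping.lookup b i)"
    by (rule monoval_superset; auto)+
  ultimately show ?thesis by (simp add: lookup_add power_add prod.distrib)
qed

lemma monoval_0 [simp]: "monoval g 0 = 1" by (simp add: monoval_def)

lemma monoval_single [simp]: "monoval g (Poly_Mapping.single i n) = g i ^ n"
  by (cases "n = 0") (simp_all add: monoval_def)

lemma mpeval_alt: "mpeval \<phi> g F = (\<Sum>m\<in>Poly_Mapping.keys F. \<phi> (Poly_Mapping.lookup F m) * monoval g m)"
  by (simp add: mpeval_def monoval_def)

lemma mpeval_superset: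
  assumes "ring_homo \<phi>" "finite A" "Poly_Mapping.keys F \<subseteq> A"
  shows "mpeval \<phi> g F = (\<Sum>m\<in>A. \<phi> (Poly_Mapping.lookup F m) * monoval g m)"
  unfolding mpeval_alt using assms
  by (intro sum.mono_neutral_left) (auto simp: in_keys_iff ring_homo_simps)

lemma mpeval_single: "ring_homo \<phi> \<Longrightarrow> mpeval \<phi> g (Poly_Mapping.single m c) = \<phi> c * monoval g m"
  by (subst mpeval_superset[of _ "{m}"]) auto

lemma mpeval_add: "ring_homo \<phi> \<Longrightarrow> mpeval \<phi> g (F + G) = mpeval \<phi> g F + mpeval \<phi> g G"
  using Poly_Mapping.keys_add[of F G]
  by (simp add: mpeval_superset[of _ "Poly_Mapping.keys F \<union> Poly_Mapping.keys G"] lookup_add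
      ring_homo_simps distrib_right sum.distrib)

lemma mpoly_induct [case_names single add]:
  assumes "\<And>m c. P (Poly_Mapping.single m c)" "\<And>F G. P F \<Longrightarrow> P G \<Longrightarrow> P (F + G)"
  shows "P (F :: 'k \<Rightarrow>\<^sub>0 'r::comm_monoid_add)"
proof (induction F rule: update_induct)
  case const
  show ?case using assms(1)[of undefined 0] by simp
next
  case (update f a b)
  have "Poly_Mapping.update a b f = Poly_Mapping.single a b + f"
    using update by (intro poly_mapping_eqI)
      (auto simp: lookup_update lookup_add lookup_single when_def in_keys_iff)
  then show ?case using assms update by metis
qed

lemma ring_homo_mpeval:
  assumes \<phi>: "ring_homo \<phi>"
  shows "ring_homo (mpeval \<phi> g)"
  unfolding ring_homo_def
proof (intro conjI allI)
  show "mpeval \<phi> g 1 = 1"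
    using mpeval_single[OF \<phi>, of g 0 1] \<phi> by (simp add: ring_homo_simps)
  fix F G :: "monomial \<Rightarrow>\<^sub>0 'a"
  show "mpeval \<phi> g (F + G) = mpeval \<phi> g F + mpeval \<phi> g G" for F G by (rule mpeval_add[OF \<phi>])
  show "mpeval \<phi> g (F * G) = mpeval \<phi> g F * mpeval \<phi> g G"
  proof (induction F rule: mpoly_induct)
    case (add F F')
    then show ?case by (simp add: distrib_right mpeval_add[OF \<phi>])
  next
    case (single m c)
    show ?case
    proof (induction G rule: mpoly_induct)
      case (add G G')
      then show ?case by (simp add: distrib_left mpeval_add[OF \<phi>])
    next
      case (single m' c')
      then show ?case by (simp add: mult_single mpeval_single[OF \<phi>] monoval_add ring_homo_simps[OF \<phi>])
    qed
  qed
qed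

section \<open>The power sums freely generate the symmetric functions\<close>

lemma coeff_sym_perm: "bij p \<Longrightarrow> coeff_sym f (Poly_Mapping.map_key p m) = coeff_sym f m"
  using coeff_sym[of f] by (auto simp: is_sym_def)

lemma coeff_sym_sum: "coeff_sym (\<Sum>i\<in>A. f i) m = (\<Sum>i\<in>A. coeff_sym (f i) m)"
  by (induction A rule: infinite_finite_induct) (simp_all add: zero_symfun.rep_eq plus_symfun.rep_eq)

lemma coeff_sym_const_mult: "coeff_sym (sym_const c * f) m = c * coeff_sym f m"
proof -
  have "(\<Sum>(a, b)\<in>decomps m. (if a = 0 then c else 0) * coeff_sym f b) =
      (\<Sum>(a, b)\<in>{(0::monomial, m)}. (if a = 0 then c else 0) * coeff_sym f b)"
    by (intro sum.mono_neutral_right) (use finite_decomps[of m] in \<open>auto simp: decomps_def split: if_splits\<close>)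
  then show ?thesis by (simp add: times_symfun.rep_eq sym_const.rep_eq)
qed

lemma coeff_sym_diff: "coeff_sym (f - g) m = coeff_sym f m - coeff_sym g m"
  by (subst minus_symfun_def, subst plus_symfun.rep_eq, subst uminus_symfun.rep_eq) simp

lemma symfun_eqI: "(\<And>m. coeff_sym f m = coeff_sym g m) \<Longrightarrow> f = g"
  by (rule coeff_sym_inject[THEN iffD1], rule ext)

lemma ring_homo_sym_const: "ring_homo sym_const"
proof -
  have 1: "sym_const 1 = 1"
    by (rule symfun_eqI) (simp only: sym_const.rep_eq one_symfun.rep_eq)
  have 2: "sym_const (a + b) = sym_const a + sym_const b" for a b :: 'a
    by (rule symfun_eqI) (simp only: sym_const.rep_eq plus_symfun.rep_eq, simp)
  have 3: "sym_const (a * b) = sym_const a * sym_const b" for a b :: 'a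
    by (rule symfun_eqI) (simp only: coeff_sym_const_mult sym_const.rep_eq, simp)
  show ?thesis unfolding ring_homo_def using 1 2 3 by blast
qed

text \<open>The power sum contributes some x_j^n, and distinct j give distinct decompositions
  because n > 0; so the sum over decompositions becomes a sum over variables.\<close>

lemma coeff_psum_mult:
  assumes "n > 0"
  shows "coeff_sym (psum n * f) m =
    (\<Sum>j\<in>{j. n \<le> Poly_Mapping.lookup m j}. coeff_sym f (m - Poly_Mapping.single j n))"
proof -
  let ?g = "\<lambda>j. (Poly_Mapping.single j n, m - Poly_Mapping.single j n)"
  let ?J = "{j. n \<le> Poly_Mapping.lookup m j}"
  have fin: "finite ?J" by (rule finite_subset[of _ "Poly_Mapping.keys m"])
      (use assms in \<open>auto simp: in_keys_iff\<close>)
  have inj: "inj_on ?g ?J"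
    using assms by (auto simp: inj_on_def) (metis keys_single less_numeral_extra(3) singletonD singletonI)
  have sub: "?g ` ?J \<subseteq> decomps m"
    by (auto simp: decomps_def intro!: poly_mapping_eqI)
      (auto simp: lookup_add lookup_minus lookup_single when_def)
  have "(\<Sum>(a, b)\<in>decomps m. (if \<exists>i. a = Poly_Mapping.single i n then 1 else 0) * coeff_sym f b)
     = (\<Sum>(a, b)\<in>?g ` ?J. (if \<exists>i. a = Poly_Mapping.single i n then 1 else 0) * coeff_sym f b)"
  proof (intro sum.mono_neutral_right finite_decomps sub ballI)
    fix x assume x: "x \<in> decomps m - ?g ` ?J"
    obtain a b where ab: "x = (a, b)" by force
    have "\<nexists>i. a = Poly_Mapping.single i n"
    proof
      assume "\<exists>i. a = Poly_Mapping.single i n"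
      then obtain i where i: "a = Poly_Mapping.single i n" by blast
      have m: "m = Poly_Mapping.single i n + b" using x ab i by (auto simp: decomps_def)
      have "x = ?g i" using ab i m by simp
      moreover have "i \<in> ?J" using m by (simp add: lookup_add)
      ultimately show False using x by blast
    qed
    then show "(case x of (a, b) \<Rightarrow> (if \<exists>i. a = Poly_Mapping.single i n then 1 else 0) * coeff_sym f b) = 0"
      using ab by simp
  qed
  also have "\<dots> = (\<Sum>j\<in>?J. coeff_sym f (m - Poly_Mapping.single j n))"
    by (subst sum.reindex[OF inj]) (auto intro!: sum.cong)
  finally show ?thesis by (simp add: times_symfun.rep_eq psum.rep_eq)
qed

text \<open>\<open>ptype m\<close> counts the parts: its entry at \<open>i\<close> is the number of variables with exponent \<open>i + 1\<close>.\<close>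

definition ptype :: "monomial \<Rightarrow> monomial" where
  "ptype m = (\<Sum>j\<in>Poly_Mapping.keys m. Poly_Mapping.single (Poly_Mapping.lookup m j - 1) 1)"

lemma mdeg_single [simp]: "mdeg (Poly_Mapping.single i n) = n" by (simp add: mdeg_def)
lemma mdeg_0 [simp]: "mdeg 0 = 0" by (simp add: mdeg_def)
lemma mdeg_sum: "mdeg (\<Sum>i\<in>A. f i) = (\<Sum>i\<in>A. mdeg (f i))"
  by (induction A rule: infinite_finite_induct) (simp_all add: mdeg_add)

lemma mdeg_ptype: "mdeg (ptype m) = card (Poly_Mapping.keys m)"
  by (simp add: ptype_def mdeg_sum)

lemma keys_add_single:
  "j \<notin> Poly_Mapping.keys m \<Longrightarrow> n > 0 \<Longrightarrow> Poly_Mapping.keys (m + Poly_Mapping.single j n) = insert j (Poly_Mapping.keys (m::monomial))"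
  by (auto simp: in_keys_iff lookup_add lookup_single when_def split: if_splits)

lemma ptype_add_single:
  assumes "j \<notin> Poly_Mapping.keys m" "n > 0"
  shows "ptype (m + Poly_Mapping.single j n) = ptype m + Poly_Mapping.single (n - 1) 1"
proof -
  have *: "Poly_Mapping.lookup m j = 0" using assms(1) by (simp add: in_keys_iff)
  have "ptype (m + Poly_Mapping.single j n) =
    Poly_Mapping.single (n - 1) 1 + (\<Sum>i\<in>Poly_Mapping.keys m. Poly_Mapping.single (Poly_Mapping.lookup (m + Poly_Mapping.single j n) i - 1) 1)"
    unfolding ptype_def keys_add_single[OF assms] using assms *
    by (subst sum.insert) (auto simp: lookup_add)
  also have "(\<Sum>i\<in>Poly_Mapping.keys m. Poly_Mapping.single (Poly_Mapping.lookup (m + Poly_Mapping.single j n) i - 1) (1::nat)) = ptype m"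
    unfolding ptype_def using assms by (intro sum.cong refl) (auto simp: lookup_add lookup_single when_def)
  finally show ?thesis by (simp add: add.commute)
qed

lemma ptype_zero_iff [simp]: "ptype m = 0 \<longleftrightarrow> m = 0"
  using mdeg_ptype[of m] by (auto simp: ptype_def)

lemma mono_pos_induct [case_names zero add]:
  assumes "P 0" "\<And>m i. P m \<Longrightarrow> P (m + Poly_Mapping.single i 1)"
  shows "P (m::monomial)"
proof (induction "mdeg m" arbitrary: m)
  case 0
  then have "m = 0" by (auto simp: mdeg_def in_keys_iff intro!: poly_mapping_eqI)
  then show ?case using assms by simp
next
  case (Suc d)
  then obtain i where i: "i \<in> Poly_Mapping.keys m" by (metis Zero_not_Suc all_not_in_conv keys_eq_empty mdeg_0)
  define m' where "m' = m - Poly_Mapping.single i 1"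
  have m: "m = m' + Poly_Mapping.single i 1"
    using i unfolding m'_def by (intro poly_mapping_eqI) (auto simp: lookup_add lookup_minus lookup_single when_def in_keys_iff)
  then have "mdeg m' = d" using Suc.hyps(2) by (simp add: mdeg_add)
  then show ?case using assms(2) Suc.hyps(1) m by metis
qed

lemma ptype_surj: "\<exists>m. ptype m = t"
proof (induction t rule: mono_pos_induct)
  case zero
  have "ptype 0 = 0" by simp
  then show ?case by blast
next
  case (add t i)
  then obtain m where m: "ptype m = t" by blast
  obtain j where "j \<notin> Poly_Mapping.keys m" using ex_new_if_finite[of "Poly_Mapping.keys m"] by auto
  then have "ptype (m + Poly_Mapping.single j (Suc i)) = t + Poly_Mapping.single i 1"
    using m by (simp add: ptype_add_single)
  then show ?case by blast
qed

lemma ptype_lookup: "Poly_Mapping.lookup (ptype m) v = card {j. Poly_Mapping.lookup m j = Suc v}"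
proof -
  have "Poly_Mapping.lookup (ptype m) v = (\<Sum>j\<in>Poly_Mapping.keys m. if Poly_Mapping.lookup m j = Suc v then 1 else 0)"
    unfolding ptype_def Poly_Mapping.lookup_sum
    by (intro sum.cong refl) (auto simp: lookup_single when_def in_keys_iff)
  also have "\<dots> = card {j. Poly_Mapping.lookup m j = Suc v}"
    by (subst sum.If_cases) (auto simp: in_keys_iff intro!: arg_cong[where f = card])
  finally show ?thesis .
qed

text \<open>Makes coefficients comparable through exponent types alone. The permutation is found
  inside the finite union of both supports, where the two multisets of exponents agree.\<close>

lemma same_ptype_perm:
  assumes "ptype m = ptype m'"
  shows "\<exists>p. bij p \<and> Poly_Mapping.map_key p m' = m"
proof -
  define A where "A = Poly_Mapping.keys m \<union> Poly_Mapping.keys m'"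
  have fA: "finite A" by (simp add: A_def)
  have cnt: "card {j\<in>A. Poly_Mapping.lookup m j = v} = card {j\<in>A. Poly_Mapping.lookup m' j = v}" for v
  proof (cases v)
    case (Suc w)
    have "{j\<in>A. Poly_Mapping.lookup m j = v} = {j. Poly_Mapping.lookup m j = Suc w}"
      "{j\<in>A. Poly_Mapping.lookup m' j = v} = {j. Poly_Mapping.lookup m' j = Suc w}"
      using Suc by (auto simp: A_def in_keys_iff)
    then show ?thesis using assms ptype_lookup by metis
  next
    \<comment> \<open>\<open>ptype\<close> does not record the exponent 0. Inside \<open>A\<close>
      it is counted by complement, since equal types have supports of equal size.\<close>
    case 0
    have "{j\<in>A. Poly_Mapping.lookup m j = v} = A - Poly_Mapping.keys m"
       "{j\<in>A. Poly_Mapping.lookup m' j = v} = A - Poly_Mapping.keys m'"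
      using 0 by (auto simp: in_keys_iff)
    moreover have "card (Poly_Mapping.keys m) = card (Poly_Mapping.keys m')"
      using assms mdeg_ptype by metis
    ultimately show ?thesis by (simp add: card_Diff_subset A_def)
  qed
  have "image_mset (Poly_Mapping.lookup m) (mset_set A) = image_mset (Poly_Mapping.lookup m') (mset_set A)"
    using cnt fA by (intro multiset_eqI) (simp add: count_image_mset_eq_card_vimage)
  then obtain p where p: "p permutes A" "\<forall>x\<in>A. Poly_Mapping.lookup m x = Poly_Mapping.lookup m' (p x)"
    using image_mset_eq_implies_permutes[OF fA] by metis
  have lk: "Poly_Mapping.lookup m x = Poly_Mapping.lookup m' (p x)" for x
  proof (cases "x \<in> A")
    case True
    then show ?thesis using p(2) by blast
  next
    case False
    then have "Poly_Mapping.lookup m x = 0" "Poly_Mapping.lookup m' x = 0"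
      by (auto simp: A_def in_keys_iff)
    then show ?thesis using permutes_not_in[OF p(1) False] by simp
  qed
  have bij: "bij p" using p(1) by (rule permutes_bij)
  have "Poly_Mapping.map_key p m' = m"
    by (rule poly_mapping_eqI) (simp only: map_key.rep_eq[OF bij_is_inj[OF bij]] lk o_apply)
  with bij show ?thesis by blast
qed

lemma coeff_sym_ptype: "ptype m = ptype m' \<Longrightarrow> coeff_sym f m = coeff_sym f m'"
  using same_ptype_perm[of m m'] coeff_sym_perm by metis

definition psum_mono :: "monomial \<Rightarrow> 'a::comm_ring_1 symfun" where
  "psum_mono = monoval (\<lambda>i. psum (Suc i))"

lemma psum_mono_Suc: "psum_mono (m + Poly_Mapping.single i 1) = psum (Suc i) * psum_mono m"
  by (simp add: psum_mono_def monoval_add)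

lemma split_lookup:
  assumes "n \<le> Poly_Mapping.lookup m j"
  shows "m = (m - Poly_Mapping.single j n) + Poly_Mapping.single j (n::nat)"
  using assms by (intro poly_mapping_eqI) (auto simp: lookup_add lookup_minus lookup_single when_def)

text \<open>Triangularity: every factor puts its whole exponent on one variable, so a monomial of
  the product has at most as many variables as there are factors, and exactly as many only if no
  variable is hit twice. Coefficients count such placements; being natural numbers they cannot
  cancel, so the leading one stays nonzero in characteristic 0.\<close>

lemma psum_mono_coeff:
  "(coeff_sym (psum_mono t) m \<noteq> (0::'a::comm_ring_1) \<longrightarrow>
      card (Poly_Mapping.keys m) \<le> mdeg t \<and> (card (Poly_Mapping.keys m) = mdeg t \<longrightarrow> ptype m = t)) \<and>
   (\<exists>N. coeff_sym (psum_mono t) m = (of_nat N :: 'a) \<and> (ptype m = t \<longrightarrow> N > 0))"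
proof (induction t arbitrary: m rule: mono_pos_induct)
  case zero
  have "coeff_sym (psum_mono 0) m = (if m = 0 then 1 else (0::'a))"
    by (simp add: psum_mono_def one_symfun.rep_eq)
  then show ?case by (auto intro: exI[of _ 1] exI[of _ 0])
next
  case (add t i)
  let ?C = "\<lambda>m. coeff_sym (psum_mono t) m :: 'a"
  let ?J = "{j. Suc i \<le> Poly_Mapping.lookup m j}"
  let ?m = "\<lambda>j. m - Poly_Mapping.single j (Suc i)"
  have finJ: "finite ?J" by (rule finite_subset[of _ "Poly_Mapping.keys m"]) (auto simp: in_keys_iff)
  have eq: "coeff_sym (psum_mono (t + Poly_Mapping.single i 1)) m = (\<Sum>j\<in>?J. ?C (?m j))"
    by (simp only: psum_mono_Suc coeff_psum_mult zero_less_Suc)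
  have keys: "Poly_Mapping.keys m \<subseteq> insert j (Poly_Mapping.keys (?m j))" for j
    by (auto simp: in_keys_iff lookup_minus lookup_single when_def split: if_splits)
  have 1: "card (Poly_Mapping.keys m) \<le> Suc (mdeg t) \<and>
     (card (Poly_Mapping.keys m) = Suc (mdeg t) \<longrightarrow> ptype m = t + Poly_Mapping.single i 1)"
    if nz: "coeff_sym (psum_mono (t + Poly_Mapping.single i 1)) m \<noteq> (0::'a)"
  proof -
    obtain j where j: "j \<in> ?J" "?C (?m j) \<noteq> 0"
      using nz unfolding eq by (meson sum.not_neutral_contains_not_neutral)
    have m: "m = ?m j + Poly_Mapping.single j (Suc i)" using j(1) by (intro split_lookup) simp
    have c: "card (Poly_Mapping.keys (?m j)) \<le> mdeg t"
      "card (Poly_Mapping.keys (?m j)) = mdeg t \<Longrightarrow> ptype (?m j) = t"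
      using add.IH[of "?m j"] j(2) by auto
    show ?thesis
    proof (cases "j \<in> Poly_Mapping.keys (?m j)")
      case True
      then have "card (Poly_Mapping.keys m) \<le> card (Poly_Mapping.keys (?m j))"
        using keys[of j] by (intro card_mono) auto
      then show ?thesis using c(1) by simp
    next
      case False
      have km: "Poly_Mapping.keys m = insert j (Poly_Mapping.keys (?m j))"
        using m keys_add_single[OF False, of "Suc i"] by simp
      have pm: "ptype m = ptype (?m j) + Poly_Mapping.single i 1"
        using m ptype_add_single[OF False, of "Suc i"] by simp
      have "card (Poly_Mapping.keys m) = Suc (card (Poly_Mapping.keys (?m j)))"
        unfolding km using False by simp
      then show ?thesis using c pm by auto
    qed
  qed
  have "\<forall>j. \<exists>N. ?C (?m j) = of_nat N \<and> (ptype (?m j) = t \<longrightarrow> N > 0)"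
    using add.IH by blast
  then obtain N where N: "\<And>j. ?C (?m j) = of_nat (N j)" "\<And>j. ptype (?m j) = t \<Longrightarrow> N j > 0"
    by metis
  have "(\<Sum>j\<in>?J. N j) > 0" if pt: "ptype m = t + Poly_Mapping.single i 1"
  proof -
    have "card {j. Poly_Mapping.lookup m j = Suc i} > 0"
      unfolding ptype_lookup[symmetric] pt by (simp add: lookup_add)
    then obtain j where j: "Poly_Mapping.lookup m j = Suc i" by (auto simp: card_gt_0_iff)
    have m: "m = ?m j + Poly_Mapping.single j (Suc i)" using j by (intro split_lookup) simp
    have nj: "j \<notin> Poly_Mapping.keys (?m j)" using j by (simp add: in_keys_iff lookup_minus)
    have "ptype (?m j) + Poly_Mapping.single i 1 = ptype m"
      using m ptype_add_single[OF nj, of "Suc i"] by simp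
    then have "ptype (?m j) = t" using pt by simp
    then have "N j > 0" by (rule N(2))
    then show ?thesis using j finJ by (auto intro!: sum_pos2[of _ j])
  qed
  then have 2: "\<exists>N. coeff_sym (psum_mono (t + Poly_Mapping.single i 1)) m = (of_nat N :: 'a) \<and>
      (ptype m = t + Poly_Mapping.single i 1 \<longrightarrow> N > 0)"
    unfolding eq N(1) by (intro exI[of _ "\<Sum>j\<in>?J. N j"]) auto
  show ?case using 1 2 by (simp add: mdeg_add)
qed

definition psum_poly :: "(monomial \<Rightarrow>\<^sub>0 'a::comm_ring_1) \<Rightarrow> 'a symfun" where
  "psum_poly = mpeval sym_const (\<lambda>i. psum (Suc i))"

lemma ring_homo_psum_poly: "ring_homo psum_poly"
  unfolding psum_poly_def by (rule ring_homo_mpeval[OF ring_homo_sym_const])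

lemma coeff_psum_poly:
  "coeff_sym (psum_poly F) m =
    (\<Sum>t\<in>Poly_Mapping.keys F. Poly_Mapping.lookup F t * coeff_sym (psum_mono t) m)"
  by (simp add: psum_poly_def mpeval_alt psum_mono_def coeff_sym_sum coeff_sym_const_mult)

text \<open>Take a monomial \<open>t\<close> of \<open>F\<close> with the most factors and read the
  coefficient at an \<open>m\<close> of type \<open>t\<close>: by triangularity all other terms
  vanish there.\<close>

lemma psum_poly_inj:
  fixes F :: "monomial \<Rightarrow>\<^sub>0 'a::field_char_0"
  assumes "psum_poly F = 0"
  shows "F = 0"
proof (rule ccontr)
  assume "F \<noteq> 0"
  then have ne: "mdeg ` Poly_Mapping.keys F \<noteq> {}" by simp
  define L where "L = Max (mdeg ` Poly_Mapping.keys F)"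
  have "L \<in> mdeg ` Poly_Mapping.keys F" unfolding L_def using ne by (intro Max_in) auto
  then obtain t where t: "t \<in> Poly_Mapping.keys F" "mdeg t = L" by auto
  have le: "mdeg t' \<le> L" if "t' \<in> Poly_Mapping.keys F" for t' unfolding L_def using that by simp
  obtain m where m: "ptype m = t" using ptype_surj by blast
  have cm: "card (Poly_Mapping.keys m) = L" using m t mdeg_ptype by metis
  have "coeff_sym (psum_poly F) m = (\<Sum>t'\<in>{t}. Poly_Mapping.lookup F t' * coeff_sym (psum_mono t') m)"
    unfolding coeff_psum_poly
  proof (intro sum.mono_neutral_right ballI)
    fix t' assume t': "t' \<in> Poly_Mapping.keys F - {t}"
    have "coeff_sym (psum_mono t') m = (0::'a)"
    proof (rule ccontr)
      assume "coeff_sym (psum_mono t') m \<noteq> (0::'a)"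
      then have "L \<le> mdeg t'" "L = mdeg t' \<Longrightarrow> ptype m = t'"
        using psum_mono_coeff[where ?'a = 'a, of t' m] cm by auto
      then show False using le[of t'] t' m by auto
    qed
    then show "Poly_Mapping.lookup F t' * coeff_sym (psum_mono t') m = 0" by simp
  qed (use t in auto)
  moreover have "coeff_sym (psum_mono t) m \<noteq> (0::'a)"
    using psum_mono_coeff[where ?'a = 'a, of t m] m by auto
  moreover have "Poly_Mapping.lookup F t \<noteq> 0" using t by (simp add: in_keys_iff)
  ultimately show False using assms by (simp add: zero_symfun.rep_eq)
qed

lemma finite_bounded_monomials: "finite {m::monomial. Poly_Mapping.keys m \<subseteq> {..<n} \<and> (\<forall>i. Poly_Mapping.lookup m i \<le> d)}"
proof (rule finite_subset)
  define M where "M = (\<Sum>i<n. Poly_Mapping.single i d)"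
  have lM: "Poly_Mapping.lookup M i = (if i < n then d else 0)" for i
    by (simp add: M_def Poly_Mapping.lookup_sum lookup_single when_def)
  show "{m::monomial. Poly_Mapping.keys m \<subseteq> {..<n} \<and> (\<forall>i. Poly_Mapping.lookup m i \<le> d)} \<subseteq> fst ` decomps M"
  proof
    fix m :: monomial assume "m \<in> {m. Poly_Mapping.keys m \<subseteq> {..<n} \<and> (\<forall>i. Poly_Mapping.lookup m i \<le> d)}"
    then have m: "Poly_Mapping.keys m \<subseteq> {..<n}" "\<And>i. Poly_Mapping.lookup m i \<le> d" by auto
    have "m + (M - m) = M"
      using m by (intro poly_mapping_eqI) (auto simp: lookup_add lookup_minus lM in_keys_iff subset_iff)
    then have "(m, M - m) \<in> decomps M" by (simp add: decomps_def)
    then show "m \<in> fst ` decomps M" by force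
  qed
qed (simp add: finite_decomps)

lemma lookup_le_mdeg: "Poly_Mapping.lookup m i \<le> mdeg m"
  by (cases "i \<in> Poly_Mapping.keys m") (auto simp: mdeg_def in_keys_iff member_le_sum)

lemma finite_ptypes: "finite {ptype m | m. mdeg m \<le> d}"
proof (rule finite_subset[OF _ finite_bounded_monomials[of d d]])
  show "{ptype m |m. mdeg m \<le> d} \<subseteq> {m. Poly_Mapping.keys m \<subseteq> {..<d} \<and> (\<forall>i. Poly_Mapping.lookup m i \<le> d)}"
  proof clarify
    fix m assume d: "mdeg m \<le> d"
    have "card (Poly_Mapping.keys m) \<le> mdeg m"
      unfolding mdeg_def card_eq_sum by (intro sum_mono) (auto simp: in_keys_iff)
    then have "Poly_Mapping.lookup (ptype m) i \<le> d" for i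
      using lookup_le_mdeg[of "ptype m" i] d by (simp add: mdeg_ptype)
    moreover have "i < d" if "i \<in> Poly_Mapping.keys (ptype m)" for i
    proof -
      have "card {j. Poly_Mapping.lookup m j = Suc i} > 0"
        using that by (simp add: in_keys_iff ptype_lookup)
      then obtain j where "Poly_Mapping.lookup m j = Suc i" by (auto simp: card_gt_0_iff)
      then show ?thesis using lookup_le_mdeg[of m j] d by simp
    qed
    ultimately show "Poly_Mapping.keys (ptype m) \<subseteq> {..<d} \<and> (\<forall>i. Poly_Mapping.lookup (ptype m) i \<le> d)" by auto
  qed
qed

text \<open>Induction on a strict bound for the number of variables in a monomial: the monomials
  with most variables are removed by products of that many power sums, which only create monomials
  with fewer variables.\<close>

lemma psum_poly_surj: "\<exists>F. psum_poly F = (f :: 'a::field_char_0 symfun)"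
proof -
  have "\<exists>F. psum_poly F = f"
    if "\<And>m. coeff_sym f m \<noteq> 0 \<Longrightarrow> card (Poly_Mapping.keys m) < L" for L and f :: "'a symfun"
    using that
  proof (induction L arbitrary: f)
    case 0
    then have "coeff_sym f m = 0" for m by blast
    then have "f = 0" by (intro symfun_eqI) (simp add: zero_symfun.rep_eq)
    then show ?case using ring_homo_simps(1)[OF ring_homo_psum_poly] by blast
  next
    case (Suc L)
    obtain d where d: "\<And>m. coeff_sym f m \<noteq> 0 \<Longrightarrow> mdeg m \<le> d"
      using coeff_sym[of f] by (auto simp: is_sym_def)
    \<comment> \<open>Bounded degree leaves only finitely many types, so the correction
      \<open>F\<close> is a polynomial.\<close>
    define S where "S = {ptype m | m. mdeg m \<le> d} \<inter> {t. mdeg t = L}"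
    have fS: "finite S" using finite_ptypes[of d] by (simp add: S_def)
    define r where "r t = (SOME m. ptype m = t)" for t
    have r: "ptype (r t) = t" for t unfolding r_def using ptype_surj[of t] by (rule someI_ex)
    define c where "c t = coeff_sym f (r t) / coeff_sym (psum_mono t) (r t)" for t
    define F where "F = (\<Sum>t\<in>S. Poly_Mapping.single t (c t))"
    have nz: "coeff_sym (psum_mono t) (r t) \<noteq> (0::'a)" for t
      using psum_mono_coeff[where ?'a = 'a, of t "r t"] r by auto
    have cF: "coeff_sym (psum_poly F) m = (\<Sum>t\<in>S. c t * coeff_sym (psum_mono t) m)" for m
      unfolding F_def ring_homo_sum[OF ring_homo_psum_poly] coeff_sym_sum
      by (intro sum.cong refl)
        (simp add: psum_poly_def mpeval_single[OF ring_homo_sym_const] psum_mono_def coeff_sym_const_mult)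
    have "card (Poly_Mapping.keys m) < L" if nz': "coeff_sym (f - psum_poly F) m \<noteq> 0" for m
    proof (rule ccontr)
      assume "\<not> card (Poly_Mapping.keys m) < L"
      then have ge: "card (Poly_Mapping.keys m) \<ge> L" by simp
      have z: "coeff_sym (psum_mono t) m = (0::'a)" if "t \<in> S" "t \<noteq> ptype m" for t
        using psum_mono_coeff[where ?'a = 'a, of t m] that ge by (auto simp: S_def)
      have "coeff_sym f m = coeff_sym (psum_poly F) m"
      proof (cases "ptype m \<in> S")
        case True
        have "coeff_sym (psum_poly F) m = (\<Sum>t\<in>{ptype m}. c t * coeff_sym (psum_mono t) m)"
          unfolding cF using True fS z by (intro sum.mono_neutral_right) auto
        also have "\<dots> = coeff_sym f m"
          using nz[of "ptype m"] by (simp add: c_def coeff_sym_ptype[of "r (ptype m)" m, OF r])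
        finally show ?thesis by simp
      next
        case False
        then have "coeff_sym (psum_poly F) m = 0" unfolding cF using z by (intro sum.neutral) auto
        moreover have "coeff_sym f m = 0"
          using False Suc.prems[of m] d[of m] ge by (fastforce simp: S_def mdeg_ptype)
        ultimately show ?thesis by simp
      qed
      then show False using nz' by (simp add: coeff_sym_diff)
    qed
    then obtain G where "psum_poly G = f - psum_poly F" using Suc.IH by blast
    then have "psum_poly (G + F) = f" by (simp add: ring_homo_simps[OF ring_homo_psum_poly])
    then show ?case by blast
  qed
  moreover obtain d where d: "\<And>m. coeff_sym f m \<noteq> 0 \<Longrightarrow> mdeg m \<le> d"
    using coeff_sym[of f] by (auto simp: is_sym_def)
  have "card (Poly_Mapping.keys m) < Suc d" if "coeff_sym f m \<noteq> 0" for m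
  proof -
    have "card (Poly_Mapping.keys m) \<le> mdeg m"
      unfolding mdeg_def card_eq_sum by (intro sum_mono) (auto simp: in_keys_iff)
    then show ?thesis using d[OF that] by simp
  qed
  ultimately show ?thesis by blast
qed

lemma bij_psum_poly: "bij (psum_poly :: _ \<Rightarrow> 'a::field_char_0 symfun)"
proof (rule bijI)
  show "inj (psum_poly :: _ \<Rightarrow> 'a symfun)"
  proof (rule injI)
    fix F G :: "monomial \<Rightarrow>\<^sub>0 'a" assume "psum_poly F = psum_poly G"
    then have "psum_poly (F - G) = 0" by (simp add: ring_homo_simps[OF ring_homo_psum_poly])
    then show "F = G" using psum_poly_inj by fastforce
  qed
  show "surj (psum_poly :: _ \<Rightarrow> 'a symfun)" using psum_poly_surj by (metis surjI)
qed

section \<open>Homomorphisms out of Sym and the existence of plethysm\<close>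

lemma ring_homo_inv:
  assumes "ring_homo \<phi>" "bij \<phi>" shows "ring_homo (inv \<phi>)"
  unfolding ring_homo_def
  using assms by (auto simp: bij_is_surj surj_f_inv_f bij_is_inj ring_homo_simps
    intro!: inv_f_eq)

lemma mpoly_gen_induct [case_names const var add mult]:
  assumes "\<And>c. P (Poly_Mapping.single 0 c)" "\<And>i. P (Poly_Mapping.single (Poly_Mapping.single i 1) 1)"
    "\<And>F G. P F \<Longrightarrow> P G \<Longrightarrow> P (F + G)" "\<And>F G. P F \<Longrightarrow> P G \<Longrightarrow> P (F * G)"
  shows "P (F :: monomial \<Rightarrow>\<^sub>0 'r::comm_ring_1)"
proof (induction F rule: mpoly_induct)
  case (single m c)
  show ?case
  proof (induction m rule: mono_pos_induct)
    case zero
    show ?case by (rule assms)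
  next
    case (add m i)
    have "P (Poly_Mapping.single m c * Poly_Mapping.single (Poly_Mapping.single i 1) 1)"
      by (intro assms add)
    then show ?case by (simp add: mult_single)
  qed
qed (rule assms)

lemma sym_induct [case_names const psum add mult]:
  assumes "\<And>c. P (sym_const c)" "\<And>n. n \<ge> 1 \<Longrightarrow> P (psum n)"
    "\<And>f g. P f \<Longrightarrow> P g \<Longrightarrow> P (f + g)" "\<And>f g. P f \<Longrightarrow> P g \<Longrightarrow> P (f * g)"
  shows "P (f :: 'a::field_char_0 symfun)"
proof -
  obtain F where "psum_poly F = f" using psum_poly_surj by blast
  moreover have "P (psum_poly F)"
  proof (induction F rule: mpoly_gen_induct)
    case (const c)
    then show ?case using assms(1)[of c] by (simp add: psum_poly_def mpeval_single ring_homo_sym_const)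
  next
    case (var i)
    then show ?case using assms(2)[of "Suc i"]
      by (simp add: psum_poly_def mpeval_single ring_homo_sym_const ring_homo_simps[OF ring_homo_sym_const])
  qed (simp_all add: assms(3,4) ring_homo_simps[OF ring_homo_psum_poly])
  ultimately show ?thesis by simp
qed

text \<open>\<open>plethysm\<close> is a definite description and becomes usable only through this.
  Existence transports polynomial evaluation through the inverse of \<open>psum_poly\<close>, in
  which variable \<open>i\<close> stands for the power sum of index \<open>i + 1\<close>.\<close>

lemma plethysm_ex1:
  fixes c :: "qt \<Rightarrow> 'b::comm_ring_1"
  assumes c: "ring_homo c"
  shows "\<exists>!\<phi>. ring_homo \<phi> \<and> (\<forall>r. \<phi> (sym_const r) = c r) \<and> (\<forall>n\<ge>1. \<phi> (psum n) = a n)"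
proof
  let ?\<phi> = "\<lambda>f. mpeval c (\<lambda>i. a (Suc i)) (inv psum_poly f)"
  note pp = bij_is_inj[OF bij_psum_poly]
  have "inv psum_poly (sym_const r :: qt symfun) = Poly_Mapping.single 0 r" for r
    by (rule inv_f_eq[OF pp]) (simp add: psum_poly_def mpeval_single ring_homo_sym_const)
  moreover have "inv psum_poly (psum (Suc i) :: qt symfun) = Poly_Mapping.single (Poly_Mapping.single i 1) 1" for i
    by (rule inv_f_eq[OF pp])
      (simp add: psum_poly_def mpeval_single ring_homo_sym_const ring_homo_simps[OF ring_homo_sym_const])
  ultimately show "ring_homo ?\<phi> \<and> (\<forall>r. ?\<phi> (sym_const r) = c r) \<and> (\<forall>n\<ge>1. ?\<phi> (psum n) = a n)"
    using ring_homo_comp[OF ring_homo_inv[OF ring_homo_psum_poly bij_psum_poly] ring_homo_mpeval[OF c]]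
    by (auto simp: mpeval_single c ring_homo_simps[OF c] Suc_le_eq gr0_conv_Suc)
next
  fix \<phi> assume \<phi>: "ring_homo \<phi> \<and> (\<forall>r. \<phi> (sym_const r) = c r) \<and> (\<forall>n\<ge>1. \<phi> (psum n) = a n)"
  let ?\<psi> = "\<lambda>f. mpeval c (\<lambda>i. a (Suc i)) (inv psum_poly f)"
  have "\<phi> (psum_poly F) = mpeval c (\<lambda>i. a (Suc i)) F" for F
  proof (induction F rule: mpoly_gen_induct)
    case (var i)
    then show ?case using \<phi> by (simp add: psum_poly_def mpeval_single ring_homo_sym_const c
      ring_homo_simps[OF ring_homo_sym_const] ring_homo_simps[OF c])
  qed (use \<phi> in \<open>simp_all add: psum_poly_def mpeval_single ring_homo_sym_const c
      ring_homo_simps[OF ring_homo_mpeval[OF c]] ring_homo_simps[OF ring_homo_mpeval[OF ring_homo_sym_const]]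
       ring_homo_simps[of \<phi>]\<close>)
  then show "\<phi> = ?\<psi>" using bij_is_surj[OF bij_psum_poly] by (metis surj_f_inv_f ext)
qed

lemma plethysm:
  assumes "ring_homo c"
  shows "ring_homo (plethysm c a)" "plethysm c a (sym_const r) = c r"
    "n \<ge> 1 \<Longrightarrow> plethysm c a (psum n) = a n"
  using theI'[OF plethysm_ex1[OF assms, of a]] unfolding plethysm_def by auto

lemma sym_homo_eqI:
  assumes "ring_homo \<phi>" "ring_homo \<psi>" "\<And>r. \<phi> (sym_const r) = \<psi> (sym_const r)"
    "\<And>n. n \<ge> 1 \<Longrightarrow> \<phi> (psum n) = \<psi> (psum n)"
  shows "\<phi> f = \<psi> (f :: 'a::field_char_0 symfun)"
  by (induction f rule: sym_induct) (simp_all add: assms ring_homo_simps[OF assms(1)] ring_homo_simps[OF assms(2)])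

section \<open>Polynomials over the symmetric functions\<close>

lemma eval_v_mpeval: "eval_v \<phi> g = mpeval \<phi> g"
  by (rule ext) (simp add: eval_v_def mpeval_def)

lemma ring_homo_eval_v: "ring_homo \<phi> \<Longrightarrow> ring_homo (eval_v \<phi> g)"
  by (simp add: eval_v_mpeval ring_homo_mpeval)

lemma ring_homo_vsym: "ring_homo vsym"
  by (simp add: ring_homo_def vsym_def single_add mult_single)

lemma ring_homo_vconst: "ring_homo vconst"
  unfolding vconst_def by (rule ring_homo_comp[OF ring_homo_sym_const ring_homo_vsym])

lemmas vconst_simps = ring_homo_simps[OF ring_homo_vconst]
lemmas vsym_simps = ring_homo_simps[OF ring_homo_vsym]

lemma eval_v_vsym: "ring_homo \<phi> \<Longrightarrow> eval_v \<phi> g (vsym f) = \<phi> f"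
  by (simp add: eval_v_mpeval vsym_def mpeval_single)

lemma eval_v_vconst: "ring_homo \<phi> \<Longrightarrow> eval_v \<phi> g (vconst c) = \<phi> (sym_const c)"
  by (simp add: vconst_def eval_v_vsym)

lemma eval_v_yvar: "ring_homo \<phi> \<Longrightarrow> eval_v \<phi> g (yvar i) = g i"
  by (simp add: eval_v_mpeval yvar_def mpeval_single ring_homo_simps)

definition vmono :: "monomial \<Rightarrow> vpoly" where "vmono m = Poly_Mapping.single m 1"

lemma vmono_add: "vmono (m + n) = vmono m * vmono n"
  by (simp add: vmono_def mult_single)

lemma vmono_0 [simp]: "vmono 0 = 1" by (simp add: vmono_def)

lemma vmono_single: "vmono (Poly_Mapping.single i n) = yvar i ^ n"
proof (induction n)
  case (Suc n)
  have "vmono (Poly_Mapping.single i (Suc n)) = vmono (Poly_Mapping.single i 1 + Poly_Mapping.single i n)"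
    by (simp flip: single_add)
  then show ?case using Suc by (simp only: vmono_add) (simp add: yvar_def vmono_def)
qed simp

lemma single_eq_vsym_vmono: "Poly_Mapping.single m c = vsym c * vmono m"
  by (simp add: vmono_def vsym_def mult_single)

text \<open>Sets other than initial segments occur when one variable is singled out for a
  coefficient functional or two for an exchange.\<close>

definition VS :: "nat set \<Rightarrow> vpoly set" where
  "VS K = {F. \<forall>m\<in>Poly_Mapping.keys F. Poly_Mapping.keys m \<subseteq> K}"

lemma V_eq_VS: "V k = VS {1..k}" by (simp add: V_def VS_def)
lemma VS_UNIV [simp]: "F \<in> VS UNIV" by (simp add: VS_def)
lemma VS_mono: "F \<in> VS K \<Longrightarrow> K \<subseteq> L \<Longrightarrow> F \<in> VS L" by (auto simp: VS_def)

lemma VS_0 [simp]: "0 \<in> VS K" by (simp add: VS_def)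
lemma VS_add: "F \<in> VS K \<Longrightarrow> G \<in> VS K \<Longrightarrow> F + G \<in> VS K"
  using Poly_Mapping.keys_add[of F G] by (auto simp: VS_def)
lemma VS_uminus: "F \<in> VS K \<Longrightarrow> - F \<in> VS K" by (auto simp: VS_def)
lemma VS_diff: "F \<in> VS K \<Longrightarrow> G \<in> VS K \<Longrightarrow> F - G \<in> VS K"
  using VS_add[of F K "- G"] VS_uminus[of G K] by simp
lemma VS_single: "Poly_Mapping.keys m \<subseteq> K \<Longrightarrow> Poly_Mapping.single m c \<in> VS K" by (simp add: VS_def)
lemma VS_vsym [simp]: "vsym f \<in> VS K" by (simp add: vsym_def VS_single)
lemma VS_vconst [simp]: "vconst f \<in> VS K" by (simp add: vconst_def)
lemma VS_1 [simp]: "1 \<in> VS K" using VS_vsym[of 1 K] by (simp add: vsym_simps)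
lemma VS_yvar: "i \<in> K \<Longrightarrow> yvar i \<in> VS K" by (simp add: yvar_def VS_single)
lemma VS_mult: "F \<in> VS K \<Longrightarrow> G \<in> VS K \<Longrightarrow> F * G \<in> VS K"
proof -
  assume FG: "F \<in> VS K" "G \<in> VS K"
  have "Poly_Mapping.keys m \<subseteq> K" if mk: "m \<in> Poly_Mapping.keys (F * G)" for m
  proof -
    obtain a b where "a \<in> Poly_Mapping.keys F" "b \<in> Poly_Mapping.keys G" "m = a + b"
      using subsetD[OF Poly_Mapping.keys_mult mk] by blast
    then show ?thesis using FG Poly_Mapping.keys_add[of a b] unfolding VS_def by blast
  qed
  then show ?thesis by (auto simp: VS_def)
qed
lemma VS_power: "F \<in> VS K \<Longrightarrow> F ^ n \<in> VS K" by (induction n) (simp_all add: VS_mult)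
lemma VS_sum: "(\<And>i. i \<in> A \<Longrightarrow> f i \<in> VS K) \<Longrightarrow> (\<Sum>i\<in>A. f i) \<in> VS K"
  by (induction A rule: infinite_finite_induct) (simp_all add: VS_add)

lemma VS_mono_induct [consumes 1, case_names single add]:
  assumes F: "F \<in> VS K"
    and single: "\<And>m c. Poly_Mapping.keys m \<subseteq> K \<Longrightarrow> P (Poly_Mapping.single m c)"
    and add: "\<And>F G. F \<in> VS K \<Longrightarrow> G \<in> VS K \<Longrightarrow> P F \<Longrightarrow> P G \<Longrightarrow> P (F + G)"
  shows "P F"
proof -
  let ?s = "\<lambda>m. Poly_Mapping.single m (Poly_Mapping.lookup F m)"
  have "A \<subseteq> Poly_Mapping.keys F \<Longrightarrow> P (\<Sum>m\<in>A. ?s m)" if "finite A" for A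
    using that
  proof (induction A rule: finite_induct)
    case empty
    then show ?case using single[of 0 0] by simp
  next
    case (insert m A)
    have k: "Poly_Mapping.keys m' \<subseteq> K" if "m' \<in> insert m A" for m'
      using F insert.prems that by (auto simp: VS_def)
    have "P (?s m + (\<Sum>m\<in>A. ?s m))"
      using insert k by (intro add single VS_sum VS_single) auto
    then show ?case using insert by simp
  qed
  from this[OF finite_keys[of F]] show ?thesis using pm_sum_single[of F] by simp
qed

lemma VS_induct [consumes 1, case_names sym var add mult]:
  assumes F: "F \<in> VS K"
    and sym: "\<And>f. P (vsym f)" and var: "\<And>i. i \<in> K \<Longrightarrow> P (yvar i)"
    and add: "\<And>F G. F \<in> VS K \<Longrightarrow> G \<in> VS K \<Longrightarrow> P F \<Longrightarrow> P G \<Longrightarrow> P (F + G)"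
    and mult: "\<And>F G. F \<in> VS K \<Longrightarrow> G \<in> VS K \<Longrightarrow> P F \<Longrightarrow> P G \<Longrightarrow> P (F * G)"
  shows "P F"
  using F
proof (induction rule: VS_mono_induct)
  case (single m c)
  then show ?case
  proof (induction m rule: mono_pos_induct)
    case zero
    then show ?case using sym[of c] by (simp add: vsym_def)
  next
    case (add m i)
    have eq: "Poly_Mapping.single (m + Poly_Mapping.single i 1) c = Poly_Mapping.single m c * yvar i"
      by (simp add: yvar_def mult_single)
    have km: "Poly_Mapping.keys m \<subseteq> K" "i \<in> K"
      using add.prems by (auto simp: in_keys_iff lookup_add subset_iff)
    show ?case unfolding eq by (intro mult add.IH km var VS_yvar VS_single)
  qed
qed (rule add)

lemma VS_left_induct [consumes 1, case_names sym var add]: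
  assumes F: "F \<in> VS K"
    and sym: "\<And>f. P (vsym f)" and var: "\<And>i F. i \<in> K \<Longrightarrow> F \<in> VS K \<Longrightarrow> P F \<Longrightarrow> P (yvar i * F)"
    and add: "\<And>F G. F \<in> VS K \<Longrightarrow> G \<in> VS K \<Longrightarrow> P F \<Longrightarrow> P G \<Longrightarrow> P (F + G)"
  shows "P F"
  using F
proof (induction rule: VS_mono_induct)
  case (single m c)
  then show ?case
  proof (induction m rule: mono_pos_induct)
    case zero
    then show ?case using sym[of c] by (simp add: vsym_def)
  next
    case (add m i)
    have eq: "Poly_Mapping.single (m + Poly_Mapping.single i 1) c = yvar i * Poly_Mapping.single m c"
      by (simp add: yvar_def mult_single add.commute)
    have km: "Poly_Mapping.keys m \<subseteq> K" "i \<in> K"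
      using add.prems by (auto simp: in_keys_iff lookup_add subset_iff)
    show ?case unfolding eq by (intro var add.IH km VS_single)
  qed
qed (rule add)

lemma vpoly_induct [case_names sym var add mult]:
  assumes "\<And>f. P (vsym f)" "\<And>i. P (yvar i)"
    "\<And>F G. P F \<Longrightarrow> P G \<Longrightarrow> P (F + G)" "\<And>F G. P F \<Longrightarrow> P G \<Longrightarrow> P (F * G)"
  shows "P F"
  by (rule VS_induct[of F UNIV]) (simp_all add: assms)

lemma vpoly_left_induct [case_names sym var add]:
  assumes "\<And>f. P (vsym f)" "\<And>i F. P F \<Longrightarrow> P (yvar i * F)"
    "\<And>F G. P F \<Longrightarrow> P G \<Longrightarrow> P (F + G)"
  shows "P F"
  by (rule VS_left_induct[of F UNIV]) (simp_all add: assms)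

text \<open>A map that is linear over the other variables is thereby determined by what it does to
  powers of the single variable \<open>j\<close>.\<close>

lemma VS_split_induct [consumes 1, case_names notin monom add]:
  assumes F: "F \<in> VS (insert j K)" and j: "j \<notin> K"
    and monom: "\<And>f n. f \<in> VS K \<Longrightarrow> P (f * yvar j ^ n)"
    and add: "\<And>F G. F \<in> VS (insert j K) \<Longrightarrow> G \<in> VS (insert j K) \<Longrightarrow> P F \<Longrightarrow> P G \<Longrightarrow> P (F + G)"
  shows "P F"
  using F
proof (induction rule: VS_mono_induct)
  case (single m c)
  define n where "n = Poly_Mapping.lookup m j"
  define m' where "m' = m - Poly_Mapping.single j n"
  have "m = m' + Poly_Mapping.single j n" unfolding m'_def n_def by (rule split_lookup) simp
  then have eq: "Poly_Mapping.single m c = vsym c * vmono m' * yvar j ^ n"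
    by (simp only: single_eq_vsym_vmono vmono_add vmono_single mult.assoc)
  have "Poly_Mapping.keys m' \<subseteq> K"
    using single unfolding m'_def n_def
    by (auto simp: subset_iff in_keys_iff lookup_minus lookup_single when_def split: if_splits)
  then have "vsym c * vmono m' \<in> VS K" by (simp add: VS_single flip: single_eq_vsym_vmono)
  then show ?case unfolding eq by (rule monom)
qed (rule add)

lemma vpoly_homo_eqI:
  assumes F: "F \<in> VS K" and h: "ring_homo \<phi>" "ring_homo \<psi>"
    and c: "\<And>c. \<phi> (vconst c) = \<psi> (vconst c)"
    and p: "\<And>n. n \<ge> 1 \<Longrightarrow> \<phi> (vsym (psum n)) = \<psi> (vsym (psum n))"
    and y: "\<And>i. i \<in> K \<Longrightarrow> \<phi> (yvar i) = \<psi> (yvar i)"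
  shows "\<phi> F = \<psi> F"
  using F
proof (induction rule: VS_induct)
  case (sym f)
  show ?case
    by (rule sym_homo_eqI[of "\<lambda>f. \<phi> (vsym f)" "\<lambda>f. \<psi> (vsym f)"])
      (use h c p in \<open>auto intro: ring_homo_comp[OF ring_homo_vsym] simp: vconst_def\<close>)
qed (simp_all add: y ring_homo_simps[OF h(1)] ring_homo_simps[OF h(2)])

text \<open>Needed twice: to recover a series from its logarithmic derivative, and to conclude x = 0
  from x = -x for antisymmetric arguments.\<close>

lemma vpoly_torsion_free:
  assumes "of_nat (Suc n) * (x :: vpoly) = 0" shows "x = 0"
proof -
  have "vconst (inverse (of_nat (Suc n))) * vconst (of_nat (Suc n)) = vconst 1"
    by (simp only: vconst_simps(4)[symmetric] left_inverse[OF of_nat_neq_0])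
  then have "x = vconst (inverse (of_nat (Suc n))) * (of_nat (Suc n) * x)"
    by (simp only: vconst_simps mult.assoc[symmetric]) simp
  then show ?thesis using assms by simp
qed

lemma vconst_cancel: "c \<noteq> 0 \<Longrightarrow> vconst c * x = vconst c * y \<Longrightarrow> x = y"
proof -
  assume c: "c \<noteq> 0" "vconst c * x = vconst c * y"
  have "vconst (inverse c) * vconst c = 1" using c by (simp flip: vconst_simps(2,4))
  then have *: "vconst (inverse c) * (vconst c * z) = z" for z by (simp flip: mult.assoc)
  have "x = vconst (inverse c) * (vconst c * x)" by (rule *[symmetric])
  also have "\<dots> = y" unfolding c(2) by (rule *)
  finally show "x = y" .
qed

section \<open>The Demazure--Lusztig operators\<close>

text \<open>From y_j Q = y_i Q the coefficient of Q at m equals the one with a factor y_i of m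
  traded for y_j. Descent on the exponent of y_i ends at a coefficient of y_i Q without y_i, which
  is 0.\<close>

lemma yvar_diff_cancel0:
  assumes "i \<noteq> j" "(yvar j - yvar i) * Q = 0"
  shows "Q = 0"
proof -
  have lk: "Poly_Mapping.lookup (yvar a * Q) (m + Poly_Mapping.single a 1) = Poly_Mapping.lookup Q m" for a m
  proof (induction Q rule: mpoly_induct)
    case (single n c)
    then show ?case by (auto simp: yvar_def mult_single lookup_single when_def add.commute)
  qed (simp_all add: distrib_left lookup_add)
  have lk0: "Poly_Mapping.lookup (yvar a * Q) m = 0" if "Poly_Mapping.lookup m a = 0" for a m
  proof (induction Q rule: mpoly_induct)
    case (single n c)
    then show ?case using that
      by (auto simp: yvar_def mult_single lookup_single when_def lookup_add)
  qed (simp_all add: distrib_left lookup_add)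
  have eq: "yvar j * Q = yvar i * Q" using assms(2) by (simp add: algebra_simps)
  have "Poly_Mapping.lookup Q m = 0" for m
  proof (induction "Poly_Mapping.lookup m i" arbitrary: m)
    case 0
    have "Poly_Mapping.lookup Q m = Poly_Mapping.lookup (yvar i * Q) (m + Poly_Mapping.single j 1)"
      by (metis lk eq)
    also have "\<dots> = 0" using 0 assms(1) by (intro lk0) (simp add: lookup_add lookup_single)
    finally show ?case .
  next
    case (Suc d)
    define m' where "m' = m - Poly_Mapping.single i 1"
    have m: "m = m' + Poly_Mapping.single i 1" unfolding m'_def
      using Suc.hyps(2) by (intro split_lookup) simp
    have "Poly_Mapping.lookup Q m = Poly_Mapping.lookup (yvar i * Q) (m + Poly_Mapping.single j 1)"
      by (metis lk eq)
    also have "m + Poly_Mapping.single j 1 = (m' + Poly_Mapping.single j 1) + Poly_Mapping.single i 1"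
      by (simp add: m ac_simps)
    also have "Poly_Mapping.lookup (yvar i * Q) \<dots> = Poly_Mapping.lookup Q (m' + Poly_Mapping.single j 1)"
      by (rule lk)
    also have "\<dots> = 0"
      using Suc.hyps(2) assms(1) by (intro Suc.hyps(1)) (simp add: m lookup_add lookup_single)
    finally show ?case .
  qed
  then show ?thesis by (intro poly_mapping_eqI) simp
qed

lemma yvar_diff_cancel:
  assumes "i \<noteq> j" "(yvar j - yvar i) * P = (yvar j - yvar i) * Q"
  shows "P = Q"
  using yvar_diff_cancel0[OF assms(1), of "P - Q"] assms(2) by (simp add: right_diff_distrib)

lemma ring_homo_swap_y: "ring_homo (swap_y i)"
  unfolding swap_y_def by (rule ring_homo_eval_v[OF ring_homo_vsym])

lemmas swap_y_simps = ring_homo_simps[OF ring_homo_swap_y]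

lemma swap_y_gens [simp]:
  "swap_y i (vsym f) = vsym f" "swap_y i (vconst c) = vconst c"
  "swap_y i (yvar i) = yvar (Suc i)" "swap_y i (yvar (Suc i)) = yvar i"
  "j \<noteq> i \<Longrightarrow> j \<noteq> Suc i \<Longrightarrow> swap_y i (yvar j) = yvar j"
  by (simp_all add: swap_y_def eval_v_vsym eval_v_vconst eval_v_yvar ring_homo_vsym flip: vconst_def)

lemma swap_y_invol [simp]: "swap_y i (swap_y i P) = P"
proof (induction P rule: vpoly_induct)
  case (var j)
  then show ?case by (cases "j = i \<or> j = Suc i") auto
qed (simp_all add: swap_y_simps)

lemma swap_y_fix: "P \<in> VS K \<Longrightarrow> i \<notin> K \<Longrightarrow> Suc i \<notin> K \<Longrightarrow> swap_y i P = P"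
proof (induction rule: VS_induct)
  case (var j)
  then show ?case by (intro swap_y_gens) auto
qed (simp_all add: swap_y_simps)

lemma swap_y_VS: "P \<in> VS K \<Longrightarrow> i \<in> K \<Longrightarrow> Suc i \<in> K \<Longrightarrow> swap_y i P \<in> VS K"
proof (induction rule: VS_induct)
  case (var j)
  then show ?case by (cases "j = i \<or> j = Suc i") (auto simp: VS_yvar)
qed (simp_all add: swap_y_simps VS_add VS_mult)

lemma divdiff_ex:
  assumes "P \<in> VS K" "i \<in> K" "Suc i \<in> K"
  shows "\<exists>Q\<in>VS K. (yvar (Suc i) - yvar i) * Q = swap_y i P - P"
  using assms
proof (induction rule: VS_induct)
  case (sym f)
  then show ?case by (intro bexI[of _ 0]) auto
next
  case (var j)
  have u: "1 \<in> VS K" "- 1 \<in> VS K" by (simp_all add: VS_uminus)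
  consider "j = i" | "j = Suc i" | "j \<noteq> i" "j \<noteq> Suc i" by blast
  then show ?case
  proof cases
    case 1 then show ?thesis using u by (intro bexI[of _ 1]) auto
  next
    case 2 then show ?thesis using u by (intro bexI[of _ "- 1"]) auto
  next
    case 3 then show ?thesis by (intro bexI[of _ 0]) auto
  qed
next
  case (add F G)
  then obtain A B where "A \<in> VS K" "(yvar (Suc i) - yvar i) * A = swap_y i F - F"
    "B \<in> VS K" "(yvar (Suc i) - yvar i) * B = swap_y i G - G" by blast
  then show ?case by (intro bexI[of _ "A + B"]) (simp_all add: swap_y_simps VS_add distrib_left)
next
  case (mult F G)
  then obtain A B where AB: "A \<in> VS K" "(yvar (Suc i) - yvar i) * A = swap_y i F - F"
    "B \<in> VS K" "(yvar (Suc i) - yvar i) * B = swap_y i G - G" by blast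
  \<comment> \<open>Twisted Leibniz rule: s(FG) - FG = (sF - F) sG + F (sG - G).\<close>
  have "(yvar (Suc i) - yvar i) * (A * swap_y i G + F * B) =
      ((yvar (Suc i) - yvar i) * A) * swap_y i G + F * ((yvar (Suc i) - yvar i) * B)"
    by (simp add: algebra_simps)
  also have "\<dots> = swap_y i (F * G) - F * G" unfolding AB by (simp add: swap_y_simps algebra_simps)
  finally show ?case using AB mult by (intro bexI[of _ "A * swap_y i G + F * B"])
    (simp_all add: VS_add VS_mult swap_y_VS)
qed

definition divdiff :: "nat \<Rightarrow> vpoly \<Rightarrow> vpoly" where
  "divdiff i P = (THE Q. (yvar (Suc i) - yvar i) * Q = swap_y i P - P)"

lemma divdiff_unique: "(yvar (Suc i) - yvar i) * Q = swap_y i P - P \<Longrightarrow> divdiff i P = Q"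
  unfolding divdiff_def by (rule the_equality) (auto intro: yvar_diff_cancel[of i "Suc i"])

lemma divdiff: "(yvar (Suc i) - yvar i) * divdiff i P = swap_y i P - P"
  using divdiff_ex[of P UNIV i] divdiff_unique by auto

lemma divdiff_VS: "P \<in> VS K \<Longrightarrow> i \<in> K \<Longrightarrow> Suc i \<in> K \<Longrightarrow> divdiff i P \<in> VS K"
  using divdiff_ex[of P K i] divdiff_unique by metis

abbreviation cq :: vpoly where "cq \<equiv> vconst qq"

lemma T_op_unique:
  assumes "(yvar (Suc i) - yvar i) * Q =
     (cq - 1) * yvar i * P + (yvar (Suc i) - cq * yvar i) * swap_y i P"
  shows "T_op i P = Q"
  unfolding T_op_def using assms
  by (intro the_equality) (auto intro: yvar_diff_cancel[of i "Suc i"] simp: vconst_simps)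

text \<open>Exhibits T_i as polynomial, and T_i - 1 as a multiple of y_(i+1) - q y_i; that factor is
  what the series of d_- later cancels.\<close>

lemma T_op_divdiff: "T_op i P = P + (yvar (Suc i) - cq * yvar i) * divdiff i P"
proof (rule T_op_unique)
  have "(yvar (Suc i) - yvar i) * (P + (yvar (Suc i) - cq * yvar i) * divdiff i P) =
    (yvar (Suc i) - yvar i) * P + (yvar (Suc i) - cq * yvar i) * ((yvar (Suc i) - yvar i) * divdiff i P)"
    by (simp add: algebra_simps)
  then show "(yvar (Suc i) - yvar i) * (P + (yvar (Suc i) - cq * yvar i) * divdiff i P) =
    (cq - 1) * yvar i * P + (yvar (Suc i) - cq * yvar i) * swap_y i P"
    unfolding divdiff by (simp add: algebra_simps)
qed

lemma T_op_eq: "(yvar (Suc i) - yvar i) * T_op i P =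
     (cq - 1) * yvar i * P + (yvar (Suc i) - cq * yvar i) * swap_y i P"
proof -
  have "(yvar (Suc i) - yvar i) * T_op i P =
    (yvar (Suc i) - yvar i) * P + (yvar (Suc i) - cq * yvar i) * ((yvar (Suc i) - yvar i) * divdiff i P)"
    by (simp add: T_op_divdiff algebra_simps)
  then show ?thesis unfolding divdiff by (simp add: algebra_simps)
qed

lemma T_op_VS: "P \<in> VS K \<Longrightarrow> i \<in> K \<Longrightarrow> Suc i \<in> K \<Longrightarrow> T_op i P \<in> VS K"
  by (simp add: T_op_divdiff VS_add VS_mult VS_diff VS_yvar divdiff_VS)

lemma T_op_add: "T_op i (P + Q) = T_op i P + T_op i Q"
  by (rule T_op_unique) (simp only: distrib_left[of "yvar (Suc i) - yvar i"] T_op_eq swap_y_simps, simp add: algebra_simps)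

lemma T_op_lin: "swap_y i a = a \<Longrightarrow> T_op i (a * P) = a * T_op i P"
proof (rule T_op_unique)
  assume a: "swap_y i a = a"
  have "(yvar (Suc i) - yvar i) * (a * T_op i P) = a * ((yvar (Suc i) - yvar i) * T_op i P)"
    by (simp add: algebra_simps)
  then show "(yvar (Suc i) - yvar i) * (a * T_op i P) =
    (cq - 1) * yvar i * (a * P) + (yvar (Suc i) - cq * yvar i) * swap_y i (a * P)"
    unfolding T_op_eq using a by (simp add: swap_y_simps algebra_simps)
qed

lemma T_op_uminus: "T_op i (- P) = - T_op i P"
  using T_op_lin[of i "- 1" P] by (simp add: swap_y_simps)

lemma T_op_diff: "T_op i (P - Q) = T_op i P - T_op i Q"
  using T_op_add[of i P "- Q"] by (simp add: T_op_uminus)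

lemma T_op_vconst [simp]: "T_op i (vconst c * P) = vconst c * T_op i P"
  by (rule T_op_lin) simp

lemma T_op_fix: "swap_y i P = P \<Longrightarrow> T_op i P = P"
  by (rule T_op_unique) (simp add: algebra_simps)

lemma T_op_right: "T_op i (yvar (Suc i) * P) = yvar i * T_op i P + (cq - 1) * yvar i * P"
proof (rule T_op_unique)
  have "(yvar (Suc i) - yvar i) * (yvar i * T_op i P + (cq - 1) * yvar i * P) =
    yvar i * ((yvar (Suc i) - yvar i) * T_op i P) + (yvar (Suc i) - yvar i) * ((cq - 1) * yvar i * P)"
    by (simp add: algebra_simps)
  then show "(yvar (Suc i) - yvar i) * (yvar i * T_op i P + (cq - 1) * yvar i * P) =
    (cq - 1) * yvar i * (yvar (Suc i) * P) + (yvar (Suc i) - cq * yvar i) * swap_y i (yvar (Suc i) * P)"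
    unfolding T_op_eq by (simp add: swap_y_simps algebra_simps)
qed

lemma T_op_left: "T_op i (yvar i * P) = yvar (Suc i) * T_op i P - (cq - 1) * yvar i * P"
proof (rule T_op_unique)
  have "(yvar (Suc i) - yvar i) * (yvar (Suc i) * T_op i P - (cq - 1) * yvar i * P) =
    yvar (Suc i) * ((yvar (Suc i) - yvar i) * T_op i P) - (yvar (Suc i) - yvar i) * ((cq - 1) * yvar i * P)"
    by (simp add: algebra_simps)
  then show "(yvar (Suc i) - yvar i) * (yvar (Suc i) * T_op i P - (cq - 1) * yvar i * P) =
    (cq - 1) * yvar i * (yvar i * P) + (yvar (Suc i) - cq * yvar i) * swap_y i (yvar i * P)"
    unfolding T_op_eq by (simp add: swap_y_simps algebra_simps)
qed

lemma T_op_other: "j \<noteq> i \<Longrightarrow> j \<noteq> Suc i \<Longrightarrow> T_op i (yvar j * P) = yvar j * T_op i P"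
  by (rule T_op_lin) simp

lemma T_op_cq1: "T_op i ((cq - 1) * P) = (cq - 1) * T_op i P"
  by (rule T_op_lin) (simp add: swap_y_simps)

lemma T_op_vsym [simp]: "T_op i (vsym f) = vsym f" by (rule T_op_fix) simp

lemmas T_op_rules = T_op_left T_op_right T_op_other T_op_add T_op_diff T_op_cq1 T_op_vconst mult.assoc

text \<open>As for the two following relations, the rules \<open>T_op_rules\<close> carry each T
  through a variable, so an induction over multiplication by variables leaves only symmetric
  functions, on which every T_i is the identity.\<close>

lemma T_op_quad: "T_op i (T_op i P) = cq * P - (cq - 1) * T_op i P"
proof (induction P rule: vpoly_left_induct)
  case (var j P)
  consider "j = i" | "j = Suc i" | "j \<noteq> i" "j \<noteq> Suc i" by blast
  then show ?case
    by cases (simp_all add: T_op_rules var(1), simp_all add: algebra_simps)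
qed (simp_all add: T_op_add algebra_simps)

lemma T_op_far:
  assumes "Suc i < j"
  shows "T_op i (T_op j P) = T_op j (T_op i P)"
proof (induction P rule: vpoly_left_induct)
  case (var m P)
  consider "m = i" | "m = Suc i" | "m = j" | "m = Suc j" | "m \<notin> {i, Suc i, j, Suc j}" by blast
  then show ?case
    by cases (use assms var(1) in \<open>simp_all add: T_op_rules\<close>)
qed (simp_all add: T_op_add)

lemma T_op_braid:
  "T_op i (T_op (Suc i) (T_op i P)) = T_op (Suc i) (T_op i (T_op (Suc i) P))"
proof (induction P rule: vpoly_left_induct)
  case (var m P)
  consider "m = i" | "m = Suc i" | "m = Suc (Suc i)" | "m \<notin> {i, Suc i, Suc (Suc i)}" by blast
  then show ?case
    by cases (simp_all add: T_op_rules var(1), simp_all add: T_op_quad, simp_all add: algebra_simps)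
qed (simp_all add: T_op_add)

lemma T_op_right_T: "T_op i (yvar (Suc i) * T_op i P) = cq * (yvar i * P)"
  by (simp add: T_op_right T_op_quad) (simp add: algebra_simps)

section \<open>Logarithmic derivatives\<close>

text \<open>Says f = exp(sum of a_n u^n / n over n >= 1), without dividing by n. With a_n = p_n[A]
  this is the generating series of h_n[A]; \<open>geo c\<close> and \<open>lin c\<close> belong to
  the alphabets c and -c.\<close>

definition lder :: "(nat \<Rightarrow> 'b::comm_ring_1) \<Rightarrow> 'b fps \<Rightarrow> bool" where
  "lder a f \<longleftrightarrow> fps_nth f 0 = 1 \<and> fps_deriv f = Abs_fps (\<lambda>i. a (Suc i)) * f"

definition geo :: "'b::comm_ring_1 \<Rightarrow> 'b fps" where "geo c = Abs_fps (\<lambda>n. c ^ n)"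
definition lin :: "'b::comm_ring_1 \<Rightarrow> 'b fps" where "lin c = 1 - fps_const c * fps_X"

lemma geo_nth [simp]: "fps_nth (geo c) n = c ^ n" by (simp add: geo_def)

lemma lin_geo: "lin c * geo c = 1" "geo c * lin c = 1"
proof -
  show "lin c * geo c = 1"
  proof (rule fps_ext)
    fix n show "fps_nth (lin c * geo c) n = fps_nth 1 n"
      by (cases n) (simp_all add: lin_def left_diff_distrib mult.assoc fps_X_mult_nth)
  qed
  then show "geo c * lin c = 1" by (simp add: mult.commute)
qed

lemma lin_geo_mult: "lin c * (geo c * f) = f" "geo c * (lin c * f) = f"
  by (simp_all add: lin_geo flip: mult.assoc)

lemma Abs_fps_add: "Abs_fps (\<lambda>n. a n + b n) = Abs_fps a + Abs_fps b" by (rule fps_ext) simp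

lemma lder_mult: "lder a f \<Longrightarrow> lder b g \<Longrightarrow> lder (\<lambda>n. a n + b n) (f * g)"
  by (simp add: lder_def Abs_fps_add algebra_simps)

lemma lder_one: "lder (\<lambda>n. 0) 1"
proof -
  have "Abs_fps (\<lambda>i. 0) = (0 :: 'a fps)" by (rule fps_ext) simp
  then show ?thesis by (simp add: lder_def)
qed

lemma lder_prod: "finite A \<Longrightarrow> (\<And>i. i \<in> A \<Longrightarrow> lder (a i) (f i)) \<Longrightarrow>
    lder (\<lambda>n. \<Sum>i\<in>A. a i n) (\<Prod>i\<in>A. f i)"
  by (induction A rule: finite_induct) (simp_all add: lder_one lder_mult)

lemma Abs_fps_geo: "Abs_fps (\<lambda>i. c ^ Suc i) = fps_const c * geo c" by (rule fps_ext) simp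

lemma lder_lin: "lder (\<lambda>n. - (c ^ n)) (lin c)"
proof -
  have "Abs_fps (\<lambda>i. - (c ^ Suc i)) = - (fps_const c * geo c)" by (rule fps_ext) simp
  moreover have "fps_deriv (lin c) = - fps_const c" by (simp add: lin_def)
  ultimately show ?thesis by (simp add: lder_def mult.assoc lin_geo) (simp add: lin_def)
qed

lemma lder_geo: "lder (\<lambda>n. c ^ n) (geo c)"
proof -
  have "fps_deriv (lin c * geo c) = 0" by (simp add: lin_geo)
  then have "lin c * fps_deriv (geo c) = fps_const c * geo c" by (simp add: lin_def algebra_simps)
  then have "geo c * (lin c * fps_deriv (geo c)) = geo c * (fps_const c * geo c)" by simp
  then show ?thesis by (simp add: lin_geo_mult lder_def Abs_fps_geo mult.assoc del: power_Suc)
qed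

text \<open>Turns identities of generating series into identities of power sums. The differential
  equation determines coefficient n + 1 only up to the factor n + 1, hence the torsion
  hypothesis.\<close>

lemma lder_unique:
  assumes tf: "\<And>n (x::'b::comm_ring_1). of_nat (Suc n) * x = 0 \<Longrightarrow> x = 0"
    and f: "lder a f" and g: "lder b g" and ab: "\<And>n. n \<ge> 1 \<Longrightarrow> a n = (b n :: 'b)"
  shows "f = g"
proof -
  have ab': "Abs_fps (\<lambda>i. a (Suc i)) = Abs_fps (\<lambda>i. b (Suc i))" using ab by simp
  define A where "A = Abs_fps (\<lambda>i. a (Suc i))"
  have d: "fps_deriv f = A * f" "fps_deriv g = A * g"
    using f g ab' by (auto simp: lder_def A_def)
  have "fps_nth f n = fps_nth g n" for n
  proof (induction n rule: less_induct)
    case (less n)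
    show ?case
    proof (cases n)
      case 0
      then show ?thesis using f g by (simp add: lder_def)
    next
      case (Suc m)
      have "of_nat (Suc m) * fps_nth f (Suc m) = fps_nth (A * f) m"
        using arg_cong[OF d(1), of "\<lambda>x. fps_nth x m"] by simp
      also have "\<dots> = fps_nth (A * g) m"
        unfolding fps_mult_nth using less Suc by (intro sum.cong refl) auto
      also have "\<dots> = of_nat (Suc m) * fps_nth g (Suc m)"
        using arg_cong[OF d(2), of "\<lambda>x. fps_nth x m"] by simp
      finally have "of_nat (Suc m) * (fps_nth f (Suc m) - fps_nth g (Suc m)) = 0"
        by (simp add: right_diff_distrib)
      then show ?thesis using tf Suc by fastforce
    qed
  qed
  then show ?thesis by (rule fps_ext)
qed

section \<open>Series under ring homomorphisms; Newton's identity\<close>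

definition fps_hom :: "('a \<Rightarrow> 'b) \<Rightarrow> 'a fps \<Rightarrow> 'b fps" where
  "fps_hom \<phi> f = Abs_fps (\<lambda>n. \<phi> (fps_nth f n))"

lemma fps_hom_nth [simp]: "fps_nth (fps_hom \<phi> f) n = \<phi> (fps_nth f n)" by (simp add: fps_hom_def)

lemma fps_hom_mult: "ring_homo \<phi> \<Longrightarrow> fps_hom \<phi> (f * g) = fps_hom \<phi> f * fps_hom \<phi> g"
  by (rule fps_ext) (simp add: fps_mult_nth ring_homo_sum ring_homo_simps)

lemma fps_hom_one: "ring_homo \<phi> \<Longrightarrow> fps_hom \<phi> 1 = 1"
  by (rule fps_ext) (simp add: ring_homo_simps)

lemma fps_hom_prod: "ring_homo \<phi> \<Longrightarrow> fps_hom \<phi> (\<Prod>i\<in>A. f i) = (\<Prod>i\<in>A. fps_hom \<phi> (f i))"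
  by (induction A rule: infinite_finite_induct) (simp_all add: fps_hom_one fps_hom_mult)

lemma fps_hom_geo: "ring_homo \<phi> \<Longrightarrow> fps_hom \<phi> (geo c) = geo (\<phi> c)"
  by (rule fps_ext) (simp add: ring_homo_simps)

lemma fps_hom_lin: "ring_homo \<phi> \<Longrightarrow> fps_hom \<phi> (lin c) = lin (\<phi> c)"
  by (rule fps_ext) (simp add: lin_def ring_homo_simps fps_X_def)

lemma lder_hom:
  assumes \<phi>: "ring_homo \<phi>" and f: "lder a f"
  shows "lder (\<lambda>n. \<phi> (a n)) (fps_hom \<phi> f)"
proof -
  have "fps_deriv (fps_hom \<phi> f) = fps_hom \<phi> (fps_deriv f)"
    by (rule fps_ext) (simp add: ring_homo_simps(3,4,8)[OF \<phi>] ring_homo_simps(2)[OF \<phi>])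
  also have "\<dots> = fps_hom \<phi> (Abs_fps (\<lambda>i. a (Suc i))) * fps_hom \<phi> f"
    using f by (simp add: lder_def fps_hom_mult[OF \<phi>])
  also have "fps_hom \<phi> (Abs_fps (\<lambda>i. a (Suc i))) = Abs_fps (\<lambda>i. \<phi> (a (Suc i)))"
    by (rule fps_ext) simp
  finally show ?thesis using f by (simp add: lder_def ring_homo_simps[OF \<phi>])
qed

text \<open>The substitution u -> w u. It is applied with w the Laurent variable that stands for the
  inverse of y_k.\<close>

lemma lder_weighted:
  assumes f: "lder a f"
  shows "lder (\<lambda>n. w ^ n * a n) (Abs_fps (\<lambda>n. w ^ n * fps_nth f n))"
proof -
  let ?f = "Abs_fps (\<lambda>n. w ^ n * fps_nth f n)"
  have "fps_nth (fps_deriv ?f) n = fps_nth (Abs_fps (\<lambda>i. w ^ Suc i * a (Suc i)) * ?f) n" for n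
  proof -
    have "fps_nth (fps_deriv ?f) n = w ^ Suc n * fps_nth (fps_deriv f) n" by (simp add: ac_simps)
    also have "\<dots> = w ^ Suc n * (\<Sum>i=0..n. a (Suc i) * fps_nth f (n - i))"
      using f by (simp add: lder_def fps_mult_nth)
    also have "\<dots> = (\<Sum>i=0..n. (w ^ Suc i * a (Suc i)) * (w ^ (n - i) * fps_nth f (n - i)))"
      unfolding sum_distrib_left
    proof (intro sum.cong refl)
      fix i assume "i \<in> {0..n}"
      then have "w ^ Suc n = w ^ Suc i * w ^ (n - i)" by (simp flip: power_add power_Suc)
      then show "w ^ Suc n * (a (Suc i) * fps_nth f (n - i)) =
        (w ^ Suc i * a (Suc i)) * (w ^ (n - i) * fps_nth f (n - i))" by (simp only: ac_simps)
    qed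
    finally show ?thesis by (simp add: fps_mult_nth)
  qed
  then show ?thesis using f by (simp add: lder_def fps_eq_iff del: power_Suc)
qed

lemma coeff_of_nat_mult: "coeff_sym (of_nat k * f) m = of_nat k * coeff_sym f m"
  by (metis coeff_sym_const_mult ring_homo_simps(8)[OF ring_homo_sym_const])

text \<open>Newton's identity, by counting: a monomial m of degree n + 1 occurs on the right once
  for every pair of a variable j and a number between 1 and its exponent in m, that is, deg m
  times.\<close>

lemma lder_hsum: "lder psum (Abs_fps hsum :: 'a::comm_ring_1 symfun fps)"
proof -
  have "(of_nat (Suc n) * hsum (Suc n) :: 'a symfun) = (\<Sum>i=0..n. psum (Suc i) * hsum (n - i))" for n
  proof (rule symfun_eqI)
    fix m :: monomial
    have fin: "finite {j. Suc i \<le> Poly_Mapping.lookup m j}" for i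
      by (rule finite_subset[of _ "Poly_Mapping.keys m"]) (auto simp: in_keys_iff)
    have deg: "mdeg m = mdeg (m - Poly_Mapping.single j r) + r" if "r \<le> Poly_Mapping.lookup m j" for r j
      using split_lookup[OF that] by (metis mdeg_add mdeg_single)
    have "coeff_sym (\<Sum>i=0..n. psum (Suc i) * hsum (n - i)) m =
      (\<Sum>i=0..n. \<Sum>j\<in>{j. Suc i \<le> Poly_Mapping.lookup m j}. if mdeg m = Suc n then 1 else (0::'a))"
      unfolding coeff_sym_sum
    proof (intro sum.cong refl)
      fix i assume i: "i \<in> {0..n}"
      have "coeff_sym (psum (Suc i) * hsum (n - i)) m =
        (\<Sum>j\<in>{j. Suc i \<le> Poly_Mapping.lookup m j}. coeff_sym (hsum (n - i)) (m - Poly_Mapping.single j (Suc i)) :: 'a)"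
        by (rule coeff_psum_mult) simp
      also have "\<dots> = (\<Sum>j\<in>{j. Suc i \<le> Poly_Mapping.lookup m j}. if mdeg m = Suc n then 1 else (0::'a))"
      proof (intro sum.cong refl)
        fix j assume "j \<in> {j. Suc i \<le> Poly_Mapping.lookup m j}"
        then show "coeff_sym (hsum (n - i)) (m - Poly_Mapping.single j (Suc i)) = (if mdeg m = Suc n then 1 else (0::'a))"
          using i deg[of "Suc i" j] by (auto simp: hsum.rep_eq)
      qed
      finally show "coeff_sym (psum (Suc i) * hsum (n - i)) m =
        (\<Sum>j\<in>{j. Suc i \<le> Poly_Mapping.lookup m j}. if mdeg m = Suc n then 1 else (0::'a))" .
    qed
    also have "\<dots> = (if mdeg m = Suc n then of_nat (\<Sum>i=0..n. card {j. Suc i \<le> Poly_Mapping.lookup m j}) else 0)"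
      by simp
    also have "\<dots> = (if mdeg m = Suc n then of_nat (Suc n) else 0)"
    proof (cases "mdeg m = Suc n")
      case True
      have "(\<Sum>i=0..n. card {j. Suc i \<le> Poly_Mapping.lookup m j}) =
        (\<Sum>i=0..n. \<Sum>j\<in>Poly_Mapping.keys m. if i < Poly_Mapping.lookup m j then 1 else 0)"
      proof (intro sum.cong refl)
        fix i
        have "{j. Suc i \<le> Poly_Mapping.lookup m j} = {j \<in> Poly_Mapping.keys m. i < Poly_Mapping.lookup m j}"
          by (auto simp: in_keys_iff)
        then show "card {j. Suc i \<le> Poly_Mapping.lookup m j} =
          (\<Sum>j\<in>Poly_Mapping.keys m. if i < Poly_Mapping.lookup m j then 1 else 0)"
          by (simp add: sum.If_cases Int_def)
      qed
      also have "\<dots> = (\<Sum>j\<in>Poly_Mapping.keys m. \<Sum>i=0..n. if i < Poly_Mapping.lookup m j then 1 else 0)"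
        by (rule sum.swap)
      also have "\<dots> = (\<Sum>j\<in>Poly_Mapping.keys m. Poly_Mapping.lookup m j)"
      proof (intro sum.cong refl)
        fix j
        have "{0..n} \<inter> {i. i < Poly_Mapping.lookup m j} = {..<Poly_Mapping.lookup m j}"
          using lookup_le_mdeg[of m j] True by auto
        then show "(\<Sum>i=0..n. if i < Poly_Mapping.lookup m j then 1 else 0) = Poly_Mapping.lookup m j"
          by (simp add: sum.If_cases)
      qed
      also have "\<dots> = Suc n" using True by (simp add: mdeg_def)
      finally show ?thesis by presburger
    qed simp
    also have "\<dots> = coeff_sym (of_nat (Suc n) * hsum (Suc n) :: 'a symfun) m"
      by (simp add: coeff_of_nat_mult hsum.rep_eq del: of_nat_Suc)
    finally show "coeff_sym (of_nat (Suc n) * hsum (Suc n) :: 'a symfun) m =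
      coeff_sym (\<Sum>i=0..n. psum (Suc i) * hsum (n - i)) m" by simp
  qed
  moreover have "(hsum 0 :: 'a symfun) = 1"
  proof (rule symfun_eqI)
    fix m
    have "mdeg m = 0 \<longleftrightarrow> m = 0"
      by (auto simp: mdeg_def in_keys_iff intro!: poly_mapping_eqI)
    then show "coeff_sym (hsum 0) m = (coeff_sym 1 m :: 'a)" by (simp add: hsum.rep_eq one_symfun.rep_eq)
  qed
  ultimately show ?thesis by (simp add: lder_def fps_eq_iff fps_mult_nth del: of_nat_Suc)
qed

lemma lder_plethysm:
  assumes "ring_homo c"
  shows "lder a (Abs_fps (\<lambda>n. plethysm c a (hsum n)))"
proof -
  have "lder (\<lambda>n. plethysm c a (psum n)) (fps_hom (plethysm c a) (Abs_fps hsum))"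
    by (rule lder_hom[OF plethysm(1)[OF assms] lder_hsum])
  moreover have "fps_hom (plethysm c a) (Abs_fps hsum) = Abs_fps (\<lambda>n. plethysm c a (hsum n))"
    by (rule fps_ext) simp
  moreover have "Abs_fps (\<lambda>i. plethysm c a (psum (Suc i))) = Abs_fps (\<lambda>i. a (Suc i))"
    by (rule fps_ext) (simp add: plethysm(3)[OF assms])
  ultimately show ?thesis by (simp add: lder_def)
qed

text \<open>\<open>hneg n = h\<^sub>n[-X]\<close>.\<close>

definition hneg :: "nat \<Rightarrow> qt symfun" where
  "hneg n = plethysm sym_const (\<lambda>n. - psum n) (hsum n)"

lemma lder_hneg: "lder (\<lambda>n. - psum n) (Abs_fps hneg)"
  using lder_plethysm[OF ring_homo_sym_const] by (simp add: hneg_def[abs_def])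

definition hnegs :: "vpoly fps" where "hnegs = fps_hom vsym (Abs_fps hneg)"

lemma lder_hnegs: "lder (\<lambda>n. - vsym (psum n)) hnegs"
  using lder_hom[OF ring_homo_vsym lder_hneg] by (simp add: hnegs_def vsym_simps)

text \<open>The generating series in \<open>1 / v\<close> of \<open>h\<^sub>n[-X + (q-1)(y\<^sub>1 + \<dots> + y\<^sub>k)]\<close>.\<close>

definition Hs :: "nat \<Rightarrow> vpoly fps" where
  "Hs k = hnegs * (\<Prod>i=1..k. lin (yvar i) * geo (cq * yvar i))"

lemma Hs_Suc: "Hs (Suc k) = lin (yvar (Suc k)) * geo (cq * yvar (Suc k)) * Hs k"
  by (simp add: Hs_def ac_simps)

lemma lder_Hs: "lder (\<lambda>n. - vsym (psum n) + (\<Sum>i=1..k. - (yvar i ^ n) + (cq * yvar i) ^ n)) (Hs k)"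
  unfolding Hs_def by (intro lder_mult lder_hnegs lder_prod lder_lin lder_geo) simp

lemma vpoly_lder_unique: "lder a f \<Longrightarrow> lder b g \<Longrightarrow> (\<And>n. n \<ge> 1 \<Longrightarrow> a n = b n) \<Longrightarrow> f = (g :: vpoly fps)"
  by (rule lder_unique[OF vpoly_torsion_free])

definition fps_in :: "nat set \<Rightarrow> vpoly fps \<Rightarrow> bool" where
  "fps_in K f \<longleftrightarrow> (\<forall>n. fps_nth f n \<in> VS K)"

lemma fps_in_mult: "fps_in K f \<Longrightarrow> fps_in K g \<Longrightarrow> fps_in K (f * g)"
  by (auto simp: fps_in_def fps_mult_nth intro!: VS_sum VS_mult)
lemma fps_in_1: "fps_in K 1" by (simp add: fps_in_def)
lemma fps_in_prod: "(\<And>i. i \<in> A \<Longrightarrow> fps_in K (f i)) \<Longrightarrow> fps_in K (\<Prod>i\<in>A. f i)"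
  by (induction A rule: infinite_finite_induct) (simp_all add: fps_in_mult fps_in_1)
lemma fps_in_geo: "c \<in> VS K \<Longrightarrow> fps_in K (geo c)" by (simp add: fps_in_def VS_power)
lemma fps_in_lin: "c \<in> VS K \<Longrightarrow> fps_in K (lin c)"
  by (auto simp: fps_in_def lin_def VS_diff fps_X_def VS_uminus)
lemma fps_in_X: "fps_in K fps_X" by (simp add: fps_in_def fps_X_def)
lemma fps_in_hnegs: "fps_in K hnegs" by (simp add: fps_in_def hnegs_def)

lemma fps_in_Hs: "fps_in {1..k} (Hs k)"
  unfolding Hs_def
  by (intro fps_in_mult fps_in_prod fps_in_hnegs fps_in_lin fps_in_geo VS_mult VS_vconst VS_yvar) auto

lemma swap_Hs: assumes "1 \<le> i" "Suc i \<le> k" shows "swap_y i (fps_nth (Hs k) n) = fps_nth (Hs k) n"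
proof -
  have f1: "fps_hom (swap_y i) hnegs = hnegs" by (rule fps_ext) (simp add: hnegs_def)
  have sw: "swap_y i (yvar j) = yvar (Transposition.transpose i (Suc i) j)" for j
    by (cases "j = i"; cases "j = Suc i") (auto simp: transpose_def)
  have bij: "bij_betw (Transposition.transpose i (Suc i)) {1..k} {1..k}"
    using assms by (intro permutes_imp_bij permutes_swap_id) auto
  have "fps_hom (swap_y i) (Hs k) = hnegs * (\<Prod>j=1..k. lin (yvar (Transposition.transpose i (Suc i) j)) *
      geo (cq * yvar (Transposition.transpose i (Suc i) j)))"
    by (simp add: Hs_def fps_hom_mult[OF ring_homo_swap_y] f1 fps_hom_prod[OF ring_homo_swap_y]
        fps_hom_lin[OF ring_homo_swap_y] fps_hom_geo[OF ring_homo_swap_y] swap_y_simps sw)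
  also have "\<dots> = Hs k"
    unfolding Hs_def
    by (subst prod.reindex_bij_betw[OF bij, of "\<lambda>j. lin (yvar j) * geo (cq * yvar j)"]) (rule refl)
  finally show ?thesis by (metis fps_hom_nth)
qed

section \<open>The substitution behind \<open>d\<^sub>+\<^sup>*\<close>\<close>

text \<open>This is d_+^* after straightening. The substitution gamma turns the shift (q-1)(y_1 +
  ... + y_(k+1)) into (q-1)(t y_1 + y_2 + ... + y_(k+1)); relative to the straightening at k + 1 the
  excess is (q-1)(t-1)y_1, whose n-th power sum appears here.\<close>

definition tau :: "vpoly \<Rightarrow> vpoly" where
  "tau = eval_v (plethysm vconst (\<lambda>n. vsym (psum n) + vconst ((qq ^ n - 1) * (tt ^ n - 1)) * yvar 1 ^ n))
     (\<lambda>i. yvar (Suc i))"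

abbreviation w1 :: vpoly where "w1 \<equiv> vconst tt * yvar (Suc 0)"

lemma ring_homo_tau: "ring_homo tau"
  unfolding tau_def by (intro ring_homo_eval_v plethysm ring_homo_vconst)

lemmas tau_simps = ring_homo_simps[OF ring_homo_tau]

lemma tau_gens:
  "tau (vconst c) = vconst c" "tau (yvar i) = yvar (Suc i)"
  "n \<ge> 1 \<Longrightarrow> tau (vsym (psum n)) = vsym (psum n) + vconst ((qq ^ n - 1) * (tt ^ n - 1)) * yvar 1 ^ n"
  unfolding tau_def
  by (simp_all add: eval_v_vconst eval_v_yvar eval_v_vsym plethysm[OF ring_homo_vconst])

lemma plethysm_VS:
  assumes "\<And>n. n \<ge> 1 \<Longrightarrow> a n \<in> VS K"
  shows "plethysm vconst a f \<in> VS K"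
proof (induction f rule: sym_induct)
  case (psum n)
  then show ?case using assms by (simp add: plethysm[OF ring_homo_vconst])
qed (simp_all add: plethysm[OF ring_homo_vconst] ring_homo_simps[OF plethysm(1)[OF ring_homo_vconst]] VS_add VS_mult)

lemma tau_vsym_VS: "1 \<in> K \<Longrightarrow> tau (vsym f) \<in> VS K"
  unfolding tau_def by (subst eval_v_vsym[OF plethysm(1)[OF ring_homo_vconst]])
    (intro plethysm_VS VS_add VS_mult VS_vsym VS_vconst VS_power VS_yvar)

lemma tau_VS: "P \<in> VS K \<Longrightarrow> 1 \<in> L \<Longrightarrow> Suc ` K \<subseteq> L \<Longrightarrow> tau P \<in> VS L"
proof (induction rule: VS_induct)
  case (var i)
  then show ?case by (auto simp: tau_gens intro!: VS_yvar)
qed (simp_all add: tau_vsym_VS tau_simps VS_add VS_mult)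

lemma tau_V: "P \<in> V k \<Longrightarrow> tau P \<in> V (Suc k)"
  unfolding V_eq_VS by (erule tau_VS) auto

lemma tau_swap: "1 \<le> i \<Longrightarrow> tau (swap_y i P) = swap_y (Suc i) (tau P)"
proof (rule vpoly_homo_eqI[of _ UNIV, OF VS_UNIV ring_homo_comp[OF ring_homo_swap_y ring_homo_tau]
      ring_homo_comp[OF ring_homo_tau ring_homo_swap_y]])
  fix j assume "1 \<le> i"
  then show "tau (swap_y i (yvar j)) = swap_y (Suc i) (tau (yvar j))"
    by (cases "j = i"; cases "j = Suc i") (simp_all add: tau_gens)
qed (simp_all add: tau_gens swap_y_simps)

lemma tau_T_op: "1 \<le> i \<Longrightarrow> tau (T_op i P) = T_op (Suc i) (tau P)"
proof (rule T_op_unique[symmetric])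
  assume i: "1 \<le> i"
  have "tau ((yvar (Suc i) - yvar i) * T_op i P) =
    tau ((cq - 1) * yvar i * P + (yvar (Suc i) - cq * yvar i) * swap_y i P)" by (simp only: T_op_eq)
  then show "(yvar (Suc (Suc i)) - yvar (Suc i)) * tau (T_op i P) =
    (cq - 1) * yvar (Suc i) * tau P + (yvar (Suc (Suc i)) - cq * yvar (Suc i)) * swap_y (Suc i) (tau P)"
    by (simp only: tau_simps tau_gens tau_swap[OF i])
qed

text \<open>The first shift is carried to y_2 by the second application, which adds the same shift
  at y_1. The sum is symmetric, which yields T_1 d_+^2 = d_+^2 for the starred generator.\<close>

lemma swap_tau_tau: "P \<in> V k \<Longrightarrow> swap_y 1 (tau (tau P)) = tau (tau P)"
  unfolding V_eq_VS
proof (erule vpoly_homo_eqI[OF _ ring_homo_comp[OF ring_homo_comp[OF ring_homo_tau ring_homo_tau] ring_homo_swap_y]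
      ring_homo_comp[OF ring_homo_tau ring_homo_tau]])
  fix n :: nat assume "1 \<le> n"
  then show "swap_y 1 (tau (tau (vsym (psum n)))) = tau (tau (vsym (psum n)))"
    using swap_y_gens(4)[of "Suc 0"] by (simp add: tau_gens tau_simps swap_y_simps numeral_2_eq_2)
next
  fix j :: nat assume "j \<in> {1..k}"
  then show "swap_y 1 (tau (tau (yvar j))) = tau (tau (yvar j))"
    by (cases j) (simp_all add: tau_gens)
qed (simp_all add: tau_gens)

text \<open>On power sums: the part of -(q^n-1)(t^n-1) y_1^n without t supplies the missing factor
  of \<open>Hs\<close> for the new y_1, and the rest is -(q w)^n + w^n with w = t y_1.\<close>

lemma tau_hnegs: "fps_hom tau (Hs k) = Hs (Suc k) * lin (cq * w1) * geo w1"
proof (rule vpoly_lder_unique[OF lder_hom[OF ring_homo_tau lder_Hs] lder_mult[OF lder_mult[OF lder_Hs lder_lin] lder_geo]])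
  fix n :: nat assume n: "n \<ge> 1"
  have s: "(\<Sum>i=1..Suc k. f i) = f 1 + (\<Sum>i=1..k. f (Suc i))" for f :: "nat \<Rightarrow> vpoly"
    by (simp add: sum.atLeast_Suc_atMost sum.shift_bounds_cl_Suc_ivl del: sum.cl_ivl_Suc)
  have v: "vconst ((qq ^ n - 1) * (tt ^ n - 1)) = (cq ^ n - 1) * (vconst tt ^ n - 1)"
    by (simp add: vconst_simps)
  show "tau (- vsym (psum n) + (\<Sum>i=1..k. - (yvar i ^ n) + (cq * yvar i) ^ n)) =
    - vsym (psum n) + (\<Sum>i=1..Suc k. - (yvar i ^ n) + (cq * yvar i) ^ n) + - ((cq * w1) ^ n) + w1 ^ n"
    using n unfolding s
    by (simp add: tau_simps tau_gens ring_homo_sum[OF ring_homo_tau] v power_mult_distrib)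
      (simp add: algebra_simps)
qed

section \<open>Coefficient functionals\<close>

definition iot :: "nat \<Rightarrow> vpoly \<Rightarrow> vpoly fls" where
  "iot j = eval_v (\<lambda>f. fls_const (vsym f)) (\<lambda>i. if i = j then fls_X_inv else fls_const (yvar i))"

lemma ring_homo_fls_const: "ring_homo (fls_const :: 'a::comm_ring_1 \<Rightarrow> 'a fls)"
  by (simp add: ring_homo_def fls_plus_const)

lemma ring_homo_iot: "ring_homo (iot j)"
  unfolding iot_def by (intro ring_homo_eval_v ring_homo_comp[OF ring_homo_vsym ring_homo_fls_const])

lemmas iot_simps = ring_homo_simps[OF ring_homo_iot]

lemma iot_gens: "iot j (vsym f) = fls_const (vsym f)" "iot j (yvar j) = fls_X_inv"
  "i \<noteq> j \<Longrightarrow> iot j (yvar i) = fls_const (yvar i)"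
  unfolding iot_def
  by (simp_all add: eval_v_vsym eval_v_yvar ring_homo_comp[OF ring_homo_vsym ring_homo_fls_const])

lemma iot_const: "F \<in> VS K \<Longrightarrow> j \<notin> K \<Longrightarrow> iot j F = fls_const F"
proof (induction rule: VS_induct)
  case (var i)
  then show ?case by (intro iot_gens) auto
qed (simp_all add: iot_gens iot_simps fls_plus_const)

text \<open>
  \<open>Lam j s\<close> is the functional \<open>F \<mapsto> [v\<^sup>-\<^sup>1] F s(1/v)\<close> with \<open>v = y\<^sub>j\<close>, so it replaces \<open>y\<^sub>j\<^sup>n\<close> by
  the coefficient \<open>s\<^sub>n\<^sub>+\<^sub>1\<close>.
\<close>

definition Lam :: "nat \<Rightarrow> vpoly fps \<Rightarrow> vpoly \<Rightarrow> vpoly" where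
  "Lam j s F = fls_nth (iot j F * fps_to_fls s) 1"

lemma Lam_add: "Lam j s (F + G) = Lam j s F + Lam j s G"
  by (simp add: Lam_def iot_simps distrib_right)

lemma Lam_diff: "Lam j s (F - G) = Lam j s F - Lam j s G"
  by (simp add: Lam_def iot_simps left_diff_distrib)

lemma Lam_uminus: "Lam j s (- F) = - Lam j s F"
  by (simp add: Lam_def iot_simps)

lemma Lam_series_diff: "Lam j (s - s') F = Lam j s F - Lam j s' F"
  by (simp add: Lam_def fps_to_fls_minus right_diff_distrib)

lemma Lam_lin: "f \<in> VS K \<Longrightarrow> j \<notin> K \<Longrightarrow> Lam j s (f * F) = f * Lam j s F"
  by (simp add: Lam_def iot_simps iot_const mult.assoc)

lemma Lam_series_lin: "Lam j (fps_const c * s) F = c * Lam j s F"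
proof -
  have "iot j F * fps_to_fls (fps_const c * s) = fls_const c * (iot j F * fps_to_fls s)"
    by (simp add: fls_times_fps_to_fls fps_const_to_fls ac_simps)
  then show ?thesis by (simp add: Lam_def)
qed

lemma Lam_power: "Lam j s (yvar j ^ n) = fps_nth s (Suc n)"
  by (simp add: Lam_def iot_simps iot_gens fls_X_inv_power_times_conv_shift nat_add_distrib)

lemma Lam_one: "Lam j s 1 = fps_nth s (Suc 0)"
  using Lam_power[of j s 0] by simp

lemma Lam_monom: "f \<in> VS K \<Longrightarrow> j \<notin> K \<Longrightarrow> Lam j s (f * yvar j ^ n) = f * fps_nth s (Suc n)"
  by (simp add: Lam_lin Lam_power)

lemma Lam_VS:
  assumes "F \<in> VS (insert j K)" "j \<notin> K" "fps_in K s"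
  shows "Lam j s F \<in> VS K"
  using assms(1)
proof (induction rule: VS_split_induct)
  case (monom f n)
  then show ?case using assms by (simp add: Lam_monom VS_mult fps_in_def)
qed (use assms in \<open>simp_all add: Lam_add VS_add\<close>)

text \<open>\<open>Dv u s\<close> is the series \<open>s / (v - u)\<close>.\<close>

definition Dv :: "vpoly \<Rightarrow> vpoly fps \<Rightarrow> vpoly fps" where "Dv u s = fps_X * geo u * s"

lemma fls_X_inv_X: "fls_X_inv * fls_X = (1 :: 'a::comm_ring_1 fls)"
  by (rule fls_eqI) (simp add: fls_X_inv_times_conv_shift)

text \<open>Lets a factor v - u move between argument and series: multiplying the argument by it
  undoes dividing the series by it.\<close>

lemma Lam_Dv:
  assumes u: "u \<in> VS K" "j \<notin> K"
  shows "Lam j (Dv u s) ((yvar j - u) * F) = Lam j s F"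
proof -
  have "iot j (yvar j - u) * fps_to_fls (fps_X * geo u * s)
      = (fls_X_inv - fls_const u) * (fls_X * fps_to_fls (geo u * s))"
    by (simp add: iot_simps iot_gens iot_const[OF u] fls_times_fps_to_fls fps_X_to_fls mult.assoc)
  also have "\<dots> = (fls_X_inv * fls_X - fls_const u * fls_X) * fps_to_fls (geo u * s)"
    by (simp only: algebra_simps)
  also have "fls_X_inv * fls_X - fls_const u * fls_X = fps_to_fls (lin u)"
    by (simp add: fls_X_inv_X lin_def fps_to_fls_minus fls_times_fps_to_fls fps_X_to_fls fps_const_to_fls)
  also have "fps_to_fls (lin u) * fps_to_fls (geo u * s) = fps_to_fls s"
    by (simp only: fls_times_fps_to_fls[symmetric] lin_geo_mult)
  finally have "iot j (yvar j - u) * fps_to_fls (Dv u s) = fps_to_fls s" by (simp add: Dv_def)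
  then have "iot j F * (iot j (yvar j - u) * fps_to_fls (Dv u s)) = iot j F * fps_to_fls s" by simp
  then show ?thesis by (simp add: Lam_def iot_simps(4) ac_simps)
qed

lemma Dv_nth_1: "fps_nth (Dv u s) (Suc 0) = fps_nth s 0"
  by (simp add: Dv_def mult.assoc fps_X_mult_nth)

lemma fps_in_Dv: "u \<in> VS K \<Longrightarrow> fps_in K s \<Longrightarrow> fps_in K (Dv u s)"
  unfolding Dv_def by (intro fps_in_mult fps_in_X fps_in_geo)

lemma Lam_swap:
  assumes "F \<in> VS (insert i K)" "i \<notin> K" "Suc i \<notin> K"
  shows "Lam (Suc i) s (swap_y i F) = Lam i s F"
  using assms(1)
proof (induction rule: VS_split_induct)
  case (monom f n)
  then show ?case using assms by (simp add: swap_y_simps swap_y_fix Lam_monom)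
qed (use assms in \<open>simp_all add: Lam_add swap_y_simps\<close>)

text \<open>The same series is used for both variables and its coefficients involve neither, so f
  y_i^m y_(i+1)^n goes to f s_(m+1) s_(n+1), which is symmetric in m and n.\<close>

lemma Lam2_swap:
  assumes "F \<in> VS (insert (Suc i) (insert i K))" "i \<notin> K" "Suc i \<notin> K" "fps_in K s"
  shows "Lam i s (Lam (Suc i) s (swap_y i F)) = Lam i s (Lam (Suc i) s F)"
  using assms(1)
proof (induction rule: VS_split_induct)
  case (monom f n)
  have "\<forall>n. Lam i s (Lam (Suc i) s (swap_y i (f * yvar (Suc i) ^ n))) = Lam i s (Lam (Suc i) s (f * yvar (Suc i) ^ n))"
    using monom
  proof (induction rule: VS_split_induct)
    case (monom g m)
    have s: "fps_nth s r \<in> VS K" for r using assms(4) by (simp add: fps_in_def)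
    have K: "K \<subseteq> insert i K" by auto
    have g: "g \<in> VS (insert i K)" using monom K by (rule VS_mono)
    have ss: "Lam (Suc i) s (g * yvar i ^ a * yvar (Suc i) ^ b) = g * yvar i ^ a * fps_nth s (Suc b)" for a b
      using g assms by (intro Lam_monom[of _ "insert i K"] VS_mult VS_power VS_yvar) auto
    have ss2: "Lam i s (g * yvar i ^ a * fps_nth s (Suc b)) = g * fps_nth s (Suc b) * fps_nth s (Suc a)" for a b
    proof -
      have "Lam i s (g * yvar i ^ a * fps_nth s (Suc b)) = Lam i s ((g * fps_nth s (Suc b)) * yvar i ^ a)"
        by (simp add: ac_simps)
      also have "\<dots> = g * fps_nth s (Suc b) * fps_nth s (Suc a)"
        using monom s assms by (intro Lam_monom[of _ K] VS_mult)
      finally show ?thesis .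
    qed
    have sw: "swap_y i (g * yvar i ^ m * yvar (Suc i) ^ n) = g * yvar i ^ n * yvar (Suc i) ^ m" for n
      using monom assms by (simp add: swap_y_simps swap_y_fix[of g K] ac_simps)
    show ?case unfolding sw ss ss2 by (simp add: ac_simps)
  qed (use assms in \<open>simp_all add: Lam_add swap_y_simps distrib_right\<close>)
  then show ?case by blast
qed (use assms in \<open>simp_all add: Lam_add swap_y_simps\<close>)

lemma Lam2_anti:
  assumes "F \<in> VS (insert (Suc i) (insert i K))" "i \<notin> K" "Suc i \<notin> K" "fps_in K s" "swap_y i F = - F"
  shows "Lam i s (Lam (Suc i) s F) = 0"
proof -
  have "Lam i s (Lam (Suc i) s F) = - Lam i s (Lam (Suc i) s F)"
    using Lam2_swap[OF assms(1-4)] by (simp add: assms(5) Lam_uminus)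
  then have "of_nat (Suc 1) * Lam i s (Lam (Suc i) s F) = 0" by (simp add: eq_neg_iff_add_eq_0 distrib_right)
  then show ?thesis by (rule vpoly_torsion_free)
qed

text \<open>\<open>M = N (v - y\<^sub>i) / (v - q y\<^sub>i)\<close>\<close>

definition attach :: "nat \<Rightarrow> vpoly fps \<Rightarrow> vpoly fps" where
  "attach i N = lin (yvar i) * geo (cq * yvar i) * N"

lemma Dv_attach: "Dv (yvar i) (attach i N) = Dv (cq * yvar i) N"
  by (simp add: Dv_def attach_def mult.assoc lin_geo_mult)

text \<open>Cross-multiplication: divide both series by the linear factor matching their numerators
  and denominators; the common quotient is \<open>Dv_attach\<close>.\<close>

lemma Lam_attach:
  assumes "i \<noteq> j"
  shows "Lam j (attach i N) ((yvar j - cq * yvar i) * F) = Lam j N ((yvar j - yvar i) * F)"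
proof -
  have i: "yvar i \<in> VS {i}" "cq * yvar i \<in> VS {i}" "j \<notin> {i}" using assms by (auto intro!: VS_mult VS_yvar)
  have "Lam j (attach i N) ((yvar j - cq * yvar i) * F) =
      Lam j (Dv (yvar i) (attach i N)) ((yvar j - yvar i) * ((yvar j - cq * yvar i) * F))"
    using Lam_Dv[OF i(1,3)] by simp
  also have "\<dots> = Lam j (Dv (cq * yvar i) N) ((yvar j - cq * yvar i) * ((yvar j - yvar i) * F))"
    unfolding Dv_attach by (simp add: ac_simps)
  also have "\<dots> = Lam j N ((yvar j - yvar i) * F)" by (rule Lam_Dv[OF i(2,3)])
  finally show ?thesis .
qed

text \<open>Dividing the attached series by v - y_i clears the denominator of T_i and leaves N/(v -
  q y_i). The exchanged term of T_i carries v - q y_i and becomes the functional at y_i. The other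
  term is free of v, so it sees only the coefficient of 1/v in N/(v - q y_i), which is the constant
  term of N.\<close>

lemma Lam_attach_T:
  assumes S: "S \<in> VS (insert i K)" "i \<notin> K" "Suc i \<notin> K"
  shows "Lam (Suc i) (attach i N) (T_op i S) = Lam i N S + (cq - 1) * fps_nth N 0 * yvar i * S"
proof -
  have i: "yvar i \<in> VS {i}" "cq * yvar i \<in> VS {i}" "Suc i \<notin> {i}" by (auto intro!: VS_mult VS_yvar)
  have "Lam (Suc i) (attach i N) (T_op i S) =
      Lam (Suc i) (Dv (yvar i) (attach i N)) ((yvar (Suc i) - yvar i) * T_op i S)"
    using Lam_Dv[OF i(1,3)] by simp
  also have "\<dots> = Lam (Suc i) (Dv (cq * yvar i) N) (((cq - 1) * yvar i * S) * 1) +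
      Lam (Suc i) (Dv (cq * yvar i) N) ((yvar (Suc i) - cq * yvar i) * swap_y i S)"
    unfolding T_op_eq Dv_attach by (simp add: Lam_add)
  also have "Lam (Suc i) (Dv (cq * yvar i) N) ((yvar (Suc i) - cq * yvar i) * swap_y i S) = Lam i N S"
    using Lam_Dv[OF i(2,3)] Lam_swap[OF S] by simp
  also have "Lam (Suc i) (Dv (cq * yvar i) N) (((cq - 1) * yvar i * S) * 1) = (cq - 1) * yvar i * S * fps_nth N 0"
  proof -
    have "(cq - 1) * yvar i * S \<in> VS (insert i K)"
      using S by (intro VS_mult VS_diff VS_vconst VS_1 VS_yvar) auto
    then have "Lam (Suc i) (Dv (cq * yvar i) N) (((cq - 1) * yvar i * S) * 1) =
      (cq - 1) * yvar i * S * Lam (Suc i) (Dv (cq * yvar i) N) 1"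
      using S by (intro Lam_lin[of _ "insert i K"]) auto
    then show ?thesis by (simp add: Lam_one Dv_nth_1)
  qed
  finally show ?thesis by (simp add: ac_simps)
qed

lemma Hs_attach: "Hs (Suc k) = attach (Suc k) (Hs k)"
  by (simp add: Hs_Suc attach_def)

lemma Hs_nth_0: "fps_nth (Hs k) 0 = 1"
  using lder_Hs[of k] by (simp add: lder_def)

text \<open>H_k/(v - t y_1), the series that represents the commutator of d_+^* and d_-. Its
  vanishing constant term removes the correction in \<open>Lam_attach_T\<close>.\<close>

definition Ks :: "nat \<Rightarrow> vpoly fps" where "Ks k = Dv w1 (Hs k)"

lemma Ks_attach: "Ks (Suc k) = attach (Suc k) (Ks k)"
  by (simp add: Ks_def Hs_attach attach_def Dv_def ac_simps)

lemma Ks_nth_0: "fps_nth (Ks k) 0 = 0" by (simp add: Ks_def Dv_def mult.assoc)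
lemma Ks_nth_1: "fps_nth (Ks k) (Suc 0) = 1" by (simp add: Ks_def Dv_nth_1 Hs_nth_0)

lemma w1_VS: "1 \<in> K \<Longrightarrow> w1 \<in> VS K" by (intro VS_mult VS_vconst VS_yvar) simp

lemma fps_in_Ks: "1 \<le> k \<Longrightarrow> fps_in {1..k} (Ks k)"
  unfolding Ks_def by (intro fps_in_Dv fps_in_Hs w1_VS) auto

section \<open>The operators in straightened coordinates\<close>

definition TW :: "nat \<Rightarrow> vpoly \<Rightarrow> vpoly" where "TW n = foldr T_op [1..<Suc n]"

lemma TW_0 [simp]: "TW 0 F = F" by (simp add: TW_def)
lemma TW_Suc: "TW (Suc n) F = TW n (T_op (Suc n) F)" by (simp add: TW_def)

lemma TW_add: "TW n (F + G) = TW n F + TW n G"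
  by (induction n arbitrary: F G) (simp_all add: TW_Suc T_op_add)

lemma TW_vconst: "TW n (vconst c * F) = vconst c * TW n F"
  by (induction n arbitrary: F) (simp_all add: TW_Suc)

lemma TW_cq1: "TW n ((cq - 1) * F) = (cq - 1) * TW n F"
  by (induction n arbitrary: F) (simp_all add: TW_Suc T_op_cq1)

lemma TW_diff: "TW n (F - G) = TW n F - TW n G"
  by (induction n arbitrary: F G) (simp_all add: TW_Suc T_op_diff)

lemma TW_VS: "F \<in> VS {1..k} \<Longrightarrow> n < k \<Longrightarrow> TW n F \<in> VS {1..k}"
  by (induction n arbitrary: F) (simp_all add: TW_Suc T_op_VS)

lemma TW_comm: "n < j - 1 \<Longrightarrow> TW n (T_op j F) = T_op j (TW n F)"
proof (induction n arbitrary: F)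
  case (Suc n)
  then show ?case using T_op_far[of "Suc n" j] by (simp add: TW_Suc)
qed simp

lemma TW_yvar: "n < j - 1 \<Longrightarrow> TW n (yvar j * F) = yvar j * TW n F"
  by (induction n arbitrary: F) (simp_all add: TW_Suc T_op_other)

lemma TW_T_op: "1 \<le> i \<Longrightarrow> i < n \<Longrightarrow> TW n (T_op i F) = T_op (Suc i) (TW n F)"
proof (induction n arbitrary: F)
  case (Suc n)
  show ?case
  proof (cases "i = n")
    case True
    then obtain m where m: "n = Suc m" using Suc.prems by (cases n) auto
    show ?thesis unfolding True m TW_Suc T_op_braid by (rule TW_comm) simp
  next
    case False
    then show ?thesis using Suc by (simp add: TW_Suc T_op_far[of i "Suc n" F, symmetric])
  qed
qed simp

text \<open>The outer T_1 travels through both words by braid relations and comes out innermost as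
  T_(k+1). On an argument free of y_(k+1) and y_(k+2) it disappears, giving T_1 d_+^2 =
  d_+^2.\<close>

lemma TW_TW: "T_op 1 (TW (Suc k) (TW k F)) = TW (Suc k) (TW k (T_op (Suc k) F))"
proof (induction k arbitrary: F)
  case 0
  show ?case by (simp add: TW_Suc)
next
  case (Suc k)
  have eq: "TW (Suc (Suc k)) (TW (Suc k) F) = TW (Suc k) (TW k (T_op (Suc (Suc k)) (T_op (Suc k) F)))" for F
    using TW_comm[of k "Suc (Suc k)"] by (simp add: TW_Suc)
  show ?case unfolding eq Suc.IH by (simp only: T_op_braid)
qed

text \<open>\<open>dmw k\<close> is \<open>d\<^sub>-\<close> at the vertex \<open>k + 1\<close> and \<open>Dst k\<close> is \<open>d\<^sub>+\<^sup>*d\<^sub>- - d\<^sub>-d\<^sub>+\<^sup>*\<close> there.\<close>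

definition dmw :: "nat \<Rightarrow> vpoly \<Rightarrow> vpoly" where "dmw k F = - Lam (Suc k) (Hs k) F"
definition Dst :: "nat \<Rightarrow> vpoly \<Rightarrow> vpoly" where "Dst k F = tau (dmw k F) - dmw (Suc k) (tau F)"

lemma V_Suc: "V (Suc k) = VS (insert (Suc k) {1..k})"
  by (simp add: V_eq_VS atLeastAtMostSuc_conv)

lemma dmw_V: "F \<in> V (Suc k) \<Longrightarrow> dmw k F \<in> V k"
  unfolding dmw_def V_Suc by (unfold V_eq_VS) (auto intro!: VS_uminus Lam_VS fps_in_Hs[simplified])

lemma dmw_add: "dmw k (F + G) = dmw k F + dmw k G" by (simp add: dmw_def Lam_add)
lemma dmw_diff: "dmw k (F - G) = dmw k F - dmw k G" by (simp add: dmw_def Lam_diff)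
lemma dmw_lin: "f \<in> V k \<Longrightarrow> dmw k (f * F) = f * dmw k F"
  unfolding V_eq_VS dmw_def by (simp add: Lam_lin)
lemma dmw_vconst: "dmw k (vconst c * F) = vconst c * dmw k F"
  by (rule dmw_lin) (simp add: V_eq_VS)

lemma T_op_V: "F \<in> V k \<Longrightarrow> 1 \<le> i \<Longrightarrow> i < k \<Longrightarrow> T_op i F \<in> V k"
  unfolding V_eq_VS by (rule T_op_VS) auto

lemma T_op_sym_right: "swap_y i a = a \<Longrightarrow> T_op i (P * a) = T_op i P * a"
  using T_op_lin[of i a P] by (simp add: mult.commute)

lemma dmw_T: "F \<in> V (Suc k) \<Longrightarrow> 1 \<le> i \<Longrightarrow> i < k \<Longrightarrow> dmw k (T_op i F) = T_op i (dmw k F)"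
  unfolding V_Suc
proof (induction rule: VS_split_induct)
  case (monom f n)
  have "swap_y i (yvar (Suc k) ^ n) = yvar (Suc k) ^ n" using monom by (simp add: swap_y_simps)
  then have "T_op i (f * yvar (Suc k) ^ n) = T_op i f * yvar (Suc k) ^ n" by (rule T_op_sym_right)
  moreover have "T_op i f \<in> VS {1..k}" using monom by (intro T_op_VS) auto
  moreover have "swap_y i (fps_nth (Hs k) (Suc n)) = fps_nth (Hs k) (Suc n)"
    using monom by (intro swap_Hs) auto
  ultimately show ?case using monom
    by (simp add: dmw_def Lam_monom[of _ "{1..k}"] T_op_sym_right T_op_uminus)
qed (simp_all add: dmw_add T_op_add)

lemma dmw_TW: "F \<in> V (Suc k) \<Longrightarrow> n < k \<Longrightarrow> dmw k (TW n F) = TW n (dmw k F)"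
  by (induction n arbitrary: F) (simp_all add: TW_Suc T_op_V dmw_T)

text \<open>T - 1 is v - q u times the divided difference. The series at the second variable trades
  v - q u for v - u, which clears the denominator; what is left is s F - F under one functional
  applied in both variables.\<close>

lemma dmw_dmw_T:
  assumes "F \<in> V (Suc (Suc k))"
  shows "dmw k (dmw (Suc k) (T_op (Suc k) F)) = dmw k (dmw (Suc k) F)"
proof -
  let ?u = "yvar (Suc k)" and ?v = "yvar (Suc (Suc k))"
  let ?A = "divdiff (Suc k) F"
  have dd: "(?v - ?u) * ?A = swap_y (Suc k) F - F" by (rule divdiff)
  have "dmw k (dmw (Suc k) (T_op (Suc k) F)) - dmw k (dmw (Suc k) F) =
      dmw k (dmw (Suc k) ((?v - cq * ?u) * ?A))"
    by (simp add: T_op_divdiff flip: dmw_diff)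
  also have "\<dots> = Lam (Suc k) (Hs k) (Lam (Suc (Suc k)) (Hs k) ((?v - ?u) * ?A))"
    by (simp add: dmw_def Lam_uminus Hs_attach Lam_attach)
  also have "\<dots> = 0"
    unfolding dd
  proof (rule Lam2_anti)
    show "swap_y (Suc k) F - F \<in> VS (insert (Suc (Suc k)) (insert (Suc k) {1..k}))"
      using assms unfolding V_eq_VS by (intro VS_diff swap_y_VS) (auto elim!: VS_mono)
  qed (auto simp: fps_in_Hs[simplified] swap_y_simps)
  finally show ?thesis by simp
qed

text \<open>The source of y_i acting as multiplication: \<open>Lam_attach_T\<close> with constant
  term 1 leaves exactly (q-1) y_(k+1) F.\<close>

lemma dcomm_W:
  assumes F: "F \<in> V (Suc k)"
  shows "TW k (dmw k F) - dmw (Suc k) (TW (Suc k) F) = (cq - 1) * TW k (yvar (Suc k) * F)"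
proof -
  have F': "F \<in> V (Suc (Suc k))" using F unfolding V_eq_VS by (rule VS_mono) auto
  have TF: "T_op (Suc k) F \<in> V (Suc (Suc k))" using F' by (rule T_op_V) auto
  have "TW k (dmw k F) - dmw (Suc k) (TW (Suc k) F) = TW k (dmw k F - dmw (Suc k) (T_op (Suc k) F))"
    by (simp add: TW_Suc dmw_TW[OF TF] TW_diff)
  also have "dmw k F - dmw (Suc k) (T_op (Suc k) F) = (cq - 1) * (yvar (Suc k) * F)"
    using Lam_attach_T[of F "Suc k" "{1..k}" "Hs k"] F
    by (simp add: dmw_def V_Suc Hs_attach Hs_nth_0 mult.assoc)
  finally show ?thesis by (simp add: TW_cq1)
qed

section \<open>The commutator of d_+^* and d_-\<close>

lemma tau_Hs_Lam: "F \<in> V (Suc k) \<Longrightarrow>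
   tau (Lam (Suc k) s F) = Lam (Suc (Suc k)) (fps_hom tau s) (tau F)"
  unfolding V_Suc
proof (induction rule: VS_split_induct)
  case (monom f n)
  have "tau f \<in> VS {1..Suc k}" using tau_V[of f k] monom by (simp add: V_eq_VS)
  then show ?case using monom
    by (simp add: Lam_monom[of _ "{1..k}"] Lam_monom[of _ "{1..Suc k}"] tau_simps tau_gens)
qed (simp_all add: Lam_add tau_simps)

lemma Dst_eq:
  assumes F: "F \<in> V (Suc k)"
  shows "Dst k F = (cq - 1) * w1 * Lam (Suc (Suc k)) (Ks (Suc k)) (tau F)"
proof -
  have lin: "fps_const (a::vpoly) * fps_X = 1 - lin a" for a by (simp add: lin_def)
  \<comment> \<open>With w = t y_1 and u = 1/v: 1 - (1 - q w u)/(1 - w u) = (q-1) w u/(1 - w u), and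
    u/(1 - w u) = 1/(v - w).\<close>
  have "Hs (Suc k) - fps_hom tau (Hs k) = fps_const ((cq - 1) * w1) * Ks (Suc k)"
  proof -
    let ?H = "Hs (Suc k)"
    have "fps_const ((cq - 1) * w1) * Ks (Suc k) =
        (fps_const (cq * w1) * fps_X - fps_const w1 * fps_X) * geo w1 * ?H"
      by (simp add: Ks_def Dv_def algebra_simps flip: fps_const_mult fps_const_sub)
    also have "\<dots> = (lin w1 - lin (cq * w1)) * geo w1 * ?H" by (simp only: lin) simp
    also have "\<dots> = ?H - ?H * lin (cq * w1) * geo w1"
      by (simp add: left_diff_distrib right_diff_distrib lin_geo ac_simps)
    finally show ?thesis by (simp add: tau_hnegs)
  qed
  then have "Lam (Suc (Suc k)) (Hs (Suc k)) (tau F) - Lam (Suc (Suc k)) (fps_hom tau (Hs k)) (tau F) =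
      (cq - 1) * w1 * Lam (Suc (Suc k)) (Ks (Suc k)) (tau F)"
    by (simp only: Lam_series_diff[symmetric] Lam_series_lin)
  then show ?thesis
    by (simp add: Dst_def dmw_def tau_simps tau_Hs_Lam[OF F])
qed

lemma Dst_T: "F \<in> V (Suc k) \<Longrightarrow> 1 \<le> i \<Longrightarrow> i < k \<Longrightarrow> Dst k (T_op i F) = T_op (Suc i) (Dst k F)"
  by (simp add: Dst_def dmw_T tau_T_op tau_V T_op_diff)

lemma Dst_no_last:
  assumes "G \<in> V k" shows "Dst k G = (cq - 1) * w1 * tau G"
proof -
  have G: "G \<in> V (Suc k)" using assms unfolding V_eq_VS by (rule VS_mono) auto
  have "Lam (Suc (Suc k)) (Ks (Suc k)) (tau G * 1) = tau G"
    using tau_V[OF assms] by (subst Lam_lin[of _ "{1..Suc k}"]) (auto simp: V_eq_VS Lam_one Ks_nth_1)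
  then show ?thesis by (simp add: Dst_eq[OF G])
qed

text \<open>Same cancellation as in \<open>dcomm_W\<close>, but \<open>Ks\<close> has constant term
  0, so no extra summand survives.\<close>

lemma Dst_T_last:
  assumes G: "G \<in> V (Suc k)"
  shows "Dst (Suc k) (T_op (Suc k) G) = Dst k G"
proof -
  have G': "G \<in> V (Suc (Suc k))" using G unfolding V_eq_VS by (rule VS_mono) auto
  have "Lam (Suc (Suc (Suc k))) (Ks (Suc (Suc k))) (T_op (Suc (Suc k)) (tau G)) =
    Lam (Suc (Suc k)) (Ks (Suc k)) (tau G)"
    using Lam_attach_T[of "tau G" "Suc (Suc k)" "{1..Suc k}" "Ks (Suc k)"] tau_V[OF G]
    by (simp add: V_Suc Ks_attach[of "Suc k"] Ks_nth_0)
  then show ?thesis using G G' by (simp add: Dst_eq T_op_V tau_T_op)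
qed

lemma Dst_TW: "F \<in> V (Suc k) \<Longrightarrow> n < k \<Longrightarrow> T_op 1 (Dst k (TW n F)) = TW (Suc n) (Dst k F)"
proof (induction n arbitrary: F)
  case (Suc n)
  have "T_op 1 (Dst k (TW (Suc n) F)) = TW (Suc n) (Dst k (T_op (Suc n) F))"
    using Suc by (simp add: TW_Suc[of n F] T_op_V)
  also have "\<dots> = TW (Suc (Suc n)) (Dst k F)" using Suc.prems by (simp add: Dst_T TW_Suc)
  finally show ?case .
qed (simp add: TW_Suc)

text \<open>The one case of z_(i+1) d_+ = d_+ z_i that involves the commutator, namely i = k; the
  others follow by conjugating with T_i.\<close>

lemma Dst_dplus:
  assumes G: "G \<in> V (Suc k)"
  shows "T_op 1 (Dst (Suc k) (TW (Suc k) G)) = TW (Suc k) (Dst k G)"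
proof -
  have G': "G \<in> V (Suc (Suc k))" using G unfolding V_eq_VS by (rule VS_mono) auto
  have "T_op 1 (Dst (Suc k) (TW k (T_op (Suc k) G))) = TW (Suc k) (Dst (Suc k) (T_op (Suc k) G))"
    using G' by (intro Dst_TW T_op_V) auto
  then show ?thesis by (simp add: TW_Suc[of k G] Dst_T_last[OF G])
qed

lemma tau_lin_w1: "tau ((cq - 1) * w1 * F) = (cq - 1) * (vconst tt * yvar 2) * tau F"
  by (simp add: tau_simps tau_gens numeral_2_eq_2)

text \<open>The relation between the starred commutator and d_- T. Both sides are brought under one
  double functional \<open>E\<close>; their difference has the factor v - q u, which
  \<open>E\<close> trades for v - u, and the remainder is antisymmetric in u and v.\<close>

lemma dmw_Dst:
  assumes F: "F \<in> V (Suc (Suc k))"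
  shows "cq * dmw (Suc k) (Dst (Suc k) F) = Dst k (dmw (Suc k) (T_op (Suc k) F))"
proof -
  define i where "i = Suc (Suc k)"
  define u where "u = yvar i"
  define v where "v = yvar (Suc i)"
  define P where "P = tau F"
  define E where "E Q = Lam i (Ks (Suc k)) (Lam (Suc i) (Ks i) Q)" for Q
  define E0 where "E0 Q = Lam i (Ks (Suc k)) (Lam (Suc i) (Ks (Suc k)) Q)" for Q
  define c where "c = (cq - 1) * w1"
  have P: "P \<in> V (Suc i)" unfolding P_def i_def by (rule tau_V[OF F])
  have c: "c \<in> VS {1..Suc k}" unfolding c_def by (intro VS_mult VS_diff VS_vconst VS_1 VS_yvar) auto
  have w: "w1 \<in> VS {1..Suc k}" "cq * w1 \<in> VS {1..Suc k}" by (intro VS_mult VS_vconst VS_yvar; simp)+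
  have E_diff: "E (Q - R) = E Q - E R" for Q R by (simp add: E_def Lam_diff)
  have E_lin: "E (a * Q) = a * E Q" if "a \<in> VS {1..Suc k}" for a Q
    using Lam_lin[OF that] by (simp add: E_def i_def)
  \<comment> \<open>Here d_- uses H itself, so its series is rewritten as \<open>Ks\<close> at the
    price of a factor u - w1.\<close>
  have L1: "dmw (Suc k) (Dst (Suc k) F) = - (c * E ((u - w1) * P))"
  proof -
    have "Dst (Suc k) F = c * Lam (Suc i) (Ks i) P"
      using Dst_eq[OF F] by (simp add: c_def i_def P_def)
    moreover have "dmw (Suc k) (c * Lam (Suc i) (Ks i) P) = c * dmw (Suc k) (Lam (Suc i) (Ks i) P)"
      using c by (intro dmw_lin) (simp add: V_eq_VS)
    moreover have "dmw (Suc k) (Lam (Suc i) (Ks i) P) = - Lam i (Ks (Suc k)) ((u - w1) * Lam (Suc i) (Ks i) P)"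
      unfolding Ks_def[of "Suc k"] u_def
      by (subst Lam_Dv[OF w(1)]) (simp_all add: i_def dmw_def)
    moreover have "(u - w1) * Lam (Suc i) (Ks i) P = Lam (Suc i) (Ks i) ((u - w1) * P)"
      unfolding u_def i_def
      by (rule Lam_lin[symmetric, of _ "{1..Suc (Suc k)}"]) (auto intro!: VS_diff VS_mult VS_yvar)
    ultimately show ?thesis by (simp add: E_def)
  qed
  \<comment> \<open>By \<open>tau_hnegs\<close> the series of tau d_- is H times (1 - q w1/v)/(1 -
    w1/v); so \<open>Ks\<close> arises from it by division by v - q w1.\<close>
  have L2: "Dst k (dmw (Suc k) G) = - (c * E ((v - cq * w1) * tau G))" if G: "G \<in> V (Suc (Suc k))" for G
  proof -
    have "Dv (cq * w1) (fps_hom tau (Hs (Suc k))) =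
        fps_X * (geo w1 * (geo (cq * w1) * (lin (cq * w1) * Hs i)))"
      by (simp add: tau_hnegs Dv_def i_def ac_simps)
    then have "Ks i = Dv (cq * w1) (fps_hom tau (Hs (Suc k)))"
      by (simp add: lin_geo_mult Ks_def Dv_def mult.assoc)
    then have "Lam (Suc i) (Ks i) ((v - cq * w1) * tau G) = Lam (Suc i) (fps_hom tau (Hs (Suc k))) (tau G)"
      unfolding v_def using Lam_Dv[OF w(2)] by (simp add: i_def)
    also have "\<dots> = - tau (dmw (Suc k) G)"
      using tau_Hs_Lam[OF G] by (simp add: dmw_def tau_simps i_def)
    finally have "Lam (Suc i) (Ks i) ((v - cq * w1) * tau G) = - tau (dmw (Suc k) G)" .
    then show ?thesis using Dst_eq[OF dmw_V[OF G]] by (simp add: E_def Lam_uminus c_def i_def)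
  qed
  have E_E0: "E ((v - cq * u) * Q) = E0 ((v - u) * Q)" for Q
    unfolding E_def E0_def u_def v_def i_def Ks_attach[of "Suc k"] by (simp add: Lam_attach)
  have TP: "tau (T_op (Suc k) F) = T_op i P" by (simp add: tau_T_op P_def i_def)
  let ?D = "divdiff i P"
  have dd: "(v - u) * ?D = swap_y i P - P" unfolding u_def v_def by (rule divdiff)
  \<comment> \<open>Expanding T_i, the coefficient of P is v - q w1 - q(u - w1) = v - q u: w1 drops
    out, so v - q u is common to all terms.\<close>
  have "(v - cq * w1) * T_op i P - cq * ((u - w1) * P) = (v - cq * u) * (P + (v - cq * w1) * ?D)"
    unfolding T_op_divdiff u_def[symmetric] v_def[symmetric] by (simp add: algebra_simps)
  then have "E ((v - cq * w1) * T_op i P) - cq * E ((u - w1) * P) = E0 ((v - u) * (P + (v - cq * w1) * ?D))"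
    by (metis E_E0 E_diff E_lin VS_vconst)
  also have "(v - u) * (P + (v - cq * w1) * ?D) = (v - u) * P + (v - cq * w1) * ((v - u) * ?D)"
    by (simp add: algebra_simps)
  also have "\<dots> = (v - cq * w1) * swap_y i P - (u - cq * w1) * P"
    unfolding dd by (simp add: algebra_simps)
  also have "E0 \<dots> = 0"
    unfolding E0_def
  proof (rule Lam2_anti)
    have V: "V (Suc i) = VS (insert (Suc i) (insert i {1..Suc k}))"
      by (simp add: V_eq_VS i_def atLeastAtMostSuc_conv)
    have uv: "u \<in> V (Suc i)" "v \<in> V (Suc i)" "w1 \<in> V (Suc i)" "cq \<in> V (Suc i)" "swap_y i P \<in> V (Suc i)"
      using P unfolding V u_def v_def by (auto intro!: VS_yvar VS_mult swap_y_VS)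
    have "v - cq * w1 \<in> V (Suc i)" "u - cq * w1 \<in> V (Suc i)"
      using uv unfolding V by (metis VS_diff VS_mult)+
    then show "(v - cq * w1) * swap_y i P - (u - cq * w1) * P \<in> VS (insert (Suc i) (insert i {1..Suc k}))"
      using P uv(5) unfolding V by (metis VS_diff VS_mult)
    have "swap_y i w1 = w1" by (simp add: swap_y_simps i_def)
    then show "swap_y i ((v - cq * w1) * swap_y i P - (u - cq * w1) * P) =
      - ((v - cq * w1) * swap_y i P - (u - cq * w1) * P)"
      by (simp add: swap_y_simps u_def v_def)
    show "fps_in {1..Suc k} (Ks (Suc k))" by (rule fps_in_Ks) simp
  qed (auto simp: i_def)
  finally have "E ((v - cq * w1) * T_op i P) = cq * E ((u - w1) * P)" by simp
  then show ?thesis using L2[OF T_op_V[OF F, of "Suc k"]] by (simp add: L1 TP)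
qed

text \<open>On f y^n both sides are a factor symmetric in y_1, y_2 times one coefficient of a
  rational series, \<open>Q\<close> or \<open>Z\<close>. Partial fractions give T_1 Q = Z, and then
  T_1 y_2 T_1 = q y_1 finishes.\<close>

lemma Dst_tau:
  assumes "F \<in> V (Suc k)"
  shows "cq * Dst (Suc k) (tau F) = T_op 1 (tau (Dst k F))"
  using assms unfolding V_Suc
proof (induction rule: VS_split_induct)
  case (monom f n)
  define w2 where "w2 = vconst tt * yvar 2"
  define H where "H = Hs (Suc (Suc k))"
  define F where "F = f * yvar (Suc k) ^ n"
  define g where "g = tau (tau f)"
  define Q where "Q = fps_nth (Dv w1 H) (Suc n)"
  define Z where "Z = fps_nth (Dv w2 (H * lin (cq * w1) * geo w1)) (Suc n)"
  have f: "f \<in> V k" using monom by (simp add: V_eq_VS)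
  have F: "F \<in> V (Suc k)" unfolding F_def V_eq_VS
    by (intro VS_mult VS_power VS_yvar VS_mono[OF monom]) auto
  have g: "g \<in> VS {1..Suc (Suc k)}" using tau_V[OF tau_V[OF f]] by (simp add: V_eq_VS g_def)
  have ttF: "tau (tau F) = g * yvar (Suc (Suc (Suc k))) ^ n" by (simp add: F_def g_def tau_simps tau_gens)
  have 1: "Dst (Suc k) (tau F) = (cq - 1) * w1 * (g * Q)"
    using g by (simp add: Dst_eq[OF tau_V[OF F]] ttF Lam_monom[of _ "{1..Suc (Suc k)}"] Q_def Ks_def H_def)
  have tK: "fps_hom tau (Ks (Suc k)) = Dv w2 (H * lin (cq * w1) * geo w1)"
  proof -
    have X: "fps_hom tau fps_X = fps_X" by (rule fps_ext) (simp add: fps_X_def tau_simps)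
    have "tau w1 = w2" by (simp add: tau_simps tau_gens w2_def numeral_2_eq_2)
    then show ?thesis
      by (simp add: Ks_def Dv_def fps_hom_mult[OF ring_homo_tau] fps_hom_geo[OF ring_homo_tau] X tau_hnegs H_def)
  qed
  have 2: "tau (Dst k F) = (cq - 1) * w2 * (g * Z)"
    unfolding Dst_eq[OF F] tau_lin_w1 tau_Hs_Lam[OF tau_V[OF F]] ttF tK
    using g by (simp add: Lam_monom[of _ "{1..Suc (Suc k)}"] Z_def w2_def)
  have sw: "swap_y 1 w1 = w2" using swap_y_gens(3)[of 1] by (simp add: swap_y_simps w2_def numeral_2_eq_2)
  have sQ: "swap_y 1 Q = fps_nth (Dv w2 H) (Suc n)"
  proof -
    have X: "fps_hom (swap_y 1) fps_X = fps_X" by (rule fps_ext) (simp add: fps_X_def swap_y_simps)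
    have "fps_hom (swap_y 1) H = H" by (rule fps_ext) (simp add: H_def swap_Hs)
    then have "fps_hom (swap_y 1) (Dv w1 H) = Dv w2 H"
      by (simp add: Dv_def fps_hom_mult[OF ring_homo_swap_y] fps_hom_geo[OF ring_homo_swap_y] X sw
          del: One_nat_def)
    then show ?thesis unfolding Q_def by (metis fps_hom_nth)
  qed
  \<comment> \<open>Partial fractions in v with poles w1 and w2; the numerators are those of the
    operator T_1, written in w1 = t y_1 and w2 = t y_2.\<close>
  have ser: "fps_const (w2 - w1) * Dv w2 (H * lin (cq * w1) * geo w1) =
     fps_const ((cq - 1) * w1) * Dv w1 H + fps_const (w2 - cq * w1) * Dv w2 H"
  proof -
    have br: "fps_const (w2 - w1) * lin (cq * w1) =
      fps_const ((cq - 1) * w1) * lin w2 + fps_const (w2 - cq * w1) * lin w1"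
      by (simp add: lin_def algebra_simps flip: fps_const_mult fps_const_sub)
    have "fps_const (w2 - w1) * Dv w2 (H * lin (cq * w1) * geo w1) =
      fps_X * H * (geo w1 * geo w2) * (fps_const (w2 - w1) * lin (cq * w1))"
      by (simp add: Dv_def ac_simps)
    also have "\<dots> = fps_X * H * (fps_const ((cq - 1) * w1) * geo w1 * (lin w2 * geo w2) +
        fps_const (w2 - cq * w1) * geo w2 * (lin w1 * geo w1))"
      unfolding br by (simp add: algebra_simps)
    also have "\<dots> = fps_const ((cq - 1) * w1) * Dv w1 H + fps_const (w2 - cq * w1) * Dv w2 H"
      by (simp add: lin_geo Dv_def algebra_simps)
    finally show ?thesis .
  qed
  have TQ: "T_op 1 Q = Z"
  \<comment> \<open>The identity is known for w1, w2; the common factor t is cancelled to reach y_1,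
    y_2.\<close>
  proof (rule T_op_unique, rule vconst_cancel)
    show "tt \<noteq> 0" by (simp add: tt_def Zero_fract_def eq_fract)
    have "(w2 - w1) * Z = (cq - 1) * w1 * Q + (w2 - cq * w1) * swap_y 1 Q"
      unfolding sQ using arg_cong[OF ser, of "\<lambda>s. fps_nth s (Suc n)"] by (simp add: Z_def Q_def)
    then show "vconst tt * ((yvar (Suc 1) - yvar 1) * Z) =
      vconst tt * ((cq - 1) * yvar 1 * Q + (yvar (Suc 1) - cq * yvar 1) * swap_y 1 Q)"
      by (simp add: w2_def algebra_simps numeral_2_eq_2)
  qed
  have sg: "swap_y 1 ((cq - 1) * vconst tt * g) = (cq - 1) * vconst tt * g"
    using swap_tau_tau[OF f] by (simp add: swap_y_simps g_def)
  have "T_op 1 (tau (Dst k F)) = T_op 1 (((cq - 1) * vconst tt * g) * (yvar (Suc 1) * T_op 1 Q))"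
    unfolding 2 TQ unfolding w2_def numeral_2_eq_2 One_nat_def by (simp only: ac_simps)
  also have "\<dots> = ((cq - 1) * vconst tt * g) * (cq * (yvar 1 * Q))"
    by (simp only: T_op_lin[OF sg] T_op_right_T)
  also have "\<dots> = cq * Dst (Suc k) (tau F)" by (simp add: 1 ac_simps)
  finally show ?case by (simp add: F_def)
next
  case (add F G)
  have a: "Dst k (F + G) = Dst k F + Dst k G" for k F G
    by (simp add: Dst_def dmw_add tau_simps)
  show ?case using add by (simp add: a tau_simps T_op_add distrib_left)
qed simp

section \<open>Straightening the operators of the polynomial representation\<close>

text \<open>\<open>shp k F = F[X + (q-1)(y\<^sub>1 + \<dots> + y\<^sub>k)]\<close>, with inverse \<open>shm k\<close>.\<close>

definition sft :: "qt \<Rightarrow> nat \<Rightarrow> vpoly \<Rightarrow> vpoly" where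
  "sft s k = eval_v (plethysm vconst
     (\<lambda>n. vsym (psum n) + vconst (s * (qq ^ n - 1)) * (\<Sum>i=1..k. yvar i ^ n))) yvar"

abbreviation "shp \<equiv> sft 1"
abbreviation "shm \<equiv> sft (- 1)"

lemma ring_homo_sft: "ring_homo (sft s k)"
  unfolding sft_def by (intro ring_homo_eval_v plethysm ring_homo_vconst)

lemmas sft_simps = ring_homo_simps[OF ring_homo_sft]

lemma sft_gens: "sft s k (vconst c) = vconst c" "sft s k (yvar i) = yvar i"
  "n \<ge> 1 \<Longrightarrow> sft s k (vsym (psum n)) = vsym (psum n) + vconst (s * (qq ^ n - 1)) * (\<Sum>i=1..k. yvar i ^ n)"
  unfolding sft_def
  by (simp_all add: eval_v_vconst eval_v_yvar eval_v_vsym plethysm[OF ring_homo_vconst])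

lemma ring_homo_id: "ring_homo (\<lambda>x. x)" by (simp add: ring_homo_def)

lemma sft_sft: "sft s k (sft (- s) k F) = F"
  by (rule vpoly_homo_eqI[of _ UNIV "\<lambda>F. sft s k (sft (- s) k F)" "\<lambda>F. F"])
    (simp_all add: ring_homo_comp[OF ring_homo_sft ring_homo_sft] sft_gens sft_simps
      ring_homo_sum[OF ring_homo_sft] ring_homo_def vconst_simps algebra_simps)

lemma shp_shm [simp]: "shp k (shm k F) = F" by (rule sft_sft)
lemma shm_shp [simp]: "shm k (shp k F) = F" using sft_sft[of "- 1" k F] by simp

lemma sft_0 [simp]: "sft s 0 F = F"
  by (rule vpoly_homo_eqI[OF VS_UNIV ring_homo_sft ring_homo_id]) (simp_all add: sft_gens)

lemma sft_VS: "F \<in> VS K \<Longrightarrow> {1..k} \<subseteq> K \<Longrightarrow> sft s k F \<in> VS K"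
proof (induction rule: VS_induct)
  case (sym f)
  have "plethysm vconst (\<lambda>n. vsym (psum n) + vconst (s * (qq ^ n - 1)) * (\<Sum>i=1..k. yvar i ^ n)) f \<in> VS K"
    using sym by (intro plethysm_VS VS_add VS_mult VS_vsym VS_vconst VS_sum VS_power VS_yvar) auto
  then show ?case unfolding sft_def by (simp add: eval_v_vsym plethysm(1)[OF ring_homo_vconst])
qed (simp_all add: sft_gens sft_simps VS_yvar VS_add VS_mult)

lemma sft_V: "F \<in> V k \<Longrightarrow> sft s k F \<in> V k"
  unfolding V_eq_VS by (rule sft_VS) auto

lemma swap_sft: "1 \<le> i \<Longrightarrow> i < k \<Longrightarrow> sft s k (swap_y i F) = swap_y i (sft s k F)"
proof (rule vpoly_homo_eqI[of _ UNIV, OF VS_UNIV ring_homo_comp[OF ring_homo_swap_y ring_homo_sft]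
      ring_homo_comp[OF ring_homo_sft ring_homo_swap_y]])
  fix n :: nat assume n: "1 \<le> i" "i < k" "1 \<le> n"
  have sw: "swap_y i (yvar j) = yvar (Transposition.transpose i (Suc i) j)" for j
    by (cases "j = i"; cases "j = Suc i") (auto simp: transpose_def)
  have bij: "bij_betw (Transposition.transpose i (Suc i)) {1..k} {1..k}"
    using n by (intro permutes_imp_bij permutes_swap_id) auto
  have "swap_y i (\<Sum>j=1..k. yvar j ^ n) = (\<Sum>j=1..k. yvar j ^ n)"
    using sum.reindex_bij_betw[OF bij, of "\<lambda>j. yvar j ^ n"]
    by (simp add: ring_homo_sum[OF ring_homo_swap_y] swap_y_simps sw)
  then show "sft s k (swap_y i (vsym (psum n))) = swap_y i (sft s k (vsym (psum n)))"
    using n by (simp add: sft_gens swap_y_simps)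
next
  fix j :: nat
  show "sft s k (swap_y i (yvar j)) = swap_y i (sft s k (yvar j))"
    by (cases "j = i"; cases "j = Suc i") (simp_all add: sft_gens)
qed (simp_all add: sft_gens)

lemma T_op_sft: "1 \<le> i \<Longrightarrow> i < k \<Longrightarrow> T_op i (sft s k F) = sft s k (T_op i F)"
proof (rule T_op_unique)
  assume i: "1 \<le> i" "i < k"
  have "sft s k ((yvar (Suc i) - yvar i) * T_op i F) =
    sft s k ((cq - 1) * yvar i * F + (yvar (Suc i) - cq * yvar i) * swap_y i F)" by (simp only: T_op_eq)
  then show "(yvar (Suc i) - yvar i) * sft s k (T_op i F) =
    (cq - 1) * yvar i * sft s k F + (yvar (Suc i) - cq * yvar i) * swap_y i (sft s k F)"
    by (simp only: sft_simps sft_gens swap_sft[OF i])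
qed

lemma TW_sft: "n < k \<Longrightarrow> TW n (sft s k F) = sft s k (TW n F)"
  by (induction n arbitrary: F) (simp_all add: TW_Suc T_op_sft)

lemma pleth_plus_gens:
  "pleth_plus i (vconst c) = vconst c" "pleth_plus i (yvar j) = yvar j"
  "n \<ge> 1 \<Longrightarrow> pleth_plus i (vsym (psum n)) = vsym (psum n) + vconst (qq ^ n - 1) * yvar i ^ n"
  unfolding pleth_plus_def
  by (simp_all add: eval_v_vconst eval_v_yvar eval_v_vsym plethysm[OF ring_homo_vconst])

lemma ring_homo_pleth_plus: "ring_homo (pleth_plus i)"
  unfolding pleth_plus_def by (intro ring_homo_eval_v plethysm ring_homo_vconst)

lemmas pleth_plus_simps = ring_homo_simps[OF ring_homo_pleth_plus]

lemma pleth_plus_shp: "pleth_plus (Suc k) (shp k F) = shp (Suc k) F"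
  by (rule vpoly_homo_eqI[of _ UNIV, OF VS_UNIV ring_homo_comp[OF ring_homo_sft ring_homo_pleth_plus] ring_homo_sft])
    (simp_all add: pleth_plus_gens sft_gens pleth_plus_simps ring_homo_sum[OF ring_homo_pleth_plus] algebra_simps)

lemma dplus_op_shp: "dplus_op k (shp k F) = shp (Suc k) (TW k F)"
  unfolding dplus_op_def TW_def[symmetric] by (simp add: pleth_plus_shp TW_sft)

lemma dplus_star_op_shp:
  assumes F: "F \<in> V k" shows "dplus_star_op k (shp k F) = shp (Suc k) (tau F)"
proof -
  define g where "g = eval_v vsym (\<lambda>i. if i = k + 1 then vconst tt * yvar 1 else yvar (i + 1))"
  have hg: "ring_homo g" unfolding g_def by (rule ring_homo_eval_v[OF ring_homo_vsym])
  note g_simps = ring_homo_simps[OF hg]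
  have gg: "g (vsym f) = vsym f" "g (vconst c) = vconst c"
    "g (yvar i) = (if i = Suc k then w1 else yvar (Suc i))" for f c i
    by (simp_all add: g_def eval_v_vsym eval_v_vconst eval_v_yvar ring_homo_vsym flip: vconst_def)
  have s: "(\<Sum>i=1..Suc k. f i) = f 1 + (\<Sum>i=1..k. f (Suc i))" for f :: "nat \<Rightarrow> vpoly"
    by (simp add: sum.atLeast_Suc_atMost sum.shift_bounds_cl_Suc_ivl del: sum.cl_ivl_Suc)
  have "g (pleth_plus (Suc k) (shp k F)) = shp (Suc k) (tau F)"
  proof (rule vpoly_homo_eqI[OF F[unfolded V_eq_VS]
        ring_homo_comp[OF ring_homo_comp[OF ring_homo_sft ring_homo_pleth_plus] hg] ring_homo_comp[OF ring_homo_tau ring_homo_sft]])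
    fix n :: nat assume n: "1 \<le> n"
    have gs: "g (\<Sum>i=1..k. yvar i ^ n) = (\<Sum>i=1..k. yvar (Suc i) ^ n)"
      unfolding ring_homo_sum[OF hg] by (intro sum.cong refl) (auto simp: g_simps gg)
    have L: "g (pleth_plus (Suc k) (shp k (vsym (psum n)))) =
      vsym (psum n) + vconst (qq ^ n - 1) * ((\<Sum>i=1..k. yvar (Suc i) ^ n) + w1 ^ n)"
      unfolding pleth_plus_shp using n by (simp add: sft_gens g_simps gg gs[simplified])
    have R: "shp (Suc k) (tau (vsym (psum n))) =
      vsym (psum n) + vconst (qq ^ n - 1) * (yvar 1 ^ n + (\<Sum>i=1..k. yvar (Suc i) ^ n))
        + vconst ((qq ^ n - 1) * (tt ^ n - 1)) * yvar 1 ^ n"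
      using n unfolding tau_gens(3)[OF n] sft_simps sft_gens(1,2) sft_gens(3)[OF n] s by simp
    show "g (pleth_plus (Suc k) (shp k (vsym (psum n)))) = shp (Suc k) (tau (vsym (psum n)))"
      unfolding L R by (simp add: vconst_simps power_mult_distrib algebra_simps)
  qed (simp_all add: pleth_plus_gens sft_gens tau_gens gg)
  then show ?thesis by (simp add: dplus_star_op_def g_def)
qed

text \<open>This is how \<open>Hs\<close> was chosen: undoing the straightening turns it into the
  series of h_n[-X] that occurs in the definition of d_-.\<close>

lemma shp_Hs: "shp k (fps_nth (Hs k) n) = fps_nth hnegs n"
proof -
  have "fps_hom (shp k) (Hs k) = hnegs"
  proof (rule vpoly_lder_unique[OF lder_hom[OF ring_homo_sft lder_Hs] lder_hnegs])
    fix n :: nat assume n: "n \<ge> 1"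
    then show "shp k (- vsym (psum n) + (\<Sum>i=1..k. - (yvar i ^ n) + (cq * yvar i) ^ n)) = - vsym (psum n)"
      by (simp add: sft_simps sft_gens ring_homo_sum[OF ring_homo_sft] power_mult_distrib vconst_simps
          sum.distrib sum_negf sum_distrib_left algebra_simps)
  qed
  then show ?thesis by (metis fps_hom_nth)
qed

section \<open>The plethystic exponential as a Laurent series\<close>

lemma dist_fls_le:
  assumes "\<And>n. n < int N \<Longrightarrow> fls_nth (a - b) n = 0"
  shows "dist a (b :: 'a::group_add fls) \<le> inverse (2 ^ N)"
proof (cases "a = b")
  case False
  then have "a - b \<noteq> 0" by simp
  then have d: "int N \<le> fls_subdegree (a - b)" using assms by (intro fls_subdegree_geI) auto
  then have "(2::real) ^ N \<le> 2 ^ nat (fls_subdegree (a - b))" by (intro power_increasing) auto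
  then show ?thesis using False d by (simp add: dist_fls_def field_simps)
qed simp

text \<open>\<open>Exp\<close> is an infinite sum in the metric on Laurent series: partial sums
  agree with the limit up to ever higher order.\<close>

lemma fls_sums: "(\<lambda>n. fls_X ^ n * fls_const (fps_nth f n)) sums fps_to_fls (f :: 'a::comm_ring_1 fps)"
proof -
  have nth: "fls_nth (\<Sum>n<N. fls_X ^ n * fls_const (fps_nth f n)) m =
      (if 0 \<le> m \<and> m < int N then fps_nth f (nat m) else 0)" for N m
    by (induction N) (auto simp: fls_X_power_times_conv_shift not_less less_Suc_eq_le nat_eq_iff2)
  have "(\<lambda>N. \<Sum>n<N. fls_X ^ n * fls_const (fps_nth f n)) \<longlonglongrightarrow> fps_to_fls f"
    unfolding lim_sequentially
  proof (intro allI impI)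
    fix r :: real assume "0 < r"
    then obtain M where M: "inverse (2 ^ M) < r"
      using real_arch_pow_inv[of r "1 / 2"] by (auto simp: power_one_over inverse_eq_divide)
    have "dist (\<Sum>n<N. fls_X ^ n * fls_const (fps_nth f n)) (fps_to_fls f) \<le> inverse (2 ^ M)" if "N \<ge> M" for N
      using that by (intro dist_fls_le) (auto simp: nth)
    then show "\<exists>M. \<forall>N\<ge>M. dist (\<Sum>n<N. fls_X ^ n * fls_const (fps_nth f n)) (fps_to_fls f) < r"
      using M by (meson order_le_less_trans)
  qed
  then show ?thesis by (simp add: sums_def)
qed

lemma Exp_laurent_eq: "Exp_laurent = fps_to_fls hnegs"
proof -
  let ?c = "\<lambda>c. fls_const (vconst c)"
  have c: "ring_homo ?c" by (rule ring_homo_comp[OF ring_homo_vconst ring_homo_fls_const])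
  let ?a = "\<lambda>n. - (fls_X ^ n * fls_const (vsym (psum n)))"
  have tf: "x = 0" if "of_nat (Suc n) * x = 0" for n and x :: "vpoly fls"
  proof (rule fls_eqI)
    fix m
    have "of_nat (Suc n) * fls_nth x m = fls_nth (of_nat (Suc n) * x) m"
      by (simp only: fls_mult_of_nat_nth)
    also have "\<dots> = 0" unfolding that by simp
    finally have "fls_nth x m = 0" by (rule vpoly_torsion_free)
    then show "fls_nth x m = fls_nth 0 m" by simp
  qed
  have "Abs_fps (\<lambda>n. plethysm ?c ?a (hsum n)) =
    Abs_fps (\<lambda>n. fls_X ^ n * fps_nth (fps_hom fls_const hnegs) n)"
    by (rule lder_unique[OF tf lder_plethysm[OF c] lder_weighted[OF lder_hom[OF ring_homo_fls_const lder_hnegs]]])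
      simp_all
  from fps_eq_iff[THEN iffD1, OF this]
  have "plethysm ?c ?a (hsum n) = fls_X ^ n * fls_const (fps_nth hnegs n)" for n
    by (simp only: fps_nth_Abs_fps fps_hom_nth)
  then show ?thesis
    unfolding Exp_laurent_def Exp_def using fls_sums[of hnegs] by (simp add: sums_iff)
qed

text \<open>The shift X - (q-1)y_(k+1) in d_- cancels the y_(k+1) part of the straightening, so for
  f free of y_(k+1) the result is constant in the Laurent variable. Only the power y_(k+1)^n meets
  the exponential, and it picks one coefficient.\<close>

lemma dminus_op_shp:
  assumes F: "F \<in> V (Suc k)"
  shows "dminus_op (Suc k) (shp (Suc k) F) = shp k (dmw k F)"
proof -
  let ?c = "\<lambda>c. fls_const (vconst c)"
  have c: "ring_homo ?c" by (rule ring_homo_comp[OF ring_homo_vconst ring_homo_fls_const])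
  let ?L = "pleth_minus_laurent (Suc k)"
  have hL: "ring_homo ?L"
    unfolding pleth_minus_laurent_def by (intro ring_homo_eval_v plethysm c)
  note L_simps = ring_homo_simps[OF hL]
  have Lc: "?L (vconst r) = ?c r" for r
    unfolding pleth_minus_laurent_def by (simp add: eval_v_vconst plethysm[OF c])
  have Lp: "?L (vsym (psum n)) = fls_const (vsym (psum n)) - ?c (qq ^ n - 1) * fls_X_inv ^ n" if "n \<ge> 1" for n
    using that unfolding pleth_minus_laurent_def by (simp add: eval_v_vsym plethysm[OF c])
  have Ly: "?L (yvar i) = (if i = Suc k then fls_X_inv else fls_const (yvar i))" for i
    unfolding pleth_minus_laurent_def by (simp add: eval_v_yvar plethysm[OF c])
  have L: "?L (shp (Suc k) f) = fls_const (shp k f)" if f: "f \<in> V k" for f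
  proof (rule vpoly_homo_eqI[OF f[unfolded V_eq_VS] ring_homo_comp[OF ring_homo_sft hL]
        ring_homo_comp[OF ring_homo_sft ring_homo_fls_const]])
    fix n :: nat assume n: "1 \<le> n"
    have s: "?L (\<Sum>i=1..k. yvar i ^ n) = fls_const (\<Sum>i=1..k. yvar i ^ n)"
      unfolding ring_homo_sum[OF hL] ring_homo_sum[OF ring_homo_fls_const]
      by (intro sum.cong refl) (auto simp: L_simps Ly fls_const_power)
    show "?L (shp (Suc k) (vsym (psum n))) = fls_const (shp k (vsym (psum n)))"
      using n s by (simp add: sft_gens L_simps Lp Lc Ly fls_plus_const distrib_left)
  qed (auto simp: sft_gens Lc Ly)
  show ?thesis using F unfolding V_Suc
  proof (induction rule: VS_split_induct)
    case (monom f n)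
    then have f: "f \<in> V k" by (simp add: V_eq_VS)
    have "?L (shp (Suc k) (f * yvar (Suc k) ^ n)) * fps_to_fls hnegs =
      fls_const (shp k f) * (fls_X_inv ^ n * fps_to_fls hnegs)"
      by (simp add: sft_simps sft_gens L_simps Ly L[OF f] mult.assoc)
    then show ?case using monom
      by (simp add: dminus_op_def Exp_laurent_eq dmw_def Lam_monom[of _ "{1..k}"] sft_simps shp_Hs
          fls_X_inv_power_times_conv_shift nat_add_distrib)
  next
    case (add F G)
    then show ?case
      by (simp add: dminus_op_def sft_simps L_simps distrib_right dmw_add)
  qed simp
qed

section \<open>Homomorphisms of algebras\<close>

definition alg_hom :: "('a::qt_algebra \<Rightarrow> 'b::qt_algebra) \<Rightarrow> bool" where
  "alg_hom f \<longleftrightarrow> (\<forall>x y. f (x + y) = f x + f y) \<and> (\<forall>x y. f (x * y) = f x * f y) \<and>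
     (\<forall>c x. f (c \<cdot> x) = c \<cdot> f x)"

lemma alg_hom_simps:
  assumes "alg_hom f"
  shows "f (x + y) = f x + f y" "f (x * y) = f x * f y" "f (c \<cdot> x) = c \<cdot> f x"
    "f 0 = 0" "f (- x) = - f x" "f (x - y) = f x - f y"
proof -
  show a: "f (x + y) = f x + f y" and "f (x * y) = f x * f y" and s: "f (c \<cdot> x) = c \<cdot> f x" for x y c
    using assms by (auto simp: alg_hom_def)
  show z: "f 0 = 0" using s[of 0 0] by (simp add: smul_zero_left)
  show u: "f (- x) = - f x" for x using s[of "- 1" x] by (simp add: smul_minus_one)
  show "f (x - y) = f x - f y" using a[of x "- y"] u by simp
qed

lemma alg_hom_comp: "alg_hom f \<Longrightarrow> alg_hom g \<Longrightarrow> alg_hom (\<lambda>x. g (f x))"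
  by (simp add: alg_hom_def)

lemma alg_hom_ideal: "alg_hom f \<Longrightarrow> (\<And>x. x \<in> S \<Longrightarrow> f x = 0) \<Longrightarrow> x \<in> ideal_gen S \<Longrightarrow> f x = 0"
  by (erule ideal_gen.induct)
    (auto simp: alg_hom_simps smul_diff_right[of _ 0 0, simplified])

lemma smul_zero_right [simp]: "c \<cdot> (0::'a::qt_algebra) = 0"
  using smul_diff_right[of c 0 0] by simp

text \<open>All four quotient types in question have a universal property of this shape.\<close>

lemma quotient_lift:
  fixes ab :: "'a::qt_algebra \<Rightarrow> 'q::qt_algebra" and F :: "'a \<Rightarrow> 'b::qt_algebra"
  assumes q: "\<And>x. ab (re x) = x" "\<And>x y. ab x = ab y \<longleftrightarrow> icong S x y"
    and ab: "alg_hom ab" and F: "alg_hom F" "\<And>x. x \<in> S \<Longrightarrow> F x = 0"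
  shows "alg_hom (\<lambda>x. F (re x))" "F (re (ab x)) = F x"
proof -
  show l: "F (re (ab x)) = F x" for x
  proof -
    have "icong S (re (ab x)) x" using q by metis
    then have "F (re (ab x) - x) = 0" unfolding icong_def using F alg_hom_ideal[of F S] by blast
    then show ?thesis by (simp add: alg_hom_simps[OF F(1)])
  qed
  have "F (re (x + y)) = F (re x) + F (re y)" for x y
    using l[of "re x + re y"] by (simp add: alg_hom_simps[OF ab] q(1) alg_hom_simps[OF F(1)])
  moreover have "F (re (x * y)) = F (re x) * F (re y)" for x y
    using l[of "re x * re y"] by (simp add: alg_hom_simps[OF ab] q(1) alg_hom_simps[OF F(1)])
  moreover have "F (re (c \<cdot> x)) = c \<cdot> F (re x)" for x c
    using l[of "c \<cdot> re x"] by (simp add: alg_hom_simps[OF ab] q(1) alg_hom_simps[OF F(1)])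
  ultimately show "alg_hom (\<lambda>x. F (re x))" by (simp add: alg_hom_def)
qed

lemma abs_zero:
  assumes "\<And>x y. ab x = ab y \<longleftrightarrow> icong S x y" "alg_hom ab" "x \<in> S" shows "ab x = 0"
  using assms(1)[of x 0] assms(3) by (simp add: icong_def ideal_gen.base alg_hom_simps[OF assms(2)])

lemma alg_hom_abs_dyck: "alg_hom abs_dyck"
  by (simp add: alg_hom_def plus_dyck.abs_eq times_dyck.abs_eq smul_dyck.abs_eq)
lemma alg_hom_abs_dyck_star: "alg_hom abs_dyck_star"
  by (simp add: alg_hom_def plus_dyck_star.abs_eq times_dyck_star.abs_eq smul_dyck_star.abs_eq)
lemma alg_hom_abs_free_product: "alg_hom abs_free_product"
  by (simp add: alg_hom_def plus_free_product.abs_eq times_free_product.abs_eq smul_free_product.abs_eq)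
lemma alg_hom_abs_double_dyck: "alg_hom abs_double_dyck"
  by (simp add: alg_hom_def plus_double_dyck.abs_eq times_double_dyck.abs_eq smul_double_dyck.abs_eq)

lemma abs_rep:
  "abs_dyck (rep_dyck a) = a" "abs_dyck_star (rep_dyck_star b) = b"
  "abs_free_product (rep_free_product f) = f" "abs_double_dyck (rep_double_dyck d) = d"
  by (rule Quotient_abs_rep[OF Quotient_dyck] Quotient_abs_rep[OF Quotient_dyck_star]
    Quotient_abs_rep[OF Quotient_free_product] Quotient_abs_rep[OF Quotient_double_dyck])+

lemma abs_fp_eq: "abs_free_product x = abs_free_product y \<longleftrightarrow> icong free_product_rels x y"
  by (rule free_product.abs_eq_iff)

section \<open>Free algebras and path algebras\<close>

lemma psalg_induct [case_names basis add]:
  assumes "\<And>p c. P (c \<cdot> basis_elt p)" "\<And>x y. P x \<Longrightarrow> P y \<Longrightarrow> P (x + y)"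
  shows "P (x :: 'p::partial_semigroup psalg)"
proof -
  have "P (Abs_psalg f)" for f
  proof (induction f rule: mpoly_induct)
    case (single p c)
    have "c \<cdot> basis_elt p = Abs_psalg (Poly_Mapping.single p c)"
      by (simp add: basis_elt_def smul_psalg.abs_eq eq_onp_def)
        (rule arg_cong[where f = Abs_psalg], rule poly_mapping_eqI, simp add: lookup_single when_def)
    then show ?case using assms(1)[of c p] by simp
  next
    case (add f g)
    then show ?case using assms(2)[of "Abs_psalg f" "Abs_psalg g"]
      by (simp add: plus_psalg.abs_eq eq_onp_def)
  qed
  then show ?thesis by (metis Rep_psalg_inverse)
qed

lemma basis_elt_mult:
  "basis_elt a * basis_elt b = (case pcomp a b of None \<Rightarrow> 0 | Some p \<Rightarrow> basis_elt p)"
  by (simp add: basis_elt_def times_psalg.abs_eq eq_onp_def pmul_single pterm_def zero_psalg_def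
      split: option.split)

definition psalg_lift :: "('p \<Rightarrow> 'b::qt_algebra) \<Rightarrow> 'p psalg \<Rightarrow> 'b" where
  "psalg_lift b x = (\<Sum>p\<in>Poly_Mapping.keys (Rep_psalg x). Poly_Mapping.lookup (Rep_psalg x) p \<cdot> b p)"

lemma psalg_lift_add: "psalg_lift b (x + y) = psalg_lift b x + psalg_lift b (y :: 'p::partial_semigroup psalg)"
proof -
  let ?A = "Poly_Mapping.keys (Rep_psalg x) \<union> Poly_Mapping.keys (Rep_psalg y)"
  have sup: "psalg_lift b z = (\<Sum>p\<in>?A. Poly_Mapping.lookup (Rep_psalg z) p \<cdot> b p)"
    if "Poly_Mapping.keys (Rep_psalg z) \<subseteq> ?A" for z :: "'p psalg"
    unfolding psalg_lift_def using that
    by (intro sum.mono_neutral_left) (auto simp: in_keys_iff smul_zero_left)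
  show ?thesis
    using Poly_Mapping.keys_add[of "Rep_psalg x" "Rep_psalg y"]
    by (simp add: sup plus_psalg.rep_eq lookup_add smul_add_left sum.distrib)
qed

lemma psalg_lift_basis: "psalg_lift b (c \<cdot> basis_elt p) = c \<cdot> b (p :: 'p::partial_semigroup)"
proof -
  have "Rep_psalg (c \<cdot> basis_elt p) = Poly_Mapping.single p c"
    by (rule poly_mapping_eqI)
      (simp add: smul_psalg.rep_eq basis_elt_def Abs_psalg_inverse lookup_single when_def)
  then show ?thesis by (simp add: psalg_lift_def smul_zero_left)
qed

lemma alg_hom_psalg_lift:
  fixes b :: "'p::partial_semigroup \<Rightarrow> 'b::qt_algebra"
  assumes b: "\<And>u v. b u * b v = (case pcomp u v of None \<Rightarrow> 0 | Some w \<Rightarrow> b w)"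
  shows "alg_hom (psalg_lift b)"
  unfolding alg_hom_def
proof (intro conjI allI)
  note basis1 = psalg_lift_basis[of b 1, simplified smul_one]
  have z: "psalg_lift b 0 = 0" using psalg_lift_add[of b 0 0] by simp
  show "psalg_lift b (x + y) = psalg_lift b x + psalg_lift b y" for x y by (rule psalg_lift_add)
  show sm: "psalg_lift b (c \<cdot> x) = c \<cdot> psalg_lift b x" for c x
    by (induction x rule: psalg_induct)
      (simp_all add: psalg_lift_add smul_add_right psalg_lift_basis flip: smul_assoc)
  show "psalg_lift b (x * y) = psalg_lift b x * psalg_lift b y" for x y
  proof (induction x rule: psalg_induct)
    case (add x x')
    then show ?case by (simp add: distrib_right psalg_lift_add)
  next
    case (basis p c)
    show ?case
    proof (induction y rule: psalg_induct)
      case (add y y')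
      then show ?case by (simp add: distrib_left psalg_lift_add)
    next
      case (basis p' c')
      have "(c \<cdot> basis_elt p) * (c' \<cdot> basis_elt p') = (c * c') \<cdot> (basis_elt p * basis_elt p')"
        by (simp add: smul_assoc mult.commute[of c] flip: smul_mult_left smul_mult_right)
      moreover have "(c \<cdot> b p) * (c' \<cdot> b p') = (c * c') \<cdot> (b p * b p')"
        by (simp add: smul_assoc mult.commute[of c] flip: smul_mult_left smul_mult_right)
      ultimately show ?case
        by (simp add: sm psalg_lift_basis basis_elt_mult b z basis1 split: option.split)
    qed
  qed
qed

text \<open>Exactly what is needed for elements of an algebra to extend to a homomorphism of the
  path algebra: orthogonal idempotents, and arrows with the right ends.\<close>

definition path_system :: "'a::qt_algebra dyck_gens \<Rightarrow> bool" where
  "path_system G \<longleftrightarrow>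
     (\<forall>k l. gE G k * gE G l = (if k = l then gE G k else 0)) \<and>
     (\<forall>k. gE G (Suc k) * gP G k = gP G k \<and> gP G k * gE G k = gP G k) \<and>
     (\<forall>k. gE G k * gM G (Suc k) = gM G (Suc k) \<and> gM G (Suc k) * gE G (Suc k) = gM G (Suc k)) \<and>
     (\<forall>k i. 1 \<le> i \<and> i < k \<longrightarrow> gE G k * gT G k i = gT G k i \<and> gT G k i * gE G k = gT G k i)"

lemma map_gens_simps [simp]:
  "gE (map_gens f G) k = f (gE G k)" "gP (map_gens f G) k = f (gP G k)"
  "gM (map_gens f G) k = f (gM G k)" "gT (map_gens f G) k i = f (gT G k i)"
  by (simp_all add: map_gens_def)

lemma map_gens_map_gens: "map_gens f (map_gens g G) = map_gens (\<lambda>x. f (g x)) G"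
  by (simp add: map_gens_def)

lemma path_system_map:
  assumes f: "alg_hom f" and G: "path_system G" shows "path_system (map_gens f G)"
proof -
  have m: "f a * f b = f (a * b)" for a b by (simp add: alg_hom_simps[OF f])
  show ?thesis using G unfolding path_system_def by (simp add: m alg_hom_simps(4)[OF f])
qed

lemma Rep_arrow: "is_arrow x \<Longrightarrow> Rep_path (Abs_path (target x, [x], source x)) = (target x, [x], source x)"
  by (simp add: Abs_path_inverse)
lemma Rep_vertex: "Rep_path (Abs_path (k, [], k)) = (k, [], k)"
  by (simp add: Abs_path_inverse)

lemma path_system_path_gens: "path_system path_gens"
proof -
  have vv: "vertex_elt k * vertex_elt l = (if k = l then vertex_elt k else 0)" for k l
  proof -
    have "path_append (Abs_path (k, [], k)) (Abs_path (k, [], k)) = Abs_path (k, [], k)"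
      by (rule Rep_path_inject[THEN iffD1]) (simp add: path_append.rep_eq Rep_vertex)
    then show ?thesis
      by (auto simp: vertex_elt_def basis_elt_mult pcomp_path_def path_start.rep_eq path_end.rep_eq Rep_vertex)
  qed
  have va: "vertex_elt (target x) * arrow_elt x = arrow_elt x" if "is_arrow x" for x
  proof -
    have "path_append (Abs_path (target x, [], target x)) (Abs_path (target x, [x], source x)) =
      Abs_path (target x, [x], source x)"
      by (rule Rep_path_inject[THEN iffD1]) (use that in \<open>simp add: path_append.rep_eq Rep_vertex Rep_arrow\<close>)
    then show ?thesis using that
      by (auto simp: vertex_elt_def arrow_elt_def basis_elt_mult pcomp_path_def path_start.rep_eq path_end.rep_eq
        Rep_vertex Rep_arrow)
  qed
  have av: "arrow_elt x * vertex_elt (source x) = arrow_elt x" if "is_arrow x" for x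
  proof -
    have "path_append (Abs_path (target x, [x], source x)) (Abs_path (source x, [], source x)) =
      Abs_path (target x, [x], source x)"
      by (rule Rep_path_inject[THEN iffD1]) (use that in \<open>simp add: path_append.rep_eq Rep_vertex Rep_arrow\<close>)
    then show ?thesis using that
      by (auto simp: vertex_elt_def arrow_elt_def basis_elt_mult pcomp_path_def path_start.rep_eq path_end.rep_eq
        Rep_vertex Rep_arrow)
  qed
  show ?thesis unfolding path_system_def path_gens_def
    using vv va[of "Dplus _"] av[of "Dplus _"] va[of "Dminus (Suc _)"] av[of "Dminus (Suc _)"]
      va[of "Loop _ _"] av[of "Loop _ _"] by auto
qed

fun arrow_val :: "'a dyck_gens \<Rightarrow> arrow \<Rightarrow> 'a" where
  "arrow_val G (Dplus k) = gP G k"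
| "arrow_val G (Dminus k) = gM G k"
| "arrow_val G (Loop k i) = gT G k i"

definition path_val :: "'a::qt_algebra dyck_gens \<Rightarrow> path \<Rightarrow> 'a" where
  "path_val G p = (case Rep_path p of (b, w, a) \<Rightarrow> foldr (\<lambda>x y. arrow_val G x * y) w (gE G a))"

lemma arrow_val_E:
  assumes "path_system G" "is_arrow x"
  shows "gE G (target x) * arrow_val G x = arrow_val G x" "arrow_val G x * gE G (source x) = arrow_val G x"
proof -
  have "gE G (target x) * arrow_val G x = arrow_val G x \<and> arrow_val G x * gE G (source x) = arrow_val G x"
  proof (cases x)
    case (Dminus k)
    then show ?thesis using assms by (cases k) (auto simp: path_system_def)
  qed (use assms in \<open>auto simp: path_system_def\<close>)
  then show "gE G (target x) * arrow_val G x = arrow_val G x" "arrow_val G x * gE G (source x) = arrow_val G x"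
    by auto
qed

lemma path_val_mult:
  assumes G: "path_system G"
  shows "path_val G u * path_val G v = (case pcomp u v of None \<Rightarrow> 0 | Some w \<Rightarrow> path_val G w)"
proof -
  let ?f = "foldr (\<lambda>x y. arrow_val G x * y)"
  have EE: "gE G k * gE G l = (if k = l then gE G k else 0)" for k l using G by (simp add: path_system_def)
  have start: "?f w (gE G a) * gE G a = ?f w (gE G a)" for w a
    by (induction w) (simp_all add: EE mult.assoc)
  have fend: "gE G b * ?f w (gE G a) = ?f w (gE G a)" if "is_path b w a" for b w a
    using that by (cases w) (auto simp: EE mult.assoc[symmetric] arrow_val_E[OF G])
  obtain b w a where u: "Rep_path u = (b, w, a)" by (cases "Rep_path u") auto
  obtain b' w' a' where v: "Rep_path v = (b', w', a')" by (cases "Rep_path v") auto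
  have pv: "is_path b' w' a'" using Rep_path[of v] v by simp
  have app: "?f w y = ?f w (gE G a) * y" if "gE G a * y = y" for y
    using that by (induction w) (simp_all add: mult.assoc)
  show ?thesis
  proof (cases "a = b'")
    case True
    then have "Rep_path (path_append u v) = (b, w @ w', a')"
      by (simp add: path_append.rep_eq u v)
    then show ?thesis using True app[of "?f w' (gE G a')"] fend[OF pv]
      by (simp add: path_val_def u v pcomp_path_def path_start.rep_eq path_end.rep_eq)
  next
    case False
    have "path_val G u * path_val G v = ?f w (gE G a) * gE G a * (gE G b' * ?f w' (gE G a'))"
      by (simp add: path_val_def u v start fend[OF pv])
    also have "\<dots> = ?f w (gE G a) * (gE G a * gE G b') * ?f w' (gE G a')" by (simp only: mult.assoc)
    also have "\<dots> = 0" using False by (simp add: EE)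
    finally show ?thesis using False by (simp add: u v pcomp_path_def path_start.rep_eq path_end.rep_eq)
  qed
qed

definition path_lift :: "'a::qt_algebra dyck_gens \<Rightarrow> path psalg \<Rightarrow> 'a" where
  "path_lift G = psalg_lift (path_val G)"

lemma alg_hom_path_lift: "path_system G \<Longrightarrow> alg_hom (path_lift G)"
  unfolding path_lift_def by (rule alg_hom_psalg_lift) (rule path_val_mult)

lemma path_lift_basis: "path_lift G (basis_elt p) = path_val G p"
  using psalg_lift_basis[of "path_val G" 1 p] by (simp add: path_lift_def smul_one)

lemma path_lift_gens:
  assumes G: "path_system G"
  shows "path_lift G (gE path_gens k) = gE G k" "path_lift G (gP path_gens k) = gP G k"
    "path_lift G (gM path_gens (Suc k)) = gM G (Suc k)"
    "1 \<le> i \<Longrightarrow> i < k \<Longrightarrow> path_lift G (gT path_gens k i) = gT G k i"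
proof -
  have ar: "path_lift G (arrow_elt x) = arrow_val G x" if "is_arrow x" for x
    using that by (simp add: arrow_elt_def path_lift_basis path_val_def Rep_arrow arrow_val_E[OF G])
  show "path_lift G (gE path_gens k) = gE G k"
    by (simp add: path_gens_def vertex_elt_def path_lift_basis path_val_def Rep_vertex)
  show "path_lift G (gP path_gens k) = gP G k" "path_lift G (gM path_gens (Suc k)) = gM G (Suc k)"
    "1 \<le> i \<Longrightarrow> i < k \<Longrightarrow> path_lift G (gT path_gens k i) = gT G k i"
    using ar[of "Dplus k"] ar[of "Dminus (Suc k)"] ar[of "Loop k i"] by (auto simp: path_gens_def)
qed

lemma path_psalg_induct [case_names E P M T add smul mult]:
  assumes "\<And>k. Q (gE path_gens k)" "\<And>k. Q (gP path_gens k)" "\<And>k. Q (gM path_gens (Suc k))"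
    "\<And>k i. 1 \<le> i \<Longrightarrow> i < k \<Longrightarrow> Q (gT path_gens k i)"
    "\<And>x y. Q x \<Longrightarrow> Q y \<Longrightarrow> Q (x + y)" "\<And>c x. Q x \<Longrightarrow> Q (c \<cdot> x)" "\<And>x y. Q x \<Longrightarrow> Q y \<Longrightarrow> Q (x * y)"
  shows "Q x"
proof (induction x rule: psalg_induct)
  case (basis p c)
  have ar: "Q (arrow_elt x)" if "is_arrow x" for x
  proof (cases x)
    case (Dminus k)
    then show ?thesis using that assms(3)[of "k - 1"] by (cases k) (auto simp: path_gens_def)
  qed (use that assms(2,4) in \<open>auto simp: path_gens_def\<close>)
  have "is_path b w a \<Longrightarrow> Q (basis_elt (Abs_path (b, w, a)))" for b w a
  proof (induction w arbitrary: b)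
    case Nil
    then show ?case using assms(1)[of b] by (simp add: path_gens_def vertex_elt_def)
  next
    case (Cons x w)
    have 2: "is_arrow x" "b = target x" using Cons.prems by auto
    have 1: "Rep_path (Abs_path (source x, w, a)) = (source x, w, a)"
      "Rep_path (Abs_path (target x, x # w, a)) = (target x, x # w, a)"
      using Cons.prems by (simp_all add: Abs_path_inverse)
    have "path_append (Abs_path (target x, [x], source x)) (Abs_path (source x, w, a)) =
      Abs_path (target x, x # w, a)"
      by (rule Rep_path_inject[THEN iffD1]) (use 2 in \<open>simp add: path_append.rep_eq 1 Rep_arrow\<close>)
    then have "arrow_elt x * basis_elt (Abs_path (source x, w, a)) = basis_elt (Abs_path (b, x # w, a))"
      using 2 by (simp add: arrow_elt_def basis_elt_mult pcomp_path_def path_start.rep_eq path_end.rep_eq Rep_arrow 1)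
    then show ?case using assms(7)[OF ar[OF 2(1)] Cons.IH[of "source x"]] Cons.prems by simp
  qed
  moreover obtain b w a where r: "Rep_path p = (b, w, a)" by (cases "Rep_path p") auto
  moreover have "is_path b w a" using Rep_path[of p] r by simp
  ultimately show ?case using assms(6) by (metis Rep_path_inverse)
qed (rule assms)

lemma dyck_rels_map:
  assumes f: "alg_hom f" shows "dyck_rels c (map_gens f G) = f ` dyck_rels c G"
proof -
  note s = alg_hom_simps[OF f]
  have d: "dcomm (map_gens f G) k = f (dcomm G k)" for k by (simp add: dcomm_def s)
  have im: "f ` {g x y z | x y z. R x y z} = {f (g x y z) | x y z. R x y z}"
    for g :: "nat \<Rightarrow> nat \<Rightarrow> nat \<Rightarrow> 'a" and R by blast
  have im2: "f ` {g x y | x y. R x y} = {f (g x y) | x y. R x y}" for g :: "nat \<Rightarrow> nat \<Rightarrow> 'a" and R by blast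
  have im1: "f ` {g x | x. R x} = {f (g x) | x. R x}" for g :: "nat \<Rightarrow> 'a" and R by blast
  show ?thesis
    unfolding dyck_rels_def image_Un im im2 im1 s d map_gens_simps by (rule refl)
qed

section \<open>Consequences of the relations of the Dyck path algebra\<close>

lemma dyck_relsI:
  "1 \<le> i \<Longrightarrow> i < k \<Longrightarrow> (gT G k i - gE G k) * (gT G k i + c \<cdot> gE G k) \<in> dyck_rels c G"
  "1 \<le> i \<Longrightarrow> i + 1 < k \<Longrightarrow>
    gT G k i * gT G k (i + 1) * gT G k i - gT G k (i + 1) * gT G k i * gT G k (i + 1) \<in> dyck_rels c G"
  "1 \<le> i \<Longrightarrow> i < k \<Longrightarrow> 1 \<le> j \<Longrightarrow> j < k \<Longrightarrow> i + 1 < j \<or> j + 1 < i \<Longrightarrow>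
    gT G k i * gT G k j - gT G k j * gT G k i \<in> dyck_rels c G"
  "1 \<le> i \<Longrightarrow> i < k - 1 \<Longrightarrow> gT G (k - 1) i * gM G k - gM G k * gT G k i \<in> dyck_rels c G"
  "1 \<le> i \<Longrightarrow> i < k \<Longrightarrow> gP G k * gT G k i - gT G (k + 1) (i + 1) * gP G k \<in> dyck_rels c G"
  "gT G (k + 2) 1 * gP G (k + 1) * gP G k - gP G (k + 1) * gP G k \<in> dyck_rels c G"
  "2 \<le> k \<Longrightarrow> gM G (k - 1) * gM G k * gT G k (k - 1) - gM G (k - 1) * gM G k \<in> dyck_rels c G"
  "2 \<le> k \<Longrightarrow> gM G k * dcomm G k * gT G k (k - 1) - c \<cdot> (dcomm G (k - 1) * gM G k) \<in> dyck_rels c G"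
  "1 \<le> k \<Longrightarrow> gT G (k + 1) 1 * dcomm G (k + 1) * gP G k - c \<cdot> (gP G k * dcomm G k) \<in> dyck_rels c G"
  unfolding dyck_rels_def Un_iff mem_Collect_eq by blast+

text \<open>One theory of the relations for all uses: c is q for the unstarred and its inverse for
  the starred algebra, and G ranges over generators in the quotients, in the double algebra and
  among operators.\<close>

locale dyck_system =
  fixes c :: qt and G :: "'a::qt_algebra dyck_gens"
  assumes c0: "c \<noteq> 0" and c1: "c \<noteq> 1"
    and path_sys: "path_system G"
    and rels: "\<And>x. x \<in> dyck_rels c G \<Longrightarrow> x = 0"
begin

abbreviation "E \<equiv> gE G"
abbreviation "P \<equiv> gP G"
abbreviation "M \<equiv> gM G"
abbreviation "T \<equiv> gT G"
abbreviation "D \<equiv> dcomm G"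

lemma EE: "E k * E l = (if k = l then E k else 0)"
  using path_sys by (simp add: path_system_def)
lemma EP: "E (Suc k) * P k = P k" "P k * E k = P k"
  using path_sys by (simp_all add: path_system_def)
lemma EM: "E k * M (Suc k) = M (Suc k)" "M (Suc k) * E (Suc k) = M (Suc k)"
  using path_sys by (simp_all add: path_system_def)
lemma ET: "1 \<le> i \<Longrightarrow> i < k \<Longrightarrow> E k * T k i = T k i" "1 \<le> i \<Longrightarrow> i < k \<Longrightarrow> T k i * E k = T k i"
  using path_sys by (simp_all add: path_system_def)

lemma EE_l: "E k * (E k * x) = E k * x"
  by (simp add: EE flip: mult.assoc)
lemma EP_l: "E (Suc k) * (P k * x) = P k * x" "P k * (E k * x) = P k * x"
  by (simp_all add: EP flip: mult.assoc)
lemma EM_l: "E k * (M (Suc k) * x) = M (Suc k) * x" "M (Suc k) * (E (Suc k) * x) = M (Suc k) * x"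
  by (simp_all add: EM flip: mult.assoc)
lemma ET_l: "1 \<le> i \<Longrightarrow> i < k \<Longrightarrow> E k * (T k i * x) = T k i * x" "1 \<le> i \<Longrightarrow> i < k \<Longrightarrow> T k i * (E k * x) = T k i * x"
  by (simp_all add: ET flip: mult.assoc)

lemma rel_eq: "x - y \<in> dyck_rels c G \<Longrightarrow> x = y" using rels[of "x - y"] by simp

lemma T_quad: "1 \<le> i \<Longrightarrow> i < k \<Longrightarrow> T k i * T k i = c \<cdot> E k - (c - 1) \<cdot> T k i"
proof -
  assume i: "1 \<le> i" "i < k"
  have "(T k i - E k) * (T k i + c \<cdot> E k) = 0"
    by (rule rels[OF dyck_relsI(1)[OF i]])
  then have q: "T k i * T k i + c \<cdot> T k i - T k i - c \<cdot> E k = 0"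
    using i by (simp add: algebra_simps ET EE smul_mult_right[symmetric] smul_diff_right)
  have d: "(c - 1) \<cdot> T k i = c \<cdot> T k i - T k i"
    using smul_add_left[of "c - 1" 1 "T k i"] by (simp add: smul_one eq_diff_eq)
  show ?thesis unfolding d using q by (simp add: algebra_simps)
qed

lemma T_braid: "1 \<le> i \<Longrightarrow> Suc i < k \<Longrightarrow> T k i * (T k (Suc i) * (T k i * x)) = T k (Suc i) * (T k i * (T k (Suc i) * x))"
proof -
  assume i: "1 \<le> i" "Suc i < k"
  have "T k i * T k (i + 1) * T k i = T k (i + 1) * T k i * T k (i + 1)"
    by (rule rel_eq[OF dyck_relsI(2)]) (use i in auto)
  then have "T k i * T k (i + 1) * T k i * x = T k (i + 1) * T k i * T k (i + 1) * x" by (rule arg_cong)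
  then show ?thesis by (simp add: mult.assoc)
qed

lemma T_far: "1 \<le> i \<Longrightarrow> i < k \<Longrightarrow> 1 \<le> j \<Longrightarrow> j < k \<Longrightarrow> Suc i < j \<or> Suc j < i \<Longrightarrow>
  T k i * (T k j * x) = T k j * (T k i * x)"
proof -
  assume i: "1 \<le> i" "i < k" "1 \<le> j" "j < k" "Suc i < j \<or> Suc j < i"
  have "T k i * T k j = T k j * T k i"
    by (rule rel_eq[OF dyck_relsI(3)]) (use i in auto)
  then have "T k i * T k j * x = T k j * T k i * x" by (rule arg_cong)
  then show ?thesis by (simp add: mult.assoc)
qed

lemma T_M: "1 \<le> i \<Longrightarrow> i < k \<Longrightarrow> T k i * (M (Suc k) * x) = M (Suc k) * (T (Suc k) i * x)"
proof -
  assume i: "1 \<le> i" "i < k"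
  have "T (Suc k - 1) i * M (Suc k) = M (Suc k) * T (Suc k) i"
    by (rule rel_eq[OF dyck_relsI(4)]) (use i in auto)
  then have "T (Suc k - 1) i * M (Suc k) * x = M (Suc k) * T (Suc k) i * x" by (rule arg_cong)
  then show ?thesis by (simp add: mult.assoc)
qed

lemma P_T: "1 \<le> i \<Longrightarrow> i < k \<Longrightarrow> P k * (T k i * x) = T (Suc k) (Suc i) * (P k * x)"
proof -
  assume i: "1 \<le> i" "i < k"
  have "P k * T k i = T (k + 1) (i + 1) * P k"
    by (rule rel_eq[OF dyck_relsI(5)]) (use i in auto)
  then have "P k * T k i * x = T (k + 1) (i + 1) * P k * x" by (rule arg_cong)
  then show ?thesis by (simp add: mult.assoc)
qed

lemma T_P_P: "T (Suc (Suc k)) 1 * (P (Suc k) * (P k * x)) = P (Suc k) * (P k * x)"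
proof -
  have "T (k + 2) 1 * P (k + 1) * P k = P (k + 1) * P k"
    by (rule rel_eq[OF dyck_relsI(6)])
  then have "T (k + 2) 1 * P (k + 1) * P k * x = P (k + 1) * P k * x" by (rule arg_cong)
  then show ?thesis by (simp add: mult.assoc numeral_2_eq_2)
qed

lemma M_M_T: "M (Suc k) * (M (Suc (Suc k)) * (T (Suc (Suc k)) (Suc k) * x)) = M (Suc k) * (M (Suc (Suc k)) * x)"
proof -
  have "M (Suc (Suc k) - 1) * M (Suc (Suc k)) * T (Suc (Suc k)) (Suc (Suc k) - 1) = M (Suc (Suc k) - 1) * M (Suc (Suc k))"
    by (rule rel_eq[OF dyck_relsI(7)]) simp
  then have "M (Suc (Suc k) - 1) * M (Suc (Suc k)) * T (Suc (Suc k)) (Suc (Suc k) - 1) * x = M (Suc (Suc k) - 1) * M (Suc (Suc k)) * x"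
    by (rule arg_cong)
  then show ?thesis by (simp add: mult.assoc)
qed

lemma M_D_T: "M (Suc (Suc k)) * (D (Suc (Suc k)) * (T (Suc (Suc k)) (Suc k) * x)) = c \<cdot> (D (Suc k) * (M (Suc (Suc k)) * x))"
proof -
  have "M (Suc (Suc k)) * D (Suc (Suc k)) * T (Suc (Suc k)) (Suc (Suc k) - 1) = c \<cdot> (D (Suc (Suc k) - 1) * M (Suc (Suc k)))"
    by (rule rel_eq[OF dyck_relsI(8)]) simp
  then have "M (Suc (Suc k)) * D (Suc (Suc k)) * T (Suc (Suc k)) (Suc (Suc k) - 1) * x = c \<cdot> (D (Suc (Suc k) - 1) * M (Suc (Suc k))) * x"
    by (rule arg_cong)
  then show ?thesis by (simp add: mult.assoc smul_mult_left[symmetric])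
qed

lemma T_D_P: "1 \<le> k \<Longrightarrow> T (Suc k) 1 * (D (Suc k) * (P k * x)) = c \<cdot> (P k * (D k * x))"
proof -
  assume k: "1 \<le> k"
  have "T (k + 1) 1 * D (k + 1) * P k = c \<cdot> (P k * D k)"
    by (rule rel_eq[OF dyck_relsI(9)]) (rule k)
  then have "T (k + 1) 1 * D (k + 1) * P k * x = c \<cdot> (P k * D k) * x" by (rule arg_cong)
  then show ?thesis by (simp add: mult.assoc smul_mult_left[symmetric])
qed

text \<open>The inverse of T_i in the corner algebra, read off from (T - 1)(T + c) = 0. Unlike the
  definite description it is visibly linear in T.\<close>

definition Ti :: "nat \<Rightarrow> nat \<Rightarrow> 'a" where "Ti k i = inverse c \<cdot> (T k i + (c - 1) \<cdot> E k)"

lemma cc [simp]: "c \<cdot> inverse c \<cdot> x = x" "inverse c \<cdot> c \<cdot> x = x"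
  using c0 by (simp_all flip: smul_assoc add: smul_one)

lemma T_Ti_mult: assumes "1 \<le> i" "i < k" shows "T k i * Ti k i = E k" "Ti k i * T k i = E k"
  using assms by (simp_all add: Ti_def smul_mult_left[symmetric] smul_mult_right[symmetric]
      distrib_left distrib_right T_quad ET)

lemma E_Ti: assumes "1 \<le> i" "i < k" shows "E k * Ti k i = Ti k i" "Ti k i * E k = Ti k i"
  using assms by (simp_all add: Ti_def smul_mult_left[symmetric] smul_mult_right[symmetric]
      distrib_left distrib_right EE ET)

lemma gTinv_eq: assumes i: "1 \<le> i" "i < k" shows "gTinv G k i = Ti k i"
  unfolding gTinv_def corner_inv_def
proof (rule the_equality)
  show "E k * Ti k i = Ti k i \<and> Ti k i * E k = Ti k i \<and> T k i * Ti k i = E k \<and> Ti k i * T k i = E k"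
    using T_Ti_mult[OF i] E_Ti[OF i] by simp
  fix y assume y: "E k * y = y \<and> y * E k = y \<and> T k i * y = E k \<and> y * T k i = E k"
  then have "y = y * (T k i * Ti k i)" using T_Ti_mult[OF i] by simp
  also have "\<dots> = Ti k i" using y E_Ti[OF i] by (simp flip: mult.assoc)
  finally show "y = Ti k i" .
qed

text \<open>Identities are stated for elements of \<open>Mod k = e\<^sub>kA\<close>, on which \<open>T\<^sub>i\<close> and \<open>Ti\<close> are mutually inverse.\<close>

definition Mod :: "nat \<Rightarrow> 'a set" where "Mod k = {x. E k * x = x}"

lemma Mod_E: "x \<in> Mod k \<Longrightarrow> E k * x = x" by (simp add: Mod_def)
lemma Mod_T [simp]: "1 \<le> i \<Longrightarrow> i < k \<Longrightarrow> T k i * x \<in> Mod k" by (simp add: Mod_def ET_l)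
lemma Mod_Ti [simp]: "1 \<le> i \<Longrightarrow> i < k \<Longrightarrow> Ti k i * x \<in> Mod k"
  by (simp add: Mod_def E_Ti flip: mult.assoc)
lemma Mod_P [simp]: "P k * x \<in> Mod (Suc k)" by (simp add: Mod_def EP_l)
lemma Mod_M [simp]: "M (Suc k) * x \<in> Mod k" by (simp add: Mod_def EM_l)
lemma Mod_0 [simp]: "0 \<in> Mod k" by (simp add: Mod_def)
lemma Mod_add: "x \<in> Mod k \<Longrightarrow> y \<in> Mod k \<Longrightarrow> x + y \<in> Mod k" by (simp add: Mod_def distrib_left)
lemma Mod_diff: "x \<in> Mod k \<Longrightarrow> y \<in> Mod k \<Longrightarrow> x - y \<in> Mod k" by (simp add: Mod_def right_diff_distrib)
lemma Mod_smul: "x \<in> Mod k \<Longrightarrow> a \<cdot> x \<in> Mod k" by (simp add: Mod_def smul_mult_right[symmetric])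
lemma Mod_Ex [simp]: "E k * x \<in> Mod k" by (simp add: Mod_def EE_l)
lemma T_Ti [simp]: "1 \<le> i \<Longrightarrow> i < k \<Longrightarrow> x \<in> Mod k \<Longrightarrow> T k i * (Ti k i * x) = x"
  "1 \<le> i \<Longrightarrow> i < k \<Longrightarrow> x \<in> Mod k \<Longrightarrow> Ti k i * (T k i * x) = x"
  by (simp_all add: T_Ti_mult Mod_E flip: mult.assoc)

text \<open>Commutation with T passes to the inverse because the inverse is a linear combination of
  T and the idempotent.\<close>

lemma Ti_lin:
  assumes "a * (E k * x) = a * x" "a * (T k i * x) = T k' i' * (a * x)" "E k' * (a * x) = a * x" "E k * x = x"
  shows "a * (Ti k i * x) = Ti k' i' * (a * x)"
  using assms by (simp add: Ti_def smul_mult_left[symmetric] smul_mult_right[symmetric] distrib_left distrib_right)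

lemma Ti_far: "1 \<le> i \<Longrightarrow> i < k \<Longrightarrow> 1 \<le> j \<Longrightarrow> j < k \<Longrightarrow> Suc i < j \<or> Suc j < i \<Longrightarrow> x \<in> Mod k \<Longrightarrow>
  T k i * (Ti k j * x) = Ti k j * (T k i * x)"
  by (rule Ti_lin) (simp_all add: ET_l Mod_E, rule T_far, simp_all)

lemma P_Ti: "1 \<le> i \<Longrightarrow> i < k \<Longrightarrow> x \<in> Mod k \<Longrightarrow> P k * (Ti k i * x) = Ti (Suc k) (Suc i) * (P k * x)"
  by (rule Ti_lin) (simp_all add: EP_l P_T Mod_E)

lemma M_Ti: "1 \<le> i \<Longrightarrow> i < k \<Longrightarrow> x \<in> Mod (Suc k) \<Longrightarrow> M (Suc k) * (Ti (Suc k) i * x) = Ti k i * (M (Suc k) * x)"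
  by (rule Ti_lin) (simp_all add: EM_l T_M Mod_E)

text \<open>T_1 ... T_n as a map on the algebra: without a unit, the empty word has no uniform
  element to denote it. \<open>Wi\<close> is its inverse T_n^-1 ... T_1^-1.\<close>

primrec W :: "nat \<Rightarrow> nat \<Rightarrow> 'a \<Rightarrow> 'a" where
  "W k 0 x = x" | "W k (Suc n) x = W k n (T k (Suc n) * x)"

primrec Wi :: "nat \<Rightarrow> nat \<Rightarrow> 'a \<Rightarrow> 'a" where
  "Wi k 0 x = x" | "Wi k (Suc n) x = Ti k (Suc n) * Wi k n x"

lemma Mod_W [simp]: "n < k \<Longrightarrow> x \<in> Mod k \<Longrightarrow> W k n x \<in> Mod k"
  by (induction n arbitrary: x) simp_all
lemma Mod_Wi [simp]: "n < k \<Longrightarrow> x \<in> Mod k \<Longrightarrow> Wi k n x \<in> Mod k"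
  by (induction n) simp_all
lemma W_Wi [simp]: "n < k \<Longrightarrow> x \<in> Mod k \<Longrightarrow> W k n (Wi k n x) = x"
  by (induction n) simp_all
lemma Wi_W [simp]: "n < k \<Longrightarrow> x \<in> Mod k \<Longrightarrow> Wi k n (W k n x) = x"
  by (induction n arbitrary: x) simp_all

lemma Wi_smul: "Wi k n (a \<cdot> x) = a \<cdot> Wi k n x"
  by (induction n) (simp_all add: smul_mult_right[symmetric])

lemma W_far: "Suc n < j \<Longrightarrow> j < k \<Longrightarrow> W k n (T k j * x) = T k j * W k n x"
  by (induction n arbitrary: x) (simp_all add: T_far)

lemma W_T: "1 \<le> i \<Longrightarrow> i < n \<Longrightarrow> n < k \<Longrightarrow> W k n (T k i * x) = T k (Suc i) * W k n x"
proof (induction n arbitrary: x)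
  case (Suc n)
  show ?case
  proof (cases "i = n")
    case True
    then obtain m where m: "n = Suc m" using Suc.prems by (cases n) auto
    show ?thesis unfolding True m W.simps using Suc.prems True m
      by (subst T_braid) (simp_all add: W_far)
  next
    case False
    then show ?thesis using Suc by (simp add: T_far[of "Suc n" k i x])
  qed
qed simp

lemma Wi_T: "1 \<le> i \<Longrightarrow> i < n \<Longrightarrow> n < k \<Longrightarrow> x \<in> Mod k \<Longrightarrow> Wi k n (T k (Suc i) * x) = T k i * Wi k n x"
  using W_T[of i n k "Wi k n x"] Wi_W[of n k "T k i * Wi k n x"] by simp

lemma W_W: "Suc n < k \<Longrightarrow> T k 1 * W k (Suc n) (W k n x) = W k (Suc n) (W k n (T k (Suc n) * x))"
proof (induction n arbitrary: x)
  case (Suc n)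
  have eq: "W k (Suc (Suc n)) (W k (Suc n) x) = W k (Suc n) (W k n (T k (Suc (Suc n)) * (T k (Suc n) * x)))" for x
    using W_far[of n "Suc (Suc n)" k] Suc.prems by simp
  show ?case unfolding eq using Suc.IH Suc.prems T_braid[of "Suc n" k] by simp
qed simp

lemma M_W: "n < k \<Longrightarrow> M (Suc k) * W (Suc k) n x = W k n (M (Suc k) * x)"
  by (induction n arbitrary: x) (simp_all add: T_M)

lemma M_Wi: "n < k \<Longrightarrow> x \<in> Mod (Suc k) \<Longrightarrow> M (Suc k) * Wi (Suc k) n x = Wi k n (M (Suc k) * x)"
  by (induction n) (simp_all add: M_Ti)

subsection \<open>The elements \<open>y\<^sub>i\<close>\<close>

text \<open>Equals T_1 ... T_(k-1) y_k, so facts on y_k are facts on the commutator up to an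
  invertible word.\<close>

definition phi :: "nat \<Rightarrow> 'a" where "phi k = (1 / (c - 1)) \<cdot> D k"

lemma D_phi: "D k * x = (c - 1) \<cdot> (phi k * x)"
  using c1 by (simp add: phi_def smul_mult_left[symmetric] smul_assoc[symmetric] smul_one)

lemma ED: "E (Suc k) * D (Suc k) = D (Suc k)" "D (Suc k) * E (Suc k) = D (Suc k)"
  by (simp_all add: dcomm_def right_diff_distrib left_diff_distrib EP_l EM_l EP EM mult.assoc)

lemma Mod_phi [simp]: "1 \<le> k \<Longrightarrow> phi k * x \<in> Mod k"
  by (cases k) (simp_all add: phi_def Mod_def smul_mult_left[symmetric] smul_mult_right[symmetric] ED flip: mult.assoc)

lemma D_T: "1 \<le> i \<Longrightarrow> Suc i < k \<Longrightarrow> D k * (T k i * x) = T k (Suc i) * (D k * x)"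
  by (cases k) (simp_all add: dcomm_def left_diff_distrib right_diff_distrib mult.assoc P_T T_M[symmetric])

lemma phi_T: "1 \<le> i \<Longrightarrow> Suc i < k \<Longrightarrow> phi k * (T k i * x) = T k (Suc i) * (phi k * x)"
  by (simp add: phi_def smul_mult_left[symmetric] smul_mult_right[symmetric] D_T)

abbreviation Y :: "nat \<Rightarrow> nat \<Rightarrow> 'a" where "Y \<equiv> ygen c G"

lemma Y_last: "1 \<le> k \<Longrightarrow> Y k k * x = Wi k (k - 1) (phi k * x)"
proof -
  assume k: "1 \<le> k"
  have f: "foldr (\<lambda>j x. gTinv G k j * x) (rev [1..<Suc n]) z * x = Wi k n (z * x)" if "n < k" for n z
    using that by (induction n) (simp_all add: gTinv_eq mult.assoc)
  obtain m where m: "k = Suc m" using k by (cases k) auto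
  show ?thesis using f[of m "D k"] unfolding m
    by (subst ygen.simps) (simp add: smul_mult_left[symmetric] phi_def Wi_smul)
qed

lemma Y_rec: "i < k \<Longrightarrow> Y k i * x = inverse c \<cdot> (T k i * (Y k (Suc i) * (T k i * x)))"
  by (subst ygen.simps) (simp add: smul_mult_left[symmetric] mult.assoc)

lemma Mod_Y [simp]: "1 \<le> i \<Longrightarrow> i \<le> k \<Longrightarrow> Y k i * x \<in> Mod k"
  by (cases "i = k") (simp_all add: Y_last Y_rec Mod_smul)

lemma T_Y_Suc: "1 \<le> i \<Longrightarrow> i < k \<Longrightarrow> x \<in> Mod k \<Longrightarrow> T k i * (Y k (Suc i) * x) = c \<cdot> (Y k i * (Ti k i * x))"
  by (simp add: Y_rec)

lemma Y_down_induct [consumes 2, case_names last step]: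
  assumes "1 \<le> i" "i \<le> (k::nat)" "1 \<le> k \<Longrightarrow> Q k" "\<And>i. 1 \<le> i \<Longrightarrow> i < k \<Longrightarrow> Q (Suc i) \<Longrightarrow> Q i"
  shows "Q i"
  using assms(2) assms(1)
proof (induction rule: inc_induct)
  case base
  then show ?case by (rule assms(3))
next
  case (step n)
  then show ?case using assms(4)[of n] by simp
qed

lemma Y_T_last: "1 \<le> i \<Longrightarrow> Suc i < k \<Longrightarrow> Y k k * (T k i * x) = T k i * (Y k k * x)"
  using Wi_T[of i "k - 1" k "phi k * x"] by (simp add: Y_last phi_T)

text \<open>Downward induction, since y_i is defined from y_(i+1). The hypothesis covers all larger
  indices because for j = i + 1 the element y_i must be expanded twice, down to y_(i+2).\<close>

lemma Y_T:
  assumes "1 \<le> i" "i \<le> k" "1 \<le> j" "j < k" "j \<noteq> i" "Suc j \<noteq> i"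
  shows "Y k i * (T k j * x) = T k j * (Y k i * x)"
proof -
  have "\<forall>i' j x. i \<le> i' \<and> i' \<le> k \<and> 1 \<le> j \<and> j < k \<and> j \<noteq> i' \<and> Suc j \<noteq> i' \<longrightarrow>
      Y k i' * (T k j * x) = T k j * (Y k i' * x)"
    using assms(1,2)
  proof (induction rule: Y_down_induct)
    case last
    then show ?case by (metis Y_T_last Suc_lessI le_antisym)
  next
    case (step i)
    show ?case
    proof (intro allI impI)
      fix i' j x assume j: "i \<le> i' \<and> i' \<le> k \<and> 1 \<le> j \<and> j < k \<and> j \<noteq> i' \<and> Suc j \<noteq> i'"
      show "Y k i' * (T k j * x) = T k j * (Y k i' * x)"
      proof (cases "i' = i")
        case False
        then show ?thesis using j step(3) by simp
      next
        case i: True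
        show ?thesis
        proof (cases "j = Suc i")
          case False
          then have "Suc i < j \<or> Suc j < i" using j i by auto
          then have far: "T k i * (T k j * z) = T k j * (T k i * z)" for z
            using j step(1,2) by (intro T_far) auto
          have "Y k (Suc i) * (T k j * z) = T k j * (Y k (Suc i) * z)" for z
            using step(3)[rule_format, of "Suc i" j z] j i False step(2) by simp
          then show ?thesis using step(2) i
            by (simp add: Y_rec[of i k] smul_mult_right[symmetric] far)
        next
          case True
          then have k: "Suc i < k" using j by simp
          have IH: "Y k (Suc (Suc i)) * (T k i * x) = T k i * (Y k (Suc (Suc i)) * x)" for x
            using step(1,2) step(3)[rule_format, of "Suc (Suc i)" i] k by simp
          \<comment> \<open>In this form T_(i+1) moves through T_i T_(i+1) by braiding, becomes T_i,
            commutes with y_(i+2), and is braided back.\<close>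
          have rec: "Y k i * z = inverse c \<cdot> inverse c \<cdot> (T k i * (T k (Suc i) * (Y k (Suc (Suc i)) * (T k (Suc i) * (T k i * z)))))" for z
            using k by (simp add: Y_rec[of i k] Y_rec[of "Suc i" k] smul_mult_right[symmetric])
          show ?thesis unfolding i True rec
            using T_braid[OF step(1) k] IH by (simp add: smul_mult_right[symmetric]) (metis T_braid[OF step(1) k] IH)
        qed
      qed
    qed
  qed
  then show ?thesis using assms by blast
qed

lemma Y_Ti:
  assumes "1 \<le> i" "i \<le> k" "1 \<le> j" "j < k" "j \<noteq> i" "Suc j \<noteq> i" "x \<in> Mod k"
  shows "Y k i * (Ti k j * x) = Ti k j * (Y k i * x)"
  using assms by (intro Ti_lin) (simp_all add: Y_T Mod_E)

lemma Wi_far: "Suc n < j \<Longrightarrow> j < k \<Longrightarrow> x \<in> Mod k \<Longrightarrow> Wi k n (T k j * x) = T k j * Wi k n x"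
  by (induction n) (simp_all add: Ti_far)

lemma Wi_diff: "Wi k n (x - y) = Wi k n x - Wi k n y"
  by (induction n) (simp_all add: right_diff_distrib)
lemma W_smul: "W k n (a \<cdot> x) = a \<cdot> W k n x"
  by (induction n arbitrary: x) (simp_all add: smul_mult_right[symmetric])

text \<open>T_i^-1 ... T_1^-1 d_+, the modification of d_+ that commutes with y_i; d_+ itself only
  does so up to conjugation.\<close>

definition Qp :: "nat \<Rightarrow> nat \<Rightarrow> 'a \<Rightarrow> 'a" where "Qp k i x = Wi (Suc k) i (P k * x)"

lemma Mod_Qp [simp]: "i \<le> k \<Longrightarrow> Qp k i x \<in> Mod (Suc k)" by (simp add: Qp_def)

lemma Qp_T_less: "1 \<le> j \<Longrightarrow> j < i \<Longrightarrow> i \<le> k \<Longrightarrow> Qp k i (T k j * x) = T (Suc k) j * Qp k i x"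
  by (simp add: Qp_def P_T Wi_T)

lemma Qp_Ti_less: "1 \<le> j \<Longrightarrow> j < i \<Longrightarrow> i \<le> k \<Longrightarrow> x \<in> Mod k \<Longrightarrow> Qp k i (Ti k j * x) = Ti (Suc k) j * Qp k i x"
  using Qp_T_less[of j i k "Ti k j * x"] T_Ti(2)[of j "Suc k" "Qp k i (Ti k j * x)"] by simp

lemma Qp_Wi: "n < i \<Longrightarrow> i \<le> k \<Longrightarrow> x \<in> Mod k \<Longrightarrow> Qp k i (Wi k n x) = Wi (Suc k) n (Qp k i x)"
  by (induction n) (simp_all add: Qp_Ti_less)

lemma Qp_T_eq:
  assumes i: "1 \<le> i" "i < k"
  shows "Qp k i (T k i * x) = T (Suc k) (Suc i) * (T (Suc k) i * Qp k (Suc i) x)"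
proof -
  obtain l where l: "i = Suc l" using i by (cases i) auto
  define z where "z = Wi (Suc k) l (P k * x)"
  define v where "v = Ti (Suc k) (Suc i) * (Ti (Suc k) i * z)"
  have z: "z \<in> Mod (Suc k)" using i l by (simp add: z_def)
  have v: "v \<in> Mod (Suc k)" using i by (simp add: v_def)
  have zv: "z = T (Suc k) i * (T (Suc k) (Suc i) * v)" using i z by (simp add: v_def)
  have "Qp k i (T k i * x) = Ti (Suc k) i * (T (Suc k) (Suc i) * z)"
    using i l by (simp add: Qp_def P_T z_def Wi_far)
  also have "\<dots> = T (Suc k) (Suc i) * (T (Suc k) i * v)"
    unfolding zv using i v by (subst T_braid[symmetric]) auto
  finally show ?thesis by (simp add: v_def z_def Qp_def l)
qed

text \<open>For i = k this is the last defining relation of the algebra, after removing the words T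
  from the commutator; downwards it propagates through \<open>Qp_T_eq\<close>.\<close>

lemma Qp_Y: "1 \<le> i \<Longrightarrow> i \<le> k \<Longrightarrow> \<forall>x\<in>Mod k. Qp k i (Y k i * x) = Y (Suc k) i * Qp k i x"
proof (induction rule: Y_down_induct)
  case last
  show ?case
  proof
    fix x assume x: "x \<in> Mod k"
    obtain l where l: "k = Suc l" using last by (cases k) auto
    define u where "u = phi (Suc k) * (P k * x)"
    define v where "v = Wi (Suc k) l (Wi (Suc k) k u)"
    have u: "u \<in> Mod (Suc k)" by (simp add: u_def)
    have v: "v \<in> Mod (Suc k)" using u l by (simp add: v_def)
    \<comment> \<open>The relation T_1 (d_+d_- - d_-d_+) d_+ = c d_+ (d_+d_- - d_-d_+), divided by
      c(c - 1). Both scalars are nonzero.\<close>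
    have Pphi: "P k * (phi k * x) = inverse c \<cdot> (T (Suc k) 1 * u)"
      using T_D_P[OF last, of x] by (simp add: u_def phi_def smul_mult_left[symmetric] smul_mult_right[symmetric])
        (metis cc(2) smul_assoc mult.commute)
    have uv: "u = W (Suc k) k (W (Suc k) l v)" using u l unfolding v_def by simp
    have "T (Suc k) 1 * u = W (Suc k) k (W (Suc k) l (T (Suc k) k * v))"
      unfolding uv l by (rule W_W) simp
    then have key: "Wi (Suc k) l (Wi (Suc k) k (T (Suc k) 1 * u)) = T (Suc k) k * v"
      using l v last by simp
    have "Qp k k (Y k k * x) = Wi (Suc k) l (Qp k k (phi k * x))"
      using l last by (simp add: Y_last Qp_Wi)
    also have "\<dots> = inverse c \<cdot> (T (Suc k) k * v)"
      by (simp only: Qp_def Pphi Wi_smul key)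
    also have "v = Y (Suc k) (Suc k) * Wi (Suc k) l (P k * x)"
    proof -
      have a: "Y (Suc k) (Suc k) * (Ti (Suc k) j * z) = Ti (Suc k) j * (Y (Suc k) (Suc k) * z)"
        if "1 \<le> j" "j < k" "z \<in> Mod (Suc k)" for j z
        using that by (intro Y_Ti) auto
      have "Y (Suc k) (Suc k) * Wi (Suc k) n (P k * x) = Wi (Suc k) n (Y (Suc k) (Suc k) * (P k * x))" if "n < k" for n
        using that by (induction n) (simp_all add: a)
      then show ?thesis using l by (simp add: v_def u_def Y_last)
    qed
    also have "Wi (Suc k) l (P k * x) = T (Suc k) k * Qp k k x"
      using l last by (simp add: Qp_def)
    also have "inverse c \<cdot> (T (Suc k) k * (Y (Suc k) (Suc k) * (T (Suc k) k * Qp k k x))) = Y (Suc k) k * Qp k k x"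
      by (simp add: Y_rec[of k "Suc k"])
    finally show "Qp k k (Y k k * x) = Y (Suc k) k * Qp k k x" .
  qed
next
  case (step i)
  show ?case
  proof
    fix x assume x: "x \<in> Mod k"
    have "Qp k i (Y k i * x) = inverse c \<cdot> Qp k i (T k i * (Y k (Suc i) * (T k i * x)))"
      using step by (simp add: Y_rec[of i k] Qp_def smul_mult_right[symmetric] Wi_smul)
    also have "\<dots> = inverse c \<cdot> (T (Suc k) (Suc i) * (T (Suc k) i * (Y (Suc k) (Suc i) * (T (Suc k) i * Qp k (Suc i) x))))"
      using step x by (simp add: Qp_T_eq Qp_T_less)
    also have "\<dots> = T (Suc k) (Suc i) * (Y (Suc k) i * Qp k (Suc i) x)"
      using step by (simp add: Y_rec[of i "Suc k"] smul_mult_right[symmetric])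
    also have "\<dots> = Y (Suc k) i * (T (Suc k) (Suc i) * Qp k (Suc i) x)"
      using step by (intro Y_T[symmetric]) auto
    also have "T (Suc k) (Suc i) * Qp k (Suc i) x = Qp k i x"
      using step by (simp add: Qp_def)
    finally show "Qp k i (Y k i * x) = Y (Suc k) i * Qp k i x" .
  qed
qed

lemma P_Y: "1 \<le> i \<Longrightarrow> i \<le> k \<Longrightarrow> x \<in> Mod k \<Longrightarrow>
    P k * (Y k i * x) = W (Suc k) i (Y (Suc k) i * Wi (Suc k) i (P k * x))"
  using Qp_Y[of i k] W_Wi[of i "Suc k" "P k * (Y k i * x)"] by (simp add: Qp_def)

lemma M_Y: "1 \<le> i \<Longrightarrow> i \<le> k \<Longrightarrow> \<forall>x\<in>Mod (Suc k). M (Suc k) * (Y (Suc k) i * x) = Y k i * (M (Suc k) * x)"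
proof (induction rule: Y_down_induct)
  case last
  obtain l where l: "k = Suc l" using last by (cases k) auto
  show ?case
  proof
    fix x assume x: "x \<in> Mod (Suc k)"
    have "Y (Suc k) k * x = inverse c \<cdot> Wi (Suc k) l (phi (Suc k) * (T (Suc k) k * x))"
      unfolding l by (simp add: Y_rec[of "Suc l" "Suc (Suc l)"] Y_last)
    then have "M (Suc k) * (Y (Suc k) k * x) = inverse c \<cdot> Wi k l (M (Suc k) * (phi (Suc k) * (T (Suc k) k * x)))"
      using l by (simp add: smul_mult_right[symmetric] M_Wi)
    also have "M (Suc k) * (phi (Suc k) * (T (Suc k) k * x)) = c \<cdot> (phi k * (M (Suc k) * x))"
      unfolding l phi_def
      by (simp add: smul_mult_left[symmetric] smul_mult_right[symmetric] M_D_T) (metis smul_assoc mult.commute)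
    finally show "M (Suc k) * (Y (Suc k) k * x) = Y k k * (M (Suc k) * x)"
      using l by (simp add: Wi_smul Y_last)
  qed
next
  case (step i)
  then show ?case by (simp add: Y_rec[of i k] Y_rec[of i "Suc k"] smul_mult_right[symmetric] T_M[symmetric])
qed

text \<open>Both d_+d_- and d_-d_+ commute with y_i once T_i^-1 ... T_1^-1 stands in front, by
  \<open>Qp_Y\<close> and \<open>M_Y\<close>; hence so does their difference. Lengthening the word
  to T_(k-1)^-1 ... T_1^-1 makes y_k out of \<open>phi\<close> and shows that the y_i
  commute.\<close>

lemma phi_Y:
  assumes "1 \<le> i" "i < k" "x \<in> Mod k"
  shows "Wi k i (phi k * (Y k i * x)) = Y k i * Wi k i (phi k * x)"
proof -
  obtain l where l: "k = Suc l" using assms by (cases k) auto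
  have D: "D k * z = P l * (M k * z) - M (Suc k) * (P k * z)" for z
    by (simp add: dcomm_def l left_diff_distrib mult.assoc)
  have 1: "Wi k i (P l * (M k * (Y k i * x))) = Y k i * Wi k i (P l * (M k * x))"
    using M_Y[of i l] Qp_Y[of i l] assms l by (simp add: Qp_def)
  have "Wi k i (M (Suc k) * (P k * (Y k i * x))) = M (Suc k) * Qp k i (Y k i * x)"
    using assms by (simp add: Qp_def M_Wi)
  also have "\<dots> = Y k i * (M (Suc k) * Qp k i x)"
    using assms Qp_Y[of i k] M_Y[of i k] by simp
  also have "\<dots> = Y k i * Wi k i (M (Suc k) * (P k * x))"
    using assms by (simp add: Qp_def M_Wi)
  finally show ?thesis
    using 1 by (simp add: phi_def smul_mult_left[symmetric] smul_mult_right[symmetric] Wi_smul D Wi_diff right_diff_distrib)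
qed

lemma Y_Y_last:
  assumes "1 \<le> i" "i < k" "x \<in> Mod k"
  shows "Y k k * (Y k i * x) = Y k i * (Y k k * x)"
proof -
  have "i \<le> n \<Longrightarrow> n < k \<Longrightarrow> Wi k n (phi k * (Y k i * x)) = Y k i * Wi k n (phi k * x)" for n
  proof (induction n rule: dec_induct)
    case base
    then show ?case using assms by (simp add: phi_Y)
  next
    case (step n)
    then show ?case using assms by (simp add: Y_Ti)
  qed
  from this[of "k - 1"] show ?thesis using assms by (simp add: Y_last)
qed

lemma Y_Y_less:
  assumes "1 \<le> i" "i < j" "j \<le> k"
  shows "\<forall>x\<in>Mod k. Y k j * (Y k i * x) = Y k i * (Y k j * x)"
proof -
  have "1 \<le> j" using assms by simp
  from this assms(3) have "\<forall>i x. 1 \<le> i \<and> i < j \<and> x \<in> Mod k \<longrightarrow> Y k j * (Y k i * x) = Y k i * (Y k j * x)"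
  proof (induction rule: Y_down_induct)
    case last
    then show ?case using Y_Y_last by blast
  next
    case (step j)
    then show ?case
      by (auto simp: Y_rec[of j k] smul_mult_right[symmetric] Y_T[symmetric])
  qed
  then show ?thesis using assms by blast
qed

lemma Y_Y: "1 \<le> i \<Longrightarrow> i \<le> k \<Longrightarrow> 1 \<le> j \<Longrightarrow> j \<le> k \<Longrightarrow> x \<in> Mod k \<Longrightarrow>
    Y k i * (Y k j * x) = Y k j * (Y k i * x)"
  using Y_Y_less[of i j k] Y_Y_less[of j i k] by (cases i j rule: linorder_cases) auto

lemma T_eq: "1 \<le> i \<Longrightarrow> i < k \<Longrightarrow> x \<in> Mod k \<Longrightarrow> T k i * x = c \<cdot> (Ti k i * x) - (c - 1) \<cdot> x"
  by (simp add: Ti_def smul_mult_left[symmetric] distrib_right Mod_E)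

lemma Ti_Y: "1 \<le> i \<Longrightarrow> i < k \<Longrightarrow> x \<in> Mod k \<Longrightarrow> c \<cdot> (Ti k i * (Y k i * x)) = Y k (Suc i) * (T k i * x)"
  by (simp add: Y_rec[of i k] smul_mult_right[symmetric])

lemma T_Y_same: "1 \<le> i \<Longrightarrow> i < k \<Longrightarrow> x \<in> Mod k \<Longrightarrow>
    T k i * (Y k i * x) = Y k (Suc i) * (T k i * x) - (c - 1) \<cdot> (Y k i * x)"
  by (simp add: T_eq[of i k "Y k i * x"] Ti_Y)

end

context dyck_system begin

section \<open>The module generated by the vertex \<open>0\<close>\<close>

primrec pw :: "nat \<Rightarrow> 'a" where
  "pw 0 = E 0" | "pw (Suc m) = P m * pw m"

lemma Mod_pw [simp]: "pw k * x \<in> Mod k"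
  by (cases k) (simp_all add: mult.assoc)

lemma T_pw: "1 \<le> i \<Longrightarrow> i < k \<Longrightarrow> T k i * (pw k * x) = pw k * x"
proof (induction k arbitrary: i)
  case (Suc k)
  show ?case
  proof (cases "i = 1")
    case True
    then obtain l where "k = Suc l" using Suc.prems by (cases k) auto
    then show ?thesis using True T_P_P[of l] by (simp add: mult.assoc)
  next
    case False
    then obtain j where j: "i = Suc j" "1 \<le> j" using Suc.prems by (cases i) auto
    then show ?thesis using Suc P_T[of j k "pw k * x"] by (simp add: mult.assoc)
  qed
qed simp

definition ypow :: "nat \<Rightarrow> nat \<Rightarrow> nat \<Rightarrow> 'a \<Rightarrow> 'a" where "ypow k i n = ((*) (Y k i) ^^ n)"

lemma ypow_0 [simp]: "ypow k i 0 x = x" by (simp add: ypow_def)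
lemma ypow_Suc: "ypow k i (Suc n) x = Y k i * ypow k i n x" by (simp add: ypow_def)
lemma ypow_Suc_right: "ypow k i (Suc n) x = ypow k i n (Y k i * x)"
  by (simp add: ypow_def funpow_Suc_right del: funpow.simps)
lemma Mod_ypow [simp]: "1 \<le> i \<Longrightarrow> i \<le> k \<Longrightarrow> x \<in> Mod k \<Longrightarrow> ypow k i n x \<in> Mod k"
  by (cases n) (simp_all add: ypow_Suc)
lemma ypow_commute:
  "(\<And>z. z \<in> Mod k \<Longrightarrow> f (Y k i * z) = Y k' i' * f z) \<Longrightarrow> 1 \<le> i \<Longrightarrow> i \<le> k \<Longrightarrow> x \<in> Mod k \<Longrightarrow>
    f (ypow k i n x) = ypow k' i' n (f x)"
  by (induction n) (simp_all add: ypow_Suc)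

lemma ypow_Y: "1 \<le> i \<Longrightarrow> i \<le> k \<Longrightarrow> 1 \<le> j \<Longrightarrow> j \<le> k \<Longrightarrow> x \<in> Mod k \<Longrightarrow>
    Y k j * ypow k i n x = ypow k i n (Y k j * x)"
  by (rule ypow_commute[where f = "\<lambda>z. Y k j * z"]) (simp_all add: Y_Y)

definition eps :: "nat \<Rightarrow> 'a \<Rightarrow> 'a" where "eps n r = M (Suc 0) * ypow (Suc 0) (Suc 0) n (P 0 * r)"

lemma Mod_eps [simp]: "eps n r \<in> Mod 0" by (simp add: eps_def)

lemma ypow_add: "ypow k i n (x + y) = ypow k i n x + ypow k i n y"
  by (induction n) (simp_all add: ypow_Suc distrib_left)
lemma ypow_smul: "ypow k i n (a \<cdot> x) = a \<cdot> ypow k i n x"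
  by (induction n) (simp_all add: ypow_Suc smul_mult_right[symmetric])
lemma eps_add: "eps n (x + y) = eps n x + eps n y"
  by (simp add: eps_def distrib_left ypow_add)
lemma eps_smul: "eps n (a \<cdot> x) = a \<cdot> eps n x"
  by (simp add: eps_def ypow_smul smul_mult_right[symmetric])

text \<open>Closed under applying \<open>eps\<close> on the left, not under multiplication; for
  elements of e_0 A this is multiplication by the element \<open>eps n (E 0)\<close>.\<close>

inductive_set RR :: "'a set" where
  one: "E 0 \<in> RR"
| add: "r \<in> RR \<Longrightarrow> s \<in> RR \<Longrightarrow> r + s \<in> RR"
| smul: "r \<in> RR \<Longrightarrow> a \<cdot> r \<in> RR"
| eps: "r \<in> RR \<Longrightarrow> eps n r \<in> RR"

text \<open>The candidate for e_k A e_0. Closure under T, d_+ and d_- is proved below, and d_- is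
  the difficult one.\<close>

inductive_set NN :: "nat \<Rightarrow> 'a set" for k where
  base: "r \<in> RR \<Longrightarrow> pw k * r \<in> NN k"
| add: "x \<in> NN k \<Longrightarrow> y \<in> NN k \<Longrightarrow> x + y \<in> NN k"
| smul: "x \<in> NN k \<Longrightarrow> a \<cdot> x \<in> NN k"
| y: "x \<in> NN k \<Longrightarrow> 1 \<le> i \<Longrightarrow> i \<le> k \<Longrightarrow> Y k i * x \<in> NN k"

lemma RR_Mod: "r \<in> RR \<Longrightarrow> r \<in> Mod 0"
  by (induction rule: RR.induct) (simp_all add: Mod_add Mod_smul, simp add: Mod_def EE)

lemma NN_Mod: "x \<in> NN k \<Longrightarrow> x \<in> Mod k"
  by (induction rule: NN.induct) (simp_all add: Mod_add Mod_smul)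

lemma NN_diff: "x \<in> NN k \<Longrightarrow> y \<in> NN k \<Longrightarrow> x - y \<in> NN k"
  using NN.add[of x k "(- 1) \<cdot> y"] NN.smul[of y k "- 1"] by (simp add: smul_minus_one)

lemma NN_Ti_from_T:
  assumes "1 \<le> i" "i < k" "x \<in> NN k" "T k i * x \<in> NN k" shows "Ti k i * x \<in> NN k"
proof -
  have "Ti k i * x = inverse c \<cdot> (T k i * x + (c - 1) \<cdot> x)"
    using NN_Mod[OF assms(3)] by (simp add: Ti_def smul_mult_left[symmetric] distrib_right Mod_E)
  then show ?thesis using assms by (simp add: NN.add NN.smul)
qed

lemma NN_T: "x \<in> NN k \<Longrightarrow> 1 \<le> i \<Longrightarrow> i < k \<Longrightarrow> T k i * x \<in> NN k"
proof (induction rule: NN.induct)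
  case (base r)
  then show ?case by (simp add: T_pw NN.base)
next
  case (y x j)
  have x: "x \<in> Mod k" using y NN_Mod by blast
  consider "j = i" | "j = Suc i" | "j \<noteq> i" "Suc i \<noteq> j" by blast
  then show ?case
  proof cases
    case 1
    then show ?thesis using y x by (simp add: T_Y_same NN_diff NN.smul NN.y)
  next
    case 2
    then show ?thesis using y x by (simp add: T_Y_Suc NN.smul NN.y NN_Ti_from_T)
  next
    case 3
    then show ?thesis using y by (simp add: Y_T[symmetric] NN.y)
  qed
qed (simp_all add: distrib_left smul_mult_right[symmetric] NN.add NN.smul)

lemma NN_Ti: "x \<in> NN k \<Longrightarrow> 1 \<le> i \<Longrightarrow> i < k \<Longrightarrow> Ti k i * x \<in> NN k"
  by (simp add: NN_Ti_from_T NN_T)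

lemma NN_W: "x \<in> NN k \<Longrightarrow> n < k \<Longrightarrow> W k n x \<in> NN k"
  by (induction n arbitrary: x) (simp_all add: NN_T)
lemma NN_Wi: "x \<in> NN k \<Longrightarrow> n < k \<Longrightarrow> Wi k n x \<in> NN k"
  by (induction n) (simp_all add: NN_Ti)

lemma NN_P: "x \<in> NN k \<Longrightarrow> P k * x \<in> NN (Suc k)"
proof (induction rule: NN.induct)
  case (base r)
  then show ?case using NN.base[of r "Suc k"] by (simp add: mult.assoc)
next
  case (y x i)
  then show ?case using NN_Mod[of x k] by (simp add: P_Y NN_W NN_Wi NN.y)
qed (simp_all add: distrib_left smul_mult_right[symmetric] NN.add NN.smul)

text \<open>T y_i^n x contains many mixed monomials in y_i and y_(i+1). Subtracting y_i times the
  previous one cancels all but the two terms with the highest powers of y_(i+1).\<close>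

lemma T_ypow_rec:
  assumes i: "1 \<le> i" "i < k" and x: "x \<in> Mod k" "T k i * x = x"
  shows "T k i * ypow k i (Suc n) x - Y k i * (T k i * ypow k i n x) =
    Y k (Suc i) * ypow k (Suc i) n x - c \<cdot> (Y k i * ypow k (Suc i) n x)"
proof (induction n)
  case 0
  have "c \<cdot> (Y k i * x) = (c - 1) \<cdot> (Y k i * x) + Y k i * x"
    using smul_add_left[of "c - 1" 1 "Y k i * x"] by (simp add: smul_one)
  then show ?case using i x by (simp add: ypow_Suc T_Y_same)
next
  case (Suc n)
  let ?u = "Y k i" and ?v = "Y k (Suc i)"
  have m: "1 \<le> i" "i \<le> k" "1 \<le> Suc i" "Suc i \<le> k" using i by auto
  have "T k i * ypow k i (Suc (Suc n)) x - ?u * (T k i * ypow k i (Suc n) x) =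
    ?v * (T k i * ypow k i (Suc n) x - ?u * (T k i * ypow k i n x))"
    using i x m
    by (simp add: ypow_Suc T_Y_same right_diff_distrib smul_mult_right[symmetric] Y_Y[of i k "Suc i"])
  then show ?case unfolding Suc.IH using x m
    by (simp add: ypow_Suc right_diff_distrib smul_mult_right[symmetric] Y_Y[of i k "Suc i"])
qed

text \<open>This is d_-d_+ = d_+d_- - (c - 1) phi behind T_l^-1 ... T_1^-1. On the left, d_+ passes
  the powers of y through \<open>Qp\<close>, and the inverse T_i are absorbed by d_+^(l+2).\<close>

lemma M_T_ypow_pw:
  assumes r: "r \<in> Mod 0"
  shows "M (Suc (Suc l)) * (T (Suc (Suc l)) (Suc l) * ypow (Suc (Suc l)) (Suc l) n (pw (Suc (Suc l)) * r)) =
    Wi (Suc l) l (P l * (M (Suc l) * ypow (Suc l) (Suc l) n (pw (Suc l) * r)))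
      - (c - 1) \<cdot> ypow (Suc l) (Suc l) (Suc n) (pw (Suc l) * r)"
proof -
  let ?k = "Suc l"
  let ?x = "ypow ?k ?k n (pw ?k * r)"
  have Wi_pw: "Wi (Suc ?k) m (pw (Suc ?k) * r) = pw (Suc ?k) * r" if "m < Suc ?k" for m
  proof (use that in \<open>induction m\<close>)
    case (Suc m)
    then have "Wi (Suc ?k) (Suc m) (pw (Suc ?k) * r) = Ti (Suc ?k) (Suc m) * (T (Suc ?k) (Suc m) * (pw (Suc ?k) * r))"
      by (simp add: T_pw del: pw.simps)
    also have "\<dots> = pw (Suc ?k) * r" using Suc.prems by (intro T_Ti) (simp_all del: pw.simps)
    finally show ?case .
  qed simp
  have "Qp ?k ?k ?x = ypow (Suc ?k) ?k n (Qp ?k ?k (pw ?k * r))"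
    by (rule ypow_commute) (use Qp_Y[of ?k ?k] in \<open>simp_all del: pw.simps\<close>)
  also have "Qp ?k ?k (pw ?k * r) = pw (Suc ?k) * r"
    using Wi_pw[of ?k] by (simp add: Qp_def mult.assoc)
  finally have Q: "Qp ?k ?k ?x = ypow (Suc ?k) ?k n (pw (Suc ?k) * r)" .
  have "P ?k * ?x = W (Suc ?k) ?k (Qp ?k ?k ?x)"
    unfolding Qp_def by (rule W_Wi[symmetric]) simp_all
  then have "M (Suc ?k) * (P ?k * ?x) = W ?k l (M (Suc ?k) * (T (Suc ?k) ?k * ypow (Suc ?k) ?k n (pw (Suc ?k) * r)))"
    unfolding Q by (simp add: M_W del: pw.simps)
  then have "Wi ?k l (M (Suc ?k) * (P ?k * ?x)) = M (Suc ?k) * (T (Suc ?k) ?k * ypow (Suc ?k) ?k n (pw (Suc ?k) * r))"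
    by (simp del: pw.simps)
  moreover have "M (Suc ?k) * (P ?k * ?x) = P l * (M ?k * ?x) - (c - 1) \<cdot> (phi ?k * ?x)"
    by (simp add: D_phi[symmetric] dcomm_def left_diff_distrib mult.assoc)
  ultimately show ?thesis
    by (simp add: Wi_diff Wi_smul ypow_Suc Y_last del: pw.simps)
qed

text \<open>Combines the two previous facts; in B(n+1) - y B(n) the terms (c - 1) y^(n+2) cancel.
  The unknown X at vertex l + 2 is thus computed from data at vertex l + 1.\<close>

lemma M_ypow_rec:
  fixes l n :: nat
  assumes r: "r \<in> Mod 0"
  defines "X \<equiv> \<lambda>n. M (Suc (Suc l)) * ypow (Suc (Suc l)) (Suc (Suc l)) n (pw (Suc (Suc l)) * r)"
  defines "B \<equiv> \<lambda>n. Wi (Suc l) l (P l * (M (Suc l) * ypow (Suc l) (Suc l) n (pw (Suc l) * r)))"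
  shows "X (Suc n) - c \<cdot> (Y (Suc l) (Suc l) * X n) = B (Suc n) - Y (Suc l) (Suc l) * B n"
    "X 0 = B 0 - (c - 1) \<cdot> (Y (Suc l) (Suc l) * (pw (Suc l) * r))"
proof -
  let ?K = "Suc (Suc l)" and ?k = "Suc l"
  let ?x = "pw ?K * r"
  have MY: "M ?K * (Y ?K ?k * z) = Y ?k ?k * (M ?K * z)" if "z \<in> Mod ?K" for z
    using M_Y[of ?k ?k] that by simp
  have "X (Suc n) - c \<cdot> (Y ?k ?k * X n) =
     M ?K * (Y ?K ?K * ypow ?K ?K n ?x - c \<cdot> (Y ?K ?k * ypow ?K ?K n ?x))"
    by (simp add: X_def right_diff_distrib smul_mult_right[symmetric] MY ypow_Suc del: pw.simps)
  also have "\<dots> = M ?K * (T ?K ?k * ypow ?K ?k (Suc n) ?x) - Y ?k ?k * (M ?K * (T ?K ?k * ypow ?K ?k n ?x))"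
    by (subst T_ypow_rec[symmetric]) (simp_all add: T_pw right_diff_distrib MY del: pw.simps)
  also have "\<dots> = B (Suc n) - Y ?k ?k * B n"
    unfolding M_T_ypow_pw[OF r] B_def
    by (simp add: right_diff_distrib smul_mult_right[symmetric] ypow_Suc del: pw.simps)
  finally show "X (Suc n) - c \<cdot> (Y (Suc l) (Suc l) * X n) = B (Suc n) - Y (Suc l) (Suc l) * B n" .
  show "X 0 = B 0 - (c - 1) \<cdot> (Y (Suc l) (Suc l) * (pw (Suc l) * r))"
    using M_T_ypow_pw[OF r, of l 0] by (simp add: X_def B_def T_pw ypow_Suc del: pw.simps)
qed

text \<open>Outer induction on the vertex, inner on the exponent, driven by
  \<open>M_ypow_rec\<close>. At the bottom vertex the element is \<open>eps n r\<close>
  itself.\<close>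

lemma NN_M_base: "r \<in> RR \<Longrightarrow> M (Suc l) * ypow (Suc l) (Suc l) n (pw (Suc l) * r) \<in> NN l"
proof (induction l arbitrary: n)
  case 0
  have "P 0 * E 0 * r = P 0 * r" using EP(2)[of 0] by simp
  then have "M (Suc 0) * ypow (Suc 0) (Suc 0) n (pw (Suc 0) * r) = pw 0 * eps n r"
    using Mod_E[OF Mod_eps] by (simp add: eps_def)
  then show ?case using NN.base[OF RR.eps[OF 0], of 0 n] by simp
next
  case (Suc l)
  let ?X = "\<lambda>n. M (Suc (Suc l)) * ypow (Suc (Suc l)) (Suc (Suc l)) n (pw (Suc (Suc l)) * r)"
  let ?B = "\<lambda>n. Wi (Suc l) l (P l * (M (Suc l) * ypow (Suc l) (Suc l) n (pw (Suc l) * r)))"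
  have B: "?B n \<in> NN (Suc l)" for n
    using Suc.IH[OF Suc.prems] by (intro NN_Wi NN_P) simp_all
  note rec = M_ypow_rec[OF RR_Mod[OF Suc.prems], where l = l]
  show ?case
  proof (induction n)
    case 0
    show ?case unfolding rec(2) by (intro NN_diff NN.smul NN.y NN.base B Suc.prems) simp_all
  next
    case (Suc n)
    have "?X (Suc n) = c \<cdot> (Y (Suc l) (Suc l) * ?X n) + (?B (Suc n) - Y (Suc l) (Suc l) * ?B n)"
      using rec(1)[where n = n] by (simp add: algebra_simps)
    moreover have "\<dots> \<in> NN (Suc l)" by (intro NN.add NN_diff NN.smul NN.y B Suc) simp_all
    ultimately show ?case by simp
  qed
qed

lemma NN_M:
  assumes "x \<in> NN (Suc k)" shows "M (Suc k) * x \<in> NN k"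
proof -
  \<comment> \<open>The power of y_(k+1) absorbs that letter, through which d_- cannot pass; the
    other y_i do commute with d_-.\<close>
  have "\<forall>n. M (Suc k) * ypow (Suc k) (Suc k) n x \<in> NN k"
    using assms
  proof (induction rule: NN.induct)
    case (base r)
    then show ?case using NN_M_base by blast
  next
    case (y x i)
    have x: "x \<in> Mod (Suc k)" using y NN_Mod by blast
    show ?case
    proof (cases "i = Suc k")
      case True
      then show ?thesis using y by (simp flip: ypow_Suc_right)
    next
      case False
      then show ?thesis using y x M_Y[of i k]
        by (simp add: ypow_Y[symmetric] NN.y)
    qed
  qed (simp_all add: ypow_add ypow_smul distrib_left smul_mult_right[symmetric] NN.add NN.smul)
  from this[rule_format, of 0] show ?thesis by simp
qed

text \<open>With u = y_1, v = y_2 at vertex 2 and p = d_+^2 r, apply d_-^2 to T u^m x - u^m x for x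
  = u^a v^a p. The result is 0 since d_-^2 T = d_-^2, and by \<open>T_ypow_rec\<close> it telescopes
  to the commutator of \<open>eps\<close> with indices a and m + a.\<close>

lemma eps_comm:
  assumes r: "r \<in> Mod 0"
  shows "eps a (eps b r) = eps b (eps a r)"
proof -
  let ?K = "Suc (Suc 0)"
  let ?u = "Y ?K (Suc 0)" and ?v = "Y ?K ?K" and ?w = "Y (Suc 0) (Suc 0)"
  let ?pu = "ypow ?K (Suc 0)" and ?pv = "ypow ?K ?K" and ?pw = "ypow (Suc 0) (Suc 0)"
  define p where "p = pw ?K * r"
  have p: "p \<in> Mod ?K" "T ?K (Suc 0) * p = p" by (simp_all add: p_def T_pw del: pw.simps)
  have p1: "pw (Suc 0) * r = P 0 * r" by (simp add: EP)
  define MM where "MM z = M (Suc 0) * (M ?K * z)" for z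
  have MM_add: "MM (x + y) = MM x + MM y" and MM_diff: "MM (x - y) = MM x - MM y" for x y
    by (simp_all add: MM_def distrib_left right_diff_distrib)
  have MU: "M ?K * ?pu i z = ?pw i (M ?K * z)" if "z \<in> Mod ?K" for i z
    by (rule ypow_commute[where f = "\<lambda>z. M ?K * z"]) (use M_Y[of "Suc 0" "Suc 0"] that in simp_all)
  have key: "MM (?pu i (?v * ?pv j p - c \<cdot> (?u * ?pv j p))) = eps i (eps (Suc j) r) - eps (Suc i) (eps j r)" for i j
  proof -
    have z: "?v * ?pv j p - c \<cdot> (?u * ?pv j p) \<in> Mod ?K" using p by (intro Mod_diff Mod_smul) simp_all
    have MYv: "M ?K * (?u * ?pv j p) = ?w * (M ?K * ?pv j p)"
      using M_Y[of "Suc 0" "Suc 0"] p by simp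
    have "M ?K * (?v * ?pv j p - c \<cdot> (?u * ?pv j p)) = P 0 * eps (Suc j) r - ?w * (P 0 * eps j r)"
      using M_ypow_rec(1)[OF r, where l = 0 and n = j] MYv
      by (simp add: p_def right_diff_distrib smul_mult_right[symmetric] ypow_Suc eps_def p1[simplified] EP)
    then have "MM (?pu i (?v * ?pv j p - c \<cdot> (?u * ?pv j p))) =
      M (Suc 0) * ?pw i (P 0 * eps (Suc j) r - ?w * (P 0 * eps j r))"
      unfolding MM_def MU[OF z] by simp
    also have "\<dots> = eps i (eps (Suc j) r) - M (Suc 0) * ?pw (Suc i) (P 0 * eps j r)"
    proof -
      have "?pw i (x - y) = ?pw i x - ?pw i y" for x y
        using ypow_add[of "Suc 0" "Suc 0" i "x - y" y] by simp
      then show ?thesis by (simp add: eps_def right_diff_distrib ypow_Suc_right)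
    qed
    finally show ?thesis by (simp only: eps_def)
  qed
  have main: "eps a (eps (n + a) r) = eps (n + a) (eps a r)" for n a
  proof -
    define x where "x = ?pu a (?pv a p)"
    \<comment> \<open>u v is symmetric and so commutes with T; hence T fixes x because it fixes
      p.\<close>
    have uv: "T ?K (Suc 0) * (?u * (?v * z)) = ?u * (?v * (T ?K (Suc 0) * z))" if z: "z \<in> Mod ?K" for z
    proof -
      have "?v * (T ?K (Suc 0) * (?v * z)) = c \<cdot> (?u * (?v * (Ti ?K (Suc 0) * z)))"
        using z by (simp add: T_Y_Suc smul_mult_right[symmetric] Y_Y[of "Suc 0" ?K ?K])
      moreover have "c \<cdot> (Ti ?K (Suc 0) * z) = T ?K (Suc 0) * z + (c - 1) \<cdot> z"
        using T_eq[of "Suc 0" ?K z] z by simp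
      then have "?u * (?v * (c \<cdot> (Ti ?K (Suc 0) * z))) = ?u * (?v * (T ?K (Suc 0) * z + (c - 1) \<cdot> z))"
        by simp
      ultimately show ?thesis using z
        by (simp add: T_Y_same smul_mult_right[symmetric] distrib_left)
    qed
    have xM: "x \<in> Mod ?K" using p by (simp add: x_def)
    have "T ?K (Suc 0) * (?pu m (?pv m p)) = ?pu m (?pv m p)" for m
    proof (induction m)
      case (Suc m)
      have e: "?pu (Suc m) (?pv (Suc m) p) = ?u * (?v * ?pu m (?pv m p))"
        using p by (simp add: ypow_Suc ypow_Y)
      show ?case unfolding e using uv[of "?pu m (?pv m p)"] p by (simp add: Suc)
    qed (simp add: p)
    then have xT: "T ?K (Suc 0) * x = x" by (simp add: x_def)
    define d where "d m = T ?K (Suc 0) * ?pu m x - ?pu m x" for m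
    have d_rec: "d (Suc m) = ?u * d m + (?v * ?pv m x - c \<cdot> (?u * ?pv m x))" for m
      using T_ypow_rec[of "Suc 0" ?K x m] xM xT by (simp add: d_def ypow_Suc right_diff_distrib algebra_simps)
    have dM: "d m \<in> Mod ?K" for m using xM by (simp add: d_def Mod_diff)
    \<comment> \<open>The extra power u^i is what the recursion d_(m+1) = u d_m + ... creates;
      adding \<open>key\<close> at (i + a, m + a) cancels the middle products.\<close>
    have MMd: "MM (?pu i (d m)) = eps (a + i) (eps (m + a) r) - eps (m + a + i) (eps a r)" for i m
    proof (induction m arbitrary: i)
      case 0
      have "?pu i 0 = 0" using ypow_smul[of ?K "Suc 0" i 0 0] by (simp add: smul_zero_left)
      then show ?case by (simp add: d_def xT MM_def)
    next
      case (Suc m)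
      have pvx: "?pv m x = ?pu a (?pv (m + a) p)"
      proof -
        have "?pv m (?pu a z) = ?pu a (?pv m z)" if "z \<in> Mod ?K" for z
          by (rule ypow_commute[where f = "?pv m"]) (use that in \<open>simp_all add: ypow_Y\<close>)
        moreover have "?pv m (?pv a p) = ?pv (m + a) p" by (simp add: ypow_def funpow_add)
        ultimately show ?thesis using p by (simp add: x_def)
      qed
      have "?v * ?pv m x - c \<cdot> (?u * ?pv m x) = ?pu a (?v * ?pv (m + a) p - c \<cdot> (?u * ?pv (m + a) p))"
      proof -
        have "?pu a (x - y) = ?pu a x - ?pu a y" for x y
          using ypow_add[of ?K "Suc 0" a "x - y" y] by simp
        then show ?thesis unfolding pvx using p by (simp add: ypow_Y ypow_smul)
      qed
      then have "?pu i (?v * ?pv m x - c \<cdot> (?u * ?pv m x)) =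
        ?pu (i + a) (?v * ?pv (m + a) p - c \<cdot> (?u * ?pv (m + a) p))"
        by (simp add: ypow_def funpow_add)
      then have "MM (?pu i (d (Suc m))) = MM (?pu (Suc i) (d m)) +
          MM (?pu (i + a) (?v * ?pv (m + a) p - c \<cdot> (?u * ?pv (m + a) p)))"
        by (simp add: d_rec ypow_add MM_add ypow_Suc_right)
      then show ?case unfolding key Suc.IH by (simp add: ac_simps)
    qed
    have "MM (d n) = 0"
      using M_M_T[of 0 "?pu n x"] by (simp add: MM_def d_def right_diff_distrib)
    then show ?thesis using MMd[of 0 n] by simp
  qed
  show ?thesis
  proof (cases "a \<le> b")
    case True
    then show ?thesis using main[of a "b - a"] by simp
  next
    case False
    then show ?thesis using main[of b "a - b"] by simp
  qed
qed

text \<open>Words in the unstarred letters that begin at e_0, with linear combinations, filtered by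
  end vertex; set up for induction on the leftmost letter.\<close>

inductive AE :: "nat \<Rightarrow> 'a \<Rightarrow> bool" where
  one: "AE 0 (E 0)"
| add: "AE k x \<Longrightarrow> AE k y \<Longrightarrow> AE k (x + y)"
| smul: "AE k x \<Longrightarrow> AE k (a \<cdot> x)"
| T: "AE k x \<Longrightarrow> 1 \<le> i \<Longrightarrow> i < k \<Longrightarrow> AE k (T k i * x)"
| P: "AE k x \<Longrightarrow> AE (Suc k) (P k * x)"
| M: "AE (Suc k) x \<Longrightarrow> AE k (M (Suc k) * x)"

lemma AE_NN: "AE k x \<Longrightarrow> x \<in> NN k"
proof (induction rule: AE.induct)
  case one
  show ?case using NN.base[OF RR.one, of 0] by (simp add: EE)
qed (simp_all add: NN.add NN.smul NN_T NN_P NN_M)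

end

context dyck_system begin

lemma Y_E_right: "1 \<le> i \<Longrightarrow> i \<le> k \<Longrightarrow> Y k i * E k = Y k i"
proof (cases "i = k")
  case True
  assume "1 \<le> i" "i \<le> k"
  then obtain m where m: "k = Suc m" by (cases k) auto
  have "foldr (\<lambda>j x. gTinv G k j * x) l z * E k = foldr (\<lambda>j x. gTinv G k j * x) l (z * E k)" for l z
    by (induction l) (simp_all add: mult.assoc)
  then show ?thesis unfolding True
    by (subst (1 2) ygen.simps) (simp add: smul_mult_left[symmetric] m ED)
next
  case False
  assume "1 \<le> i" "i \<le> k"
  with False show ?thesis
    by (subst (1 2) ygen.simps) (simp add: smul_mult_left[symmetric] mult.assoc ET)
qed

lemma Y_last_elt: "1 \<le> k \<Longrightarrow> Y k k = Wi k (k - 1) (phi k)"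
proof -
  assume k: "1 \<le> k"
  then have "phi k * E k = phi k" by (cases k) (simp_all add: phi_def smul_mult_left[symmetric] ED)
  then show ?thesis using Y_last[OF k, of "E k"] Y_E_right[of k k] k by simp
qed

primrec Wr :: "nat \<Rightarrow> nat \<Rightarrow> 'a \<Rightarrow> 'a" where
  "Wr k 0 x = x" | "Wr k (Suc n) x = T k (Suc n) * Wr k n x"

text \<open>Unfolding y_1 up to y_(k+1) gives c^-k T_1 ... T_k y_(k+1) T_k ... T_1, and the left
  half is \<open>phi\<close>. It serves to evaluate z_1 d_+.\<close>

lemma Y_first: "Y (Suc k) 1 * x = inverse c ^ k \<cdot> (phi (Suc k) * Wr (Suc k) k x)"
proof -
  have "n \<le> k \<Longrightarrow> Y (Suc k) 1 * x = inverse c ^ n \<cdot> W (Suc k) n (Y (Suc k) (Suc n) * Wr (Suc k) n x)" for n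
  proof (induction n)
    case (Suc n)
    then show ?case
      by (simp add: Y_rec[of "Suc n" "Suc k"] W_smul flip: smul_assoc) (simp add: mult.commute)
  qed (simp add: smul_one)
  from this[of k] show ?thesis by (simp add: Y_last)
qed

text \<open>Reduces a family of relations indexed by i to one on the commutator, since the remaining
  y_i are obtained from y_k by conjugations that \<open>p\<close> respects.\<close>

lemma Y_intertwine:
  assumes pE: "\<And>k. E (Suc k) * p k = p k" "\<And>k. p k * E k = p k"
    and pT: "\<And>k i. 1 \<le> i \<Longrightarrow> i < k \<Longrightarrow> p k * T k i = T (Suc k) (Suc i) * p k"
    and pphi: "\<And>k. 1 \<le> k \<Longrightarrow> Ti (Suc k) 1 * (phi (Suc k) * p k) = p k * phi k"
    and i: "1 \<le> i" "i \<le> k"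
  shows "Y (Suc k) (Suc i) * p k = p k * Y k i"
proof -
  have pM [simp]: "p k * z \<in> Mod (Suc k)" for k z using pE(1)[of k] by (simp add: Mod_def flip: mult.assoc)
  have pTl: "p k * (T k i * z) = T (Suc k) (Suc i) * (p k * z)" if "1 \<le> i" "i < k" for k i z
    using pT[OF that] by (simp flip: mult.assoc)
  have pEl: "p k * (E k * z) = p k * z" for z k using pE(2)[of k] by (simp flip: mult.assoc)
  have pTi: "p k * (Ti k i * z) = Ti (Suc k) (Suc i) * (p k * z)" if "1 \<le> i" "i < k" "z \<in> Mod k" for k i z
    using that by (intro Ti_lin) (simp_all add: pTl pEl Mod_E)
  have "\<forall>x\<in>Mod k. Y (Suc k) (Suc i) * (p k * x) = p k * (Y k i * x)"
    using i
  proof (induction rule: Y_down_induct)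
    case last
    show ?case
    proof
      fix x assume x: "x \<in> Mod k"
      have 1: "Wi (Suc k) (Suc n) (phi (Suc k) * (p k * x)) = p k * Wi k n (phi k * x)" if "n < k" for n
        using that
      proof (induction n)
        case 0
        then show ?case using arg_cong[OF pphi[OF last], of "\<lambda>z. z * x"] by (simp add: mult.assoc)
      next
        case (Suc n)
        then show ?case using last by (simp add: pTi)
      qed
      from 1[of "k - 1"] show "Y (Suc k) (Suc k) * (p k * x) = p k * (Y k k * x)"
        using last by (simp add: Y_last)
    qed
  next
    case (step i)
    then show ?case by (auto simp: Y_rec[of i k] Y_rec[of "Suc i" "Suc k"] smul_mult_right[symmetric] pTl[symmetric])
  qed
  from this[rule_format, of "E k"] show ?thesis
    using Y_E_right[OF i] pE(2) by (simp add: Mod_def EE)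
qed

end

section \<open>Transport along homomorphisms and the double algebra\<close>

lemma dyck_system_map:
  assumes "dyck_system c G" "alg_hom f" shows "dyck_system c (map_gens f G)"
proof -
  interpret dyck_system c G by fact
  show ?thesis
  proof
    show "c \<noteq> 0" "c \<noteq> 1" "path_system (map_gens f G)"
      by (fact c0 c1 path_system_map[OF assms(2) path_sys])+
    fix x assume "x \<in> dyck_rels c (map_gens f G)"
    then obtain y where "y \<in> dyck_rels c G" "x = f y" by (auto simp: dyck_rels_map[OF assms(2)])
    then show "x = 0" using rels[of y] by (simp add: alg_hom_simps[OF assms(2)])
  qed
qed

text \<open>\<open>gTinv\<close> is a definite description, which a homomorphism need not respect;
  the explicit inverse \<open>Ti\<close> is respected.\<close>

lemma map_gTinv:
  assumes "dyck_system c G" "alg_hom f" "1 \<le> i" "i < k"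
  shows "f (gTinv G k i) = gTinv (map_gens f G) k i"
  using dyck_system.gTinv_eq[OF assms(1,3,4)] dyck_system.gTinv_eq[OF dyck_system_map[OF assms(1,2)] assms(3,4)]
    dyck_system.Ti_def[OF assms(1)] dyck_system.Ti_def[OF dyck_system_map[OF assms(1,2)]]
  by (simp add: alg_hom_simps[OF assms(2)])

lemma map_ygen:
  assumes "dyck_system c G" "alg_hom f" "1 \<le> i" "i \<le> k"
  shows "f (ygen c G k i) = ygen c (map_gens f G) k i"
  using assms(4,3)
proof (induction rule: inc_induct)
  case base
  note f = alg_hom_simps[OF assms(2)]
  have "f (foldr (\<lambda>j x. gTinv G k j * x) l z) = foldr (\<lambda>j x. gTinv (map_gens f G) k j * x) l (f z)"
    if "\<forall>j\<in>set l. 1 \<le> j \<and> j < k" for l z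
    using that by (induction l) (auto simp: f map_gTinv[OF assms(1,2)])
  from this[of "rev [1..<k]"] show ?case
    by (subst (1 2) ygen.simps) (simp add: f dcomm_def)
next
  case (step n)
  then show ?case by (subst (1 2) ygen.simps) (simp add: alg_hom_simps[OF assms(2)])
qed

lemma qq_neq: "qq \<noteq> 0" "qq \<noteq> 1" "inverse qq \<noteq> 0" "inverse qq \<noteq> 1"
proof -
  show "qq \<noteq> 0" by (simp add: qq_def Zero_fract_def eq_fract)
  then show "inverse qq \<noteq> 0" by simp
  show "qq \<noteq> 1" by (simp add: qq_def One_fract_def eq_fract one_pCons)
  then show "inverse qq \<noteq> 1" by simp
qed

lemma dyck_system_dyck: "dyck_system qq dyck_alg_gens"
  unfolding dyck_alg_gens_def
  by standard (use qq_neq path_system_map[OF alg_hom_abs_dyck path_system_path_gens] in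
    \<open>auto simp: dyck_rels_map[OF alg_hom_abs_dyck] intro: abs_zero[OF dyck.abs_eq_iff alg_hom_abs_dyck]\<close>)

lemma dyck_system_dyck_star: "dyck_system (inverse qq) dyck_star_gens"
  unfolding dyck_star_gens_def
  by standard (use qq_neq path_system_map[OF alg_hom_abs_dyck_star path_system_path_gens] in
    \<open>auto simp: dyck_rels_map[OF alg_hom_abs_dyck_star] intro: abs_zero[OF dyck_star.abs_eq_iff alg_hom_abs_dyck_star]\<close>)

lemma hom_relsI:
  "i (x + y) - (i x + i y) \<in> hom_rels i" "i (c \<cdot> x) - c \<cdot> i x \<in> hom_rels i" "i (x * y) - i x * i y \<in> hom_rels i"
  by (auto simp: hom_rels_def)

lemma alg_hom_of_hom_rels:
  assumes ab: "alg_hom ab" and z: "\<And>x. x \<in> hom_rels i \<Longrightarrow> ab x = 0"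
  shows "alg_hom (\<lambda>x. ab (i x))"
  using z[OF hom_relsI(1)] z[OF hom_relsI(2)] z[OF hom_relsI(3)]
  by (simp add: alg_hom_def alg_hom_simps[OF ab])

lemma alg_hom_fp_inl: "alg_hom fp_inl"
  unfolding fp_inl_def
  by (rule alg_hom_of_hom_rels[OF alg_hom_abs_free_product abs_zero[OF abs_fp_eq alg_hom_abs_free_product]])
    (simp add: free_product_rels_def)

lemma alg_hom_fp_inr: "alg_hom fp_inr"
  unfolding fp_inr_def
  by (rule alg_hom_of_hom_rels[OF alg_hom_abs_free_product abs_zero[OF abs_fp_eq alg_hom_abs_free_product]])
    (simp add: free_product_rels_def)

definition dinl :: "dyck \<Rightarrow> double_dyck" where "dinl a = abs_double_dyck (fp_inl a)"
definition dinr :: "dyck_star \<Rightarrow> double_dyck" where "dinr b = abs_double_dyck (fp_inr b)"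

lemma alg_hom_dinl: "alg_hom dinl"
  unfolding dinl_def[abs_def] by (rule alg_hom_comp[OF alg_hom_fp_inl alg_hom_abs_double_dyck])
lemma alg_hom_dinr: "alg_hom dinr"
  unfolding dinr_def[abs_def] by (rule alg_hom_comp[OF alg_hom_fp_inr alg_hom_abs_double_dyck])

lemma double_gens_eq: "double_gens = map_gens dinl dyck_alg_gens"
  by (simp add: double_gens_def dinl_def[abs_def])
lemma double_star_gens_eq: "double_star_gens = map_gens dinr dyck_star_gens"
  by (simp add: double_star_gens_def dinr_def[abs_def])

lemma dyck_system_double: "dyck_system qq double_gens"
  unfolding double_gens_eq by (rule dyck_system_map[OF dyck_system_dyck alg_hom_dinl])
lemma dyck_system_double_star: "dyck_system (inverse qq) double_star_gens"
  unfolding double_star_gens_eq by (rule dyck_system_map[OF dyck_system_dyck_star alg_hom_dinr])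

definition cross_rels :: "'a::qt_algebra dyck_gens \<Rightarrow> 'a dyck_gens \<Rightarrow> bool" where
  "cross_rels A S \<longleftrightarrow>
    (\<forall>k. gM S (Suc k) = gM A (Suc k)) \<and> (\<forall>k i. 1 \<le> i \<and> i < k \<longrightarrow> gT S k i = gTinv A k i) \<and>
    (\<forall>k. gE S k = gE A k) \<and>
    (\<forall>k i. 1 \<le> i \<and> i \<le> k \<longrightarrow>
      ygen (inverse qq) S (Suc k) (Suc i) * gP A k = gP A k * ygen (inverse qq) S k i) \<and>
    (\<forall>k i. 1 \<le> i \<and> i \<le> k \<longrightarrow> ygen qq A (Suc k) (Suc i) * gP S k = gP S k * ygen qq A k i) \<and>
    (\<forall>k. ygen (inverse qq) S (Suc k) 1 * gP A k = (- tt * qq ^ Suc k) \<cdot> (ygen qq A (Suc k) 1 * gP S k))"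

lemma cross_rels_double: "cross_rels double_gens double_star_gens"
proof -
  note ab = alg_hom_simps[OF alg_hom_abs_double_dyck]
  have z: "abs_double_dyck x = 0" if "x \<in> double_rels" for x
    by (rule abs_zero[OF double_dyck.abs_eq_iff alg_hom_abs_double_dyck that])
  have eq: "abs_double_dyck x = abs_double_dyck y" if "x - y \<in> double_rels" for x y
    using z[OF that] by (simp add: ab)
  have yd: "dinl (y_elt k i) = ygen qq double_gens k i" if "1 \<le> i" "i \<le> k" for k i
    unfolding y_elt_def double_gens_eq by (rule map_ygen[OF dyck_system_dyck alg_hom_dinl that])
  have zd: "dinr (z_elt k i) = ygen (inverse qq) double_star_gens k i" if "1 \<le> i" "i \<le> k" for k i
    unfolding z_elt_def double_star_gens_eq by (rule map_ygen[OF dyck_system_dyck_star alg_hom_dinr that])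
  have td: "dinl (gTinv dyck_alg_gens k i) = gTinv double_gens k i" if "1 \<le> i" "i < k" for k i
    unfolding double_gens_eq by (rule map_gTinv[OF dyck_system_dyck alg_hom_dinl that])
  have g: "gP double_gens k = dinl (gP dyck_alg_gens k)" "gM double_gens k = dinl (gM dyck_alg_gens k)"
     "gE double_gens k = dinl (gE dyck_alg_gens k)"
     "gP double_star_gens k = dinr (gP dyck_star_gens k)" "gM double_star_gens k = dinr (gM dyck_star_gens k)"
     "gE double_star_gens k = dinr (gE dyck_star_gens k)" "gT double_star_gens k i = dinr (gT dyck_star_gens k i)" for k i
    by (simp_all add: double_gens_eq double_star_gens_eq)
  have 1: "gM double_star_gens (Suc k) = gM double_gens (Suc k)" for k
    unfolding g dinl_def dinr_def by (rule eq) (unfold double_rels_def Un_iff mem_Collect_eq, force)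
  have 2: "gT double_star_gens k i = gTinv double_gens k i" if "1 \<le> i" "i < k" for k i
    unfolding td[OF that, symmetric] g dinl_def dinr_def
    by (rule eq) (unfold double_rels_def Un_iff mem_Collect_eq, use that in blast)
  have 3: "gE double_star_gens k = gE double_gens k" for k
    unfolding g dinl_def dinr_def by (rule eq) (unfold double_rels_def Un_iff mem_Collect_eq, blast)
  have 4: "ygen (inverse qq) double_star_gens (k + 1) (i + 1) * gP double_gens k = gP double_gens k * ygen (inverse qq) double_star_gens k i"
    if i: "1 \<le> i" "i \<le> k" for k i
  proof -
    have z: "dinr (z_elt (k + 1) (i + 1)) = ygen (inverse qq) double_star_gens (k + 1) (i + 1)"
      "dinr (z_elt k i) = ygen (inverse qq) double_star_gens k i" using i by (intro zd; simp)+
    show ?thesis unfolding z[symmetric] g dinl_def dinr_def ab(2)[symmetric]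
      by (rule eq) (unfold double_rels_def Un_iff mem_Collect_eq, use i in blast)
  qed
  have 5: "ygen qq double_gens (k + 1) (i + 1) * gP double_star_gens k = gP double_star_gens k * ygen qq double_gens k i"
    if i: "1 \<le> i" "i \<le> k" for k i
  proof -
    have z: "dinl (y_elt (k + 1) (i + 1)) = ygen qq double_gens (k + 1) (i + 1)"
      "dinl (y_elt k i) = ygen qq double_gens k i" using i by (intro yd; simp)+
    show ?thesis unfolding z[symmetric] g dinl_def dinr_def ab(2)[symmetric]
      by (rule eq) (unfold double_rels_def Un_iff mem_Collect_eq, use i in blast)
  qed
  have 6: "ygen (inverse qq) double_star_gens (k + 1) 1 * gP double_gens k =
    (- tt * qq ^ (k + 1)) \<cdot> (ygen qq double_gens (k + 1) 1 * gP double_star_gens k)" for k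
  proof -
    have z: "dinl (y_elt (k + 1) 1) = ygen qq double_gens (k + 1) 1"
      "dinr (z_elt (k + 1) 1) = ygen (inverse qq) double_star_gens (k + 1) 1" by (intro yd zd; simp)+
    show ?thesis unfolding z[symmetric] g dinl_def dinr_def ab(2,3)[symmetric]
      by (rule eq) (unfold double_rels_def Un_iff mem_Collect_eq, blast)
  qed
  show ?thesis unfolding cross_rels_def using 1 2 3 4 5 6 by auto
qed

section \<open>Universal property and generators of the double algebra\<close>

text \<open>The target need not have a unit, so there is no product of the empty word; 0 is a
  default, and only nonempty words are evaluated.\<close>

fun wprod :: "('g \<Rightarrow> 'b::qt_algebra) \<Rightarrow> 'g list \<Rightarrow> 'b" where
  "wprod f [] = 0"
| "wprod f [x] = f x"
| "wprod f (x # y # zs) = f x * wprod f (y # zs)"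

lemma wprod_append: "u \<noteq> [] \<Longrightarrow> v \<noteq> [] \<Longrightarrow> wprod f (u @ v) = wprod f u * wprod f v"
proof (induction f u rule: wprod.induct)
  case (2 f x)
  then show ?case by (cases v) auto
qed (simp_all add: mult.assoc)

definition word_lift :: "('g \<Rightarrow> 'b::qt_algebra) \<Rightarrow> 'g word psalg \<Rightarrow> 'b" where
  "word_lift f = psalg_lift (\<lambda>w. wprod f (Rep_word w))"

lemma Rep_word_neq_Nil: "Rep_word w \<noteq> []"
  using Rep_word[of w] by simp

lemma alg_hom_word_lift: "alg_hom (word_lift f)"
  unfolding word_lift_def
  by (rule alg_hom_psalg_lift)
    (simp add: pcomp_word_def append_word.rep_eq wprod_append[OF Rep_word_neq_Nil Rep_word_neq_Nil])

lemma word_lift_letter: "word_lift f (letter x) = f x"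
  using psalg_lift_basis[of "\<lambda>w. wprod f (Rep_word w)" 1 "Abs_word [x]"]
  by (simp add: word_lift_def letter_def smul_one Abs_word_inverse)

lemma word_psalg_induct [case_names letter add smul mult]:
  assumes "\<And>x. Q (letter x)" "\<And>x y. Q x \<Longrightarrow> Q y \<Longrightarrow> Q (x + y)" "\<And>c x. Q x \<Longrightarrow> Q (c \<cdot> x)"
    "\<And>x y. Q x \<Longrightarrow> Q y \<Longrightarrow> Q (x * y)"
  shows "Q x"
proof (induction x rule: psalg_induct)
  case (basis p c)
  have "w \<noteq> [] \<Longrightarrow> Q (basis_elt (Abs_word w))" for w
  proof (induction w)
    case (Cons x w)
    show ?case
    proof (cases "w = []")
      case True
      then show ?thesis using assms(1)[of x] by (simp add: letter_def)
    next
      case False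
      have "append_word (Abs_word [x]) (Abs_word w) = Abs_word (x # w)"
        by (rule Rep_word_inject[THEN iffD1]) (use False in \<open>simp add: append_word.rep_eq Abs_word_inverse\<close>)
      then have "letter x * basis_elt (Abs_word w) = basis_elt (Abs_word (x # w))"
        by (simp add: letter_def basis_elt_mult pcomp_word_def)
      then show ?thesis using assms(4)[OF assms(1) Cons.IH[OF False], of x] by simp
    qed
  qed simp
  from this[of "Rep_word p"] show ?case using Rep_word[of p] assms(3) by (simp add: Rep_word_inverse)
qed (rule assms)

text \<open>
  The record fields are also defined at indices without an arrow, such as \<open>d\<^sub>-\<close> at the vertex 0;
  there \<open>norm_gens\<close> takes the junk values of the path algebra, so that equality of records is attainable.
\<close>

definition norm_gens :: "'a::qt_algebra dyck_gens \<Rightarrow> 'a dyck_gens" where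
  "norm_gens H = map_gens (path_lift H) path_gens"

lemma norm_gens_simps:
  assumes "path_system H"
  shows "gE (norm_gens H) k = gE H k" "gP (norm_gens H) k = gP H k" "gM (norm_gens H) (Suc k) = gM H (Suc k)"
    "1 \<le> i \<Longrightarrow> i < k \<Longrightarrow> gT (norm_gens H) k i = gT H k i"
  using path_lift_gens[OF assms] by (simp_all add: norm_gens_def)

lemma quotient_path_lift:
  assumes H: "path_system H" and rels: "\<And>x. x \<in> dyck_rels c (norm_gens H) \<Longrightarrow> x = 0"
    and q: "\<And>x. ab (re x) = x" "\<And>x y. ab x = ab y \<longleftrightarrow> icong (dyck_rels c path_gens) x y" "alg_hom ab"
  shows "\<exists>f. alg_hom f \<and> map_gens f (map_gens ab path_gens) = norm_gens H"
proof -
  have z: "path_lift H x = 0" if "x \<in> dyck_rels c path_gens" for x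
    using rels dyck_rels_map[OF alg_hom_path_lift[OF H], of c path_gens] that by (auto simp: norm_gens_def)
  note l = quotient_lift[OF q alg_hom_path_lift[OF H] z]
  show ?thesis
    by (rule exI[of _ "\<lambda>x. path_lift H (re x)"])
      (use l in \<open>simp add: map_gens_map_gens norm_gens_def\<close>)
qed

text \<open>Four universal properties in a row: path algebras, their quotients, the free product,
  and its quotient. \<open>cross_rels\<close> is what the last step consumes.\<close>

lemma double_dyck_lift:
  assumes A0: "path_system A0" and A: "dyck_system qq (norm_gens A0)"
    and S0: "path_system S0" and S: "dyck_system (inverse qq) (norm_gens S0)"
    and cross: "cross_rels (norm_gens A0) (norm_gens S0)"
  shows "\<exists>f. alg_hom f \<and> map_gens f double_gens = norm_gens A0 \<and> map_gens f double_star_gens = norm_gens S0"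
proof -
  obtain f1 where f1: "alg_hom f1" "map_gens f1 dyck_alg_gens = norm_gens A0"
    using quotient_path_lift[OF A0 dyck_system.rels[OF A] abs_rep(1) dyck.abs_eq_iff alg_hom_abs_dyck]
    unfolding dyck_alg_gens_def by blast
  obtain f2 where f2: "alg_hom f2" "map_gens f2 dyck_star_gens = norm_gens S0"
    using quotient_path_lift[OF S0 dyck_system.rels[OF S] abs_rep(2) dyck_star.abs_eq_iff alg_hom_abs_dyck_star]
    unfolding dyck_star_gens_def by blast
  define g where "g = word_lift (case_sum f1 f2)"
  have g: "alg_hom g" unfolding g_def by (rule alg_hom_word_lift)
  have gl: "g (letter (Inl a)) = f1 a" "g (letter (Inr b)) = f2 b" for a b
    by (simp_all add: g_def word_lift_letter)
  have gz: "g x = 0" if "x \<in> free_product_rels" for x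
    using that by (auto simp: free_product_rels_def hom_rels_def alg_hom_simps[OF g] gl
        alg_hom_simps[OF f1(1)] alg_hom_simps[OF f2(1)])
  note ql = quotient_lift[OF abs_rep(3) abs_fp_eq alg_hom_abs_free_product g gz]
  define h where "h x = g (rep_free_product x)" for x
  have h: "alg_hom h" unfolding h_def[abs_def] by (rule ql(1))
  have hl: "h (fp_inl a) = f1 a" "h (fp_inr b) = f2 b" for a b
    using ql(2) by (simp_all add: h_def fp_inl_def fp_inr_def gl)
  have f1g: "f1 (gP dyck_alg_gens k) = gP (norm_gens A0) k" "f1 (gM dyck_alg_gens k) = gM (norm_gens A0) k"
      "f1 (gE dyck_alg_gens k) = gE (norm_gens A0) k" for k
    using f1(2)[symmetric] by simp_all
  have f2g: "f2 (gP dyck_star_gens k) = gP (norm_gens S0) k" "f2 (gM dyck_star_gens k) = gM (norm_gens S0) k"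
     "f2 (gE dyck_star_gens k) = gE (norm_gens S0) k" "f2 (gT dyck_star_gens k i) = gT (norm_gens S0) k i" for k i
    using f2(2)[symmetric] by simp_all
  have ty: "f1 (y_elt k i) = ygen qq (norm_gens A0) k i" if "1 \<le> i" "i \<le> k" for k i
    using map_ygen[OF dyck_system_dyck f1(1) that] by (simp add: y_elt_def f1(2))
  have tz: "f2 (z_elt k i) = ygen (inverse qq) (norm_gens S0) k i" if "1 \<le> i" "i \<le> k" for k i
    using map_ygen[OF dyck_system_dyck_star f2(1) that] by (simp add: z_elt_def f2(2))
  have tT: "f1 (gTinv dyck_alg_gens k i) = gTinv (norm_gens A0) k i" if "1 \<le> i" "i < k" for k i
    using map_gTinv[OF dyck_system_dyck f1(1) that] by (simp add: f1(2))
  have cr: "gM (norm_gens S0) (Suc k) = gM (norm_gens A0) (Suc k)"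
     "gE (norm_gens S0) k = gE (norm_gens A0) k"
     "ygen (inverse qq) (norm_gens S0) (Suc k) 1 * gP (norm_gens A0) k =
        (- tt * qq ^ Suc k) \<cdot> (ygen qq (norm_gens A0) (Suc k) 1 * gP (norm_gens S0) k)" for k
    using cross unfolding cross_rels_def by blast+
  have cr2: "1 \<le> i \<Longrightarrow> i < k \<Longrightarrow> gT (norm_gens S0) k i = gTinv (norm_gens A0) k i"
     "1 \<le> i \<Longrightarrow> i \<le> k \<Longrightarrow> ygen (inverse qq) (norm_gens S0) (Suc k) (Suc i) * gP (norm_gens A0) k = gP (norm_gens A0) k * ygen (inverse qq) (norm_gens S0) k i"
     "1 \<le> i \<Longrightarrow> i \<le> k \<Longrightarrow> ygen qq (norm_gens A0) (Suc k) (Suc i) * gP (norm_gens S0) k = gP (norm_gens S0) k * ygen qq (norm_gens A0) k i" for k i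
    using cross unfolding cross_rels_def by blast+
  have hz: "h x = 0" if "x \<in> double_rels" for x
  proof -
    note hs = alg_hom_simps[OF h] hl f1g f2g ty tz tT
    have m1: "h (fp_inr (gM dyck_star_gens k) - fp_inl (gM dyck_alg_gens k)) = 0" if "1 \<le> k" for k
      using that cr(1)[of "k - 1"] by (simp add: hs)
    have m2: "h (fp_inr (gT dyck_star_gens k i) - fp_inl (gTinv dyck_alg_gens k i)) = 0"
      if "1 \<le> i" "i < k" for k i
      using that cr2(1) by (simp add: hs)
    have m3: "h (fp_inr (gE dyck_star_gens k) - fp_inl (gE dyck_alg_gens k)) = 0" for k
      by (simp add: hs cr(2))
    have m4: "h (fp_inr (z_elt (k + 1) (i + 1)) * fp_inl (gP dyck_alg_gens k) -
        fp_inl (gP dyck_alg_gens k) * fp_inr (z_elt k i)) = 0" if "1 \<le> i" "i \<le> k" for k i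
      using that cr2(2) by (simp add: hs)
    have m5: "h (fp_inl (y_elt (k + 1) (i + 1)) * fp_inr (gP dyck_star_gens k) -
        fp_inr (gP dyck_star_gens k) * fp_inl (y_elt k i)) = 0" if "1 \<le> i" "i \<le> k" for k i
      using that cr2(3) by (simp add: hs)
    have yz1: "f1 (y_elt (Suc k) 1) = ygen qq (norm_gens A0) (Suc k) 1"
      "f2 (z_elt (Suc k) 1) = ygen (inverse qq) (norm_gens S0) (Suc k) 1" for k by (intro ty tz; simp)+
    have m6: "h (fp_inr (z_elt (k + 1) 1) * fp_inl (gP dyck_alg_gens k) -
        (- tt * qq ^ (k + 1)) \<cdot> (fp_inl (y_elt (k + 1) 1) * fp_inr (gP dyck_star_gens k))) = 0" for k
      by (simp only: alg_hom_simps[OF h] hl f1g f2g Suc_eq_plus1[symmetric] yz1 cr(3)) simp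
    show ?thesis
      using that unfolding double_rels_def Un_iff mem_Collect_eq
      by (elim disjE exE conjE; simp only: m1 m2 m3 m4 m5 m6)
  qed
  note ql2 = quotient_lift[OF abs_rep(4) double_dyck.abs_eq_iff alg_hom_abs_double_dyck h hz]
  show ?thesis
  proof (intro exI conjI)
    show "alg_hom (\<lambda>x. h (rep_double_dyck x))" by (rule ql2(1))
    show "map_gens (\<lambda>x. h (rep_double_dyck x)) double_gens = norm_gens A0"
      using f1(2) by (simp add: double_gens_eq dinl_def[abs_def] map_gens_map_gens ql2(2) hl)
    show "map_gens (\<lambda>x. h (rep_double_dyck x)) double_star_gens = norm_gens S0"
      using f2(2) by (simp add: double_star_gens_eq dinr_def[abs_def] map_gens_map_gens ql2(2) hl)
  qed
qed

lemma dinl_induct [case_names E P M T add smul mult]: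
  assumes "\<And>k. Q (gE double_gens k)" "\<And>k. Q (gP double_gens k)" "\<And>k. Q (gM double_gens (Suc k))"
    "\<And>k i. 1 \<le> i \<Longrightarrow> i < k \<Longrightarrow> Q (gT double_gens k i)"
    "\<And>x y. Q x \<Longrightarrow> Q y \<Longrightarrow> Q (x + y)" "\<And>c x. Q x \<Longrightarrow> Q (c \<cdot> x)" "\<And>x y. Q x \<Longrightarrow> Q y \<Longrightarrow> Q (x * y)"
  shows "Q (dinl a)"
proof -
  have "Q (dinl (abs_dyck p))" for p
  proof (induction p rule: path_psalg_induct)
    case (E k) then show ?case using assms(1)[of k] by (simp add: double_gens_eq dyck_alg_gens_def)
  next
    case (P k) then show ?case using assms(2)[of k] by (simp add: double_gens_eq dyck_alg_gens_def)
  next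
    case (M k) then show ?case using assms(3)[of k] by (simp add: double_gens_eq dyck_alg_gens_def)
  next
    case (T k i) then show ?case using assms(4)[of i k] by (simp add: double_gens_eq dyck_alg_gens_def)
  qed (simp_all add: alg_hom_simps[OF alg_hom_dinl] alg_hom_simps[OF alg_hom_abs_dyck] assms(5-7))
  then show ?thesis by (metis abs_rep(1))
qed

text \<open>The relations identify the starred d_-, e_k and T_i with elements already generated, so
  d_+^* is the only additional letter.\<close>

lemma double_dyck_induct [case_names E P M T PS add smul mult]:
  assumes E: "\<And>k. Q (gE double_gens k)" and P: "\<And>k. Q (gP double_gens k)" and M: "\<And>k. Q (gM double_gens (Suc k))"
    and T: "\<And>k i. 1 \<le> i \<Longrightarrow> i < k \<Longrightarrow> Q (gT double_gens k i)" and PS: "\<And>k. Q (gP double_star_gens k)"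
    and add: "\<And>x y. Q x \<Longrightarrow> Q y \<Longrightarrow> Q (x + y)" and smul: "\<And>c x. Q x \<Longrightarrow> Q (c \<cdot> x)"
    and mult: "\<And>x y. Q x \<Longrightarrow> Q y \<Longrightarrow> Q (x * y)"
  shows "Q x"
proof -
  have cr: "gM double_star_gens (Suc k) = gM double_gens (Suc k)" "gE double_star_gens k = gE double_gens k" for k
    using cross_rels_double unfolding cross_rels_def by blast+
  have crT: "gT double_star_gens k i = gTinv double_gens k i" if "1 \<le> i" "i < k" for k i
    using cross_rels_double that unfolding cross_rels_def by blast
  have QT: "Q (gT double_star_gens k i)" if "1 \<le> i" "i < k" for k i
    unfolding crT[OF that] dyck_system.gTinv_eq[OF dyck_system_double that] dyck_system.Ti_def[OF dyck_system_double]
    using that by (intro smul add T E)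
  have inl: "Q (dinl a)" for a by (rule dinl_induct) (fact E P M T add smul mult)+
  have inr: "Q (dinr a)" for a
  proof -
    have "Q (dinr (abs_dyck_star p))" for p
    proof (induction p rule: path_psalg_induct)
      case (E k) then show ?case using assms(1)[of k] cr(2)[of k] by (simp add: double_star_gens_eq dyck_star_gens_def)
    next
      case (P k) then show ?case using PS[of k] by (simp add: double_star_gens_eq dyck_star_gens_def)
    next
      case (M k) then show ?case using assms(3)[of k] cr(1)[of k] by (simp add: double_star_gens_eq dyck_star_gens_def)
    next
      case (T k i) then show ?case using QT[of i k] by (simp add: double_star_gens_eq dyck_star_gens_def)
    qed (simp_all add: alg_hom_simps[OF alg_hom_dinr] alg_hom_simps[OF alg_hom_abs_dyck_star] add smul mult)
    then show ?thesis by (metis abs_rep(2))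
  qed
  have "Q (abs_double_dyck (abs_free_product w))" for w
  proof (induction w rule: word_psalg_induct)
    case (letter x)
    then show ?case using inl inr by (cases x) (auto simp: dinl_def dinr_def fp_inl_def fp_inr_def)
  qed (simp_all add: alg_hom_simps[OF alg_hom_abs_free_product] alg_hom_simps[OF alg_hom_abs_double_dyck] add smul mult)
  then show ?thesis by (metis abs_rep(3) abs_rep(4))
qed

section \<open>The algebra of linear operators on \<open>V\<^sub>*\<close>\<close>

lemma V_0 [simp]: "0 \<in> V k" by (simp add: V_eq_VS)
lemma V_add: "F \<in> V k \<Longrightarrow> G \<in> V k \<Longrightarrow> F + G \<in> V k" by (simp add: V_eq_VS VS_add)
lemma V_uminus: "F \<in> V k \<Longrightarrow> - F \<in> V k" by (simp add: V_eq_VS VS_uminus)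
lemma V_diff: "F \<in> V k \<Longrightarrow> G \<in> V k \<Longrightarrow> F - G \<in> V k" by (simp add: V_eq_VS VS_diff)
lemma V_mult: "F \<in> V k \<Longrightarrow> G \<in> V k \<Longrightarrow> F * G \<in> V k" by (simp add: V_eq_VS VS_mult)
lemma V_vconst [simp]: "vconst c \<in> V k" by (simp add: V_eq_VS)
lemma V_cq1: "cq - 1 \<in> V k" by (simp add: V_eq_VS VS_diff)
lemma V_scale: "F \<in> V k \<Longrightarrow> vconst c * F \<in> V k" by (simp add: V_mult)
lemma V_Suc_mono: "F \<in> V k \<Longrightarrow> F \<in> V (Suc k)" unfolding V_eq_VS by (erule VS_mono) auto
lemma V_yvar: "1 \<le> i \<Longrightarrow> i \<le> k \<Longrightarrow> yvar i \<in> V k" unfolding V_eq_VS by (rule VS_yvar) simp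

lemma lookup_vscale [simp]: "Poly_Mapping.lookup (vscale c v) k = vconst c * Poly_Mapping.lookup v k"
  by (simp add: vscale_def Poly_Mapping.map.rep_eq when_def)

lemma Vstar_lookup: "v \<in> Vstar \<Longrightarrow> Poly_Mapping.lookup v k \<in> V k" by (simp add: Vstar_def)
lemma Vstar_0 [simp]: "0 \<in> Vstar" by (simp add: Vstar_def)
lemma Vstar_add: "v \<in> Vstar \<Longrightarrow> w \<in> Vstar \<Longrightarrow> v + w \<in> Vstar" by (simp add: Vstar_def lookup_add V_add)
lemma Vstar_uminus: "v \<in> Vstar \<Longrightarrow> - v \<in> Vstar" by (simp add: Vstar_def V_uminus)
lemma Vstar_scale: "v \<in> Vstar \<Longrightarrow> vscale c v \<in> Vstar" by (simp add: Vstar_def V_scale)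
lemma Vstar_single: "F \<in> V k \<Longrightarrow> Poly_Mapping.single k F \<in> Vstar"
  by (simp add: Vstar_def lookup_single when_def)

lemma vscale_simps: "vscale c (v + w) = vscale c v + vscale c w" "vscale (c + d) v = vscale c v + vscale d v"
  "vscale (c * d) v = vscale c (vscale d v)" "vscale 1 v = v" "vscale c 0 = 0" "vscale c (- v) = - vscale c v"
  by (rule poly_mapping_eqI; simp add: lookup_add vconst_simps algebra_simps)+

lemma vscale_single: "vscale c (Poly_Mapping.single k F) = Poly_Mapping.single k (vconst c * F)"
  by (rule poly_mapping_eqI) (simp add: lookup_single when_def)

text \<open>The value 0 outside \<open>Vstar\<close> makes operators that agree on
  \<open>Vstar\<close> equal, so that relations can be stated as equations of
  \<open>vop\<close>.\<close>

definition vlinear :: "(vfam \<Rightarrow> vfam) \<Rightarrow> bool" where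
  "vlinear f \<longleftrightarrow> (\<forall>v\<in>Vstar. f v \<in> Vstar) \<and> (\<forall>v\<in>Vstar. \<forall>w\<in>Vstar. f (v + w) = f v + f w) \<and>
     (\<forall>c. \<forall>v\<in>Vstar. f (vscale c v) = vscale c (f v)) \<and> (\<forall>v. v \<notin> Vstar \<longrightarrow> f v = 0)"

typedef vop = "{f. vlinear f}" morphisms vapp Abs_vop
  by (rule exI[of _ "\<lambda>_. 0"]) (simp add: vlinear_def vscale_simps)

setup_lifting type_definition_vop

lemma vlinear_0: "vlinear f \<Longrightarrow> f 0 = 0"
proof -
  assume f: "vlinear f"
  then have "f (0 + 0) = f 0 + f 0" unfolding vlinear_def using Vstar_0 by blast
  then show ?thesis by simp
qed

instantiation vop :: qt_algebra
begin

lift_definition zero_vop :: vop is "\<lambda>_. 0" by (simp add: vlinear_def vscale_simps)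
lift_definition plus_vop :: "vop \<Rightarrow> vop \<Rightarrow> vop" is "\<lambda>f g v. f v + g v"
  by (simp add: vlinear_def Vstar_add vscale_simps add.assoc add.left_commute)
lift_definition uminus_vop :: "vop \<Rightarrow> vop" is "\<lambda>f v. - f v"
  by (simp add: vlinear_def Vstar_uminus vscale_simps)
definition minus_vop :: "vop \<Rightarrow> vop \<Rightarrow> vop" where "minus_vop f g = f + - g"
lift_definition times_vop :: "vop \<Rightarrow> vop \<Rightarrow> vop" is "\<lambda>f g v. f (g v)"
proof -
  fix f g assume fg: "vlinear f" "vlinear g"
  then show "vlinear (\<lambda>v. f (g v))" using vlinear_0[OF fg(1)] unfolding vlinear_def by simp
qed
lift_definition smul_vop :: "qt \<Rightarrow> vop \<Rightarrow> vop" is "\<lambda>c f v. vscale c (f v)"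
  by (simp add: vlinear_def Vstar_scale vscale_simps flip: vscale_simps(3)) (simp add: mult.commute)

instance
proof
  fix x y z :: vop and c d :: qt
  show "x + y + z = x + (y + z)" by transfer (simp add: add.assoc)
  show "x + y = y + x" by transfer (simp add: add.commute)
  show "0 + x = x" by transfer simp
  show "- x + x = 0" by transfer simp
  show "x - y = x + - y" by (rule minus_vop_def)
  show "x * y * z = x * (y * z)" by transfer simp
  show "(x + y) * z = x * z + y * z" by transfer simp
  show "(c + d) \<cdot> x = c \<cdot> x + d \<cdot> x" by transfer (simp add: vscale_simps)
  show "c \<cdot> (x + y) = c \<cdot> x + c \<cdot> y" by transfer (simp add: vscale_simps)
  show "(c * d) \<cdot> x = c \<cdot> d \<cdot> x" by transfer (simp add: vscale_simps)
  show "1 \<cdot> x = x" by transfer (simp add: vscale_simps)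
  show "c \<cdot> (x * y) = (c \<cdot> x) * y" by transfer simp
  show "x * (y + z) = x * y + x * z"
  proof transfer
    fix x y z assume l: "vlinear x" "vlinear y" "vlinear z"
    show "(\<lambda>v. x (y v + z v)) = (\<lambda>v. x (y v) + x (z v))"
    proof
      fix v show "x (y v + z v) = x (y v) + x (z v)"
        using l vlinear_0[OF l(1)] by (cases "v \<in> Vstar") (simp_all add: vlinear_def)
    qed
  qed
  show "c \<cdot> (x * y) = x * (c \<cdot> y)"
  proof transfer
    fix c x y assume l: "vlinear x" "vlinear y"
    show "(\<lambda>v. vscale c (x (y v))) = (\<lambda>v. x (vscale c (y v)))"
    proof
      fix v show "vscale c (x (y v)) = x (vscale c (y v))"
        using l vlinear_0[OF l(1)] by (cases "v \<in> Vstar") (simp_all add: vlinear_def vscale_simps)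
    qed
  qed
qed

end

lemma vop_eqI: "(\<And>v. v \<in> Vstar \<Longrightarrow> vapp x v = vapp y v) \<Longrightarrow> x = y"
  using vapp[of x] vapp[of y] by (intro vapp_inject[THEN iffD1] ext) (metis mem_Collect_eq vlinear_def)

lemma vapp_simps: "vapp (x + y) v = vapp x v + vapp y v" "vapp (x * y) v = vapp x (vapp y v)"
  "vapp (c \<cdot> x) v = vscale c (vapp x v)" "vapp 0 v = 0" "vapp (x - y) v = vapp x v - vapp y v"
  by (simp_all add: plus_vop.rep_eq times_vop.rep_eq smul_vop.rep_eq zero_vop.rep_eq)
    (subst minus_vop_def, simp only: plus_vop.rep_eq uminus_vop.rep_eq, simp)

lemma vapp_linear:
  "v \<in> Vstar \<Longrightarrow> vapp x v \<in> Vstar" "v \<in> Vstar \<Longrightarrow> w \<in> Vstar \<Longrightarrow> vapp x (v + w) = vapp x v + vapp x w"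
  "v \<in> Vstar \<Longrightarrow> vapp x (vscale c v) = vscale c (vapp x v)"
  using vapp[of x] by (simp_all add: vlinear_def)

definition Vlin :: "nat \<Rightarrow> nat \<Rightarrow> (vpoly \<Rightarrow> vpoly) \<Rightarrow> bool" where
  "Vlin k l f \<longleftrightarrow> (\<forall>F\<in>V k. f F \<in> V l) \<and> (\<forall>F\<in>V k. \<forall>G\<in>V k. f (F + G) = f F + f G) \<and>
     (\<forall>c. \<forall>F\<in>V k. f (vconst c * F) = vconst c * f F)"

text \<open>The operator \<open>V\<^sub>k \<rightarrow> V\<^sub>l\<close> that is \<open>f\<close> in straightened coordinates.\<close>

definition sop :: "nat \<Rightarrow> nat \<Rightarrow> (vpoly \<Rightarrow> vpoly) \<Rightarrow> vop" where
  "sop k l f = Abs_vop (\<lambda>v. if v \<in> Vstar then Poly_Mapping.single l (shp l (f (shm k (Poly_Mapping.lookup v k)))) else 0)"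

lemma Vlin_V: "Vlin k l f \<Longrightarrow> F \<in> V k \<Longrightarrow> f F \<in> V l" by (simp add: Vlin_def)

lemma vapp_sop:
  assumes f: "Vlin k l f" and v: "v \<in> Vstar"
  shows "vapp (sop k l f) v = Poly_Mapping.single l (shp l (f (shm k (Poly_Mapping.lookup v k))))"
proof -
  have sh: "shm k (Poly_Mapping.lookup v k) \<in> V k" if "v \<in> Vstar" for v
    using that by (intro sft_V Vstar_lookup)
  have "vlinear (\<lambda>v. if v \<in> Vstar then Poly_Mapping.single l (shp l (f (shm k (Poly_Mapping.lookup v k)))) else 0)"
    using f sh unfolding vlinear_def Vlin_def
    by (auto intro!: Vstar_single sft_V simp: Vstar_add Vstar_scale lookup_add sft_simps sft_gens single_add vscale_single)
  then show ?thesis using v by (simp add: sop_def Abs_vop_inverse)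
qed

lemma sop_eqI: "(\<And>F. F \<in> V k \<Longrightarrow> f F = g F) \<Longrightarrow> sop k l f = sop k l g"
proof -
  assume *: "\<And>F. F \<in> V k \<Longrightarrow> f F = g F"
  have "f (shm k (Poly_Mapping.lookup v k)) = g (shm k (Poly_Mapping.lookup v k))" if "v \<in> Vstar" for v
    by (intro * sft_V Vstar_lookup that)
  then show ?thesis unfolding sop_def by (intro arg_cong[where f = Abs_vop] ext) simp
qed

lemma Vlin_zero: "Vlin k l (\<lambda>F. 0)" by (simp add: Vlin_def)

lemma sop_zero: "sop k l (\<lambda>F. 0) = 0"
  by (rule vop_eqI) (simp add: vapp_sop[OF Vlin_zero] vapp_simps sft_simps)

lemma Vlin_0: "Vlin k l f \<Longrightarrow> f 0 = 0"
proof -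
  assume f: "Vlin k l f"
  then have "f (vconst 0 * 0) = vconst 0 * f 0" unfolding Vlin_def using V_0 by blast
  then show ?thesis by (simp add: vconst_simps)
qed

lemma Vlin_comp: "Vlin l m g \<Longrightarrow> Vlin k l f \<Longrightarrow> Vlin k m (\<lambda>F. g (f F))"
  by (simp add: Vlin_def)
lemma Vlin_add: "Vlin k l f \<Longrightarrow> Vlin k l g \<Longrightarrow> Vlin k l (\<lambda>F. f F + g F)"
  by (simp add: Vlin_def V_add algebra_simps)
lemma Vlin_diff: "Vlin k l f \<Longrightarrow> Vlin k l g \<Longrightarrow> Vlin k l (\<lambda>F. f F - g F)"
  by (simp add: Vlin_def V_diff algebra_simps)
lemma Vlin_scale: "Vlin k l f \<Longrightarrow> Vlin k l (\<lambda>F. vconst c * f F)"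
  by (simp add: Vlin_def V_scale algebra_simps)
lemma Vlin_id: "Vlin k k (\<lambda>F. F)" by (simp add: Vlin_def)
lemma Vlin_T: "1 \<le> i \<Longrightarrow> i < k \<Longrightarrow> Vlin k k (T_op i)"
  by (simp add: Vlin_def T_op_add T_op_V)
lemma Vlin_TW: "Vlin k (Suc k) (TW k)"
  unfolding Vlin_def using TW_VS[of _ "Suc k" k] V_Suc_mono by (auto simp: TW_add TW_vconst V_eq_VS)
lemma Vlin_dmw: "Vlin (Suc k) k (dmw k)"
  by (simp add: Vlin_def dmw_V dmw_add dmw_vconst)
lemma Vlin_tau: "Vlin k (Suc k) tau"
  by (simp add: Vlin_def tau_V tau_simps tau_gens)
lemma Vlin_incl: "Vlin k (Suc k) (\<lambda>F. F)" by (simp add: Vlin_def V_Suc_mono)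
lemma Vlin_yvar: "1 \<le> i \<Longrightarrow> i \<le> k \<Longrightarrow> Vlin k k (\<lambda>F. yvar i * F)"
  by (simp add: Vlin_def V_mult V_yvar algebra_simps)

lemma sop_mult:
  assumes g: "Vlin l m g" and f: "Vlin k l f"
  shows "sop l m g * sop k l f = sop k m (\<lambda>F. g (f F))"
proof (rule vop_eqI)
  fix v assume v: "v \<in> Vstar"
  have "f (shm k (Poly_Mapping.lookup v k)) \<in> V l"
    by (intro Vlin_V[OF f] sft_V Vstar_lookup v)
  then show "vapp (sop l m g * sop k l f) v = vapp (sop k m (\<lambda>F. g (f F))) v"
    using v by (simp add: vapp_simps vapp_sop[OF f] vapp_sop[OF g] vapp_sop[OF Vlin_comp[OF g f]] Vstar_single sft_V)
qed

lemma sop_mult_neq: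
  assumes g: "Vlin l' m g" and f: "Vlin k l f" and "l \<noteq> l'"
  shows "sop l' m g * sop k l f = 0"
proof (rule vop_eqI)
  fix v assume v: "v \<in> Vstar"
  have "f (shm k (Poly_Mapping.lookup v k)) \<in> V l"
    by (intro Vlin_V[OF f] sft_V Vstar_lookup v)
  then show "vapp (sop l' m g * sop k l f) v = vapp 0 v"
    using v assms(3) Vlin_0[OF g]
    by (simp add: vapp_simps vapp_sop[OF f] vapp_sop[OF g] Vstar_single sft_V lookup_single when_def sft_simps)
qed

lemma sop_add: "Vlin k l f \<Longrightarrow> Vlin k l g \<Longrightarrow> sop k l f + sop k l g = sop k l (\<lambda>F. f F + g F)"
  by (rule vop_eqI) (simp add: vapp_simps vapp_sop Vlin_add sft_simps single_add)
lemma sop_diff: "Vlin k l f \<Longrightarrow> Vlin k l g \<Longrightarrow> sop k l f - sop k l g = sop k l (\<lambda>F. f F - g F)"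
  by (rule vop_eqI) (simp add: vapp_simps vapp_sop Vlin_diff sft_simps single_diff)
lemma sop_smul: "Vlin k l f \<Longrightarrow> c \<cdot> sop k l f = sop k l (\<lambda>F. vconst c * f F)"
  by (rule vop_eqI) (simp add: vapp_simps vapp_sop Vlin_scale sft_simps sft_gens vscale_single)

lemma dyck_rels_zeroI:
  assumes 1: "\<And>k i. 1 \<le> i \<Longrightarrow> i < k \<Longrightarrow> (gT G k i - gE G k) * (gT G k i + c \<cdot> gE G k) = 0"
    and 2: "\<And>k i. 1 \<le> i \<Longrightarrow> Suc i < k \<Longrightarrow> gT G k i * gT G k (Suc i) * gT G k i = gT G k (Suc i) * gT G k i * gT G k (Suc i)"
    and 3: "\<And>k i j. 1 \<le> i \<Longrightarrow> i < k \<Longrightarrow> 1 \<le> j \<Longrightarrow> j < k \<Longrightarrow> Suc i < j \<or> Suc j < i \<Longrightarrow> gT G k i * gT G k j = gT G k j * gT G k i"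
    and 4: "\<And>k i. 1 \<le> i \<Longrightarrow> i < k \<Longrightarrow> gT G k i * gM G (Suc k) = gM G (Suc k) * gT G (Suc k) i"
    and 5: "\<And>k i. 1 \<le> i \<Longrightarrow> i < k \<Longrightarrow> gP G k * gT G k i = gT G (Suc k) (Suc i) * gP G k"
    and 6: "\<And>k. gT G (Suc (Suc k)) 1 * gP G (Suc k) * gP G k = gP G (Suc k) * gP G k"
    and 7: "\<And>k. gM G (Suc k) * gM G (Suc (Suc k)) * gT G (Suc (Suc k)) (Suc k) = gM G (Suc k) * gM G (Suc (Suc k))"
    and 8: "\<And>k. gM G (Suc (Suc k)) * dcomm G (Suc (Suc k)) * gT G (Suc (Suc k)) (Suc k) = c \<cdot> (dcomm G (Suc k) * gM G (Suc (Suc k)))"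
    and 9: "\<And>k. gT G (Suc (Suc k)) 1 * dcomm G (Suc (Suc k)) * gP G (Suc k) = c \<cdot> (gP G (Suc k) * dcomm G (Suc k))"
    and x: "x \<in> dyck_rels c (G :: 'a::qt_algebra dyck_gens)"
  shows "x = 0"
proof -
  have r4: "gT G (k - 1) i * gM G k - gM G k * gT G k i = 0" if "1 \<le> i" "i < k - 1" for k i
    using 4[of i "k - 1"] that by simp
  have r2: "gT G k i * gT G k (i + 1) * gT G k i - gT G k (i + 1) * gT G k i * gT G k (i + 1) = 0" if "1 \<le> i" "i + 1 < k" for k i
    using 2[of i k] that by simp
  have r3: "gT G k i * gT G k j - gT G k j * gT G k i = 0" if "1 \<le> i" "i < k" "1 \<le> j" "j < k" "i + 1 < j \<or> j + 1 < i" for k i j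
    using 3[of i k j] that by simp
  note r3a = r3[OF _ _ _ _ disjI1] and r3b = r3[OF _ _ _ _ disjI2]
  have r5: "gP G k * gT G k i - gT G (k + 1) (i + 1) * gP G k = 0" if "1 \<le> i" "i < k" for k i
    using 5[of i k] that by simp
  have r6: "gT G (k + 2) 1 * gP G (k + 1) * gP G k - gP G (k + 1) * gP G k = 0" for k
    using 6[of k] by (simp add: numeral_2_eq_2)
  have r7: "gM G (k - 1) * gM G k * gT G k (k - 1) - gM G (k - 1) * gM G k = 0" if k: "2 \<le> k" for k
  proof -
    obtain j where j: "k = Suc (Suc j)" using k by (metis add_2_eq_Suc le_Suc_ex)
    show ?thesis unfolding j using 7[of j] by simp
  qed
  have r8: "gM G k * dcomm G k * gT G k (k - 1) - c \<cdot> (dcomm G (k - 1) * gM G k) = 0" if k: "2 \<le> k" for k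
  proof -
    obtain j where j: "k = Suc (Suc j)" using k by (metis add_2_eq_Suc le_Suc_ex)
    show ?thesis unfolding j using 8[of j] by simp
  qed
  have r9: "gT G (k + 1) 1 * dcomm G (k + 1) * gP G k - c \<cdot> (gP G k * dcomm G k) = 0" if k: "1 \<le> k" for k
  proof -
    obtain j where j: "k = Suc j" using k by (metis Suc_le_D One_nat_def)
    show ?thesis unfolding j using 9[of j] by simp
  qed
  show ?thesis
    using x unfolding dyck_rels_def Un_iff mem_Collect_eq
    by (elim disjE exE conjE; simp only: 1 r2 r3a r3b r4 r5 r6 r7 r8 r9)
qed

definition sgens :: "(nat \<Rightarrow> vpoly \<Rightarrow> vpoly) \<Rightarrow> (nat \<Rightarrow> vpoly \<Rightarrow> vpoly) \<Rightarrow> vop dyck_gens" where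
  "sgens tf pf = \<lparr>gE = \<lambda>k. sop k k (\<lambda>F. F), gP = \<lambda>k. sop k (Suc k) (pf k),
     gM = \<lambda>k. sop k (k - 1) (dmw (k - 1)), gT = \<lambda>k i. sop k k (tf i)\<rparr>"

text \<open>Collects the polynomial identities that amount to the defining relations; d_- is the
  same for both instances. \<open>Dc\<close> is a closed form of the commutator, so that the last
  two relations need not be expanded.\<close>

locale sop_system =
  fixes c :: qt and tf pf :: "nat \<Rightarrow> vpoly \<Rightarrow> vpoly"
  assumes c: "c \<noteq> 0" "c \<noteq> 1"
    and tl: "\<And>k i. 1 \<le> i \<Longrightarrow> i < k \<Longrightarrow> Vlin k k (tf i)"
    and pl: "\<And>k. Vlin k (Suc k) (pf k)"
    and quad: "\<And>i F. tf i (tf i F) = vconst c * F - (vconst c - 1) * tf i F"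
    and braid: "\<And>i F. tf i (tf (Suc i) (tf i F)) = tf (Suc i) (tf i (tf (Suc i) F))"
    and far: "\<And>i j F. Suc i < j \<Longrightarrow> tf i (tf j F) = tf j (tf i F)"
    and tm: "\<And>k i F. F \<in> V (Suc k) \<Longrightarrow> 1 \<le> i \<Longrightarrow> i < k \<Longrightarrow> dmw k (tf i F) = tf i (dmw k F)"
    and pt: "\<And>k i F. F \<in> V k \<Longrightarrow> 1 \<le> i \<Longrightarrow> i < k \<Longrightarrow> pf k (tf i F) = tf (Suc i) (pf k F)"
    and tpp: "\<And>k F. F \<in> V k \<Longrightarrow> tf 1 (pf (Suc k) (pf k F)) = pf (Suc k) (pf k F)"
    and mmt: "\<And>k F. F \<in> V (Suc (Suc k)) \<Longrightarrow> dmw k (dmw (Suc k) (tf (Suc k) F)) = dmw k (dmw (Suc k) F)"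
  fixes Dc assumes Dc: "\<And>k F. F \<in> V (Suc k) \<Longrightarrow> Dc k F = pf k (dmw k F) - dmw (Suc k) (pf (Suc k) F)"
    and mdt: "\<And>k F. F \<in> V (Suc (Suc k)) \<Longrightarrow> dmw (Suc k) (Dc (Suc k) (tf (Suc k) F)) = vconst c * Dc k (dmw (Suc k) F)"
    and tdp: "\<And>k F. F \<in> V (Suc k) \<Longrightarrow> tf 1 (Dc (Suc k) (pf (Suc k) F)) = vconst c * pf (Suc k) (Dc k F)"
begin

abbreviation "H \<equiv> sgens tf pf"
abbreviation "G \<equiv> norm_gens H"

lemma path_H: "path_system H"
  unfolding path_system_def sgens_def
  by (auto simp: sop_mult Vlin_id pl tl Vlin_dmw sop_mult_neq)

lemma G_gens [simp]: "gE G k = sop k k (\<lambda>F. F)" "gP G k = sop k (Suc k) (pf k)" "gM G (Suc k) = sop (Suc k) k (dmw k)"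
  by (simp_all add: norm_gens_simps[OF path_H]) (simp_all add: sgens_def)
lemma G_T [simp]: "1 \<le> i \<Longrightarrow> i < k \<Longrightarrow> gT G k i = sop k k (tf i)"
  by (simp add: norm_gens_simps[OF path_H]) (simp add: sgens_def)

lemma Dl: "Vlin (Suc k) (Suc k) (Dc k)"
proof -
  have "Vlin (Suc k) (Suc k) (\<lambda>F. pf k (dmw k F) - dmw (Suc k) (pf (Suc k) F))"
    by (intro Vlin_diff Vlin_comp[OF pl Vlin_dmw] Vlin_comp[OF Vlin_dmw pl])
  then show ?thesis unfolding Vlin_def using Dc by (simp add: V_add V_scale)
qed

lemma G_D: "dcomm G (Suc k) = sop (Suc k) (Suc k) (Dc k)"
proof -
  have "dcomm G (Suc k) = sop (Suc k) (Suc k) (\<lambda>F. pf k (dmw k F) - dmw (Suc k) (pf (Suc k) F))"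
    unfolding dcomm_def
    by (simp add: sop_mult[OF pl Vlin_dmw] sop_mult[OF Vlin_dmw pl] sop_diff[OF Vlin_comp[OF pl Vlin_dmw] Vlin_comp[OF Vlin_dmw pl]])
  also have "\<dots> = sop (Suc k) (Suc k) (Dc k)" by (rule sop_eqI) (simp add: Dc)
  finally show ?thesis .
qed

lemma dyck_system: "dyck_system c G"
proof
  show "path_system G"
    unfolding norm_gens_def by (rule path_system_map[OF alg_hom_path_lift[OF path_H] path_system_path_gens])
  fix x assume "x \<in> dyck_rels c G"
  then show "x = 0"
  proof (rule dyck_rels_zeroI[rotated -1])
    fix k i :: nat assume i: "1 \<le> i" "i < k"
    have lin: "tf i (tf i F + vconst c * F) = tf i (tf i F) + vconst c * tf i F" if "F \<in> V k" for F
      using tl[OF i] that by (simp add: Vlin_def V_scale)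
    have q: "sop k k (\<lambda>F. tf i F - F) * sop k k (\<lambda>F. tf i F + vconst c * F) = sop k k (\<lambda>F. 0)"
      unfolding sop_mult[OF Vlin_diff[OF tl[OF i] Vlin_id] Vlin_add[OF tl[OF i] Vlin_scale[OF Vlin_id]]]
      by (rule sop_eqI) (simp add: lin quad, simp add: algebra_simps)
    show "(gT G k i - gE G k) * (gT G k i + c \<cdot> gE G k) = 0"
      using i tl[OF i] q by (simp add: sop_diff Vlin_id sop_smul sop_add Vlin_scale sop_zero)
    show "gP G k * gT G k i = gT G (Suc k) (Suc i) * gP G k"
      using i tl[OF i] tl[of "Suc i" "Suc k"] by (simp add: sop_mult pl, intro sop_eqI, simp add: pt)
    show "gT G k i * gM G (Suc k) = gM G (Suc k) * gT G (Suc k) i"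
      using i tl[OF i] tl[of i "Suc k"] by (simp add: sop_mult Vlin_dmw, intro sop_eqI, simp add: tm)
  next
    fix k i :: nat assume "1 \<le> i" "Suc i < k"
    then show "gT G k i * gT G k (Suc i) * gT G k i = gT G k (Suc i) * gT G k i * gT G k (Suc i)"
      using tl[of i k] tl[of "Suc i" k] by (simp add: sop_mult Vlin_comp braid)
  next
    fix k i j :: nat assume "1 \<le> i" "i < k" "1 \<le> j" "j < k" "Suc i < j \<or> Suc j < i"
    then show "gT G k i * gT G k j = gT G k j * gT G k i"
      using tl[of i k] tl[of j k] far[of i j] far[of j i] by (auto simp: sop_mult)
  next
    fix k :: nat
    have t1: "Vlin (Suc (Suc k)) (Suc (Suc k)) (tf (Suc 0))" by (rule tl) auto
    have "gT G (Suc (Suc k)) 1 * gP G (Suc k) * gP G k =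
      sop k (Suc (Suc k)) (\<lambda>F. tf 1 (pf (Suc k) (pf k F)))"
      by (simp add: mult.assoc sop_mult[OF pl pl] sop_mult[OF t1 Vlin_comp[OF pl pl]])
    also have "\<dots> = gP G (Suc k) * gP G k"
      unfolding G_gens sop_mult[OF pl pl] by (rule sop_eqI) (rule tpp)
    finally show "gT G (Suc (Suc k)) 1 * gP G (Suc k) * gP G k = gP G (Suc k) * gP G k" .
    show "gM G (Suc k) * gM G (Suc (Suc k)) * gT G (Suc (Suc k)) (Suc k) = gM G (Suc k) * gM G (Suc (Suc k))"
      using tl[of "Suc k" "Suc (Suc k)"] by (simp add: sop_mult Vlin_dmw Vlin_comp[OF Vlin_dmw Vlin_dmw], intro sop_eqI, simp add: mmt)
    show "gM G (Suc (Suc k)) * dcomm G (Suc (Suc k)) * gT G (Suc (Suc k)) (Suc k) = c \<cdot> (dcomm G (Suc k) * gM G (Suc (Suc k)))"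
      using tl[of "Suc k" "Suc (Suc k)"]
      by (simp add: G_D sop_mult Vlin_dmw Dl Vlin_comp[OF Vlin_dmw Dl] Vlin_comp[OF Dl Vlin_dmw] sop_smul, intro sop_eqI, simp add: mdt)
    have "gT G (Suc (Suc k)) 1 * dcomm G (Suc (Suc k)) * gP G (Suc k) =
      sop (Suc k) (Suc (Suc k)) (\<lambda>F. tf 1 (Dc (Suc k) (pf (Suc k) F)))"
      by (simp add: G_D mult.assoc sop_mult[OF Dl pl] sop_mult[OF t1 Vlin_comp[OF Dl pl]])
    also have "\<dots> = c \<cdot> (gP G (Suc k) * dcomm G (Suc k))"
      unfolding G_gens G_D sop_mult[OF pl Dl] sop_smul[OF Vlin_comp[OF pl Dl]] by (rule sop_eqI) (rule tdp)
    finally show "gT G (Suc (Suc k)) 1 * dcomm G (Suc (Suc k)) * gP G (Suc k) = c \<cdot> (gP G (Suc k) * dcomm G (Suc k))" .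
  qed
qed (rule c)+

end

section \<open>The two systems of generators\<close>

abbreviation cqi :: vpoly where "cqi \<equiv> vconst (inverse qq)"

lemma cqi_cq [simp]: "cqi * cq = 1" "cq * cqi = 1" "cqi * (cq * x) = x" "cq * (cqi * x) = x"
  "cq * (x * cqi) = x" "cq * (x * (cqi * y)) = x * y"
proof -
  show 1: "cqi * cq = 1" using qq_neq by (simp flip: vconst_simps(2,4))
  then show 2: "cq * cqi = 1" by (simp add: mult.commute)
  show 3: "cqi * (cq * x) = x" "cq * (cqi * x) = x" for x by (simp_all add: 1 2 flip: mult.assoc)
  show "cq * (x * cqi) = x" "cq * (x * (cqi * y)) = x * y"
    using 3(2) by (simp_all add: mult.left_commute mult.commute)
qed

definition Tv :: "nat \<Rightarrow> vpoly \<Rightarrow> vpoly" where "Tv i F = cqi * (T_op i F + (cq - 1) * F)"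

lemma T_Tv [simp]: "T_op i (Tv i F) = F" "Tv i (T_op i F) = F"
  unfolding Tv_def by (simp_all add: T_op_add T_op_cq1 T_op_quad)

lemma T_op_inj: "T_op i F = T_op i G \<Longrightarrow> F = G" by (metis T_Tv(2))

lemma Tv_braid: "Tv i (Tv (Suc i) (Tv i F)) = Tv (Suc i) (Tv i (Tv (Suc i) F))"
proof -
  have "T_op i (T_op (Suc i) (T_op i (Tv i (Tv (Suc i) (Tv i F))))) =
    T_op i (T_op (Suc i) (T_op i (Tv (Suc i) (Tv i (Tv (Suc i) F)))))"
    by (simp only: T_Tv) (simp add: T_op_braid)
  then show ?thesis by (metis T_op_inj)
qed

lemma dmw_cq1: "dmw k ((cq - 1) * X) = (cq - 1) * dmw k X"
  by (rule dmw_lin) (rule V_cq1)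

lemma sop_system_A: "sop_system qq T_op TW (\<lambda>k F. (cq - 1) * TW k (yvar (Suc k) * F))"
proof
  show "qq \<noteq> 0" "qq \<noteq> 1" by (fact qq_neq)+
  fix k F assume "F \<in> V k"
  then show "T_op 1 (TW (Suc k) (TW k F)) = TW (Suc k) (TW k F)"
    unfolding TW_TW by (subst T_op_fix) (auto intro!: swap_y_fix[of _ "{1..k}"] simp: V_eq_VS)
next
  fix k F assume F: "F \<in> V (Suc (Suc k))"
  have "dmw (Suc k) (TW (Suc k) (yvar (Suc (Suc k)) * T_op (Suc k) F)) = cq * TW k (yvar (Suc k) * dmw (Suc k) F)"
  proof -
    have y: "yvar (Suc k) * F \<in> V (Suc (Suc k))" using F by (intro V_mult V_yvar) auto
    have "TW (Suc k) (yvar (Suc (Suc k)) * T_op (Suc k) F) = cq * TW k (yvar (Suc k) * F)"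
      by (simp add: TW_Suc T_op_right_T TW_vconst)
    moreover have "dmw (Suc k) (yvar (Suc k) * F) = yvar (Suc k) * dmw (Suc k) F"
      by (rule dmw_lin) (simp add: V_yvar)
    ultimately show ?thesis using y by (simp add: dmw_vconst dmw_TW)
  qed
  then show "dmw (Suc k) ((cq - 1) * TW (Suc k) (yvar (Suc (Suc k)) * T_op (Suc k) F)) =
      cq * ((cq - 1) * TW k (yvar (Suc k) * dmw (Suc k) F))"
    by (simp only: dmw_cq1 mult.left_commute)
next
  fix k F assume F: "F \<in> V (Suc k)"
  have "yvar (Suc (Suc k)) * TW (Suc k) F = TW k (yvar (Suc (Suc k)) * T_op (Suc k) F)"
    by (simp add: TW_Suc TW_yvar)
  then have "T_op 1 (TW (Suc k) (yvar (Suc (Suc k)) * TW (Suc k) F)) =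
    TW (Suc k) (TW k (T_op (Suc k) (yvar (Suc (Suc k)) * T_op (Suc k) F)))"
    by (simp only: TW_TW)
  then show "T_op 1 ((cq - 1) * TW (Suc k) (yvar (Suc (Suc k)) * TW (Suc k) F)) =
    cq * TW (Suc k) ((cq - 1) * TW k (yvar (Suc k) * F))"
    by (simp only: T_op_right_T T_op_cq1 TW_cq1 TW_vconst mult.left_commute)
next
  show "T_op i (T_op j F) = T_op j (T_op i F)" if "Suc i < j" for i j F by (rule T_op_far[OF that])
qed (simp_all add: Vlin_T Vlin_TW T_op_quad T_op_braid dmw_T TW_T_op dmw_dmw_T dcomm_W)

lemma Tv_vconst: "Tv i (vconst c * F) = vconst c * Tv i F"
  by (simp add: Tv_def) (simp add: algebra_simps)

lemma Tv_add: "Tv i (F + G) = Tv i F + Tv i G"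
  by (simp add: Tv_def T_op_add) (simp add: algebra_simps)

lemma Tv_V: "F \<in> V k \<Longrightarrow> 1 \<le> i \<Longrightarrow> i < k \<Longrightarrow> Tv i F \<in> V k"
  unfolding Tv_def by (intro V_scale V_add T_op_V V_mult V_cq1)

lemma Vlin_Tv: "1 \<le> i \<Longrightarrow> i < k \<Longrightarrow> Vlin k k (Tv i)"
  by (simp add: Vlin_def Tv_add Tv_vconst Tv_V)

lemma tau_Tv: "1 \<le> i \<Longrightarrow> tau (Tv i F) = Tv (Suc i) (tau F)"
  by (simp add: Tv_def tau_simps tau_gens tau_T_op)

lemma Tv_fix: "T_op i F = F \<Longrightarrow> Tv i F = F" by (metis T_Tv(2))

text \<open>The starred T is the inverse of \<open>T_op\<close>; each identity is the one for
  \<open>T_op\<close> applied to an argument of the form \<open>Tv i F\<close> or solved for the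
  inverse.\<close>

lemma sop_system_S: "sop_system (inverse qq) Tv (\<lambda>k. tau) Dst"
proof
  show "inverse qq \<noteq> 0" "inverse qq \<noteq> 1" by (fact qq_neq)+
  show "Tv i (Tv i F) = cqi * F - (cqi - 1) * Tv i F" for i F
    unfolding Tv_def[of i "Tv i F"] by (simp add: algebra_simps)
  show "Tv i (Tv j F) = Tv j (Tv i F)" if "Suc i < j" for i j F
    using T_op_far[OF that, of F] by (simp add: Tv_def T_op_add T_op_cq1) (simp add: algebra_simps)
  show "dmw k (Tv i F) = Tv i (dmw k F)" if "F \<in> V (Suc k)" "1 \<le> i" "i < k" for k i F
    using that by (simp add: Tv_def dmw_vconst dmw_add dmw_cq1 dmw_T)
  show "Tv 1 (tau (tau F)) = tau (tau F)" if "F \<in> V k" for k F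
    by (intro Tv_fix T_op_fix swap_tau_tau[OF that])
  show "dmw k (dmw (Suc k) (Tv (Suc k) F)) = dmw k (dmw (Suc k) F)" if F: "F \<in> V (Suc (Suc k))" for k F
    using dmw_dmw_T[OF Vlin_V[OF Vlin_Tv F], of "Suc k"] by simp
  show "dmw (Suc k) (Dst (Suc k) (Tv (Suc k) F)) = cqi * Dst k (dmw (Suc k) F)" if F: "F \<in> V (Suc (Suc k))" for k F
  proof -
    have "cq * dmw (Suc k) (Dst (Suc k) (Tv (Suc k) F)) = Dst k (dmw (Suc k) F)"
      using dmw_Dst[OF Vlin_V[OF Vlin_Tv F], of "Suc k"] by simp
    from this[symmetric] show ?thesis by simp
  qed
  show "Tv 1 (Dst (Suc k) (tau F)) = cqi * tau (Dst k F)" if F: "F \<in> V (Suc k)" for k F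
  proof -
    have "cq * Tv 1 (Dst (Suc k) (tau F)) = tau (Dst k F)"
      using arg_cong[OF Dst_tau[OF F], of "Tv 1"] by (simp add: Tv_vconst)
    from this[symmetric] show ?thesis by simp
  qed
qed (simp_all add: Vlin_Tv Vlin_tau Tv_braid tau_Tv Dst_def)

interpretation opA: sop_system qq T_op TW "\<lambda>k F. (cq - 1) * TW k (yvar (Suc k) * F)"
  by (rule sop_system_A)
interpretation opS: sop_system "inverse qq" Tv "\<lambda>k. tau" Dst
  by (rule sop_system_S)
interpretation dA: dyck_system qq "norm_gens (sgens T_op TW)" by (rule opA.dyck_system)
interpretation dS: dyck_system "inverse qq" "norm_gens (sgens Tv (\<lambda>k. tau))" by (rule opS.dyck_system)

abbreviation "genA \<equiv> norm_gens (sgens T_op TW)"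
abbreviation "genS \<equiv> norm_gens (sgens Tv (\<lambda>k. tau))"

lemma phi_A: "dA.phi (Suc l) = sop (Suc l) (Suc l) (\<lambda>F. TW l (yvar (Suc l) * F))"
proof -
  have "vconst (1 / (qq - 1)) * (cq - 1) = vconst (1 / (qq - 1)) * vconst (qq - 1)" by (simp add: vconst_simps)
  also have "\<dots> = 1" unfolding vconst_simps(4)[symmetric] using qq_neq by (simp add: vconst_simps)
  finally have "vconst (1 / (qq - 1)) * ((cq - 1) * F) = F" for F by (simp flip: mult.assoc)
  then show ?thesis unfolding dA.phi_def opA.G_D sop_smul[OF opA.Dl] by simp
qed

lemma W_A: "n \<le> l \<Longrightarrow> Vlin k (Suc l) f \<Longrightarrow> dA.W (Suc l) n (sop k (Suc l) f) = sop k (Suc l) (\<lambda>F. TW n (f F))"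
proof (induction n arbitrary: f)
  case (Suc n)
  then show ?case
    by (simp add: sop_mult[OF Vlin_T] Vlin_comp[OF Vlin_T] TW_Suc)
qed simp

text \<open>At i = k, \<open>dcomm_W\<close> gives \<open>phi\<close> as T_1 ... T_(k-1) after
  multiplication by y_k; below, T_i y_(i+1) T_i = q y_i matches the recursion.\<close>

lemma Y_A: "1 \<le> i \<Longrightarrow> i \<le> k \<Longrightarrow> ygen qq genA k i = sop k k (\<lambda>F. yvar i * F)"
proof (induction rule: dA.Y_down_induct)
  case last
  then obtain l where k: "k = Suc l" by (cases k) auto
  have y: "Vlin (Suc l) (Suc l) (\<lambda>F. yvar (Suc l) * F)" by (rule Vlin_yvar) auto
  have M: "sop (Suc l) (Suc l) (\<lambda>F. yvar (Suc l) * F) \<in> dA.Mod (Suc l)"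
    by (simp add: dA.Mod_def sop_mult[OF Vlin_id y])
  have "dA.phi (Suc l) = dA.W (Suc l) l (sop (Suc l) (Suc l) (\<lambda>F. yvar (Suc l) * F))"
    by (simp add: phi_A W_A y)
  then show ?case unfolding k using M by (simp add: dA.Y_last_elt)
next
  case (step i)
  have y: "Vlin k k (\<lambda>F. yvar (Suc i) * F)" using step by (intro Vlin_yvar) auto
  have T: "Vlin k k (T_op i)" using step by (intro Vlin_T) auto
  have "ygen qq genA k i = inverse qq \<cdot> (gT genA k i * ygen qq genA k (Suc i) * gT genA k i)"
    using step by (subst ygen.simps) simp
  also have "\<dots> = sop k k (\<lambda>F. cqi * T_op i (yvar (Suc i) * T_op i F))"
    using step by (simp add: mult.assoc sop_mult[OF y T] sop_mult[OF T Vlin_comp[OF y T]] sop_smul[OF Vlin_comp[OF T Vlin_comp[OF y T]]])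
  also have "\<dots> = sop k k (\<lambda>F. yvar i * F)" by (simp add: T_op_right_T)
  finally show ?case .
qed

primrec TWi :: "nat \<Rightarrow> vpoly \<Rightarrow> vpoly" where
  "TWi 0 F = F" | "TWi (Suc n) F = Tv (Suc n) (TWi n F)"

lemma TWi_TW: "TWi n (TW n F) = F" by (induction n arbitrary: F) (simp_all add: TW_Suc)

lemma Vlin_TWi: "n \<le> l \<Longrightarrow> Vlin k (Suc l) f \<Longrightarrow> Vlin k (Suc l) (\<lambda>F. TWi n (f F))"
  by (induction n) (simp_all add: Vlin_comp[OF Vlin_Tv])

lemma Wr_S: "n \<le> l \<Longrightarrow> Vlin k (Suc l) f \<Longrightarrow> dS.Wr (Suc l) n (sop k (Suc l) f) = sop k (Suc l) (\<lambda>F. TWi n (f F))"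
  by (induction n) (simp_all add: sop_mult[OF Vlin_Tv Vlin_TWi])

lemma Vlin_Dst: "Vlin (Suc k) (Suc k) (Dst k)" by (rule opS.Dl)

lemma phi_S: "dS.phi (Suc l) = (1 / (inverse qq - 1)) \<cdot> sop (Suc l) (Suc l) (Dst l)"
  by (simp add: dS.phi_def opS.G_D)

lemma TW_Tv: "1 \<le> i \<Longrightarrow> i < n \<Longrightarrow> TW n (Tv i F) = Tv (Suc i) (TW n F)"
  by (simp add: Tv_def TW_vconst TW_add TW_cq1 TW_T_op)

lemma Ti_S: "1 \<le> i \<Longrightarrow> i < k \<Longrightarrow> dS.Ti k i = sop k k (T_op i)"
proof -
  assume i: "1 \<le> i" "i < k"
  have "dS.Ti k i = dS.Ti k i * (gT genS k i * sop k k (T_op i))"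
    using i dS.E_Ti(2)[OF i] by (simp add: sop_mult[OF Vlin_Tv Vlin_T])
  also have "\<dots> = gE genS k * sop k k (T_op i)" by (simp only: dS.T_Ti_mult(2)[OF i] flip: mult.assoc)
  also have "\<dots> = sop k k (T_op i)" using i by (simp add: sop_mult[OF Vlin_id Vlin_T])
  finally show ?thesis .
qed

lemma cross_rels_op: "cross_rels genA genS"
  unfolding cross_rels_def
proof (intro conjI allI impI)
  fix k :: nat
  show "gM genS (Suc k) = gM genA (Suc k)" "gE genS k = gE genA k" by simp_all
  have P: "gP genA k = sop k (Suc k) (TW k)" and PS: "gP genS k = sop k (Suc k) tau" by simp_all
  show "ygen (inverse qq) genS (Suc k) 1 * gP genA k = (- tt * qq ^ Suc k) \<cdot> (ygen qq genA (Suc k) 1 * gP genS k)"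
  proof -
    \<comment> \<open>The starred word in \<open>Y_first\<close> is inverse to d_+ = T_1 ... T_k, so
      only the inclusion of V_k into V_(k+1) remains, on which the commutator is known from
      \<open>Dst_no_last\<close>.\<close>
    have "ygen (inverse qq) genS (Suc k) 1 * gP genA k =
      qq ^ k \<cdot> (dS.phi (Suc k) * sop k (Suc k) (\<lambda>F. F))"
      unfolding dS.Y_first P by (simp add: Wr_S Vlin_TW TWi_TW)
    also have "dS.phi (Suc k) * sop k (Suc k) (\<lambda>F. F) = (1 / (inverse qq - 1)) \<cdot> sop k (Suc k) (\<lambda>F. Dst k F)"
      unfolding phi_S by (simp add: smul_mult_left[symmetric] sop_mult[OF Vlin_Dst Vlin_incl])
    also have "sop k (Suc k) (\<lambda>F. Dst k F) = sop k (Suc k) (\<lambda>F. vconst ((qq - 1) * tt) * (yvar 1 * tau F))"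
      by (rule sop_eqI) (simp add: Dst_no_last vconst_simps ac_simps)
    also have "\<dots> = ((qq - 1) * tt) \<cdot> (ygen qq genA (Suc k) 1 * gP genS k)"
      by (simp add: Y_A sop_mult[OF Vlin_yvar Vlin_tau] sop_smul[OF Vlin_comp[OF Vlin_yvar Vlin_tau]])
    finally have "ygen (inverse qq) genS (Suc k) 1 * gP genA k =
      (qq ^ k * (1 / (inverse qq - 1) * ((qq - 1) * tt))) \<cdot> (ygen qq genA (Suc k) 1 * gP genS k)"
      by (simp only: smul_assoc)
    \<comment> \<open>q^k comes from \<open>Y_first\<close>, the fraction normalizes z, and (q-1)t
      comes from the commutator; the sign is that of 1/q - 1 = -(q-1)/q.\<close>
    moreover have "qq ^ k * (1 / (inverse qq - 1) * ((qq - 1) * tt)) = - tt * qq ^ Suc k"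
    proof -
      have "inverse qq - 1 = - ((qq - 1) * inverse qq)" using qq_neq by (simp add: field_simps)
      moreover have "qq - 1 \<noteq> 0" using qq_neq by simp
      ultimately show ?thesis using qq_neq by (simp add: divide_simps) (simp add: algebra_simps)
    qed
    ultimately show ?thesis by simp
  qed
next
  fix k i :: nat assume i: "1 \<le> i \<and> i < k"
  then have "gTinv genA k i = inverse qq \<cdot> (gT genA k i + (qq - 1) \<cdot> gE genA k)"
    by (simp add: dA.gTinv_eq dA.Ti_def)
  also have "\<dots> = sop k k (\<lambda>F. cqi * (T_op i F + vconst (qq - 1) * F))"
    using i by (simp add: sop_smul Vlin_id Vlin_scale[OF Vlin_id] sop_add Vlin_T Vlin_add)
  also have "\<dots> = sop k k (Tv i)" by (rule sop_eqI) (simp add: Tv_def vconst_simps)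
  finally show "gT genS k i = gTinv genA k i" using i by simp
next
  fix k i :: nat assume i: "1 \<le> i \<and> i \<le> k"
  show "ygen qq genA (Suc k) (Suc i) * gP genS k = gP genS k * ygen qq genA k i"
    using i by (simp add: Y_A sop_mult[OF Vlin_yvar Vlin_tau] sop_mult[OF Vlin_tau Vlin_yvar] tau_simps tau_gens)
  show "ygen (inverse qq) genS (Suc k) (Suc i) * gP genA k = gP genA k * ygen (inverse qq) genS k i"
  proof (rule dS.Y_intertwine)
    fix k
    show "gE genS (Suc k) * gP genA k = gP genA k" "gP genA k * gE genS k = gP genA k"
      by (simp_all add: sop_mult Vlin_id Vlin_TW)
  next
    fix k i :: nat assume i: "1 \<le> i" "i < k"
    then show "gP genA k * gT genS k i = gT genS (Suc k) (Suc i) * gP genA k"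
      by (simp add: sop_mult[OF Vlin_TW Vlin_Tv] sop_mult[OF Vlin_Tv Vlin_TW] TW_Tv)
  next
    fix k :: nat assume k: "1 \<le> k"
    then obtain l where l: "k = Suc l" by (cases k) auto
    have "sop (Suc k) (Suc k) (T_op 1) * (sop (Suc k) (Suc k) (Dst k) * gP genA k) = gP genA k * sop k k (Dst l)"
      unfolding l opA.G_gens sop_mult[OF Vlin_Dst Vlin_TW] sop_mult[OF Vlin_TW Vlin_Dst]
      by (subst sop_mult[OF Vlin_T Vlin_comp[OF Vlin_Dst Vlin_TW]]) (auto intro!: sop_eqI simp: Dst_dplus[unfolded One_nat_def])
    then show "dS.Ti (Suc k) 1 * (dS.phi (Suc k) * gP genA k) = gP genA k * dS.phi k"
      using k by (simp add: Ti_S phi_S l smul_mult_left[symmetric] smul_mult_right[symmetric])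
  qed (use i in auto)
qed

section \<open>The action on V and its uniqueness\<close>

definition act :: "double_dyck \<Rightarrow> vop" where
  "act = (SOME f. alg_hom f \<and> map_gens f double_gens = genA \<and> map_gens f double_star_gens = genS)"

lemma act: "alg_hom act" "map_gens act double_gens = genA" "map_gens act double_star_gens = genS"
  using someI_ex[OF double_dyck_lift[OF opA.path_H opA.dyck_system opS.path_H opS.dyck_system cross_rels_op]]
  unfolding act_def by blast+

lemmas act_simps = alg_hom_simps[OF act(1)]

lemma act_gens: "act (gE double_gens k) = sop k k (\<lambda>F. F)" "act (gP double_gens k) = sop k (Suc k) (TW k)"
  "act (gM double_gens (Suc k)) = sop (Suc k) k (dmw k)" "1 \<le> i \<Longrightarrow> i < k \<Longrightarrow> act (gT double_gens k i) = sop k k (T_op i)"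
  "act (gP double_star_gens k) = sop k (Suc k) tau"
proof -
  have "gE (map_gens act double_gens) k = sop k k (\<lambda>F. F)" "gP (map_gens act double_gens) k = sop k (Suc k) (TW k)"
    "gM (map_gens act double_gens) (Suc k) = sop (Suc k) k (dmw k)" "gP (map_gens act double_star_gens) k = sop k (Suc k) tau"
    unfolding act by simp_all
  then show "act (gE double_gens k) = sop k k (\<lambda>F. F)" "act (gP double_gens k) = sop k (Suc k) (TW k)"
    "act (gM double_gens (Suc k)) = sop (Suc k) k (dmw k)" "act (gP double_star_gens k) = sop k (Suc k) tau" by simp_all
  show "act (gT double_gens k i) = sop k k (T_op i)" if i: "1 \<le> i" "i < k"
  proof -
    have "gT (map_gens act double_gens) k i = sop k k (T_op i)" unfolding act using i by simp
    then show ?thesis by simp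
  qed
qed

lemma act_Y: "1 \<le> i \<Longrightarrow> i \<le> k \<Longrightarrow> act (ygen qq double_gens k i) = sop k k (\<lambda>F. yvar i * F)"
  using map_ygen[OF dyck_system_double act(1)] by (simp add: act(2) Y_A)

definition rho :: "double_dyck \<Rightarrow> vfam \<Rightarrow> vfam" where "rho x v = vapp (act x) v"

lemma rho_action: "is_action rho"
  unfolding is_action_def rho_def by (simp add: vapp_linear vapp_simps act_simps)

lemma rho_operators: "acts_by_operators rho"
  unfolding acts_by_operators_def
proof (intro ballI conjI allI impI)
  fix v assume v: "v \<in> Vstar"
  fix k :: nat
  let ?F = "Poly_Mapping.lookup v k"
  have F: "shm k ?F \<in> V k" by (intro sft_V Vstar_lookup v)
  show "rho (gE double_gens k) v = on_summand k k (\<lambda>F. F) v"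
    by (simp add: rho_def act_gens vapp_sop[OF Vlin_id v] on_summand_def)
  show "rho (gP double_gens k) v = on_summand k (k + 1) (dplus_op k) v"
    using dplus_op_shp[of k "shm k ?F"] by (simp add: rho_def act_gens vapp_sop[OF Vlin_TW v] on_summand_def)
  show "rho (gP double_star_gens k) v = on_summand k (k + 1) (dplus_star_op k) v"
    using dplus_star_op_shp[OF F] by (simp add: rho_def act_gens vapp_sop[OF Vlin_tau v] on_summand_def)
  show "rho (gT double_gens k i) v = on_summand k k (T_op i) v" if "1 \<le> i \<and> i < k" for i
    using that T_op_sft[of i k 1 "shm k ?F"] by (simp add: rho_def act_gens vapp_sop[OF Vlin_T v] on_summand_def)
next
  fix v and k :: nat assume v: "v \<in> Vstar" and "1 \<le> k"
  then obtain l where l: "k = Suc l" by (cases k) auto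
  have F: "shm k (Poly_Mapping.lookup v k) \<in> V k" by (intro sft_V Vstar_lookup v)
  show "rho (gM double_gens k) v = on_summand k (k - 1) (dminus_op k) v"
    unfolding l using dminus_op_shp[OF F[unfolded l]]
    by (simp add: rho_def act_gens vapp_sop[OF Vlin_dmw v] on_summand_def)
qed

lemma rho_unique:
  assumes r: "is_action r" "acts_by_operators r"
  shows "\<forall>v\<in>Vstar. r x v = rho x v"
proof (induction x rule: double_dyck_induct)
  case (E k)
  then show ?case using r(2) rho_operators unfolding acts_by_operators_def by simp
next
  case (P k)
  then show ?case using r(2) rho_operators unfolding acts_by_operators_def by simp
next
  case (M k)
  then show ?case using r(2) rho_operators unfolding acts_by_operators_def by simp
next
  case (T k i)
  then show ?case using r(2) rho_operators unfolding acts_by_operators_def by simp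
next
  case (PS k)
  then show ?case using r(2) rho_operators unfolding acts_by_operators_def by simp
next
  case (add x y)
  then show ?case using r(1) rho_action unfolding is_action_def by simp
next
  case (smul c x)
  then show ?case using r(1) rho_action unfolding is_action_def by simp
next
  case (mult x y)
  then show ?case using r(1) rho_action unfolding is_action_def by simp
qed

section \<open>The symmetric functions \<open>h\<^sub>n[-X]\<close> are free generators\<close>

definition hpoly :: "(monomial \<Rightarrow>\<^sub>0 qt) \<Rightarrow> qt symfun" where
  "hpoly = mpeval sym_const (\<lambda>i. hneg (Suc i))"

lemma ring_homo_hpoly: "ring_homo hpoly"
  unfolding hpoly_def by (rule ring_homo_mpeval[OF ring_homo_sym_const])

lemma hpoly_gens: "hpoly (Poly_Mapping.single 0 c) = sym_const c"
  "hpoly (Poly_Mapping.single (Poly_Mapping.single i 1) 1) = hneg (Suc i)"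
  by (simp_all add: hpoly_def mpeval_single ring_homo_sym_const ring_homo_simps[OF ring_homo_sym_const])

lemma ring_homo_single_0: "ring_homo (Poly_Mapping.single (0::monomial) :: 'r::comm_ring_1 \<Rightarrow> _)"
  by (simp add: ring_homo_def single_add mult_single)

text \<open>The inverse is built by treating the h_n[-X] as indeterminates: \<open>X\<close> is
  their generic series, its logarithmic derivative gives polynomials \<open>p n\<close>, and
  \<open>K\<close> sends the n-th power sum there. Uniqueness of series with given logarithmic
  derivative gives one composition, cancelling the invertible series of h_n[-X] the other.\<close>

lemma bij_hpoly: "bij hpoly"
proof -
  define X :: "(monomial \<Rightarrow>\<^sub>0 qt) fps" where
    "X = Abs_fps (\<lambda>n. case n of 0 \<Rightarrow> 1 | Suc i \<Rightarrow> Poly_Mapping.single (Poly_Mapping.single i 1) 1)"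
  define B where "B = fps_right_inverse X 1"
  have XB: "X * B = 1" unfolding B_def by (rule fps_right_inverse) (simp add: X_def)
  define p where "p n = - fps_nth (fps_deriv X * B) (n - 1)" for n
  have lX: "lder (\<lambda>n. - p n) X"
  proof -
    have "Abs_fps (\<lambda>i. - p (Suc i)) = fps_deriv X * B" by (rule fps_ext) (simp add: p_def)
    then have "Abs_fps (\<lambda>i. - p (Suc i)) * X = fps_deriv X" using XB by (simp add: ac_simps)
    then show ?thesis by (simp add: lder_def X_def)
  qed
  define K where "K = plethysm (Poly_Mapping.single (0::monomial)) p"
  note K = plethysm[OF ring_homo_single_0, where a = p, folded K_def]
  note K_simps = ring_homo_simps[OF K(1)]
  have tf: "x = 0" if "of_nat (Suc n) * x = 0" for n and x :: "monomial \<Rightarrow>\<^sub>0 qt"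
    using that by (metis mult_eq_0_iff of_nat_neq_0)
  have "fps_hom K (Abs_fps hneg) = X"
    by (rule lder_unique[OF tf lder_hom[OF K(1) lder_hneg] lX]) (simp_all add: K_simps K(3))
  then have Kh: "K (hneg (Suc i)) = Poly_Mapping.single (Poly_Mapping.single i 1) 1" for i
    using fps_hom_nth[of K "Abs_fps hneg" "Suc i"] by (simp add: X_def)
  have 1: "K (hpoly F) = F" for F
  proof (induction F rule: mpoly_gen_induct)
    case (const c)
    then show ?case by (simp add: hpoly_gens K(2))
  next
    case (var i)
    then show ?case unfolding hpoly_gens by (rule Kh)
  qed (simp_all add: ring_homo_simps[OF ring_homo_hpoly] K_simps)
  have hX: "fps_hom hpoly X = Abs_fps hneg"
  proof (rule fps_ext)
    fix n show "fps_nth (fps_hom hpoly X) n = fps_nth (Abs_fps hneg) n"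
      using lder_hneg hpoly_gens(2) by (cases n) (simp_all add: X_def ring_homo_simps[OF ring_homo_hpoly] lder_def)
  qed
  have l2: "lder (\<lambda>n. hpoly (- p n)) (Abs_fps hneg)" using lder_hom[OF ring_homo_hpoly lX] hX by simp
  have "hpoly (- p (Suc i)) = - psum (Suc i)" for i
  proof -
    define C where "C = fps_right_inverse (Abs_fps hneg) 1"
    have C: "Abs_fps hneg * C = 1" unfolding C_def
      by (rule fps_right_inverse) (use lder_hneg in \<open>simp add: lder_def\<close>)
    have "Abs_fps (\<lambda>i. hpoly (- p (Suc i))) * Abs_fps hneg = Abs_fps (\<lambda>i. - psum (Suc i)) * Abs_fps hneg"
      using l2 lder_hneg by (simp add: lder_def)
    then have "Abs_fps (\<lambda>i. hpoly (- p (Suc i))) * (Abs_fps hneg * C) = Abs_fps (\<lambda>i. - psum (Suc i)) * (Abs_fps hneg * C)"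
      by (simp flip: mult.assoc)
    then show ?thesis unfolding C by (simp add: fps_eq_iff)
  qed
  then have hp: "hpoly (p (Suc i)) = psum (Suc i)" for i by (simp add: ring_homo_simps[OF ring_homo_hpoly])
  have 2: "hpoly (K f) = f" for f
  proof (rule sym_homo_eqI[OF ring_homo_comp[OF K(1) ring_homo_hpoly] ring_homo_id])
    fix n :: nat assume n: "1 \<le> n"
    then show "hpoly (K (psum n)) = psum n" using hp[of "n - 1"] by (simp add: K(3))
  qed (simp add: K(2) hpoly_gens)
  show ?thesis by (rule o_bij[of K]) (use 1 2 in \<open>auto simp: fun_eq_iff\<close>)
qed

lemma sym_hneg_induct [case_names const mult add]:
  assumes "\<And>c. Q (sym_const c)" "\<And>i f. Q f \<Longrightarrow> Q (hneg (Suc i) * f)" "\<And>f g. Q f \<Longrightarrow> Q g \<Longrightarrow> Q (f + g)"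
  shows "Q f"
proof -
  have "Q (hpoly F)" for F
  proof (induction F rule: mpoly_induct)
    case (single m c)
    show ?case
    proof (induction m rule: mono_pos_induct)
      case zero
      show ?case by (simp add: hpoly_gens assms(1))
    next
      case (add m i)
      have "Poly_Mapping.single (m + Poly_Mapping.single i 1) c =
        Poly_Mapping.single (Poly_Mapping.single i 1) 1 * Poly_Mapping.single m c"
        by (simp add: mult_single add.commute)
      then show ?case using assms(2)[OF add, of i] by (simp only: ring_homo_simps[OF ring_homo_hpoly] hpoly_gens)
    qed
  qed (simp add: ring_homo_simps[OF ring_homo_hpoly] assms(3))
  then show ?thesis using bij_is_surj[OF bij_hpoly] by (metis surj_f_inv_f)
qed

interpretation d: dyck_system qq double_gens by (rule dyck_system_double)

section \<open>Linear extension and ordered monomials of commuting operators\<close>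

definition lext :: "('k \<Rightarrow> 'r::comm_monoid_add \<Rightarrow> 'a::comm_monoid_add) \<Rightarrow> ('k \<Rightarrow>\<^sub>0 'r) \<Rightarrow> 'a" where
  "lext h F = (\<Sum>m\<in>Poly_Mapping.keys F. h m (Poly_Mapping.lookup F m))"

lemma lext_superset:
  "(\<And>m. h m 0 = 0) \<Longrightarrow> finite A \<Longrightarrow> Poly_Mapping.keys F \<subseteq> A \<Longrightarrow>
    lext h F = (\<Sum>m\<in>A. h m (Poly_Mapping.lookup F m))"
  unfolding lext_def by (intro sum.mono_neutral_left) (auto simp: in_keys_iff)

lemma lext_single: "(\<And>m. h m 0 = 0) \<Longrightarrow> lext h (Poly_Mapping.single m c) = h m c"
  by (subst lext_superset[of _ "{m}"]) auto

lemma lext_add: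
  assumes "\<And>m. h m 0 = 0" "\<And>m a b. h m (a + b) = h m a + h m b"
  shows "lext h (F + G) = lext h F + lext h G"
  using Poly_Mapping.keys_add[of F G]
  by (simp add: lext_superset[of h "Poly_Mapping.keys F \<union> Poly_Mapping.keys G"] assms lookup_add sum.distrib)

text \<open>A product of powers of commuting operators. The fold requires commutation at every
  argument and every index, which is why the operators used with it are total.\<close>

definition opmon :: "(nat \<Rightarrow> 'a \<Rightarrow> 'a) \<Rightarrow> monomial \<Rightarrow> 'a \<Rightarrow> 'a" where
  "opmon f m x = Finite_Set.fold (\<lambda>i. f i ^^ Poly_Mapping.lookup m i) x (Poly_Mapping.keys m)"

lemma opmon_0: "opmon f 0 x = x" by (simp add: opmon_def)

context
  fixes f :: "nat \<Rightarrow> 'a \<Rightarrow> 'a"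
  assumes f: "\<And>i j x. f i (f j x) = f j (f i x)"
begin

lemma comp_fun_commute_pow: "comp_fun_commute (\<lambda>i. f i ^^ n i)"
proof -
  interpret comp_fun_commute f by standard (auto simp: f)
  show ?thesis by (rule comp_fun_commute_funpow)
qed

lemma opmon_superset:
  assumes "finite A" "Poly_Mapping.keys m \<subseteq> A"
  shows "opmon f m x = Finite_Set.fold (\<lambda>i. f i ^^ Poly_Mapping.lookup m i) x A"
proof -
  let ?h = "\<lambda>i. f i ^^ Poly_Mapping.lookup m i"
  interpret comp_fun_commute ?h by (rule comp_fun_commute_pow)
  have "finite B \<Longrightarrow> B \<inter> Poly_Mapping.keys m = {} \<Longrightarrow>
    Finite_Set.fold ?h x (B \<union> Poly_Mapping.keys m) = opmon f m x" for B
  proof (induction rule: finite_induct)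
    case (insert i B)
    then show ?case by (simp add: in_keys_iff)
  qed (simp add: opmon_def)
  moreover have "A - Poly_Mapping.keys m \<union> Poly_Mapping.keys m = A" using assms(2) by blast
  ultimately show ?thesis using assms(1) by (metis Diff_disjoint finite_Diff inf_commute)
qed

lemma opmon_add: "opmon f (m + Poly_Mapping.single i 1) x = f i (opmon f m x)"
proof -
  let ?m = "m + Poly_Mapping.single i 1"
  let ?h = "\<lambda>i. f i ^^ Poly_Mapping.lookup m i" and ?h' = "\<lambda>i. f i ^^ Poly_Mapping.lookup ?m i"
  define B where "B = Poly_Mapping.keys m - {i}"
  interpret h: comp_fun_commute ?h by (rule comp_fun_commute_pow)
  interpret h': comp_fun_commute ?h' by (rule comp_fun_commute_pow)
  have B: "finite B" "i \<notin> B" "Poly_Mapping.keys m \<subseteq> insert i B" "Poly_Mapping.keys ?m \<subseteq> insert i B"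
    using Poly_Mapping.keys_add[of m "Poly_Mapping.single i 1"] by (auto simp: B_def)
  have c: "Finite_Set.fold ?h' x B = Finite_Set.fold ?h x B"
    by (rule Finite_Set.fold_cong[of UNIV])
      (use comp_fun_commute_pow[unfolded comp_fun_commute_def'] in \<open>blast\<close>, use comp_fun_commute_pow[unfolded comp_fun_commute_def'] in \<open>blast\<close>,
       use B in \<open>auto simp: lookup_add lookup_single when_def\<close>)
  have "opmon f ?m x = Finite_Set.fold ?h' x (insert i B)" by (rule opmon_superset) (use B in auto)
  also have "\<dots> = ?h' i (Finite_Set.fold ?h x B)" by (simp only: h'.fold_insert[OF B(1,2)] c)
  also have "\<dots> = f i (?h i (Finite_Set.fold ?h x B))" by (simp add: lookup_add)
  also have "?h i (Finite_Set.fold ?h x B) = Finite_Set.fold ?h x (insert i B)"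
    by (simp only: h.fold_insert[OF B(1,2)])
  also have "\<dots> = opmon f m x" by (rule opmon_superset[symmetric]) (use B in auto)
  finally show ?thesis .
qed

end

lemma opmon_linear:
  fixes f :: "nat \<Rightarrow> 'a::qt_algebra \<Rightarrow> 'a"
  assumes f: "\<And>i j x. f i (f j x) = f j (f i x)"
    and lin: "\<And>i x y. f i (x + y) = f i x + f i y" "\<And>i c x. f i (c \<cdot> x) = c \<cdot> f i x"
  shows "opmon f m (x + y) = opmon f m x + opmon f m y" "opmon f m (c \<cdot> x) = c \<cdot> opmon f m x"
proof -
  have "opmon f m (x + y) = opmon f m x + opmon f m y \<and> opmon f m (c \<cdot> x) = c \<cdot> opmon f m x"
    by (induction m rule: mono_pos_induct) (simp_all add: opmon_0 opmon_add[where f = f, OF f, simplified] lin)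
  then show "opmon f m (x + y) = opmon f m x + opmon f m y" "opmon f m (c \<cdot> x) = c \<cdot> opmon f m x" by auto
qed

section \<open>Values at the vacuum\<close>

text \<open>\<open>F\<close> is the value at 1 in straightened coordinates, where y_i multiplies and
  d_+^k 1 = 1.\<close>

definition hasval :: "nat \<Rightarrow> double_dyck \<Rightarrow> vpoly \<Rightarrow> bool" where
  "hasval k x F \<longleftrightarrow> F \<in> V k \<and> vapp (act x) vac = Poly_Mapping.single k (shp k F)"

lemma vac_Vstar: "vac \<in> Vstar"
  unfolding vac_def by (rule Vstar_single) (simp add: V_eq_VS)

lemma hv_mult: "hasval k x F \<Longrightarrow> act g = sop k l f \<Longrightarrow> Vlin k l f \<Longrightarrow> hasval l (g * x) (f F)"
  by (simp add: hasval_def act_simps vapp_simps vapp_sop Vstar_single sft_V Vlin_V)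

lemma hv_add: "hasval k x F \<Longrightarrow> hasval k y G \<Longrightarrow> hasval k (x + y) (F + G)"
  by (simp add: hasval_def act_simps vapp_simps V_add single_add sft_simps)

lemma hv_smul: "hasval k x F \<Longrightarrow> hasval k (c \<cdot> x) (vconst c * F)"
  by (simp add: hasval_def act_simps vapp_simps V_scale vscale_single sft_simps sft_gens)

lemma hv_minus: "hasval k x F \<Longrightarrow> hasval k (- x) (- F)"
  using hv_smul[of k x F "- 1"] by (simp add: smul_minus_one vconst_simps)

lemma hv_E: "hasval 0 (d.E 0) 1"
  by (simp add: hasval_def act_gens vapp_sop[OF Vlin_id vac_Vstar] V_eq_VS) (simp add: vac_def sft_simps)

lemma hv_Y: "hasval k x F \<Longrightarrow> 1 \<le> i \<Longrightarrow> i \<le> k \<Longrightarrow> hasval k (d.Y k i * x) (yvar i * F)"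
  by (rule hv_mult[OF _ act_Y Vlin_yvar])

lemma TW_vsym: "TW n (vsym f) = vsym f"
  by (induction n) (simp_all add: TW_Suc)

lemma hv_pw: "hasval 0 x (vsym f) \<Longrightarrow> x \<in> d.Mod 0 \<Longrightarrow> hasval k (d.pw k * x) (vsym f)"
proof (induction k)
  case (Suc k)
  then have "hasval (Suc k) (d.P k * (d.pw k * x)) (TW k (vsym f))"
    by (intro hv_mult[OF _ act_gens(2) Vlin_TW])
  then show ?case by (simp add: TW_vsym mult.assoc)
qed (simp add: d.Mod_E)

lemma hv_eps:
  assumes "hasval 0 x (vsym f)" shows "hasval 0 (- d.eps n x) (vsym (hneg (Suc n) * f))"
proof -
  have 1: "hasval 1 (d.P 0 * x) (vsym f)" using hv_mult[OF assms act_gens(2) Vlin_TW] by simp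
  have "hasval 1 (d.ypow 1 1 n (d.P 0 * x)) (yvar 1 ^ n * vsym f)"
  proof (induction n)
    case (Suc n)
    show ?case using hv_Y[OF Suc, of 1] by (simp add: d.ypow_Suc mult.assoc)
  qed (use 1 in simp)
  then have "hasval 0 (d.eps n x) (dmw 0 (yvar 1 ^ n * vsym f))"
    unfolding d.eps_def One_nat_def by (rule hv_mult[OF _ act_gens(3) Vlin_dmw])
  moreover have "dmw 0 (yvar 1 ^ n * vsym f) = - vsym (hneg (Suc n) * f)"
    using Lam_monom[of "vsym f" "{}" "Suc 0" "Hs 0" n]
    by (simp add: dmw_def Hs_def hnegs_def mult.commute vsym_simps)
  ultimately show ?thesis using hv_minus by fastforce
qed

section \<open>The inverse of the value map\<close>

text \<open>The sign makes this act on V_0 as multiplication by h_(i+1)[-X].\<close>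

definition eps' :: "nat \<Rightarrow> double_dyck \<Rightarrow> double_dyck" where "eps' i x = - d.eps i x"

lemma eps'_add: "eps' i (x + y) = eps' i x + eps' i y"
  by (simp add: eps'_def d.eps_add)
lemma eps'_smul: "eps' i (c \<cdot> x) = c \<cdot> eps' i x"
  by (simp add: eps'_def d.eps_smul smul_minus_right)
lemma eps'_comm: "eps' i (eps' j x) = eps' j (eps' i x)"
proof -
  \<comment> \<open>d_+ starting at 0 absorbs e_0, so commutation on e_0 A extends to every
    element.\<close>
  have e: "d.eps n (d.E 0 * x) = d.eps n x" for n by (simp add: d.eps_def d.EP_l)
  have m: "d.eps n (- x) = - d.eps n x" for n x
    using d.eps_smul[of n "- 1" x] by (simp add: smul_minus_one)
  show ?thesis using d.eps_comm[of "d.E 0 * x" i j] by (simp add: eps'_def m e)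
qed

lemmas em_add = opmon_add[where f = eps', OF eps'_comm]

definition Psi_poly :: "(monomial \<Rightarrow>\<^sub>0 qt) \<Rightarrow> double_dyck" where
  "Psi_poly = lext (\<lambda>m c. c \<cdot> opmon eps' m (d.E 0))"

lemma Psi_poly_add: "Psi_poly (F + G) = Psi_poly F + Psi_poly G"
  unfolding Psi_poly_def by (rule lext_add) (simp_all add: smul_zero_left smul_add_left)

lemma Psi_poly_single: "Psi_poly (Poly_Mapping.single m c) = c \<cdot> opmon eps' m (d.E 0)"
  unfolding Psi_poly_def by (rule lext_single) (simp add: smul_zero_left)

lemma Psi_poly_var: "Psi_poly (Poly_Mapping.single (Poly_Mapping.single i 1) 1 * F) = eps' i (Psi_poly F)"
proof (induction F rule: mpoly_induct)
  case (single m c)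
  show ?case using em_add[of m i "d.E 0"] by (simp add: mult_single Psi_poly_single eps'_smul add.commute)
qed (simp add: distrib_left Psi_poly_add eps'_add)

definition Psi :: "qt symfun \<Rightarrow> double_dyck" where "Psi f = Psi_poly (inv hpoly f)"

lemma Psi_hpoly: "Psi (hpoly F) = Psi_poly F"
  by (simp add: Psi_def bij_is_inj[OF bij_hpoly])

lemma hpoly_surj: obtains F where "f = hpoly F"
  using bij_is_surj[OF bij_hpoly] by (metis surjD)

lemma Psi_add: "Psi (f + g) = Psi f + Psi g"
  by (rule hpoly_surj[of f], rule hpoly_surj[of g])
    (simp add: Psi_hpoly Psi_poly_add flip: ring_homo_simps(3)[OF ring_homo_hpoly])

lemma Psi_hneg: "Psi (hneg (Suc i) * f) = eps' i (Psi f)"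
  by (rule hpoly_surj[of f])
    (simp add: Psi_hpoly Psi_poly_var del: One_nat_def
       flip: ring_homo_simps(4)[OF ring_homo_hpoly] hpoly_gens(2))

lemma Psi_const: "Psi (sym_const c) = c \<cdot> d.E 0"
  by (simp add: Psi_hpoly Psi_poly_single opmon_0 flip: hpoly_gens(1))

lemma Psi_0: "Psi 0 = 0"
  using Psi_add[of 0 0] by simp

lemma Psi_smul: "Psi (sym_const c * f) = c \<cdot> Psi f"
proof (induction f rule: sym_hneg_induct)
  case (const a)
  show ?case by (simp add: Psi_const smul_assoc flip: ring_homo_simps(4)[OF ring_homo_sym_const])
next
  case (mult i f)
  then show ?case by (subst mult.left_commute) (simp add: Psi_hneg eps'_smul)
qed (simp add: distrib_left Psi_add smul_add_right)

text \<open>The generation of r is mirrored by \<open>Psi\<close>, so r is recovered from its value;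
  this yields independence without any argument in the algebra.\<close>

lemma RR_val: "r \<in> d.RR \<Longrightarrow> \<exists>f. hasval 0 r (vsym f) \<and> Psi f = r"
proof (induction rule: d.RR.induct)
  case one
  have "Psi 1 = d.E 0"
    using Psi_const[of 1] by (simp only: ring_homo_simps(2)[OF ring_homo_sym_const] smul_one)
  then show ?case using hv_E by (intro exI[of _ 1]) (simp add: vsym_simps)
next
  case (add r s)
  then obtain f g where "hasval 0 r (vsym f)" "Psi f = r" "hasval 0 s (vsym g)" "Psi g = s" by blast
  then show ?case using hv_add[of 0 r "vsym f" s "vsym g"] Psi_add[of f g] by (auto simp flip: vsym_simps)
next
  case (smul r a)
  then obtain f where "hasval 0 r (vsym f)" "Psi f = r" by blast
  then show ?case using hv_smul[of 0 r "vsym f" a] Psi_smul[of a f] by (auto simp: vconst_def simp flip: vsym_simps)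
next
  case (eps r n)
  then obtain f where f: "hasval 0 r (vsym f)" "Psi f = r" by blast
  have "hasval 0 (d.eps n r) (vsym (- (hneg (Suc n) * f)))"
    using hv_minus[OF hv_eps[OF f(1), of n]] by (simp add: vsym_simps)
  moreover have "Psi (- (hneg (Suc n) * f)) = d.eps n r"
    using Psi_add[of "- (hneg (Suc n) * f)" "hneg (Suc n) * f"] f(2)
    by (simp add: Psi_hneg eps'_def Psi_0)
  ultimately show ?case by blast
qed

text \<open>The identity outside 1..k, so that the operators commute for all indices, as
  \<open>opmon\<close> demands.\<close>

definition yop :: "nat \<Rightarrow> nat \<Rightarrow> double_dyck \<Rightarrow> double_dyck" where
  "yop k i x = (if 1 \<le> i \<and> i \<le> k then d.Y k i * x else x)"

lemma yop_comm: "yop k i (yop k j x) = yop k j (yop k i x)"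
proof -
  have "d.Y k i * (d.Y k j * x) = d.Y k j * (d.Y k i * x)" if "1 \<le> i" "i \<le> k" "1 \<le> j" "j \<le> k"
  proof -
    have "d.Y k l * (d.E k * x) = d.Y k l * x" if "1 \<le> l" "l \<le> k" for l
      using d.Y_E_right[OF that] by (simp flip: mult.assoc)
    then show ?thesis using d.Y_Y[OF that, of "d.E k * x"] that by simp
  qed
  then show ?thesis by (simp add: yop_def)
qed

lemma yop_add: "yop k i (x + y) = yop k i x + yop k i y"
  by (simp add: yop_def distrib_left)
lemma yop_smul: "yop k i (c \<cdot> x) = c \<cdot> yop k i x"
  by (simp add: yop_def smul_mult_right)

lemmas ym_add = opmon_add[where f = "yop k" for k, OF yop_comm]
lemmas ym_linear = opmon_linear[where f = "yop k" for k, OF yop_comm yop_add yop_smul]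

lemma ym_zero: "opmon (yop k) m 0 = 0"
  using ym_linear(1)[of k m 0 0] by simp

definition psi :: "nat \<Rightarrow> vpoly \<Rightarrow> double_dyck" where
  "psi k = lext (\<lambda>m f. opmon (yop k) m (d.pw k * Psi f))"

lemma psi_add: "psi k (F + G) = psi k F + psi k G"
  unfolding psi_def by (rule lext_add) (simp_all add: Psi_0 Psi_add ym_zero ym_linear distrib_left)

lemma psi_single: "psi k (Poly_Mapping.single m f) = opmon (yop k) m (d.pw k * Psi f)"
  unfolding psi_def by (rule lext_single) (simp add: Psi_0 ym_zero)

lemma psi_vsym: "psi k (vsym f) = d.pw k * Psi f"
  by (simp add: vsym_def psi_single opmon_0)

lemma psi_yvar: "1 \<le> i \<Longrightarrow> i \<le> k \<Longrightarrow> psi k (yvar i * F) = d.Y k i * psi k F"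
proof (induction F rule: mpoly_induct)
  case (single m c)
  then show ?case using ym_add[of k m i "d.pw k * Psi c"]
    by (simp add: yvar_def mult_single psi_single add.commute yop_def)
qed (simp add: distrib_left psi_add)

lemma psi_smul: "psi k (vconst c * F) = c \<cdot> psi k F"
proof (induction F rule: mpoly_induct)
  case (single m f)
  then show ?case
    by (simp add: vconst_def vsym_def mult_single psi_single Psi_smul ym_linear smul_mult_right[symmetric])
qed (simp add: distrib_left psi_add smul_add_right)

lemma NN_val: "x \<in> d.NN k \<Longrightarrow> \<exists>F. hasval k x F \<and> psi k F = x"
proof (induction rule: d.NN.induct)
  case (base r)
  then obtain f where "hasval 0 r (vsym f)" "Psi f = r" using RR_val by blast
  then show ?case using hv_pw[of r f k] d.RR_Mod[OF base] psi_vsym[of k f] by blast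
next
  case (add x y)
  then show ?case using hv_add psi_add by metis
next
  case (smul x a)
  then show ?case using hv_smul psi_smul by metis
next
  case (y x i)
  then show ?case using hv_Y psi_yvar by metis
qed

definition vpsi :: "vfam \<Rightarrow> double_dyck" where
  "vpsi = lext (\<lambda>k F. psi k (shm k F))"

lemma psi_0: "psi k 0 = 0" by (simp add: psi_def lext_def)

lemma vpsi_add: "vpsi (v + w) = vpsi v + vpsi w"
  unfolding vpsi_def by (rule lext_add) (simp_all add: sft_simps psi_add psi_0)

lemma vpsi_0: "vpsi 0 = 0" by (simp add: vpsi_def lext_def)

text \<open>An element of the unstarred span is determined by its value at 1. This makes the
  unstarred part of the kernel trivial.\<close>

lemma AE_vpsi: "d.AE k x \<Longrightarrow> vpsi (vapp (act x) vac) = x"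
proof -
  assume "d.AE k x"
  then obtain F where F: "hasval k x F" "psi k F = x" using NN_val[OF d.AE_NN] by blast
  have "vpsi (Poly_Mapping.single k (shp k F)) = psi k (shm k (shp k F))"
    unfolding vpsi_def by (rule lext_single) (simp add: sft_simps psi_0)
  then show ?thesis using F by (simp add: hasval_def)
qed

section \<open>Surjectivity\<close>

text \<open>Same mirror as \<open>NN_val\<close> in the opposite direction: constants, h_n[-X] and
  y_i are realized by e_0, \<open>eps\<close> and the y_i. The right factor e_0 is carried along to
  land in \<open>Ae0\<close>.\<close>

lemma V_val: "F \<in> V k \<Longrightarrow> \<exists>x. x * d.E 0 = x \<and> hasval k x F"
  unfolding V_eq_VS
proof (induction rule: VS_left_induct)
  case (sym f)
  have "\<exists>x. x * d.E 0 = x \<and> x \<in> d.Mod 0 \<and> hasval 0 x (vsym f)"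
  proof (induction f rule: sym_hneg_induct)
    case (const c)
    then show ?case using hv_smul[OF hv_E, of c]
      by (intro exI[of _ "c \<cdot> d.E 0"])
        (simp add: vconst_def smul_mult_left[symmetric] smul_mult_right[symmetric] d.EE d.Mod_def)
  next
    case (mult i f)
    then obtain x where x: "x * d.E 0 = x" "hasval 0 x (vsym f)" by blast
    have y: "d.ypow 1 1 i z * d.E 0 = d.ypow 1 1 i (z * d.E 0)" for z
      by (induction i) (simp_all add: d.ypow_Suc mult.assoc)
    have "- d.eps i x * d.E 0 = - d.eps i x" "- d.eps i x \<in> d.Mod 0"
      using x(1) y d.Mod_diff[OF d.Mod_0 d.Mod_eps, of i x] by (simp_all add: d.eps_def mult.assoc)
    then show ?case using hv_eps[OF x(2), of i] by blast
  next
    case (add f g)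
    then obtain x y where "x * d.E 0 = x" "y * d.E 0 = y" "x \<in> d.Mod 0" "y \<in> d.Mod 0"
      "hasval 0 x (vsym f)" "hasval 0 y (vsym g)" by blast
    then show ?case by (intro exI[of _ "x + y"])
      (simp add: distrib_right d.Mod_add hv_add vsym_simps)
  qed
  then obtain x where x: "x * d.E 0 = x" "x \<in> d.Mod 0" "hasval 0 x (vsym f)" by blast
  then show ?case using hv_pw[OF x(3,2), of k] by (intro exI[of _ "d.pw k * x"]) (simp add: mult.assoc)
next
  case (var i F)
  then obtain x where "x * d.E 0 = x" "hasval k x F" by blast
  then show ?case using hv_Y[of k x F i] var by (intro exI[of _ "d.Y k i * x"]) (simp add: mult.assoc)
next
  case (add F G)
  then obtain x y where "x * d.E 0 = x" "hasval k x F" "y * d.E 0 = y" "hasval k y G" by blast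
  then show ?case using hv_add[of k x F y G] by (intro exI[of _ "x + y"]) (simp add: distrib_right)
qed

interpretation s: dyck_system "inverse qq" double_star_gens by (rule dyck_system_double_star)

section \<open>The left ideal generated by the vacuum relations\<close>

lemma cross:
  "s.M (Suc k) = d.M (Suc k)" "s.E k = d.E k" "1 \<le> i \<Longrightarrow> i < k \<Longrightarrow> s.T k i = d.Ti k i"
  "1 \<le> i \<Longrightarrow> i \<le> k \<Longrightarrow> s.Y (Suc k) (Suc i) * d.P k = d.P k * s.Y k i"
  "1 \<le> i \<Longrightarrow> i \<le> k \<Longrightarrow> d.Y (Suc k) (Suc i) * s.P k = s.P k * d.Y k i"
  "s.Y (Suc k) 1 * d.P k = (- tt * qq ^ Suc k) \<cdot> (d.Y (Suc k) 1 * s.P k)"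
  using cross_rels_double d.gTinv_eq unfolding cross_rels_def by auto

lemma Y_dinl: "1 \<le> i \<Longrightarrow> i \<le> k \<Longrightarrow> d.Y k i = dinl (y_elt k i)"
  unfolding y_elt_def double_gens_eq by (rule map_ygen[OF dyck_system_dyck alg_hom_dinl, symmetric])

lemma I_ideal_Ie0: "x \<in> I_ideal \<Longrightarrow> x * d.E 0 = x \<Longrightarrow> x \<in> Ie0"
  unfolding Ie0_def by (metis (mono_tags, lifting) mem_Collect_eq)

lemma Ie0_closed: "0 \<in> Ie0" "x \<in> Ie0 \<Longrightarrow> y \<in> Ie0 \<Longrightarrow> x + y \<in> Ie0" "x \<in> Ie0 \<Longrightarrow> c \<cdot> x \<in> Ie0"
  "x \<in> Ie0 \<Longrightarrow> a * x \<in> Ie0"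
proof -
  show "0 \<in> Ie0" by (rule I_ideal_Ie0) (simp_all add: I_ideal_def left_ideal_gen.zero)
  show "x + y \<in> Ie0" if xy: "x \<in> Ie0" "y \<in> Ie0"
  proof -
    obtain x' y' where "x = x' * d.E 0" "y = y' * d.E 0" "x' \<in> I_ideal" "y' \<in> I_ideal"
      using xy by (auto simp: Ie0_def)
    then have "x + y = (x' + y') * d.E 0" "x' + y' \<in> I_ideal"
      by (simp_all add: distrib_right I_ideal_def left_ideal_gen.add)
    then show ?thesis unfolding Ie0_def by blast
  qed
  assume "x \<in> Ie0"
  then obtain x' where x: "x = x' * d.E 0" "x' \<in> I_ideal" by (auto simp: Ie0_def)
  then have "c \<cdot> x = (c \<cdot> x') * d.E 0" "c \<cdot> x' \<in> I_ideal" "a * x = (a * x') * d.E 0" "a * x' \<in> I_ideal"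
    by (simp_all add: smul_mult_left mult.assoc I_ideal_def left_ideal_gen.smul left_ideal_gen.mult_left)
  then show "c \<cdot> x \<in> Ie0" "a * x \<in> Ie0" unfolding Ie0_def by blast+
qed

text \<open>Shown to be a left ideal containing e_0, hence all of Ae_0; stability under d_+^* is the
  point.\<close>

inductive_set NH :: "double_dyck set" where
  ae: "d.AE k x \<Longrightarrow> x \<in> NH"
| ie: "x \<in> Ie0 \<Longrightarrow> x \<in> NH"
| add: "x \<in> NH \<Longrightarrow> y \<in> NH \<Longrightarrow> x + y \<in> NH"

lemma NH_0: "0 \<in> NH" by (rule NH.ie[OF Ie0_closed(1)])

lemma NH_smul: "x \<in> NH \<Longrightarrow> c \<cdot> x \<in> NH"
  by (induction rule: NH.induct) (auto intro: NH.intros d.AE.smul Ie0_closed simp: smul_add_right)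

lemma AE_Mod: "d.AE k x \<Longrightarrow> x \<in> d.Mod k" by (rule d.NN_Mod[OF d.AE_NN])

lemma NH_gen:
  assumes g: "g * d.E l = g" and ae: "\<And>x. d.AE l x \<Longrightarrow> g * x \<in> NH" and x: "x \<in> NH"
  shows "g * x \<in> NH"
  using x
proof (induction rule: NH.induct)
  case (ae k x)
  show ?case
  proof (cases "k = l")
    case False
    have "g * x = g * (d.E l * (d.E k * x))" using g AE_Mod[OF ae] by (simp add: d.Mod_E flip: mult.assoc)
    also have "\<dots> = 0" using False by (simp add: d.EE flip: mult.assoc)
    finally show ?thesis by (simp add: NH_0)
  qed (use ae assms(2) in simp)
qed (auto intro: NH.intros Ie0_closed simp: distrib_left)

lemma NH_E: "x \<in> NH \<Longrightarrow> d.E k * x \<in> NH"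
  by (rule NH_gen) (auto simp: d.EE d.Mod_E[OF AE_Mod] intro: NH.ae)
lemma NH_P: "x \<in> NH \<Longrightarrow> d.P k * x \<in> NH"
  by (rule NH_gen) (auto simp: d.EP intro: NH.ae d.AE.P)
lemma NH_M: "x \<in> NH \<Longrightarrow> d.M (Suc k) * x \<in> NH"
  by (rule NH_gen) (auto simp: d.EM intro: NH.ae d.AE.M)
lemma NH_T: "1 \<le> i \<Longrightarrow> i < k \<Longrightarrow> x \<in> NH \<Longrightarrow> d.T k i * x \<in> NH"
  by (rule NH_gen[of _ k]) (simp add: d.ET, rule NH.ae[OF d.AE.T], simp_all)

lemma NH_dinl: "x \<in> NH \<Longrightarrow> dinl a * x \<in> NH"
proof -
  have "\<forall>x\<in>NH. dinl a * x \<in> NH"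
    by (induction a rule: dinl_induct)
      (auto simp: NH_E NH_P NH_M NH_T distrib_right NH.add NH_smul mult.assoc simp flip: smul_mult_left)
  then show "x \<in> NH \<Longrightarrow> dinl a * x \<in> NH" by blast
qed

lemma NH_Y: "1 \<le> i \<Longrightarrow> i \<le> k \<Longrightarrow> x \<in> NH \<Longrightarrow> d.Y k i * x \<in> NH"
  by (simp add: Y_dinl NH_dinl)
lemma NH_Ti: "1 \<le> i \<Longrightarrow> i < k \<Longrightarrow> x \<in> NH \<Longrightarrow> d.Ti k i * x \<in> NH"
  by (simp add: d.Ti_def smul_mult_left[symmetric] distrib_right NH_smul NH.add NH_T NH_E)

text \<open>d_+^* commutes with T_i and y_i up to raising the index, so this set is stable under
  T_i, y_i and therefore under \<open>phi\<close>.\<close>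

definition NS :: "nat \<Rightarrow> double_dyck set" where "NS n = {u. s.P n * u \<in> NH}"

lemma NS_add: "u \<in> NS n \<Longrightarrow> v \<in> NS n \<Longrightarrow> u + v \<in> NS n"
  by (simp add: NS_def distrib_left NH.add)
lemma NS_smul: "u \<in> NS n \<Longrightarrow> c \<cdot> u \<in> NS n"
  by (simp add: NS_def smul_mult_right[symmetric] NH_smul)

lemma s_Ti: "1 \<le> i \<Longrightarrow> i < k \<Longrightarrow> s.Ti k i = d.T k i"
  unfolding s.Ti_def cross using qq_neq
  by (simp add: d.Ti_def smul_add_right smul_assoc[symmetric] algebra_simps smul_one)
     (simp flip: smul_add_left add: smul_zero_left)

lemma NS_T: "1 \<le> i \<Longrightarrow> i < n \<Longrightarrow> u \<in> NS n \<Longrightarrow> d.T n i * u \<in> NS n"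
proof -
  assume i: "1 \<le> i" "i < n" and u: "u \<in> NS n"
  have "s.P n * (s.Ti n i * (s.E n * u)) = s.Ti (Suc n) (Suc i) * (s.P n * (s.E n * u))"
    by (rule s.P_Ti[OF i s.Mod_Ex])
  moreover have "s.Ti n i * (s.E n * u) = s.Ti n i * u" using s.E_Ti(2)[OF i] by (simp flip: mult.assoc)
  ultimately have "s.P n * (s.Ti n i * u) = s.Ti (Suc n) (Suc i) * (s.P n * u)" by (simp only: s.EP_l)
  then show ?thesis using i u NH_T[of "Suc i" "Suc n"] by (simp add: NS_def s_Ti)
qed

lemma NS_Y: "1 \<le> i \<Longrightarrow> i \<le> n \<Longrightarrow> u \<in> NS n \<Longrightarrow> d.Y n i * u \<in> NS n"
  using NH_Y[of "Suc i" "Suc n" "s.P n * u"] by (simp add: NS_def cross(5) flip: mult.assoc)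

lemma NS_W: "n < k \<Longrightarrow> u \<in> NS k \<Longrightarrow> d.W k n u \<in> NS k"
  by (induction n arbitrary: u) (simp_all add: NS_T)
lemma NS_Wr: "n < k \<Longrightarrow> u \<in> NS k \<Longrightarrow> d.Wr k n u \<in> NS k"
  by (induction n) (simp_all add: NS_T)

lemma NS_phi: "1 \<le> n \<Longrightarrow> u \<in> NS n \<Longrightarrow> d.phi n * u \<in> NS n"
proof -
  assume n: "1 \<le> n" and u: "u \<in> NS n"
  have "d.phi n * u = d.W n (n - 1) (d.Y n n * u)" using n by (simp add: d.Y_last)
  then show ?thesis using n u by (simp add: NS_W NS_Y)
qed

primrec pj :: "nat \<Rightarrow> nat \<Rightarrow> double_dyck \<Rightarrow> double_dyck" where
  "pj k 0 x = x" | "pj k (Suc j) x = d.P (k + j) * pj k j x"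

lemma pj_P: "pj (Suc k) j (d.P k * x) = pj k (Suc j) x"
  by (induction j) simp_all
lemma pj_add: "pj k j (x + y) = pj k j x + pj k j y"
  by (induction j) (simp_all add: distrib_left)
lemma pj_smul: "pj k j (c \<cdot> x) = c \<cdot> pj k j x"
  by (induction j) (simp_all add: smul_mult_right[symmetric])
lemma pj_T: "1 \<le> i \<Longrightarrow> i < k \<Longrightarrow> pj k j (d.T k i * x) = d.T (k + j) (i + j) * pj k j x"
  by (induction j) (simp_all add: d.P_T)

lemma Wr_Suc_P: "n < k \<Longrightarrow> d.Wr (Suc k) (Suc n) z = d.P k * d.Wr k n x" if "d.T (Suc k) 1 * z = d.P k * x"
  using that by (induction n) (simp_all add: d.P_T)

lemma d_Wr_smul: "d.Wr k n (c \<cdot> x) = c \<cdot> d.Wr k n x"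
  by (induction n) (simp_all add: smul_mult_right[symmetric])

text \<open>Iterates q d_+ phi = T_1 phi d_+; each further d_+ raises the indices of the T already
  collected and adds a new T_1 on their right.\<close>

lemma pj_phi: "1 \<le> k \<Longrightarrow> pj k j (d.phi k * x) = inverse qq ^ j \<cdot> d.Wr (k + j) j (d.phi (k + j) * pj k j x)"
proof (induction j)
  case (Suc j)
  let ?y = "pj k j x"
  have "d.T (Suc (k + j)) 1 * (d.phi (Suc (k + j)) * (d.P (k + j) * ?y)) = qq \<cdot> (d.P (k + j) * (d.phi (k + j) * ?y))"
    using d.T_D_P[of "k + j" ?y] Suc.prems
    by (simp add: d.phi_def smul_mult_left[symmetric] smul_mult_right[symmetric])
      (simp add: smul_assoc[symmetric] mult.commute)
  then have "d.T (Suc (k + j)) 1 * (inverse qq \<cdot> (d.phi (Suc (k + j)) * (d.P (k + j) * ?y))) = d.P (k + j) * (d.phi (k + j) * ?y)"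
    by (simp add: smul_mult_right[symmetric])
  from Wr_Suc_P[OF this, of j] have
    "d.P (k + j) * d.Wr (k + j) j (d.phi (k + j) * ?y) = inverse qq \<cdot> d.Wr (Suc (k + j)) (Suc j) (d.phi (Suc (k + j)) * (d.P (k + j) * ?y))"
    using Suc.prems by (simp only: d_Wr_smul)
  then show ?case using Suc
    by (simp add: smul_mult_right[symmetric] smul_assoc[symmetric] mult.commute)
qed (simp add: smul_one)

text \<open>
  Moving \<open>d\<^sub>+\<^sup>*\<close> past \<open>d\<^sub>-\<close> produces \<open>z\<^sub>i\<close>, and moving \<open>z\<^sub>1\<close> past \<open>d\<^sub>+\<close> produces \<open>d\<^sub>+\<^sup>*\<close>; hence the induction on words
  for \<open>d\<^sub>+\<^sup>*x \<in> NH\<close> needs the stronger hypothesis that all \<open>d\<^sub>+\<^sup>*d\<^sub>+\<^sup>jx\<close> and \<open>z\<^sub>ix\<close> lie in \<open>NH\<close>.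
\<close>

definition Q1 :: "nat \<Rightarrow> double_dyck \<Rightarrow> bool" where "Q1 k x \<longleftrightarrow> (\<forall>j. pj k j x \<in> NS (k + j))"
definition Q2 :: "nat \<Rightarrow> double_dyck \<Rightarrow> bool" where "Q2 k x \<longleftrightarrow> (\<forall>i. 1 \<le> i \<and> i \<le> k \<longrightarrow> s.Y k i * x \<in> NH)"

lemma Q1_0: "Q1 k x \<Longrightarrow> s.P k * x \<in> NH"
  unfolding Q1_def NS_def by (drule spec[of _ 0]) simp

text \<open>z_1 d_+ is a scalar times y_1 d_+^*, handled by \<open>Q1\<close>; z_(i+1) d_+ = d_+
  z_i, handled by \<open>Q2\<close>.\<close>

lemma Q_P:
  assumes "Q1 k x" "Q2 k x" shows "Q1 (Suc k) (d.P k * x)" "Q2 (Suc k) (d.P k * x)"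
proof -
  show "Q1 (Suc k) (d.P k * x)" unfolding Q1_def pj_P
    using assms(1) unfolding Q1_def by (metis add_Suc add_Suc_right)
  have x: "s.P k * x \<in> NH" using assms(1) by (rule Q1_0)
  show "Q2 (Suc k) (d.P k * x)" unfolding Q2_def
  proof (intro allI impI)
    fix i assume i: "1 \<le> i \<and> i \<le> Suc k"
    show "s.Y (Suc k) i * (d.P k * x) \<in> NH"
    proof (cases "i = 1")
      case True
      have "s.Y (Suc k) 1 * d.P k * x = (- tt * qq ^ Suc k) \<cdot> (d.Y (Suc k) 1 * s.P k) * x"
        by (simp only: cross(6))
      then have "s.Y (Suc k) 1 * (d.P k * x) = (- tt * qq ^ Suc k) \<cdot> (d.Y (Suc k) 1 * (s.P k * x))"
        by (simp only: mult.assoc smul_mult_left[symmetric])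
      then show ?thesis unfolding True using NH_Y[of 1 "Suc k", OF _ _ x] by (simp only: NH_smul)
    next
      case False
      then obtain i' where i': "i = Suc i'" "1 \<le> i'" "i' \<le> k" using i by (cases i) auto
      have "s.Y (Suc k) (Suc i') * d.P k * x = d.P k * s.Y k i' * x" by (simp only: cross(4)[OF i'(2,3)])
      then show ?thesis using assms(2) i' by (simp add: mult.assoc NH_P Q2_def)
    qed
  qed
qed

lemma Q1_phi: "1 \<le> k \<Longrightarrow> Q1 k x \<Longrightarrow> Q1 k (d.phi k * x)"
  by (simp add: Q1_def pj_phi NS_smul NS_Wr NS_phi)

lemma s_phi: "1 \<le> k \<Longrightarrow> Q2 k x \<Longrightarrow> s.phi k * x \<in> NH"
proof -
  assume k: "1 \<le> k" and x: "Q2 k x"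
  have W: "s.W k n u \<in> NH" if "n < k" "u \<in> NH" for n u
    using that by (induction n arbitrary: u) (simp_all add: cross(3) NH_Ti)
  have "s.phi k * x = s.W k (k - 1) (s.Y k k * x)" using k by (simp add: s.Y_last)
  moreover have "s.Y k k * x \<in> NH" using k x by (simp add: Q2_def)
  ultimately show ?thesis using k W by simp
qed

text \<open>Induction on the number of d_+ in front of d_-. Each is moved inside at the cost of a
  commutator \<open>phi\<close>, which \<open>Q1\<close> tolerates; finally d_+^* meets d_- and
  produces the starred commutator, covered by \<open>Q2\<close>.\<close>

lemma Q1_M: "Q1 (Suc k) x \<Longrightarrow> Q2 (Suc k) x \<Longrightarrow> pj k j (d.M (Suc k) * x) \<in> NS (k + j)"
proof (induction j arbitrary: k x)
  case 0
  have "s.P (Suc k) * x \<in> NH" using 0(1) by (rule Q1_0)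
  then have "d.M (Suc (Suc k)) * (s.P (Suc k) * x) + (inverse qq - 1) \<cdot> (s.phi (Suc k) * x) \<in> NH"
    using 0(2) by (intro NH.add NH_smul NH_M s_phi) auto
  moreover have "s.P k * (d.M (Suc k) * x) = d.M (Suc (Suc k)) * (s.P (Suc k) * x) + (inverse qq - 1) \<cdot> (s.phi (Suc k) * x)"
    using s.D_phi[of "Suc k" x] by (simp add: dcomm_def left_diff_distrib mult.assoc cross algebra_simps)
  ultimately show ?case by (simp add: NS_def)
next
  case (Suc j)
  have "d.P k * (d.M (Suc k) * x) = d.M (Suc (Suc k)) * (d.P (Suc k) * x) + (qq - 1) \<cdot> (d.phi (Suc k) * x)"
    using d.D_phi[of "Suc k" x] by (simp add: dcomm_def left_diff_distrib mult.assoc algebra_simps)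
  then have "pj k (Suc j) (d.M (Suc k) * x) =
    pj (Suc k) j (d.M (Suc (Suc k)) * (d.P (Suc k) * x)) + (qq - 1) \<cdot> pj (Suc k) j (d.phi (Suc k) * x)"
    by (simp only: pj_P[symmetric] pj_add pj_smul)
  moreover have "pj (Suc k) j (d.M (Suc (Suc k)) * (d.P (Suc k) * x)) \<in> NS (Suc k + j)"
    by (rule Suc.IH[OF Q_P[OF Suc.prems]])
  moreover have "pj (Suc k) j (d.phi (Suc k) * x) \<in> NS (Suc k + j)"
    using Q1_phi[OF _ Suc.prems(1)] by (simp add: Q1_def)
  ultimately show ?case by (simp add: NS_add NS_smul)
qed

lemma Q2_T:
  assumes x: "x \<in> d.Mod k" "Q2 k x" and i: "1 \<le> i" "i < k" shows "Q2 k (d.T k i * x)"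
  unfolding Q2_def
proof (intro allI impI)
  fix l assume l: "1 \<le> l \<and> l \<le> k"
  have xs: "x \<in> s.Mod k" using x(1) by (simp add: d.Mod_def s.Mod_def cross)
  have Y: "s.Y k m * x \<in> NH" if "1 \<le> m" "m \<le> k" for m using x(2) that by (simp add: Q2_def)
  have T: "s.T k i * z \<in> NH" if "z \<in> NH" for z using i that by (simp add: cross NH_Ti)
  consider "l = i" | "l = Suc i" | "l \<noteq> i" "l \<noteq> Suc i" by blast
  then have "s.Y k l * (s.Ti k i * x) \<in> NH"
  proof cases
    case 1
    have "inverse qq \<cdot> (s.Y k i * (s.Ti k i * x)) = s.T k i * (s.Y k (Suc i) * x)"
      by (rule s.T_Y_Suc[OF i xs, symmetric])
    then have "s.Y k i * (s.Ti k i * x) = qq \<cdot> (s.T k i * (s.Y k (Suc i) * x))" by (metis d.cc(1))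
    then show ?thesis using 1 i NH_smul T Y by simp
  next
    case 2
    have "inverse qq \<cdot> (s.Ti k i * (s.Y k i * x)) = s.Y k (Suc i) * (s.T k i * x)"
      by (rule s.Ti_Y[OF i xs])
    then have "s.Y k (Suc i) * (s.T k i * x) \<in> NH"
      using NH_smul[OF NH_T[OF i Y[of i]]] i by (metis s_Ti less_imp_le)
    moreover have "s.Y k (Suc i) * (s.Ti k i * x) =
      qq \<cdot> (s.Y k (Suc i) * (s.T k i * x) + (inverse qq - 1) \<cdot> (s.Y k (Suc i) * x))"
      by (simp add: s.Ti_def smul_mult_left[symmetric] smul_mult_right[symmetric] distrib_left distrib_right s.Mod_E[OF xs])
    ultimately show ?thesis using 2 i by (simp add: NH_smul NH.add Y)
  next
    case 3
    then have "s.Y k l * (s.Ti k i * x) = s.Ti k i * (s.Y k l * x)"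
      using l i xs by (intro s.Y_Ti) auto
    then show ?thesis using i l Y[of l] NH_T by (simp add: s_Ti)
  qed
  then show "s.Y k l * (d.T k i * x) \<in> NH" using i by (simp add: s_Ti)
qed

lemma dplus_pow_pw: "dplus_pow 0 m = d.pw m"
  by (induction m) simp_all

lemma pw_E: "d.pw m * d.E 0 = d.pw m"
  by (induction m) (simp_all add: mult.assoc d.EE)

lemma AE_Q: "d.AE k x \<Longrightarrow> Q1 k x \<and> Q2 k x"
proof (induction rule: d.AE.induct)
  case one
  have AE_pw: "d.AE m (d.pw m)" for m by (induction m) (auto intro: d.AE.intros)
  have pj: "pj 0 j (d.E 0) = d.pw j" for j by (induction j) simp_all
  \<comment> \<open>The only use of the generators of I: modulo Ie_0 this is d_+^(j+1) e_0.\<close>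
  have "s.P j * d.pw j \<in> NH" for j
  proof -
    have "s.P (0 + j) * dplus_pow 0 j - dplus_pow 0 (j + 1) \<in> I_ideal"
      unfolding I_ideal_def by (rule left_ideal_gen.base) blast
    then have "s.P j * d.pw j - d.pw (Suc j) \<in> Ie0"
      using pw_E[of j] pw_E[of "Suc j"]
      by (intro I_ideal_Ie0) (simp_all add: dplus_pow_pw left_diff_distrib mult.assoc del: d.pw.simps dplus_pow.simps)
    from NH.add[OF NH.ie[OF this] NH.ae[OF AE_pw[of "Suc j"]]] show ?thesis by simp
  qed
  then show ?case by (simp add: Q1_def Q2_def NS_def pj)
next
  case (add k x y)
  then show ?case by (simp add: Q1_def Q2_def pj_add NS_add NH.add distrib_left)
next
  case (smul k x a)
  then show ?case by (simp add: Q1_def Q2_def pj_smul NS_smul NH_smul smul_mult_right[symmetric])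
next
  case (T k x i)
  then have "Q1 k (d.T k i * x)" by (simp add: Q1_def pj_T NS_T)
  then show ?case using T Q2_T[OF AE_Mod] by blast
next
  case (P k x)
  then show ?case using Q_P by blast
next
  case (M k x)
  then have x: "x \<in> s.Mod (Suc k)" using AE_Mod by (simp add: d.Mod_def s.Mod_def cross)
  have "s.Y k i * (d.M (Suc k) * x) \<in> NH" if i: "1 \<le> i" "i \<le> k" for i
  proof -
    have "s.Y k i * (d.M (Suc k) * x) = d.M (Suc k) * (s.Y (Suc k) i * x)"
      using s.M_Y[OF i] x by (simp add: cross)
    then show ?thesis using M.IH i by (simp add: NH_M Q2_def)
  qed
  then have "Q2 k (d.M (Suc k) * x)" by (simp add: Q2_def)
  then show ?case using M.IH Q1_M by (simp add: Q1_def)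
qed

lemma NH_PS: "x \<in> NH \<Longrightarrow> s.P k * x \<in> NH"
proof (rule NH_gen)
  show "s.P k * d.E k = s.P k" using s.EP(2)[of k] by (simp add: cross)
  fix x assume "d.AE k x"
  then show "s.P k * x \<in> NH" using AE_Q Q1_0 by blast
qed

lemma NH_left: "\<forall>x\<in>NH. a * x \<in> NH"
  by (induction a rule: double_dyck_induct)
    (auto simp: NH_E NH_P NH_M NH_T NH_PS distrib_right NH.add NH_smul mult.assoc simp flip: smul_mult_left)

lemma Ae0_NH: "x \<in> Ae0 \<Longrightarrow> x \<in> NH"
  using NH_left NH.ae[OF d.AE.one] by (auto simp: Ae0_def)

section \<open>The kernel\<close>

definition val :: "double_dyck \<Rightarrow> vfam" where "val x = vapp (act x) vac"

lemma val_simps: "val (x + y) = val x + val y" "val (c \<cdot> x) = vscale c (val x)" "val (x - y) = val x - val y"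
  "val (a * x) = rho a (val x)" "val x \<in> Vstar" "val 0 = 0"
  by (simp_all add: val_def rho_def act_simps vapp_simps vapp_linear vac_Vstar)

lemma val_E: "val (x * d.E 0) = val x"
proof -
  have "val (d.E 0) = vac" using hv_E by (simp add: val_def hasval_def vac_def)
  then have "val (x * d.E 0) = rho x vac" by (simp only: val_simps)
  then show ?thesis by (simp add: rho_def val_def)
qed

lemma hv_pw1: "hasval m (d.pw m) 1"
  using hv_pw[of "d.E 0" 1 m] hv_E pw_E[of m] by (simp add: vsym_simps d.Mod_def d.EE)

lemma Ie0_val: "x \<in> Ie0 \<Longrightarrow> val x = 0"
proof -
  assume "x \<in> Ie0"
  then obtain y where y: "x = y * d.E 0" "y \<in> I_ideal" by (auto simp: Ie0_def)
  from y(2) have "val (y * d.E 0) = 0" unfolding I_ideal_def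
  proof (induction rule: left_ideal_gen.induct)
    case (base g)
    then obtain k m where g: "g = s.P (k + m) * dplus_pow k m - dplus_pow k (m + 1)" by blast
    show ?case
    proof (cases "k = 0")
      case True
      \<comment> \<open>Both terms of the generator have value 1 in straightened coordinates, as tau
        is a ring homomorphism and every T_i fixes 1.\<close>
      have "hasval (Suc m) (s.P m * d.pw m) (tau 1)" by (rule hv_mult[OF hv_pw1 act_gens(5) Vlin_tau])
      then have "val (s.P m * d.pw m) = val (d.pw (Suc m))"
        using hv_pw1[of "Suc m"] by (simp add: hasval_def val_def tau_simps)
      then show ?thesis unfolding val_E g True by (simp add: val_simps dplus_pow_pw del: d.pw.simps dplus_pow.simps)
    next
      case False
      have "dplus_pow k n * d.E 0 = 0" for n
        using False by (induction n) (simp_all add: mult.assoc d.EE)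
      then show ?thesis unfolding g by (simp only: left_diff_distrib mult.assoc) (simp add: val_simps)
    qed
  next
    case (mult_left x a)
    have "vapp (act a) 0 = 0" using vlinear_0 vapp[of "act a"] by simp
    then show ?case using mult_left by (simp add: mult.assoc val_simps rho_def)
  qed (simp_all add: distrib_right smul_mult_left[symmetric] val_simps vscale_simps)
  then show ?thesis by (simp add: y(1))
qed

text \<open>On the unstarred part the difference is 0 by \<open>AE_vpsi\<close>; on Ie_0 the value
  is 0. Since \<open>NH\<close> contains Ae_0, an element with value 0 lies in Ie_0.\<close>

lemma NH_vpsi: "x \<in> NH \<Longrightarrow> x - vpsi (val x) \<in> Ie0"
proof (induction rule: NH.induct)
  case (ae k x)
  then show ?case using AE_vpsi Ie0_closed(1) by (simp add: val_def)
next
  case (ie x)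
  then show ?case by (simp add: Ie0_val vpsi_0)
next
  case (add x y)
  have eq: "x + y - vpsi (val (x + y)) = (x - vpsi (val x)) + (y - vpsi (val y))"
    by (simp add: val_simps vpsi_add)
  show ?case unfolding eq by (rule Ie0_closed(2)[OF add.IH])
qed

lemma Ie0_Ae0: "x \<in> Ie0 \<Longrightarrow> x \<in> Ae0" by (auto simp: Ie0_def Ae0_def)

lemma val_kernel: "{x \<in> Ae0. val x = 0} = Ie0"
  using NH_vpsi Ae0_NH Ie0_val Ie0_Ae0 vpsi_0 by fastforce

lemma Ae0_add: "x \<in> Ae0 \<Longrightarrow> y \<in> Ae0 \<Longrightarrow> x + y \<in> Ae0"
  unfolding Ae0_def by clarify (metis distrib_right)
lemma Ae0_smul: "x \<in> Ae0 \<Longrightarrow> c \<cdot> x \<in> Ae0"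
  unfolding Ae0_def by clarify (metis smul_mult_left)
lemma Ae0_mult: "x \<in> Ae0 \<Longrightarrow> a * x \<in> Ae0"
  unfolding Ae0_def by clarify (metis mult.assoc)
lemma Ae0_diff: "x \<in> Ae0 \<Longrightarrow> y \<in> Ae0 \<Longrightarrow> x - y \<in> Ae0"
  unfolding Ae0_def by clarify (metis left_diff_distrib)

lemma val_surj: "v \<in> Vstar \<Longrightarrow> \<exists>x\<in>Ae0. val x = v"
proof -
  assume v: "v \<in> Vstar"
  have "\<exists>x\<in>Ae0. val x = (\<Sum>k\<in>A. Poly_Mapping.single k (Poly_Mapping.lookup v k))" if "finite A" for A
    using that
  proof (induction A rule: finite_induct)
    case empty
    have "0 \<in> Ae0" using Ie0_closed(1) by (rule Ie0_Ae0)
    then show ?case using val_simps(6) by auto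
  next
    case (insert k A)
    then obtain y where y: "y \<in> Ae0" "val y = (\<Sum>k\<in>A. Poly_Mapping.single k (Poly_Mapping.lookup v k))" by blast
    have "shm k (Poly_Mapping.lookup v k) \<in> V k" by (intro sft_V Vstar_lookup v)
    from V_val[OF this] obtain x where x: "x * d.E 0 = x" "hasval k x (shm k (Poly_Mapping.lookup v k))" by blast
    have "x \<in> Ae0" using x(1) unfolding Ae0_def by (metis (mono_tags) mem_Collect_eq)
    moreover have "val (x + y) = (\<Sum>k\<in>insert k A. Poly_Mapping.single k (Poly_Mapping.lookup v k))"
      using x(2) y(2) insert(1,2) by (simp add: val_simps) (simp add: val_def hasval_def)
    ultimately show ?case using y(1) Ae0_add by blast
  qed
  from this[of "Poly_Mapping.keys v"] show ?thesis by (simp flip: pm_sum_single)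
qed

theorem theorem7p3:
  shows "\<exists>\<rho>. is_action \<rho> \<and> acts_by_operators \<rho> \<and>
    (\<forall>\<rho>'. is_action \<rho>' \<and> acts_by_operators \<rho>' \<longrightarrow> (\<forall>x. \<forall>v\<in>Vstar. \<rho>' x v = \<rho> x v)) \<and>
    (\<exists>\<nu>. (\<forall>f. \<nu> (f * gE double_gens 0) = \<rho> f vac) \<and>
      {x \<in> Ae0. \<nu> x = 0} = Ie0 \<and>
      (\<exists>\<Phi>. is_quotient_iso \<rho> \<Phi> \<and> (\<forall>x\<in>Ae0. \<Phi> (Ie0_rel `` {x}) = \<nu> x)))"
proof -
  \<comment> \<open>The choice of a representative is harmless, since cosets are precisely the
    fibres of \<open>val\<close> on \<open>Ae0\<close>.\<close>
  define \<Phi> where "\<Phi> C = val (SOME x. x \<in> C)" for C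
  have val_eq: "x - y \<in> Ie0 \<longleftrightarrow> val x = val y" if "x \<in> Ae0" "y \<in> Ae0" for x y
  proof -
    have "x - y \<in> Ie0 \<longleftrightarrow> val (x - y) = 0" using val_kernel Ae0_diff[OF that] by blast
    then show ?thesis by (simp add: val_simps)
  qed
  have cls: "Ie0_rel `` {x} = {y \<in> Ae0. val y = val x}" if "x \<in> Ae0" for x
    using that val_eq by (auto simp: Ie0_rel_def)
  have \<Phi>: "\<Phi> (Ie0_rel `` {x}) = val x" if "x \<in> Ae0" for x
  proof -
    have "(SOME y. y \<in> Ie0_rel `` {x}) \<in> Ie0_rel `` {x}"
      by (rule someI[of _ x]) (simp add: cls that)
    then show ?thesis by (simp add: \<Phi>_def cls that)
  qed
  have "is_quotient_iso rho \<Phi>"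
    unfolding is_quotient_iso_def
  proof (intro conjI ballI allI)
    show "bij_betw \<Phi> (Ae0 // Ie0_rel) Vstar"
      unfolding bij_betw_def
    proof
      show "inj_on \<Phi> (Ae0 // Ie0_rel)"
      proof (rule inj_onI)
        fix A B assume AB: "A \<in> Ae0 // Ie0_rel" "B \<in> Ae0 // Ie0_rel" "\<Phi> A = \<Phi> B"
        then obtain x y where "x \<in> Ae0" "A = Ie0_rel `` {x}" "y \<in> Ae0" "B = Ie0_rel `` {y}"
          by (auto elim!: quotientE)
        then show "A = B" using AB(3) cls \<Phi> by simp
      qed
      show "\<Phi> ` (Ae0 // Ie0_rel) = Vstar"
      proof
        show "\<Phi> ` (Ae0 // Ie0_rel) \<subseteq> Vstar" by (auto elim!: quotientE simp: \<Phi> val_simps)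
        show "Vstar \<subseteq> \<Phi> ` (Ae0 // Ie0_rel)"
        proof
          fix v assume "v \<in> Vstar"
          then obtain x where "x \<in> Ae0" "val x = v" using val_surj by blast
          then show "v \<in> \<Phi> ` (Ae0 // Ie0_rel)" using \<Phi>[of x] by (intro image_eqI[of _ _ "Ie0_rel `` {x}"] quotientI) auto
        qed
      qed
    qed
  qed (simp_all add: \<Phi> Ae0_add Ae0_smul Ae0_mult val_simps)
  moreover have "val (f * gE double_gens 0) = rho f vac" for f
    by (simp only: val_E) (simp add: val_def rho_def)
  ultimately have "\<exists>\<nu>. (\<forall>f. \<nu> (f * gE double_gens 0) = rho f vac) \<and> {x \<in> Ae0. \<nu> x = 0} = Ie0 \<and>
      (\<exists>\<Phi>. is_quotient_iso rho \<Phi> \<and> (\<forall>x\<in>Ae0. \<Phi> (Ie0_rel `` {x}) = \<nu> x))"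
    using val_kernel \<Phi> by (intro exI[of _ val] conjI exI[of _ \<Phi>]) auto
  then show ?thesis using rho_action rho_operators rho_unique by blast
qed

end
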